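(* Let $G$ be a finitely presented group, and let $H$ be a subgroup of $G$. If $H$ is acylindrically hyperbolic and existentially closed in $G$, then $G$ is acylindrically hyperbolic.
   Context: Existentially closed: let $H$ be a subgroup of a group $G$. One says that $H$ is existentially closed in $G$ if for every existential first-order formula $\phi(\boldsymbol{x})$ in the language of groups and every tuple $\boldsymbol{h}\in H^p$ with $p=|\boldsymbol{x}|$, the sentence $\phi(\boldsymbol{h})$ is satisfied by $H$ if and only if it is satisfied by $G$. Equivalently, any finite disjunction of finite systems of equations and inequations with constants in $H$ has a solution in $H$ if and only if it has a solution in $G$. Acylindrical action: an action of a group $G$ by isometries on a metric space $(X,d)$ is called acylindrical if for every $\varepsilon\geq 0$ there exist $N>0$ and $R>0$ such that for every two points $x,y\in X$ with $d(x,y)\geq R$ there are at most $N$ elements $g\in G$ such that $d(x,gx)\leq\varepsilon$ and $d(y,gy)\leq\varepsilon$. Loxodromic elements: let $G$ act by isometries on a $\delta$-hyperbolic (in the sense of Gromov, geodesic) metric space $(X,d)$. An element $g\in G$ is loxodromic if the map $\mathbb{Z}\to X$, $n\mapsto g^n x$, is a quasi-isometric embedding for some (equivalently, any) $x\in X$. A loxodromic element $g$ has exactly two limit points $g^{+\infty},g^{-\infty}$ on the Gromov boundary $\partial_\infty X$. Two loxodromic elements $g,h$ are independent if $\{g^{\pm\infty}\}$ and $\{h^{\pm\infty}\}$ are disjoint. Acylindrically hyperbolic: a group $G$ is acylindrically hyperbolic if it admits an acylindrical action by isometries on some $\delta$-hyperbolic metric space such that $G$ contains two independent loxodromic elements for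 this action. *)

theory Defs
  imports "HOL-Analysis.Analysis" "HOL-Algebra.Algebra"
begin

section \<open>Finitely presented groups\<close>

text \<open>A letter \<open>(s, True)\<close> stands for the generator \<open>s\<close>, and \<open>(s, False)\<close> for its formal inverse.\<close>

type_synonym 's word = "('s \<times> bool) list"

definition words :: "'s set \<Rightarrow> 's word set" where
  "words S = lists (S \<times> UNIV)"

inductive_set free_cong :: "'s set \<Rightarrow> ('s word \<times> 's word) set" for S where
  cancel: "\<lbrakk>u \<in> words S; v \<in> words S; s \<in> S\<rbrakk>
             \<Longrightarrow> (u @ [(s, b), (s, \<not> b)] @ v, u @ v) \<in> free_cong S"
| refl: "u \<in> words S \<Longrightarrow> (u, u) \<in> free_cong S"
| sym: "(u, v) \<in> free_cong S \<Longrightarrow> (v, u) \<in> free_cong S"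
| trans: "\<lbrakk>(u, v) \<in> free_cong S; (v, w) \<in> free_cong S\<rbrakk> \<Longrightarrow> (u, w) \<in> free_cong S"

definition free_group :: "'s set \<Rightarrow> 's word set monoid" where
  "free_group S =
     \<lparr>carrier = words S // free_cong S,
      mult = (\<lambda>A B. \<Union>a\<in>A. \<Union>b\<in>B. free_cong S `` {a @ b}),
      one = free_cong S `` {[]}\<rparr>"

definition normal_closure :: "('a, 'b) monoid_scheme \<Rightarrow> 'a set \<Rightarrow> 'a set" where
  "normal_closure G R = \<Inter>{N. N \<lhd> G \<and> R \<subseteq> N}"

definition presented_group :: "'s set \<Rightarrow> 's word set set \<Rightarrow> 's word set set monoid" where
  "presented_group S R = free_group S Mod normal_closure (free_group S) R"

definition finitely_presented :: "('a, 'b) monoid_scheme \<Rightarrow> bool" where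
  "finitely_presented G \<longleftrightarrow>
     (\<exists>(n::nat) R. finite R \<and> R \<subseteq> carrier (free_group {..<n}) \<and>
        presented_group {..<n} R \<cong> G)"

lemma words_append_iff [simp]: "u @ v \<in> words S \<longleftrightarrow> u \<in> words S \<and> v \<in> words S"
  by (simp add: words_def)

lemma free_cong_words: "(u, v) \<in> free_cong S \<Longrightarrow> u \<in> words S \<and> v \<in> words S"
  by (induction rule: free_cong.induct) (auto simp: words_def)

lemma equiv_free_cong: "equiv (words S) (free_cong S)"
  by (rule equivI)
     (auto simp: refl_on_def sym_def trans_def dest: free_cong_words
           intro: free_cong.refl free_cong.sym free_cong.trans)

lemma free_cong_append1:
  assumes "(u, v) \<in> free_cong S" "w \<in> words S"
  shows "(u @ w, v @ w) \<in> free_cong S"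
  using assms(1)
proof induction
  case (cancel u v s b)
  then show ?case
    using free_cong.cancel[of u S "v @ w" s b] assms(2) by simp
qed (auto intro: free_cong.refl free_cong.sym free_cong.trans simp: assms(2))

lemma free_cong_append2:
  assumes "(u, v) \<in> free_cong S" "w \<in> words S"
  shows "(w @ u, w @ v) \<in> free_cong S"
  using assms(1)
proof induction
  case (cancel u v s b)
  then show ?case
    using free_cong.cancel[of "w @ u" S v s b] assms(2) by simp
qed (auto intro: free_cong.refl free_cong.sym free_cong.trans simp: assms(2))

lemma free_cong_append:
  "\<lbrakk>(u, u') \<in> free_cong S; (v, v') \<in> free_cong S\<rbrakk> \<Longrightarrow> (u @ v, u' @ v') \<in> free_cong S"
  by (meson free_cong.trans free_cong_append1 free_cong_append2 free_cong_words)

lemma free_group_mult: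
  assumes "u \<in> words S" "v \<in> words S"
  shows "(free_cong S `` {u}) \<otimes>\<^bsub>free_group S\<^esub> (free_cong S `` {v}) = free_cong S `` {u @ v}"
proof -
  have "congruent2 (free_cong S) (free_cong S) (\<lambda>a b. free_cong S `` {a @ b})"
    by (rule congruent2I')
       (metis equiv_class_eq_iff equiv_free_cong free_cong_append)
  then show ?thesis
    by (simp add: free_group_def UN_equiv_class2[OF equiv_free_cong equiv_free_cong _ assms])
qed

lemma free_cong_inverse:
  "u \<in> words S \<Longrightarrow> (rev (map (\<lambda>(s, b). (s, \<not> b)) u) @ u, []) \<in> free_cong S
     \<and> rev (map (\<lambda>(s, b). (s, \<not> b)) u) \<in> words S"
proof (induction u)
  case Nil
  then show ?case by (auto intro: free_cong.refl simp: words_def)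
next
  case (Cons a u)
  obtain s b where a: "a = (s, b)" by force
  let ?i = "rev (map (\<lambda>(s, b). (s, \<not> b)) u)"
  have *: "s \<in> S" "u \<in> words S" using Cons.prems a by (auto simp: words_def)
  with Cons.IH have IH: "(?i @ u, []) \<in> free_cong S" "?i \<in> words S" by auto
  have "(?i @ [(s, \<not> b), (s, \<not> \<not> b)] @ u, ?i @ u) \<in> free_cong S"
    by (rule free_cong.cancel) (use * IH in auto)
  with IH * a show ?case
    by (auto intro: free_cong.trans simp: words_def)
qed

lemma group_free_group: "group (free_group S)"
proof (rule groupI)
  have Nil: "[] \<in> words S" by (simp add: words_def)
  show "\<one>\<^bsub>free_group S\<^esub> \<in> carrier (free_group S)"
    using Nil by (auto simp: free_group_def intro: quotientI)
  fix x assume x: "x \<in> carrier (free_group S)"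
  then obtain u where u: "u \<in> words S" "x = free_cong S `` {u}"
    by (auto simp: free_group_def elim: quotientE)
  show "\<one>\<^bsub>free_group S\<^esub> \<otimes>\<^bsub>free_group S\<^esub> x = x"
    using free_group_mult[OF Nil u(1)] u by (simp add: free_group_def)
  show "\<exists>y\<in>carrier (free_group S). y \<otimes>\<^bsub>free_group S\<^esub> x = \<one>\<^bsub>free_group S\<^esub>"
  proof
    let ?i = "rev (map (\<lambda>(s, b). (s, \<not> b)) u)"
    have "free_cong S `` {?i @ u} = free_cong S `` {[]}"
      using free_cong_inverse[OF u(1)] by (intro equiv_class_eq[OF equiv_free_cong]) blast
    then show "free_cong S `` {?i} \<otimes>\<^bsub>free_group S\<^esub> x = \<one>\<^bsub>free_group S\<^esub>"
      using free_group_mult[of ?i S u] free_cong_inverse[OF u(1)] u by (simp add: free_group_def)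
    show "free_cong S `` {?i} \<in> carrier (free_group S)"
      using free_cong_inverse[OF u(1)] by (auto simp: free_group_def intro: quotientI)
  qed
  fix y assume "y \<in> carrier (free_group S)"
  then obtain v where v: "v \<in> words S" "y = free_cong S `` {v}"
    by (auto simp: free_group_def elim: quotientE)
  show "x \<otimes>\<^bsub>free_group S\<^esub> y \<in> carrier (free_group S)"
    using u v by (simp add: free_group_mult) (auto simp: free_group_def intro: quotientI)
  fix z assume "z \<in> carrier (free_group S)"
  then obtain w where w: "w \<in> words S" "z = free_cong S `` {w}"
    by (auto simp: free_group_def elim: quotientE)
  show "x \<otimes>\<^bsub>free_group S\<^esub> y \<otimes>\<^bsub>free_group S\<^esub> z
      = x \<otimes>\<^bsub>free_group S\<^esub> (y \<otimes>\<^bsub>free_group S\<^esub> z)"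
    using u v w by (simp add: free_group_mult)
qed

lemma (in group) normal_closure_normal:
  assumes "R \<subseteq> carrier G"
  shows "normal_closure G R \<lhd> G"
proof -
  let ?\<N> = "{N. N \<lhd> G \<and> R \<subseteq> N}"
  have "carrier G \<in> ?\<N>"
    using assms by (simp add: normal_inv_iff subgroup_self)
  then have "?\<N> \<noteq> {}" by blast
  then have "subgroup (\<Inter>?\<N>) G"
    by (intro subgroups_Inter) (auto simp: normal_inv_iff)
  then show ?thesis
    unfolding normal_closure_def normal_inv_iff[of "\<Inter>?\<N>"]
    by (auto simp: normal_inv_iff)
qed

lemma group_presented_group:
  "R \<subseteq> carrier (free_group S) \<Longrightarrow> group (presented_group S R)"
  unfolding presented_group_def
  by (intro normal.factorgroup_is_group group.normal_closure_normal group_free_group)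


section \<open>Existentially closed subgroups\<close>

datatype gterm = Var nat | Unit | Inverse gterm | Times gterm gterm

datatype gformula =
    Eq gterm gterm
  | Neg gformula
  | And gformula gformula
  | Or gformula gformula
  | Exists nat gformula
  | Forall nat gformula

primrec gterm_val :: "('a, 'b) monoid_scheme \<Rightarrow> (nat \<Rightarrow> 'a) \<Rightarrow> gterm \<Rightarrow> 'a" where
  "gterm_val G e (Var n) = e n"
| "gterm_val G e Unit = \<one>\<^bsub>G\<^esub>"
| "gterm_val G e (Inverse t) = inv\<^bsub>G\<^esub> (gterm_val G e t)"
| "gterm_val G e (Times s t) = gterm_val G e s \<otimes>\<^bsub>G\<^esub> gterm_val G e t"

primrec satisfies :: "('a, 'b) monoid_scheme \<Rightarrow> (nat \<Rightarrow> 'a) \<Rightarrow> gformula \<Rightarrow> bool" where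
  "satisfies G e (Eq s t) \<longleftrightarrow> gterm_val G e s = gterm_val G e t"
| "satisfies G e (Neg \<psi>) \<longleftrightarrow> \<not> satisfies G e \<psi>"
| "satisfies G e (And \<psi> \<rho>) \<longleftrightarrow> satisfies G e \<psi> \<and> satisfies G e \<rho>"
| "satisfies G e (Or \<psi> \<rho>) \<longleftrightarrow> satisfies G e \<psi> \<or> satisfies G e \<rho>"
| "satisfies G e (Exists n \<psi>) \<longleftrightarrow> (\<exists>a\<in>carrier G. satisfies G (e(n := a)) \<psi>)"
| "satisfies G e (Forall n \<psi>) \<longleftrightarrow> (\<forall>a\<in>carrier G. satisfies G (e(n := a)) \<psi>)"

primrec quantifier_free :: "gformula \<Rightarrow> bool" where
  "quantifier_free (Eq s t) \<longleftrightarrow> True"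
| "quantifier_free (Neg \<psi>) \<longleftrightarrow> quantifier_free \<psi>"
| "quantifier_free (And \<psi> \<rho>) \<longleftrightarrow> quantifier_free \<psi> \<and> quantifier_free \<rho>"
| "quantifier_free (Or \<psi> \<rho>) \<longleftrightarrow> quantifier_free \<psi> \<and> quantifier_free \<rho>"
| "quantifier_free (Exists n \<psi>) \<longleftrightarrow> False"
| "quantifier_free (Forall n \<psi>) \<longleftrightarrow> False"

inductive existential :: "gformula \<Rightarrow> bool" where
  "quantifier_free \<psi> \<Longrightarrow> existential \<psi>"
| "existential \<psi> \<Longrightarrow> existential (Exists n \<psi>)"

text \<open>The tuple of constants from \<open>H\<close> is given by a valuation of all variables in \<open>H\<close>,
  of which only the values at the finitely many free variables of the formula matter.\<close>

definition existentially_closed :: "'a set \<Rightarrow> ('a, 'b) monoid_scheme \<Rightarrow> bool" where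
  "existentially_closed H G \<longleftrightarrow> subgroup H G \<and>
     (\<forall>\<psi> e. existential \<psi> \<longrightarrow> (\<forall>n. e n \<in> H) \<longrightarrow>
        (satisfies (G\<lparr>carrier := H\<rparr>) e \<psi> \<longleftrightarrow> satisfies G e \<psi>))"


section \<open>Gromov hyperbolic spaces\<close>

definition quasi_isometric_embedding ::
  "'x set \<Rightarrow> ('x \<Rightarrow> 'x \<Rightarrow> real) \<Rightarrow> 'y set \<Rightarrow> ('y \<Rightarrow> 'y \<Rightarrow> real) \<Rightarrow> ('x \<Rightarrow> 'y) \<Rightarrow> bool" where
  "quasi_isometric_embedding M d M' d' f \<longleftrightarrow> f \<in> M \<rightarrow> M' \<and>
     (\<exists>L\<ge>1. \<exists>C\<ge>0. \<forall>x\<in>M. \<forall>y\<in>M.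
        d x y / L - C \<le> d' (f x) (f y) \<and> d' (f x) (f y) \<le> L * d x y + C)"

context Metric_space
begin

definition geodesic_space :: bool where
  "geodesic_space \<longleftrightarrow> (\<forall>x\<in>M. \<forall>y\<in>M. \<exists>c.
     c \<in> {0..d x y} \<rightarrow> M \<and> c 0 = x \<and> c (d x y) = y \<and>
     (\<forall>s\<in>{0..d x y}. \<forall>t\<in>{0..d x y}. d (c s) (c t) = \<bar>s - t\<bar>))"

definition gromov_product :: "'a \<Rightarrow> 'a \<Rightarrow> 'a \<Rightarrow> real" where
  "gromov_product w x y = (d x w + d y w - d x y) / 2"

definition delta_hyperbolic :: "real \<Rightarrow> bool" where
  "delta_hyperbolic \<delta> \<longleftrightarrow> (\<forall>w\<in>M. \<forall>x\<in>M. \<forall>y\<in>M. \<forall>z\<in>M.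
     gromov_product w x z \<ge> min (gromov_product w x y) (gromov_product w y z) - \<delta>)"

definition gromov_hyperbolic :: bool where
  "gromov_hyperbolic \<longleftrightarrow> geodesic_space \<and> (\<exists>\<delta>\<ge>0. delta_hyperbolic \<delta>)"

text \<open>The Gromov boundary consists of the classes of sequences converging to infinity, the general
  definition for spaces that are not assumed proper. Whether the Gromov products below tend to
  infinity does not depend on the base point \<open>w\<close>.\<close>

definition asymptotic :: "(nat \<Rightarrow> 'a) \<Rightarrow> (nat \<Rightarrow> 'a) \<Rightarrow> bool" where
  "asymptotic s t \<longleftrightarrow>
     (\<forall>w\<in>M. LIM (i, j) (sequentially \<times>\<^sub>F sequentially). gromov_product w (s i) (t j) :> at_top)"

definition seqs_to_infinity :: "(nat \<Rightarrow> 'a) set" where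
  "seqs_to_infinity = {s. range s \<subseteq> M \<and> asymptotic s s}"

definition boundary_rel :: "((nat \<Rightarrow> 'a) \<times> (nat \<Rightarrow> 'a)) set" where
  "boundary_rel = {(s, t). s \<in> seqs_to_infinity \<and> t \<in> seqs_to_infinity \<and> asymptotic s t}"

definition gromov_boundary :: "(nat \<Rightarrow> 'a) set set" where
  "gromov_boundary = seqs_to_infinity // boundary_rel"

definition boundary_limit :: "(nat \<Rightarrow> 'a) \<Rightarrow> (nat \<Rightarrow> 'a) set" where
  "boundary_limit s = boundary_rel `` {s}"

lemma boundary_limit_in_gromov_boundary:
  "s \<in> seqs_to_infinity \<Longrightarrow> boundary_limit s \<in> gromov_boundary"
  by (simp add: boundary_limit_def gromov_boundary_def quotientI)

lemma asymptotic_at_iff: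
  "(LIM (i, j) (sequentially \<times>\<^sub>F sequentially). gromov_product w (s i) (t j) :> at_top) \<longleftrightarrow>
     (\<forall>Z. \<exists>N. \<forall>i\<ge>N. \<forall>j\<ge>N. Z \<le> gromov_product w (s i) (t j))"
  unfolding filterlim_at_top eventually_prod_sequentially by (simp, meson)

lemma gromov_product_commute: "gromov_product w x y = gromov_product w y x"
  by (simp add: gromov_product_def commute add.commute)

lemma gromov_product_base:
  assumes "w \<in> M" "w' \<in> M" "x \<in> M" "y \<in> M"
  shows "gromov_product w x y \<le> gromov_product w' x y + d w w'"
proof -
  have "d x w \<le> d x w' + d w w'" "d y w \<le> d y w' + d w w'"
    using assms by (simp_all add: triangle')
  then show ?thesis
    unfolding gromov_product_def by argo
qed

lemma asymptotic_base:
  assumes w: "w \<in> M" and M: "range s \<subseteq> M" "range t \<subseteq> M"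
  shows "asymptotic s t \<longleftrightarrow> (\<forall>Z. \<exists>N. \<forall>i\<ge>N. \<forall>j\<ge>N. Z \<le> gromov_product w (s i) (t j))"
proof
  assume R: "\<forall>Z. \<exists>N. \<forall>i\<ge>N. \<forall>j\<ge>N. Z \<le> gromov_product w (s i) (t j)"
  show "asymptotic s t"
    unfolding asymptotic_def asymptotic_at_iff
  proof (intro ballI allI)
    fix w' Z assume w': "w' \<in> M"
    obtain N where "\<forall>i\<ge>N. \<forall>j\<ge>N. Z + d w w' \<le> gromov_product w (s i) (t j)"
      using R by blast
    moreover have "gromov_product w (s i) (t j) \<le> gromov_product w' (s i) (t j) + d w w'" for i j
      using w w' M by (intro gromov_product_base) auto
    ultimately show "\<exists>N. \<forall>i\<ge>N. \<forall>j\<ge>N. Z \<le> gromov_product w' (s i) (t j)"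
      by (meson add_le_cancel_right order_trans)
  qed
qed (use w in \<open>simp add: asymptotic_def asymptotic_at_iff\<close>)

lemma asymptotic_sym: "asymptotic s t \<Longrightarrow> asymptotic t s"
  unfolding asymptotic_def asymptotic_at_iff by (metis gromov_product_commute)

lemma asymptotic_trans:
  assumes hyp: "delta_hyperbolic \<delta>" and M: "range s \<subseteq> M" "range t \<subseteq> M" "range u \<subseteq> M"
    and st: "asymptotic s t" and tu: "asymptotic t u"
  shows "asymptotic s u"
  unfolding asymptotic_def asymptotic_at_iff
proof (intro ballI allI)
  fix w Z assume w: "w \<in> M"
  obtain N1 where N1: "\<forall>i\<ge>N1. \<forall>j\<ge>N1. gromov_product w (s i) (t j) \<ge> Z + \<delta>"
    using st w unfolding asymptotic_def asymptotic_at_iff by blast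
  obtain N2 where N2: "\<forall>i\<ge>N2. \<forall>j\<ge>N2. gromov_product w (t i) (u j) \<ge> Z + \<delta>"
    using tu w unfolding asymptotic_def asymptotic_at_iff by blast
  have "gromov_product w (s i) (u j) \<ge> Z" if "i \<ge> max N1 N2" "j \<ge> max N1 N2" for i j
  proof -
    have "gromov_product w (s i) (u j)
        \<ge> min (gromov_product w (s i) (t i)) (gromov_product w (t i) (u j)) - \<delta>"
      using hyp w M unfolding delta_hyperbolic_def by (meson range_subsetD)
    moreover have "gromov_product w (s i) (t i) \<ge> Z + \<delta>" "gromov_product w (t i) (u j) \<ge> Z + \<delta>"
      using N1 N2 that by auto
    ultimately show ?thesis by linarith
  qed
  then show "\<exists>N. \<forall>i\<ge>N. \<forall>j\<ge>N. Z \<le> gromov_product w (s i) (u j)"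
    by blast
qed

lemma equiv_boundary_rel:
  assumes "gromov_hyperbolic"
  shows "equiv seqs_to_infinity boundary_rel"
proof (rule equivI)
  obtain \<delta> where "delta_hyperbolic \<delta>"
    using assms by (auto simp: gromov_hyperbolic_def)
  then show "trans boundary_rel"
    unfolding trans_def boundary_rel_def seqs_to_infinity_def
    using asymptotic_trans by blast
qed (auto simp: boundary_rel_def refl_on_def sym_def seqs_to_infinity_def asymptotic_sym)

end


section \<open>Acylindrically hyperbolic groups\<close>

locale isometric_action = Metric_space M d + group_action G M \<phi>
  for M :: "'x set" and d :: "'x \<Rightarrow> 'x \<Rightarrow> real"
    and G :: "('a, 'b) monoid_scheme" (structure) and \<phi> :: "'a \<Rightarrow> 'x \<Rightarrow> 'x" +
  assumes isometry: "\<lbrakk>g \<in> carrier G; x \<in> M; y \<in> M\<rbrakk> \<Longrightarrow> d (\<phi> g x) (\<phi> g y) = d x y"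
begin

definition acylindrical :: bool where
  "acylindrical \<longleftrightarrow> (\<forall>\<epsilon>\<ge>0. \<exists>(N::nat)>0. \<exists>R>0. \<forall>x\<in>M. \<forall>y\<in>M. d x y \<ge> R \<longrightarrow>
     finite {g \<in> carrier G. d x (\<phi> g x) \<le> \<epsilon> \<and> d y (\<phi> g y) \<le> \<epsilon>} \<and>
     card {g \<in> carrier G. d x (\<phi> g x) \<le> \<epsilon> \<and> d y (\<phi> g y) \<le> \<epsilon>} \<le> N)"

definition loxodromic :: "'a \<Rightarrow> bool" where
  "loxodromic g \<longleftrightarrow> g \<in> carrier G \<and>
     (\<exists>x\<in>M. quasi_isometric_embedding UNIV (\<lambda>m n. \<bar>real_of_int (m - n)\<bar>) M d
        (\<lambda>n::int. \<phi> (g [^] n) x))"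

text \<open>For loxodromic \<open>g\<close> on a hyperbolic space this is the pair \<open>{g\<^sup>+\<^sup>\<infinity>, g\<^sup>-\<^sup>\<infinity>}\<close>, the two limits being
  the same for every choice of \<open>x\<close>.\<close>

definition limit_points :: "'a \<Rightarrow> (nat \<Rightarrow> 'x) set set" where
  "limit_points g =
     (\<Union>x\<in>M. {boundary_limit (\<lambda>n. \<phi> (g [^] int n) x), boundary_limit (\<lambda>n. \<phi> (g [^] (- int n)) x)})"

definition independent_loxodromics :: "'a \<Rightarrow> 'a \<Rightarrow> bool" where
  "independent_loxodromics g h \<longleftrightarrow>
     loxodromic g \<and> loxodromic h \<and> limit_points g \<inter> limit_points h = {}"

end

text \<open>HOL cannot quantify over types inside a formula, so the type \<open>'x\<close> of points of the space is a
  parameter. The lemma \<open>acylindrically_hyperbolic_any_type\<close> below shows that for \<open>G\<close> with elements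
  of type \<open>'a\<close> the choice \<open>'x = 'a \<times> real\<close> is as general as any other: an action on a space
  of any type can be replaced by one on a space of that type.\<close>

definition acylindrically_hyperbolic :: "'x itself \<Rightarrow> ('a, 'b) monoid_scheme \<Rightarrow> bool" where
  "acylindrically_hyperbolic (T :: 'x itself) G \<longleftrightarrow>
     (\<exists>(M :: 'x set) d \<phi>.
        isometric_action M d G \<phi> \<and>
        Metric_space.gromov_hyperbolic M d \<and>
        isometric_action.acylindrical M d G \<phi> \<and>
        (\<exists>g\<in>carrier G. \<exists>h\<in>carrier G. isometric_action.independent_loxodromics M d G \<phi> g h))"

subsection \<open>Independence of the type of points\<close>

context isometric_action
begin

lemma act_closed: "\<lbrakk>g \<in> carrier G; x \<in> M\<rbrakk> \<Longrightarrow> \<phi> g x \<in> M"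
  using surj_prop by blast

lemma act_mult: "\<lbrakk>g \<in> carrier G; h \<in> carrier G; x \<in> M\<rbrakk> \<Longrightarrow> \<phi> (g \<otimes> h) x = \<phi> g (\<phi> h x)"
  using composition_rule by blast

lemma act_one: "x \<in> M \<Longrightarrow> \<phi> \<one> x = x"
  using id_eq_one by (metis restrict_apply')

lemma group_G: "group G"
  using group_hom by (simp add: group_hom_def)

lemma loxodromic_any_point:
  assumes "loxodromic g" "y \<in> M"
  shows "quasi_isometric_embedding UNIV (\<lambda>m n. \<bar>real_of_int (m - n)\<bar>) M d (\<lambda>n::int. \<phi> (g [^] n) y)"
proof -
  have g: "g \<in> carrier G" using assms by (simp add: loxodromic_def)
  have gn: "g [^] n \<in> carrier G" for n :: int
    using g group.int_pow_closed[OF group_G] by blast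
  obtain x L C where x: "x \<in> M" and L: "L \<ge> 1" and C: "C \<ge> 0"
    and q: "\<And>(m::int) (n::int). \<bar>real_of_int (m - n)\<bar> / L - C \<le> d (\<phi> (g [^] m) x) (\<phi> (g [^] n) x) \<and>
              d (\<phi> (g [^] m) x) (\<phi> (g [^] n) x) \<le> L * \<bar>real_of_int (m - n)\<bar> + C"
    using assms(1) unfolding loxodromic_def quasi_isometric_embedding_def by auto
  have "\<bar>d (\<phi> (g [^] m) x) (\<phi> (g [^] n) x) - d (\<phi> (g [^] m) y) (\<phi> (g [^] n) y)\<bar> \<le> 2 * d x y"
    for m n :: int
  proof -
    have e: "d (\<phi> (g [^] k) x) (\<phi> (g [^] k) y) = d x y" for k :: int
      using isometry gn x assms(2) by blast
    have c: "\<phi> (g [^] k) z \<in> M" if "z \<in> M" for k :: int and z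
      using act_closed gn that by blast
    note c = c[OF x] c[OF assms(2)]
    show ?thesis
      using triangle[OF c(1)[of m] c(2)[of m] c(2)[of n]] triangle[OF c(1)[of m] c(2)[of n] c(1)[of n]]
        triangle[OF c(2)[of m] c(1)[of m] c(1)[of n]] triangle[OF c(2)[of m] c(1)[of n] c(2)[of n]]
        e[of m] e[of n] commute
      by (smt (verit))
  qed
  then have "\<bar>real_of_int (m - n)\<bar> / L - (C + 2 * d x y) \<le> d (\<phi> (g [^] m) y) (\<phi> (g [^] n) y) \<and>
      d (\<phi> (g [^] m) y) (\<phi> (g [^] n) y) \<le> L * \<bar>real_of_int (m - n)\<bar> + (C + 2 * d x y)" for m n :: int
    using q[of m n] by (smt (verit))
  moreover have "C + 2 * d x y \<ge> 0" using C by simp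
  ultimately show ?thesis
    unfolding quasi_isometric_embedding_def using L act_closed gn assms(2)
    by (meson Pi_I)
qed

end

text \<open>\<open>k\<close> identifies \<open>N\<close> with an invariant subspace of \<open>M\<close>.\<close>

locale transported_action = isometric_action M d G \<phi>
  for M :: "'x set" and d and G (structure) and \<phi> :: "'a \<Rightarrow> 'x \<Rightarrow> 'x" +
  fixes N :: "'y set" and k :: "'y \<Rightarrow> 'x"
  assumes inj: "inj_on k N" and kN: "k ` N \<subseteq> M" and ne: "N \<noteq> {}"
    and invariant: "\<lbrakk>g \<in> carrier G; p \<in> N\<rbrakk> \<Longrightarrow> \<phi> g (k p) \<in> k ` N"
begin

definition d' where "d' p q = d (k p) (k q)"
definition \<phi>' where "\<phi>' g = (\<lambda>p\<in>N. the_inv_into N k (\<phi> g (k p)))"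

lemma kM: "p \<in> N \<Longrightarrow> k p \<in> M" using kN by blast

lemma k_\<phi>': "\<lbrakk>g \<in> carrier G; p \<in> N\<rbrakk> \<Longrightarrow> k (\<phi>' g p) = \<phi> g (k p)"
  by (simp add: \<phi>'_def f_the_inv_into_f[OF inj] invariant)

lemma \<phi>'_N: "\<lbrakk>g \<in> carrier G; p \<in> N\<rbrakk> \<Longrightarrow> \<phi>' g p \<in> N"
  unfolding \<phi>'_def using the_inv_into_into[OF inj invariant subset_refl] by simp

lemma metric': "Metric_space N d'"
proof
  fix x y z assume "x \<in> N" "y \<in> N"
  then show "d' x y = 0 \<longleftrightarrow> x = y"
    using inj kM by (auto simp: d'_def inj_on_def)
  assume "z \<in> N"
  then show "d' x z \<le> d' x y + d' y z"
    using \<open>x \<in> N\<close> \<open>y \<in> N\<close> kM triangle by (simp add: d'_def)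
qed (simp_all add: d'_def commute)

lemma action': "isometric_action N d' G \<phi>'"
proof -
  interpret G: group G by (rule group_G)
  have mult: "\<phi>' (g \<otimes> h) p = \<phi>' g (\<phi>' h p)" if "g \<in> carrier G" "h \<in> carrier G" "p \<in> N" for g h p
    using that inj by (intro inj_onD[OF inj]) (simp_all add: k_\<phi>' \<phi>'_N act_mult kM)
  have one: "\<phi>' \<one> p = p" if "p \<in> N" for p
    using that by (intro inj_onD[OF inj]) (simp_all add: k_\<phi>' \<phi>'_N act_one kM)
  have Bij: "\<phi>' g \<in> Bij N" if "g \<in> carrier G" for g
  proof -
    have "bij_betw (\<phi>' g) N N"
    proof (rule bij_betwI)
      show "\<phi>' g \<in> N \<rightarrow> N" "\<phi>' (inv\<^bsub>G\<^esub> g) \<in> N \<rightarrow> N" using that by (auto simp: \<phi>'_N)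
      show "\<phi>' (inv\<^bsub>G\<^esub> g) (\<phi>' g x) = x" if "x \<in> N" for x
        using mult[of "inv\<^bsub>G\<^esub> g" g x] \<open>g \<in> carrier G\<close> that one by simp
      show "\<phi>' g (\<phi>' (inv\<^bsub>G\<^esub> g) y) = y" if "y \<in> N" for y
        using mult[of g "inv\<^bsub>G\<^esub> g" y] \<open>g \<in> carrier G\<close> that one by simp
    qed
    then show ?thesis by (simp add: Bij_def \<phi>'_def)
  qed
  have "group_hom G (BijGroup N) \<phi>'"
  proof -
    have "\<phi>' \<in> hom G (BijGroup N)"
    proof (rule homI)
      show "\<phi>' x \<in> carrier (BijGroup N)" if "x \<in> carrier G" for x
        using Bij that by (simp add: BijGroup_def)
      show "\<phi>' (x \<otimes> y) = \<phi>' x \<otimes>\<^bsub>BijGroup N\<^esub> \<phi>' y" if "x \<in> carrier G" "y \<in> carrier G" for x y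
      proof
        fix p
        show "\<phi>' (x \<otimes> y) p = (\<phi>' x \<otimes>\<^bsub>BijGroup N\<^esub> \<phi>' y) p"
          using that Bij mult[of x y p]
          by (cases "p \<in> N") (simp_all add: BijGroup_def compose_def, simp add: \<phi>'_def)
      qed
    qed
    then show ?thesis
      by (simp add: group_hom_def group_hom_axioms_def group_BijGroup group_G)
  qed
  then show ?thesis
    unfolding isometric_action_def isometric_action_axioms_def group_action_def
    using metric' isometry kM by (auto simp: d'_def k_\<phi>')
qed

sublocale T: isometric_action N d' G \<phi>' by (rule action')

lemma gromov_product': "T.gromov_product w p q = gromov_product (k w) (k p) (k q)"
  by (simp add: T.gromov_product_def gromov_product_def d'_def)

lemma asymptotic': 
  assumes "range s \<subseteq> N" "range t \<subseteq> N"
  shows "T.asymptotic s t \<longleftrightarrow> asymptotic (k \<circ> s) (k \<circ> t)"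
proof -
  obtain w where "w \<in> N" using ne by blast
  with assms kN show ?thesis
    by (subst T.asymptotic_base[of w], simp_all, subst asymptotic_base[of "k w"])
       (auto simp: gromov_product')
qed

lemma seqs': "range s \<subseteq> N \<Longrightarrow> s \<in> T.seqs_to_infinity \<longleftrightarrow> k \<circ> s \<in> seqs_to_infinity"
  using kN by (auto simp: T.seqs_to_infinity_def seqs_to_infinity_def asymptotic')

lemma limit': 
  assumes hyp: gromov_hyperbolic and st: "range s \<subseteq> N" "range t \<subseteq> N"
    and eq: "T.boundary_limit s = T.boundary_limit t"
  shows "boundary_limit (k \<circ> s) = boundary_limit (k \<circ> t)"
proof (cases "s \<in> T.seqs_to_infinity")
  case True
  then have "s \<in> T.boundary_limit t"
    unfolding eq[symmetric] by (auto simp: T.boundary_limit_def T.boundary_rel_def T.seqs_to_infinity_def)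
  then have "(k \<circ> t, k \<circ> s) \<in> boundary_rel"
    using st seqs' asymptotic' by (auto simp: T.boundary_limit_def T.boundary_rel_def boundary_rel_def)
  then show ?thesis
    unfolding boundary_limit_def using equiv_class_eq[OF equiv_boundary_rel[OF hyp]] by metis
next
  case False
  then have "T.boundary_limit t = {}"
    unfolding eq[symmetric] by (auto simp: T.boundary_limit_def T.boundary_rel_def)
  then have "t \<notin> T.seqs_to_infinity"
    by (auto simp: T.boundary_limit_def T.boundary_rel_def T.seqs_to_infinity_def)
  with False st show ?thesis
    by (auto simp: seqs' boundary_limit_def boundary_rel_def)
qed

lemma limit_points':
  assumes "g \<in> carrier G" "P \<in> T.limit_points g"
  obtains s where "range s \<subseteq> N" "P = T.boundary_limit s" "boundary_limit (k \<circ> s) \<in> limit_points g"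
proof -
  interpret G: group G by (rule group_G)
  obtain p where p: "p \<in> N" and
    "P = T.boundary_limit (\<lambda>n. \<phi>' (g [^] int n) p) \<or> P = T.boundary_limit (\<lambda>n. \<phi>' (g [^] (- int n)) p)"
    using assms(2) unfolding T.limit_points_def by auto
  moreover have "k \<circ> (\<lambda>n. \<phi>' (g [^] int n) p) = (\<lambda>n. \<phi> (g [^] int n) (k p))"
    "k \<circ> (\<lambda>n. \<phi>' (g [^] (- int n)) p) = (\<lambda>n. \<phi> (g [^] (- int n)) (k p))"
    using p assms(1) by (auto simp: fun_eq_iff k_\<phi>')
  moreover have "range (\<lambda>n. \<phi>' (g [^] int n) p) \<subseteq> N" "range (\<lambda>n. \<phi>' (g [^] (- int n)) p) \<subseteq> N"
    using p assms(1) by (auto simp: \<phi>'_N)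
  ultimately show thesis
    using that[of "\<lambda>n. \<phi>' (g [^] int n) p"] that[of "\<lambda>n. \<phi>' (g [^] (- int n)) p"] kM[OF p]
    unfolding limit_points_def by fastforce
qed

lemma loxodromic': "loxodromic g \<Longrightarrow> T.loxodromic g"
proof -
  interpret G: group G by (rule group_G)
  assume g: "loxodromic g"
  then have gc: "g \<in> carrier G" by (simp add: loxodromic_def)
  obtain p where p: "p \<in> N" using ne by blast
  have "quasi_isometric_embedding UNIV (\<lambda>m n. \<bar>real_of_int (m - n)\<bar>) M d (\<lambda>n::int. \<phi> (g [^] n) (k p))"
    by (rule loxodromic_any_point[OF g kM[OF p]])
  then have "quasi_isometric_embedding UNIV (\<lambda>m n. \<bar>real_of_int (m - n)\<bar>) N d' (\<lambda>n::int. \<phi>' (g [^] n) p)"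
    using p gc unfolding quasi_isometric_embedding_def by (simp add: d'_def k_\<phi>' \<phi>'_N Pi_iff)
  then show ?thesis using gc p unfolding T.loxodromic_def by blast
qed

lemma independent':
  assumes gromov_hyperbolic "independent_loxodromics g h"
  shows "T.independent_loxodromics g h"
proof -
  have c: "g \<in> carrier G" "h \<in> carrier G"
    using assms by (auto simp: independent_loxodromics_def loxodromic_def)
  have "P \<notin> T.limit_points h" if P: "P \<in> T.limit_points g" for P
  proof
    assume Q: "P \<in> T.limit_points h"
    obtain s where s: "range s \<subseteq> N" "P = T.boundary_limit s" "boundary_limit (k \<circ> s) \<in> limit_points g"
      using limit_points'[OF c(1) P] by blast
    obtain t where t: "range t \<subseteq> N" "P = T.boundary_limit t" "boundary_limit (k \<circ> t) \<in> limit_points h"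
      using limit_points'[OF c(2) Q] by blast
    show False
      using limit'[OF assms(1) s(1) t(1)] s t assms(2) unfolding independent_loxodromics_def by auto
  qed
  then show ?thesis
    using assms(2) loxodromic' unfolding independent_loxodromics_def T.independent_loxodromics_def
    by blast
qed

lemma acylindrical':
  assumes acylindrical shows T.acylindrical
  unfolding T.acylindrical_def
proof (intro allI impI)
  fix \<epsilon> :: real assume "\<epsilon> \<ge> 0"
  then obtain K :: nat and R where K: "K > 0" "R > 0" and
    *: "\<And>x y. \<lbrakk>x \<in> M; y \<in> M; d x y \<ge> R\<rbrakk> \<Longrightarrow>
     finite {g \<in> carrier G. d x (\<phi> g x) \<le> \<epsilon> \<and> d y (\<phi> g y) \<le> \<epsilon>} \<and>
     card {g \<in> carrier G. d x (\<phi> g x) \<le> \<epsilon> \<and> d y (\<phi> g y) \<le> \<epsilon>} \<le> K"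
    using assms unfolding acylindrical_def by meson
  have "{g \<in> carrier G. d' p (\<phi>' g p) \<le> \<epsilon> \<and> d' q (\<phi>' g q) \<le> \<epsilon>}
     = {g \<in> carrier G. d (k p) (\<phi> g (k p)) \<le> \<epsilon> \<and> d (k q) (\<phi> g (k q)) \<le> \<epsilon>}"
    if "p \<in> N" "q \<in> N" for p q
    using that by (auto simp: d'_def k_\<phi>')
  then show "\<exists>(K::nat)>0. \<exists>R>0. \<forall>x\<in>N. \<forall>y\<in>N. d' x y \<ge> R \<longrightarrow>
     finite {g \<in> carrier G. d' x (\<phi>' g x) \<le> \<epsilon> \<and> d' y (\<phi>' g y) \<le> \<epsilon>} \<and>
     card {g \<in> carrier G. d' x (\<phi>' g x) \<le> \<epsilon> \<and> d' y (\<phi>' g y) \<le> \<epsilon>} \<le> K"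
    using K * kM by (intro exI[of _ K] conjI exI[of _ R]) (auto simp: d'_def)
qed

lemma geodesic':
  assumes "\<And>x y. \<lbrakk>x \<in> k ` N; y \<in> k ` N\<rbrakk> \<Longrightarrow> \<exists>c.
     c \<in> {0..d x y} \<rightarrow> k ` N \<and> c 0 = x \<and> c (d x y) = y \<and>
     (\<forall>s\<in>{0..d x y}. \<forall>t\<in>{0..d x y}. d (c s) (c t) = \<bar>s - t\<bar>)"
  shows T.geodesic_space
  unfolding T.geodesic_space_def
proof (intro ballI)
  fix p q assume pq: "p \<in> N" "q \<in> N"
  obtain c where c: "c \<in> {0..d' p q} \<rightarrow> k ` N" "c 0 = k p" "c (d' p q) = k q"
     "\<forall>s\<in>{0..d' p q}. \<forall>t\<in>{0..d' p q}. d (c s) (c t) = \<bar>s - t\<bar>"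
    using assms[of "k p" "k q"] pq unfolding d'_def by blast
  have k: "k (the_inv_into N k (c s)) = c s" "the_inv_into N k (c s) \<in> N" if "s \<in> {0..d' p q}" for s
    using c(1) that f_the_inv_into_f[OF inj] the_inv_into_into[OF inj _ subset_refl] by blast+
  show "\<exists>c. c \<in> {0..d' p q} \<rightarrow> N \<and> c 0 = p \<and> c (d' p q) = q \<and>
     (\<forall>s\<in>{0..d' p q}. \<forall>t\<in>{0..d' p q}. d' (c s) (c t) = \<bar>s - t\<bar>)"
  proof (intro exI conjI)
    show "(\<lambda>s. the_inv_into N k (c s)) \<in> {0..d' p q} \<rightarrow> N" using k by auto
    show "the_inv_into N k (c 0) = p" "the_inv_into N k (c (d' p q)) = q"
      using c(2,3) pq the_inv_into_f_f[OF inj] by auto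
    show "\<forall>s\<in>{0..d' p q}. \<forall>t\<in>{0..d' p q}.
        d' (the_inv_into N k (c s)) (the_inv_into N k (c t)) = \<bar>s - t\<bar>"
      using c(4) k by (simp add: d'_def)
  qed
qed

lemma hyperbolic': "delta_hyperbolic \<delta> \<Longrightarrow> T.delta_hyperbolic \<delta>"
  unfolding delta_hyperbolic_def T.delta_hyperbolic_def gromov_product' using kM by blast

end

text \<open>Starting from a point, close up countably often under the group and under one chosen geodesic for
  each pair of points.\<close>

lemma (in isometric_action) small_geodesic_subspace:
  assumes geo: geodesic_space and x0: "x0 \<in> M"
  obtains M' where "M' \<subseteq> M" "M' \<noteq> {}" "M' \<lesssim> (UNIV :: ('a \<times> real) set)"
    "\<And>g x. \<lbrakk>g \<in> carrier G; x \<in> M'\<rbrakk> \<Longrightarrow> \<phi> g x \<in> M'"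
    "\<And>x y. \<lbrakk>x \<in> M'; y \<in> M'\<rbrakk> \<Longrightarrow> \<exists>c.
     c \<in> {0..d x y} \<rightarrow> M' \<and> c 0 = x \<and> c (d x y) = y \<and>
     (\<forall>s\<in>{0..d x y}. \<forall>t\<in>{0..d x y}. d (c s) (c t) = \<bar>s - t\<bar>)"
proof -
  interpret G: group G by (rule group_G)
  obtain c where c: "\<And>x y. \<lbrakk>x \<in> M; y \<in> M\<rbrakk> \<Longrightarrow>
     c x y \<in> {0..d x y} \<rightarrow> M \<and> c x y 0 = x \<and> c x y (d x y) = y \<and>
     (\<forall>s\<in>{0..d x y}. \<forall>t\<in>{0..d x y}. d (c x y s) (c x y t) = \<bar>s - t\<bar>)"
    using geo unfolding geodesic_space_def by metis
  define step where "step g x y r = \<phi> g (c x y (max 0 (min (d x y) r)))" for g x y r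
  define S where "S = rec_nat {x0} (\<lambda>n A. (\<lambda>(g, x, y, r). step g x y r) ` (carrier G \<times> A \<times> A \<times> UNIV))"
  have S0: "S 0 = {x0}" and
    SS: "S (Suc n) = (\<lambda>(g, x, y, r). step g x y r) ` (carrier G \<times> S n \<times> S n \<times> UNIV)" for n
    by (simp_all add: S_def)
  have step_in: "step g x y r \<in> S (Suc n)" if "g \<in> carrier G" "x \<in> S n" "y \<in> S n" for g x y r n
    unfolding SS using that by (intro image_eqI[of _ _ "(g, x, y, r)"]) auto
  have step_M: "step g x y r \<in> M" if "g \<in> carrier G" "x \<in> M" "y \<in> M" for g x y r
    unfolding step_def using c[OF that(2,3)] that by (intro act_closed) (auto simp: Pi_iff)
  have SM: "S n \<subseteq> M" for n
  proof (induction n)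
    case 0
    show ?case using x0 by (simp add: S0)
  next
    case (Suc n)
    then show ?case unfolding SS by (auto intro!: step_M)
  qed
  have step_x: "step g x x 0 = \<phi> g x" if "x \<in> M" for g x
    using c[OF that that] that by (simp add: step_def)
  have act: "\<phi> g x \<in> S (Suc n)" if "g \<in> carrier G" "x \<in> S n" for g x n
    using step_in[OF that(1) that(2) that(2), of 0] step_x[of x g] subsetD[OF SM that(2)] by simp
  have "S n \<subseteq> S (Suc n)" for n
  proof
    fix x assume x: "x \<in> S n"
    show "x \<in> S (Suc n)"
      using act[OF G.one_closed x] act_one[OF subsetD[OF SM x]] by simp
  qed
  then have mono: "m \<le> n \<Longrightarrow> S m \<subseteq> S n" for m n
    by (rule lift_Suc_mono_le)
  let ?K = "UNIV :: ('a \<times> real) set"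
  have infK: "infinite ?K" by (simp add: finite_prod infinite_UNIV_char_0)
  have KK: "?K \<times> ?K \<lesssim> ?K"
    using card_of_Times_same_infinite[OF infK] by (simp add: eqpoll_imp_lepoll eqpoll_iff_card_of_ordIso)
  have R: "(UNIV::real set) \<lesssim> ?K"
    unfolding lepoll_def by (intro exI[of _ "\<lambda>r. (undefined, r)"]) (auto simp: inj_on_def)
  have A: "carrier G \<lesssim> ?K"
    unfolding lepoll_def by (intro exI[of _ "\<lambda>g. (g, 0)"]) (auto simp: inj_on_def)
  have times: "P \<times> Q \<lesssim> ?K" if "P \<lesssim> ?K" "Q \<lesssim> ?K" for P :: "'u set" and Q :: "'v set"
    using times_lepoll_mono[OF that] KK lepoll_trans by blast
  have small: "S n \<lesssim> ?K" for n
  proof (induction n)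
    case 0
    show ?case unfolding S0 lepoll_def by auto
  next
    case (Suc n)
    have "carrier G \<times> S n \<times> S n \<times> (UNIV::real set) \<lesssim> ?K"
      by (intro times A Suc R)
    then show ?case
      unfolding SS using image_lepoll lepoll_trans by blast
  qed
  show thesis
  proof
    show "(\<Union>n. S n) \<subseteq> M" using SM by blast
    show "(\<Union>n. S n) \<noteq> {}" using S0 by blast
    have "(UNIV::nat set) \<lesssim> ?K" using infK infinite_le_lepoll by blast
    with small show "(\<Union>n. S n) \<lesssim> ?K"
      using card_of_UNION_ordLeq_infinite[OF infK, of UNIV S]
      by (simp add: lepoll_def flip: card_of_ordLeq)
    show "\<phi> g x \<in> (\<Union>n. S n)" if "g \<in> carrier G" "x \<in> (\<Union>n. S n)" for g x
      using act that by blast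
    fix x y assume xy: "x \<in> (\<Union>n. S n)" "y \<in> (\<Union>n. S n)"
    then obtain m n where "x \<in> S m" "y \<in> S n" by blast
    then have S: "x \<in> S (max m n)" "y \<in> S (max m n)"
      using mono[of m "max m n"] mono[of n "max m n"] by auto
    then have M: "x \<in> M" "y \<in> M" using SM by auto
    have "c x y r \<in> S (Suc (max m n))" if "r \<in> {0..d x y}" for r
    proof -
      have "c x y r \<in> M" using c[OF M] that by blast
      then have "step \<one> x y r = c x y r" using that by (simp add: step_def act_one)
      then show ?thesis using step_in[OF G.one_closed S, of r] by simp
    qed
    then have "c x y \<in> {0..d x y} \<rightarrow> (\<Union>n. S n)" by blast
    then show "\<exists>c. c \<in> {0..d x y} \<rightarrow> (\<Union>n. S n) \<and> c 0 = x \<and> c (d x y) = y \<and>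
     (\<forall>s\<in>{0..d x y}. \<forall>t\<in>{0..d x y}. d (c s) (c t) = \<bar>s - t\<bar>)"
      using c[OF M] by blast
  qed
qed

lemma acylindrically_hyperbolic_any_type:
  fixes G :: "('a, 'b) monoid_scheme"
  assumes "acylindrically_hyperbolic TYPE('x) G"
  shows "acylindrically_hyperbolic TYPE('a \<times> real) G"
proof -
  obtain M :: "'x set" and d \<phi> g h where
    act: "isometric_action M d G \<phi>" and hyp: "Metric_space.gromov_hyperbolic M d" and
    acyl: "isometric_action.acylindrical M d G \<phi>" and
    ind: "isometric_action.independent_loxodromics M d G \<phi> g h"
    using assms unfolding acylindrically_hyperbolic_def by (elim exE conjE bexE) (rule that)
  interpret isometric_action M d G \<phi> by (rule act)
  have geo: geodesic_space using hyp by (simp add: gromov_hyperbolic_def)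
  obtain x0 where x0: "x0 \<in> M"
    using ind unfolding independent_loxodromics_def loxodromic_def by blast
  obtain M' where M': "M' \<subseteq> M" "M' \<noteq> {}" "M' \<lesssim> (UNIV :: ('a \<times> real) set)"
    "\<And>g x. \<lbrakk>g \<in> carrier G; x \<in> M'\<rbrakk> \<Longrightarrow> \<phi> g x \<in> M'"
    and geo': "\<And>x y. \<lbrakk>x \<in> M'; y \<in> M'\<rbrakk> \<Longrightarrow> \<exists>c.
     c \<in> {0..d x y} \<rightarrow> M' \<and> c 0 = x \<and> c (d x y) = y \<and>
     (\<forall>s\<in>{0..d x y}. \<forall>t\<in>{0..d x y}. d (c s) (c t) = \<bar>s - t\<bar>)"
    by (rule small_geodesic_subspace[OF geo x0]) (rule that; assumption)
  obtain f :: "'x \<Rightarrow> 'a \<times> real" where f: "inj_on f M'"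
    using M'(3) unfolding lepoll_def by blast
  define N where "N = f ` M'"
  define k where "k = the_inv_into M' f"
  have image_k: "k ` N = M'" and k: "inj_on k N"
    using f by (simp_all add: N_def k_def the_inv_into_onto inj_on_the_inv_into)
  interpret transported_action M d G \<phi> N k
  proof
    show "inj_on k N" by (rule k)
    show "k ` N \<subseteq> M" using M'(1) image_k by simp
    show "N \<noteq> {}" using M'(2) by (simp add: N_def)
    show "\<phi> g (k p) \<in> k ` N" if "g \<in> carrier G" "p \<in> N" for g p
      using M'(4)[OF that(1), of "k p"] that(2) image_k by blast
  qed
  have "T.geodesic_space"
    by (rule geodesic') (unfold image_k, rule geo')
  moreover obtain \<delta> where "\<delta> \<ge> 0" "delta_hyperbolic \<delta>"
    using hyp unfolding gromov_hyperbolic_def by blast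
  ultimately have "T.gromov_hyperbolic"
    using hyperbolic' unfolding T.gromov_hyperbolic_def by blast
  moreover have "T.independent_loxodromics g h" "T.acylindrical"
    using independent'[OF hyp ind] acylindrical'[OF acyl] .
  moreover have "g \<in> carrier G" "h \<in> carrier G"
    using ind by (auto simp: independent_loxodromics_def loxodromic_def)
  ultimately show ?thesis
    unfolding acylindrically_hyperbolic_def
    by (intro exI[of _ N] exI[of _ d'] exI[of _ "\<phi>'"] conjI action' bexI[of _ g] bexI[of _ h])
qed

end

theory Submission
  imports Defs "HOL-Real_Asymp.Real_Asymp"
begin

text \<open>Let \<open>H\<close> act acylindrically on a hyperbolic space \<open>X\<close>, with independent loxodromic elements \<open>a\<close> and \<open>b\<close>.
  As \<open>H\<close> is existentially closed, the finitely presented group \<open>G\<close> has homomorphisms to \<open>H\<close> that fix \<open>a\<close> and \<open>b\<close>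
  and are injective on any given finite set. Pull the action on \<open>X\<close> back along them and take a limit along an
  ultrafilter. If the orbits of a base point stay bounded, then \<open>G\<close> acts acylindrically on the limit space, because
  acylindricity bounds the number of elements of finite sets. Otherwise the rescaled limit is a tree on which \<open>a\<close>
  and \<open>b\<close> fix the base point. A generator \<open>s\<close> that moves the base point yields a word \<open>w = (s h s h')\<^sup>2\<close>, with
  \<open>h\<close> and \<open>h'\<close> among the powers of \<open>a\<close> or \<open>b\<close>, whose axis contains a segment that is almost fixed by
  boundedly many elements only. Counting the disjoint translates of this segment between two points gives a
  hyperbolic distance on \<open>G\<close>, whose injective hull is a geodesic space with an acylindrical action of \<open>G\<close>.\<close>

section \<open>Loxodromic elements\<close>

text \<open>A single homomorphism is injective only on a finite set. Finiteness statements about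
  \<open>G\<close> are therefore put as bounds on the cardinality of arbitrary finite subsets, and
  these survive the limit as soon as they are uniform in the homomorphism. This uniformity is the
  obstacle in the rescaled case: the argument gives no bound for the stabilizers of general segments
  of the tree. What acylindricity of \<open>H\<close> does control is a bent path, with constants
  that depend only on the displacements of \<open>h\<close> and \<open>h'\<close> and on Gromov
  products at the base point. Hence \<open>h\<close> and \<open>h'\<close> are powers of
  \<open>a\<close> or \<open>b\<close>, whose images are the same under all homomorphisms, and
  directions are compared before rescaling, where "different" means a bounded Gromov product and not
  merely one that is small against the scale. The two bends have to differ, which is why two
  elements \<open>h\<close> and \<open>h'\<close> are needed. The square in \<open>w\<close> makes
  the segment from the identity to \<open>w\<close> long enough to contain the bent path
  \<open>s h s h' s\<close>. Either case ends with a pseudometric on a bare set of points, and the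
  injective hull turns it into a geodesic metric space.\<close>

lemma superadditive_up_to_constant:
  fixes a :: "nat \<Rightarrow> real"
  assumes four: "\<And>p q r. a (p + q) + a (q + r) \<le> max (a p + a r) (a (p + q + r) + a q) + 2 * \<delta>"
    and nonneg: "\<And>n. 0 \<le> a n" and zero: "a 0 = 0" and \<delta>: "0 \<le> \<delta>"
    and sub: "\<And>m n. a (m + n) \<le> a m + a n" "\<And>m n. a m \<le> a (m + n) + a n"
    and L: "0 < L" and lower: "\<And>n. n / L - C \<le> a n"
  obtains K where "\<And>m n. a m + a n \<le> a (m + n) + K"
proof -
  \<comment> \<open>Otherwise every doubling of the argument adds at most
    \<open>4 * \<delta> + 1\<close>, so that \<open>a\<close> grows only logarithmically along
    powers of 2, against the linear lower bound.\<close>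
  have "\<exists>N\<ge>1. a (2 * N) > a N + 4 * \<delta> + 1"
  proof (rule ccontr)
    assume "\<not> ?thesis"
    then have *: "a (2 * N) \<le> a N + (4 * \<delta> + 1)" if "N \<ge> 1" for N
      using that by (simp add: not_less add.assoc)
    have upper: "a (2 ^ j) \<le> a 1 + j * (4 * \<delta> + 1)" for j
    proof (induction j)
      case (Suc j)
      have "a (2 ^ Suc j) \<le> a (2 ^ j) + (4 * \<delta> + 1)"
        using *[of "2 ^ j"] by simp
      then show ?case using Suc by (simp add: algebra_simps)
    qed simp
    have "2 ^ j / L - C \<le> a 1 + j * (4 * \<delta> + 1)" for j :: nat
      using lower[of "2 ^ j"] upper[of j] by simp
    moreover have "eventually (\<lambda>j. 2 ^ j / L - C > a 1 + j * (4 * \<delta> + 1)) at_top"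
      using L by real_asymp
    ultimately show False
      by (meson eventually_at_top_linorder not_less order_refl)
  qed
  then obtain N where N: "N \<ge> 1" "a (2 * N) > a N + 4 * \<delta> + 1" by blast
  \<comment> \<open>The gap \<open>2 * \<delta> + 1\<close> is what rules out the first term of the
    maximum in the four-point inequality; the second term then reproduces the gap for the next
    multiple.\<close>
  have mono: "a (Suc k * N) \<ge> a (k * N) + (2 * \<delta> + 1)" for k
  proof (induction k)
    case 0
    have "a (2 * N) \<le> a N + a N" using sub(1)[of N N] by (simp only: mult_2)
    then have "a N \<ge> 2 * \<delta> + 1" using N(2) \<delta> by linarith
    then show ?case using zero by simp
  next
    case (Suc k)
    have e: "k * N + N = Suc k * N" "N + N = 2 * N" "Suc k * N + N = Suc (Suc k) * N" by simp_all
    have "a (Suc k * N) + a (2 * N) \<le> max (a (k * N) + a N) (a (Suc (Suc k) * N) + a N) + 2 * \<delta>"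
      using four[of "k * N" N N] unfolding e .
    with Suc N(2) \<delta> show ?case unfolding max_def by (simp only: split: if_splits)
  qed
  \<comment> \<open>Again \<open>mono\<close> excludes the first term of the maximum. Remainders
    modulo \<open>N\<close> are absorbed afterwards by the maximum \<open>A\<close>.\<close>
  have mult: "a (i * N) + a (j * N) \<le> a ((i + j) * N) + (a N + 2 * \<delta>)" for i j
  proof (cases j)
    case 0
    then show ?thesis using \<delta> nonneg[of N] zero by simp
  next
    case (Suc k)
    have e: "i * N + N = Suc i * N" "N + k * N = j * N" "Suc i * N + k * N = (i + j) * N"
      using Suc by (simp_all add: algebra_simps)
    have "a (Suc i * N) + a (j * N) \<le> max (a (i * N) + a (k * N)) (a ((i + j) * N) + a N) + 2 * \<delta>"
      using four[of "i * N" N "k * N"] unfolding e .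
    with mono[of i] mono[of k] \<delta> show ?thesis
      unfolding max_def Suc by (simp only: split: if_splits)
  qed
  define A where "A = Max (a ` {..<N})"
  have A: "a r \<le> A" if "r < N" for r
    unfolding A_def using that by simp
  have "a m + a n \<le> a (m + n) + (a N + 2 * \<delta> + 4 * A)" for m n
  proof -
    let ?i = "m div N" let ?j = "n div N" let ?r = "m mod N" let ?s = "n mod N"
    have "(?i + ?j) * N + (?r + ?s) = m + n" unfolding add_mult_distrib
      using div_mult_mod_eq[of m N] div_mult_mod_eq[of n N] by linarith
    then have "a m \<le> a (?i * N) + a ?r" "a n \<le> a (?j * N) + a ?s"
      "a ((?i + ?j) * N) \<le> a (m + n) + a (?r + ?s)"
      using sub(1)[of "?i * N" ?r] sub(1)[of "?j * N" ?s] sub(2)[of "(?i + ?j) * N" "?r + ?s"]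
      by simp_all
    moreover have "a (?r + ?s) \<le> a ?r + a ?s" by (rule sub)
    moreover have "a ?r \<le> A" "a ?s \<le> A" using A N by auto
    ultimately show ?thesis using mult[of ?i ?j] by linarith
  qed
  then show thesis by (rule that)
qed

section \<open>Hyperbolicity as a four-point condition\<close>

context Metric_space
begin

lemma four_point:
  assumes "delta_hyperbolic \<delta>" "x \<in> M" "y \<in> M" "z \<in> M" "w \<in> M"
  shows "d x z + d y w \<le> max (d x y + d z w) (d y z + d x w) + 2 * \<delta>"
proof -
  have "gromov_product w x z \<ge> min (gromov_product w x y) (gromov_product w y z) - \<delta>"
    using assms unfolding delta_hyperbolic_def by blast
  then show ?thesis
    unfolding gromov_product_def min_def max_def
    by (simp add: commute split: if_splits) (simp_all add: commute field_simps)
qed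

lemma delta_hyperbolicI:
  assumes "\<And>x y z w. \<lbrakk>x \<in> M; y \<in> M; z \<in> M; w \<in> M\<rbrakk>
    \<Longrightarrow> d x z + d y w \<le> max (d x y + d z w) (d y z + d x w) + 2 * \<delta>"
  shows "delta_hyperbolic \<delta>"
  unfolding delta_hyperbolic_def
proof (intro ballI)
  fix w x y z assume "w \<in> M" "x \<in> M" "y \<in> M" "z \<in> M"
  then show "min (gromov_product w x y) (gromov_product w y z) - \<delta> \<le> gromov_product w x z"
    using assms[of x y z w] unfolding gromov_product_def min_def max_def
    by (simp split: if_splits) (simp_all add: field_simps)
qed

lemma gromov_product_le:
  assumes "w \<in> M" "x \<in> M" "y \<in> M"
  shows "gromov_product w x y \<le> d w x" "gromov_product w x y \<le> d w y"
  using assms triangle[of y x w] triangle[of x y w] by (simp_all add: gromov_product_def commute)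

end

section \<open>Orbits of loxodromic elements\<close>

context isometric_action
begin

sublocale G: group G by (rule group_G)

lemma act_pow_closed [simp]: "\<lbrakk>g \<in> carrier G; x \<in> M\<rbrakk> \<Longrightarrow> \<phi> (g [^] (n::int)) x \<in> M"
  by (simp add: act_closed)

lemma dist_act_inv:
  assumes "g \<in> carrier G" "x \<in> M" "y \<in> M"
  shows "d (\<phi> (inv\<^bsub>G\<^esub> g) x) y = d x (\<phi> g y)"
proof -
  have "d (\<phi> g (\<phi> (inv\<^bsub>G\<^esub> g) x)) (\<phi> g y) = d (\<phi> (inv\<^bsub>G\<^esub> g) x) y"
    using assms by (intro isometry act_closed) auto
  moreover have "\<phi> g (\<phi> (inv\<^bsub>G\<^esub> g) x) = x"
    using assms act_mult[of g "inv\<^bsub>G\<^esub> g" x] by (simp add: act_one)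
  ultimately show ?thesis by simp
qed

lemma dist_orbit:
  assumes "g \<in> carrier G" "x \<in> M"
  shows "d (\<phi> (g [^] (m::int)) x) (\<phi> (g [^] (n::int)) x) = d x (\<phi> (g [^] (n - m)) x)"
proof -
  have "g [^] n = g [^] m \<otimes> g [^] (n - m)"
    using assms by (simp add: flip: G.int_pow_mult)
  then have "\<phi> (g [^] n) x = \<phi> (g [^] m) (\<phi> (g [^] (n - m)) x)"
    using assms by (simp add: act_mult)
  then show ?thesis
    using assms isometry[of "g [^] m" x "\<phi> (g [^] (n - m)) x"] by (simp add: act_closed)
qed

lemma dist_orbit_neg:
  assumes "g \<in> carrier G" "x \<in> M"
  shows "d x (\<phi> (g [^] (- n::int)) x) = d x (\<phi> (g [^] n) x)"
  using dist_orbit[OF assms, of 0 "-n"] dist_orbit[OF assms, of "-n" 0] assms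
  by (simp add: act_one commute)

lemma orbit_superadditive:
  assumes hyp: "delta_hyperbolic \<delta>" "0 \<le> \<delta>" and g: "g \<in> carrier G" and x: "x \<in> M"
    and L: "0 < L" and lower: "\<And>n::nat. n / L - C \<le> d x (\<phi> (g [^] int n) x)"
  shows "\<exists>K. \<forall>m n::nat.
    d x (\<phi> (g [^] int m) x) + d x (\<phi> (g [^] int n) x) \<le> d x (\<phi> (g [^] int (m + n)) x) + K"
proof -
  define a where "a n = d x (\<phi> (g [^] int n) x)" for n
  have a: "d (\<phi> (g [^] int m) x) (\<phi> (g [^] int n) x) = a (n - m)"
    "d (\<phi> (g [^] int n) x) (\<phi> (g [^] int m) x) = a (n - m)" if "m \<le> n" for m n
    using dist_orbit[OF g x, of "int m" "int n"] that by (simp_all add: a_def of_nat_diff commute)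
  have M: "\<phi> (g [^] int n) x \<in> M" for n using g x by simp
  have zero: "a 0 = 0" using x by (simp add: a_def act_one)
  note m0 = M[of 0]
  have "\<exists>K. \<forall>m n. a m + a n \<le> a (m + n) + K"
  proof (rule superadditive_up_to_constant[of a \<delta> L C])
    fix p q r :: nat
    show "a (p + q) + a (q + r) \<le> max (a p + a r) (a (p + q + r) + a q) + 2 * \<delta>"
      using four_point[OF hyp(1) M[of 0] M[of p] M[of "p + q"] M[of "p + q + r"]]
      by (simp add: a del: of_nat_add of_nat_0)
  next
    fix m n :: nat
    show "a (m + n) \<le> a m + a n"
      using triangle[OF M[of 0] M[of m] M[of "m + n"]] by (simp add: a del: of_nat_add of_nat_0)
    show "a m \<le> a (m + n) + a n"
      using triangle[OF M[of 0] M[of "m + n"] M[of m]] by (simp add: a del: of_nat_add of_nat_0)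
    next
    show "\<exists>K. \<forall>m n. a m + a n \<le> a (m + n) + K" if "\<And>m n. a m + a n \<le> a (m + n) + K" for K
      using that by blast
    show "n / L - C \<le> a n" for n unfolding a_def by (rule lower)
    show "0 \<le> a n" for n by (simp add: a_def)
  qed (use zero hyp L in auto)
  then show ?thesis unfolding a_def .
qed

text \<open>Superadditivity up to a constant means that the point with exponent \<open>m\<close>
  lies almost on a geodesic from \<open>x\<close> to the point with exponent \<open>n\<close>, so
  the Gromov product is almost the whole distance to the former.\<close>

lemma orbit_gromov_product:
  assumes hyp: "delta_hyperbolic \<delta>" "0 \<le> \<delta>" and g: "g \<in> carrier G" and x: "x \<in> M"
    and L: "0 < L" and lower: "\<And>n::nat. n / L - C \<le> d x (\<phi> (g [^] int n) x)"
  shows "\<exists>K. \<forall>m n::nat. m \<le> n \<longrightarrow>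
    d x (\<phi> (g [^] int m) x) - K \<le> gromov_product x (\<phi> (g [^] int m) x) (\<phi> (g [^] int n) x)"
proof -
  obtain K where K: "\<And>m n::nat.
    d x (\<phi> (g [^] int m) x) + d x (\<phi> (g [^] int n) x) \<le> d x (\<phi> (g [^] int (m + n)) x) + K"
    using orbit_superadditive[OF assms] by blast
  show ?thesis
  proof (intro exI[of _ "K / 2"] allI impI)
    fix m n :: nat assume "m \<le> n"
    then have "d (\<phi> (g [^] int m) x) (\<phi> (g [^] int n) x) = d x (\<phi> (g [^] int (n - m)) x)"
      "int (m + (n - m)) = int n"
      using dist_orbit[OF g x, of "int m" "int n"] by (simp_all add: of_nat_diff)
    then show "d x (\<phi> (g [^] int m) x) - K / 2 \<le> gromov_product x (\<phi> (g [^] int m) x) (\<phi> (g [^] int n) x)"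
      using K[of m "n - m"] commute[of x "\<phi> (g [^] int m) x"] commute[of x "\<phi> (g [^] int n) x"]
      unfolding gromov_product_def by (simp del: of_nat_add of_nat_diff)
  qed
qed

text \<open>The triangle inequality supplies the upper bound of a quasi-isometric embedding, and
  opposite powers have equal displacement. What remains to be checked is linear growth along the
  positive powers at one point.\<close>

lemma loxodromicI:
  assumes g: "g \<in> carrier G" and x: "x \<in> M"
    and L: "0 < L" and lower: "\<And>n::nat. n / L - C \<le> d x (\<phi> (g [^] int n) x)"
  shows "loxodromic g"
proof -
  define K where "K = max (max L 1) (d x (\<phi> g x))"
  have up: "d x (\<phi> (g [^] int n) x) \<le> n * d x (\<phi> g x)" for n :: nat
  proof (induction n)
    case (Suc n)
    have "d x (\<phi> (g [^] int (Suc n)) x) \<le> d x (\<phi> (g [^] int n) x) + d (\<phi> (g [^] int n) x) (\<phi> (g [^] int (Suc n)) x)"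
      using g x by (intro triangle) auto
    also have "d (\<phi> (g [^] int n) x) (\<phi> (g [^] int (Suc n)) x) = d x (\<phi> g x)"
      using dist_orbit[OF g x, of "int n" "int (Suc n)"] g by simp
    finally show ?case using Suc by (simp add: algebra_simps)
  qed (use x in \<open>simp add: act_one\<close>)
  have *: "\<bar>real_of_int n\<bar> / L - C \<le> d x (\<phi> (g [^] n) x) \<and> d x (\<phi> (g [^] n) x) \<le> \<bar>real_of_int n\<bar> * d x (\<phi> g x)" for n :: int
  proof (cases "n \<ge> 0")
    case True
    then show ?thesis using up[of "nat n"] lower[of "nat n"] by simp
  next
    case False
    then show ?thesis using up[of "nat (- n)"] lower[of "nat (- n)"] dist_orbit_neg[OF g x, of n] by simp
  qed
  have K: "K \<ge> 1" "K \<ge> L" "K \<ge> d x (\<phi> g x)" by (auto simp: K_def)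
  have "\<bar>real_of_int (m - n)\<bar> / K - \<bar>C\<bar> \<le> d (\<phi> (g [^] m) x) (\<phi> (g [^] n) x) \<and>
     d (\<phi> (g [^] m) x) (\<phi> (g [^] n) x) \<le> K * \<bar>real_of_int (m - n)\<bar> + \<bar>C\<bar>" for m n :: int
  proof -
    have "\<bar>real_of_int (m - n)\<bar> / K \<le> \<bar>real_of_int (m - n)\<bar> / L"
      using K L by (intro divide_left_mono) auto
    moreover have "\<bar>real_of_int (m - n)\<bar> * d x (\<phi> g x) \<le> \<bar>real_of_int (m - n)\<bar> * K"
      using K by (intro mult_left_mono) auto
    moreover have "\<bar>real_of_int (n - m)\<bar> = \<bar>real_of_int (m - n)\<bar>" by simp
    with *[of "n - m"] dist_orbit[OF g x, of m n]
    have "\<bar>real_of_int (m - n)\<bar> / L - C \<le> d (\<phi> (g [^] m) x) (\<phi> (g [^] n) x)"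
      "d (\<phi> (g [^] m) x) (\<phi> (g [^] n) x) \<le> \<bar>real_of_int (m - n)\<bar> * d x (\<phi> g x)"
      by metis+
    ultimately show ?thesis
      using abs_ge_zero[of C] abs_ge_self[of C] unfolding mult.commute[of K] by linarith
  qed
  then show ?thesis
    unfolding loxodromic_def quasi_isometric_embedding_def
    using g x K(1) by (intro conjI bexI[of _ x] exI[of _ K] exI[of _ "\<bar>C\<bar>"]) auto
qed

lemma loxodromic_lower:
  assumes "loxodromic g" "x \<in> M"
  obtains L C where "0 < L" "\<And>n::int. \<bar>real_of_int n\<bar> / L - C \<le> d x (\<phi> (g [^] n) x)"
proof -
  have "g \<in> carrier G" using assms by (simp add: loxodromic_def)
  have "quasi_isometric_embedding UNIV (\<lambda>m n. \<bar>real_of_int (m - n)\<bar>) M d (\<lambda>n::int. \<phi> (g [^] n) x)"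
    by (rule loxodromic_any_point[OF assms])
  then obtain L C where L: "L \<ge> 1" and
    *: "\<And>m n. \<bar>real_of_int (m - n)\<bar> / L - C \<le> d (\<phi> (g [^] m) x) (\<phi> (g [^] n) x)"
    unfolding quasi_isometric_embedding_def by blast
  have "\<bar>real_of_int n\<bar> / L - C \<le> d x (\<phi> (g [^] n) x)" for n
    using *[of 0 n] assms by (simp add: act_one)
  then show thesis using that[of L C] L by simp
qed

lemma loxodromic_inv:
  assumes "loxodromic g"
  shows "loxodromic (inv\<^bsub>G\<^esub> g)"
proof -
  have g: "g \<in> carrier G" using assms by (simp add: loxodromic_def)
  obtain x where x: "x \<in> M" using assms by (auto simp: loxodromic_def)
  obtain L C where L: "0 < L" "\<And>n::int. \<bar>real_of_int n\<bar> / L - C \<le> d x (\<phi> (g [^] n) x)"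
    using loxodromic_lower[OF assms x] by blast
  show ?thesis
  proof (rule loxodromicI[OF _ x L(1)])
    show "real n / L - C \<le> d x (\<phi> ((inv\<^bsub>G\<^esub> g) [^] int n) x)" for n
      using L(2)[of "- int n"] g by (simp add: G.int_pow_inv G.int_pow_neg)
  qed (use g in simp)
qed

lemma loxodromic_gromov_product:
  assumes hyp: "delta_hyperbolic \<delta>" "0 \<le> \<delta>" and g: "loxodromic g" and x: "x \<in> M"
  shows "\<exists>K. \<forall>m n::nat. m \<le> n \<longrightarrow>
    d x (\<phi> (g [^] int m) x) - K \<le> gromov_product x (\<phi> (g [^] int m) x) (\<phi> (g [^] int n) x)"
proof -
  obtain L C where L: "0 < L" "\<And>n::int. \<bar>real_of_int n\<bar> / L - C \<le> d x (\<phi> (g [^] n) x)"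
    using loxodromic_lower[OF g x] by blast
  show ?thesis
  proof (rule orbit_gromov_product[OF hyp _ x L(1)])
    show "g \<in> carrier G" using g by (simp add: loxodromic_def)
    show "real n / L - C \<le> d x (\<phi> (g [^] int n) x)" for n
      using L(2)[of "int n"] by simp
  qed
qed

lemma loxodromic_seq_to_infinity:
  assumes hyp: "delta_hyperbolic \<delta>" "0 \<le> \<delta>" and g: "loxodromic g" and x: "x \<in> M"
  shows "(\<lambda>n. \<phi> (g [^] int n) x) \<in> seqs_to_infinity"
proof -
  have gc: "g \<in> carrier G" using g by (simp add: loxodromic_def)
  obtain L C where L: "0 < L" "\<And>n::int. \<bar>real_of_int n\<bar> / L - C \<le> d x (\<phi> (g [^] n) x)"
    using loxodromic_lower[OF g x] by blast
  obtain K where K: "\<And>m n::nat. m \<le> n \<Longrightarrow>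
    d x (\<phi> (g [^] int m) x) - K \<le> gromov_product x (\<phi> (g [^] int m) x) (\<phi> (g [^] int n) x)"
    using loxodromic_gromov_product[OF assms] by blast
  have "\<exists>N. \<forall>i\<ge>N. \<forall>j\<ge>N. Z \<le> gromov_product x (\<phi> (g [^] int i) x) (\<phi> (g [^] int j) x)" for Z
  proof -
    obtain N :: nat where N: "N \<ge> (Z + K + C) * L" using real_arch_simple by blast
    have far: "Z + K \<le> d x (\<phi> (g [^] int i) x)" if "i \<ge> N" for i
    proof -
      have "(Z + K + C) * L \<le> real i" using N that by linarith
      then have "Z + K + C \<le> real i / L" using L(1) by (simp add: pos_le_divide_eq)
      then show ?thesis using L(2)[of "int i"] by simp
    qed
    have "Z \<le> gromov_product x (\<phi> (g [^] int i) x) (\<phi> (g [^] int j) x)" if "i \<ge> N" "j \<ge> N" for i j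
      using K[of i j] K[of j i] far[OF that(1)] far[OF that(2)]
        gromov_product_commute[of x "\<phi> (g [^] int i) x" "\<phi> (g [^] int j) x"]
      by (cases "i \<le> j") linarith+
    then show ?thesis by blast
  qed
  moreover have "range (\<lambda>n. \<phi> (g [^] int n) x) \<subseteq> M" using gc x by auto
  ultimately show ?thesis
    unfolding seqs_to_infinity_def by (simp add: asymptotic_base[OF x])
qed

end

section \<open>Boundary points compared by Gromov products\<close>

context Metric_space
begin

lemma boundary_limit_eqI:
  assumes hyp: "delta_hyperbolic \<delta>" and s: "s \<in> seqs_to_infinity" and t: "t \<in> seqs_to_infinity"
    and st: "asymptotic s t"
  shows "boundary_limit s = boundary_limit t"
proof -
  have M: "range s \<subseteq> M" "range t \<subseteq> M" using s t by (auto simp: seqs_to_infinity_def)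
  have "asymptotic s u \<longleftrightarrow> asymptotic t u" if "range u \<subseteq> M" for u
    using asymptotic_trans[OF hyp M(2,1) that asymptotic_sym[OF st]] asymptotic_trans[OF hyp M that st] by blast
  then show ?thesis
    unfolding boundary_limit_def boundary_rel_def using s t by (auto simp: seqs_to_infinity_def)
qed

lemma boundary_limit_eqD:
  assumes "s \<in> seqs_to_infinity" "boundary_limit s = boundary_limit t"
  shows "asymptotic t s"
proof -
  have "s \<in> boundary_limit s"
    using assms(1) by (auto simp: boundary_limit_def boundary_rel_def seqs_to_infinity_def)
  then show ?thesis
    unfolding assms(2) by (simp add: boundary_limit_def boundary_rel_def)
qed

lemma gromov_product_move:
  assumes "w \<in> M" "x \<in> M" "y \<in> M" "z \<in> M"
  shows "gromov_product w x y \<le> gromov_product w z y + d x z"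
    "gromov_product w y x \<le> gromov_product w y z + d x z"
  using assms triangle[of x z w] triangle[of z x y] commute[of x z] commute[of y x] commute[of y z]
  by (simp_all add: gromov_product_def field_simps)

lemma gromov_product_min:
  assumes "delta_hyperbolic \<delta>" "w \<in> M" "x \<in> M" "y \<in> M" "z \<in> M"
  shows "min (gromov_product w x y) (gromov_product w y z) \<le> gromov_product w x z + \<delta>"
  using assms unfolding delta_hyperbolic_def by (simp add: algebra_simps)

end

section \<open>Independence as boundedness of Gromov products of orbits\<close>

context isometric_action
begin

lemma loxodromic_signed:
  assumes "loxodromic g" "e = 1 \<or> e = - (1::int)"
  shows "loxodromic (g [^] e)"
  using assms loxodromic_inv[OF assms(1)] by (auto simp: loxodromic_def G.int_pow_neg)

lemma pow_signed: "g \<in> carrier G \<Longrightarrow> (g [^] (e::int)) [^] (n::int) = g [^] (e * n)"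
  by (simp add: G.int_pow_pow)

text \<open>Some Gromov products of points arbitrarily far out stay below a fixed \<open>Z\<close>.
  Two applications of hyperbolicity lead from \<open>m\<close>, \<open>n\<close> to such far points
  \<open>i\<close>, \<open>j\<close>; the Gromov products along each single orbit are almost full
  distances, so they are not the reason for a small minimum, and the bound passes back to
  \<open>m\<close>, \<open>n\<close>.\<close>

lemma nonasymptotic_orbits_bounded:
  assumes hyp: "delta_hyperbolic \<delta>" "0 \<le> \<delta>" and g: "loxodromic g" and h: "loxodromic h" and x: "x \<in> M"
    and na: "\<not> asymptotic (\<lambda>n. \<phi> (g [^] int n) x) (\<lambda>n. \<phi> (h [^] int n) x)"
  shows "\<exists>B. \<forall>m n::nat. gromov_product x (\<phi> (g [^] int m) x) (\<phi> (h [^] int n) x) \<le> B"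
proof -
  have gc: "g \<in> carrier G" "h \<in> carrier G" using g h by (auto simp: loxodromic_def)
  let ?g = "\<lambda>n::nat. \<phi> (g [^] int n) x" and ?h = "\<lambda>n::nat. \<phi> (h [^] int n) x"
  have M: "?g n \<in> M" "?h n \<in> M" for n using gc x by auto
  obtain K where K: "\<And>m n. m \<le> n \<Longrightarrow> d x (?g m) - K \<le> gromov_product x (?g m) (?g n)"
    using loxodromic_gromov_product[OF hyp g x] by blast
  obtain K' where K': "\<And>m n. m \<le> n \<Longrightarrow> d x (?h m) - K' \<le> gromov_product x (?h m) (?h n)"
    using loxodromic_gromov_product[OF hyp h x] by blast
  have "range ?g \<subseteq> M" "range ?h \<subseteq> M" using M by auto
  with na obtain Z where Z: "\<And>N. \<exists>i\<ge>N. \<exists>j\<ge>N. gromov_product x (?g i) (?h j) < Z"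
    unfolding asymptotic_base[OF x \<open>range ?g \<subseteq> M\<close> \<open>range ?h \<subseteq> M\<close>] by (meson not_le)
  have "gromov_product x (?g m) (?h n) \<le> \<bar>Z\<bar> + 2 * \<delta> + \<bar>K\<bar> + \<bar>K'\<bar>" for m n
  proof -
    obtain i j where ij: "i \<ge> max m n" "j \<ge> max m n" "gromov_product x (?g i) (?h j) < Z"
      using Z by blast
    have "min (gromov_product x (?g i) (?g m)) (gromov_product x (?g m) (?h n)) \<le> gromov_product x (?g i) (?h n) + \<delta>"
      "min (gromov_product x (?g i) (?h n)) (gromov_product x (?h n) (?h j)) \<le> gromov_product x (?g i) (?h j) + \<delta>"
      using M x by (auto intro!: gromov_product_min hyp)
    moreover have "d x (?g m) - K \<le> gromov_product x (?g i) (?g m)" "d x (?h n) - K' \<le> gromov_product x (?h n) (?h j)"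
      using K[of m i] K'[of n j] ij gromov_product_commute[of x "?g i" "?g m"] by auto
    moreover have "gromov_product x (?g m) (?h n) \<le> d x (?g m)" "gromov_product x (?g m) (?h n) \<le> d x (?h n)"
      using gromov_product_le M x by auto
    ultimately show ?thesis using ij(3) hyp(2) unfolding min_def by (simp only: split: if_splits)
  qed
  then show ?thesis by blast
qed

text \<open>Each choice of signs gives two half-orbits with different limits, and the four bounds
  cover all pairs of integers.\<close>

lemma independent_bounded:
  assumes hyp: "delta_hyperbolic \<delta>" "0 \<le> \<delta>" and ind: "independent_loxodromics g h" and x: "x \<in> M"
  shows "\<exists>B. \<forall>(m::int) (n::int). gromov_product x (\<phi> (g [^] m) x) (\<phi> (h [^] n) x) \<le> B"
proof -
  have g: "loxodromic g" and h: "loxodromic h" and gc: "g \<in> carrier G" "h \<in> carrier G"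
    using ind by (auto simp: independent_loxodromics_def loxodromic_def)
  have "\<exists>B. \<forall>m n::nat. gromov_product x (\<phi> (g [^] (e * int m)) x) (\<phi> (h [^] (f * int n)) x) \<le> B"
    if ef: "e = 1 \<or> e = - (1::int)" "f = 1 \<or> f = - (1::int)" for e f
  proof -
    let ?s = "\<lambda>n. \<phi> ((g [^] e) [^] int n) x" and ?t = "\<lambda>n. \<phi> ((h [^] f) [^] int n) x"
    have *: "loxodromic (g [^] e)" "loxodromic (h [^] f)"
      using loxodromic_signed g h ef by auto
    have "boundary_limit ?s \<in> limit_points g" "boundary_limit ?t \<in> limit_points h"
      using ef x gc by (auto simp: limit_points_def pow_signed)
    then have "boundary_limit ?s \<noteq> boundary_limit ?t"
      using ind by (auto simp: independent_loxodromics_def)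
    then have "\<not> asymptotic ?s ?t"
      using boundary_limit_eqI[OF hyp(1)] loxodromic_seq_to_infinity[OF hyp _ x] * by blast
    then show ?thesis
      using nonasymptotic_orbits_bounded[OF hyp * x] gc by (simp add: pow_signed)
  qed
  note B = this
  obtain B1 where B1: "\<And>m n::nat. gromov_product x (\<phi> (g [^] (1 * int m)) x) (\<phi> (h [^] (1 * int n)) x) \<le> B1"
    using B[of 1 1] by blast
  obtain B2 where B2: "\<And>m n::nat. gromov_product x (\<phi> (g [^] (1 * int m)) x) (\<phi> (h [^] (- 1 * int n)) x) \<le> B2"
    using B[of 1 "-1"] by blast
  obtain B3 where B3: "\<And>m n::nat. gromov_product x (\<phi> (g [^] (- 1 * int m)) x) (\<phi> (h [^] (1 * int n)) x) \<le> B3"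
    using B[of "-1" 1] by blast
  obtain B4 where B4: "\<And>m n::nat. gromov_product x (\<phi> (g [^] (- 1 * int m)) x) (\<phi> (h [^] (- 1 * int n)) x) \<le> B4"
    using B[of "-1" "-1"] by blast
  have "gromov_product x (\<phi> (g [^] m) x) (\<phi> (h [^] n) x) \<le> max (max B1 B2) (max B3 B4)" for m n :: int
  proof -
    have "m = 1 * int (nat m) \<or> m = - 1 * int (nat (- m))" "n = 1 * int (nat n) \<or> n = - 1 * int (nat (- n))"
      by auto
    then show ?thesis
      using B1[of "nat m" "nat n"] B2[of "nat m" "nat (- n)"] B3[of "nat (- m)" "nat n"] B4[of "nat (- m)" "nat (- n)"]
      by (elim disjE) (simp_all add: le_max_iff_disj)
  qed
  then show ?thesis by blast
qed

text \<open>Limit points are formed with orbits of arbitrary points \<open>y\<close> and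
  \<open>z\<close>. Replacing both by \<open>x\<close> changes a Gromov product by at most
  \<open>d y x + d z x\<close>, so a common limit would push it above \<open>B\<close>.\<close>

lemma independentI:
  assumes hyp: "delta_hyperbolic \<delta>" "0 \<le> \<delta>" and g: "loxodromic g" and h: "loxodromic h" and x: "x \<in> M"
    and B: "\<And>(m::int) (n::int). gromov_product x (\<phi> (g [^] m) x) (\<phi> (h [^] n) x) \<le> B"
  shows "independent_loxodromics g h"
proof -
  have gc: "g \<in> carrier G" "h \<in> carrier G" using g h by (auto simp: loxodromic_def)
  have "False" if P: "P \<in> limit_points g" "P \<in> limit_points h" for P
  proof -
    obtain y e where y: "y \<in> M" and e: "e = 1 \<or> e = - (1::int)" and Pg: "P = boundary_limit (\<lambda>n. \<phi> (g [^] (e * int n)) y)"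
    proof -
      from P(1) obtain y where "y \<in> M" "P = boundary_limit (\<lambda>n. \<phi> (g [^] int n) y) \<or> P = boundary_limit (\<lambda>n. \<phi> (g [^] (- int n)) y)"
        unfolding limit_points_def by blast
      then show thesis using that[of y 1] that[of y "-1"] by auto
    qed
    obtain z f where z: "z \<in> M" and f: "f = 1 \<or> f = - (1::int)" and Ph: "P = boundary_limit (\<lambda>n. \<phi> (h [^] (f * int n)) z)"
    proof -
      from P(2) obtain y where "y \<in> M" "P = boundary_limit (\<lambda>n. \<phi> (h [^] int n) y) \<or> P = boundary_limit (\<lambda>n. \<phi> (h [^] (- int n)) y)"
        unfolding limit_points_def by blast
      then show thesis using that[of y 1] that[of y "-1"] by auto
    qed
    let ?s = "\<lambda>n. \<phi> (g [^] (e * int n)) y" and ?t = "\<lambda>n. \<phi> (h [^] (f * int n)) z"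
    have "(\<lambda>n. \<phi> ((g [^] e) [^] int n) y) \<in> seqs_to_infinity"
      using loxodromic_seq_to_infinity[OF hyp loxodromic_signed[OF g e] y] .
    then have "asymptotic ?t ?s"
      using boundary_limit_eqD[of ?s ?t] Pg Ph gc by (simp add: pow_signed)
    moreover have "range ?s \<subseteq> M" "range ?t \<subseteq> M" using gc y z by auto
    ultimately obtain N where N: "\<And>i j. \<lbrakk>i \<ge> N; j \<ge> N\<rbrakk> \<Longrightarrow> B + d y x + d z x + 1 \<le> gromov_product x (?t i) (?s j)"
      using asymptotic_base[OF x] by meson
    let ?s' = "\<phi> (g [^] (e * int N)) x" and ?t' = "\<phi> (h [^] (f * int N)) x"
    have M: "?s N \<in> M" "?t N \<in> M" "?s' \<in> M" "?t' \<in> M" using gc x y z by auto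
    have "d (?s N) ?s' = d y x" "d (?t N) ?t' = d z x"
      using gc x y z by (auto intro!: isometry)
    moreover have "gromov_product x (?t N) (?s N) \<le> gromov_product x ?t' (?s N) + d (?t N) ?t'"
      "gromov_product x ?t' (?s N) \<le> gromov_product x ?t' ?s' + d (?s N) ?s'"
      using M x by (auto intro!: gromov_product_move)
    moreover have "gromov_product x ?t' ?s' \<le> B"
      using B gromov_product_commute[of x ?t' ?s'] by simp
    ultimately show False using N[of N N] by simp
  qed
  then show ?thesis using g h by (auto simp: independent_loxodromics_def)
qed

text \<open>If the powers commuted, so would the larger powers \<open>a\<close> and
  \<open>b\<close>, and the points \<open>x\<close>, \<open>a x\<close>, \<open>a b x\<close>,
  \<open>b x\<close> would form a parallelogram. By independence both diagonals are almost as long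
  as two adjacent sides together, which violates the four-point inequality as soon as both sides
  exceed \<open>2 * B + \<delta>\<close>.\<close>

lemma independent_not_commuting:
  assumes hyp: "delta_hyperbolic \<delta>" "0 \<le> \<delta>" and ind: "independent_loxodromics g h"
    and "i \<noteq> (0::int)" "j \<noteq> (0::int)"
  shows "g [^] i \<otimes> h [^] j \<noteq> h [^] j \<otimes> g [^] i"
proof
  assume comm: "g [^] i \<otimes> h [^] j = h [^] j \<otimes> g [^] i"
  have g: "loxodromic g" and h: "loxodromic h" and gc: "g \<in> carrier G" "h \<in> carrier G"
    using ind by (auto simp: independent_loxodromics_def loxodromic_def)
  obtain x where x: "x \<in> M" using g by (auto simp: loxodromic_def)
  obtain B where B: "\<And>(m::int) (n::int). gromov_product x (\<phi> (g [^] m) x) (\<phi> (h [^] n) x) \<le> B"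
    using independent_bounded[OF hyp ind x] by blast
  have far: "\<exists>n::nat. d x (\<phi> (f [^] (k * int n)) x) > 2 * B + \<delta>" if f: "loxodromic f" and k: "k \<noteq> 0" for f and k :: int
  proof -
    obtain L C where L: "0 < L" "\<And>n::int. \<bar>real_of_int n\<bar> / L - C \<le> d x (\<phi> (f [^] n) x)"
      using loxodromic_lower[OF f x] by blast
    obtain n :: nat where n: "n > (2 * B + \<delta> + C) * L" using reals_Archimedean2 by blast
    have "1 * real n \<le> \<bar>real_of_int k\<bar> * real n" using k by (intro mult_right_mono) auto
    then have "(2 * B + \<delta> + C) * L < \<bar>real_of_int (k * int n)\<bar>" using n by (simp add: abs_mult)
    then have "2 * B + \<delta> + C < \<bar>real_of_int (k * int n)\<bar> / L" using L(1) by (simp add: pos_less_divide_eq)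
    then show ?thesis using L(2)[of "k * int n"] by (intro exI[of _ n]) linarith
  qed
  obtain m n :: nat where mn: "d x (\<phi> (g [^] (i * int m)) x) > 2 * B + \<delta>" "d x (\<phi> (h [^] (j * int n)) x) > 2 * B + \<delta>"
    using far[OF g assms(4)] far[OF h assms(5)] by blast
  define a b where "a = g [^] (i * int m)" and "b = h [^] (j * int n)"
  have ab: "a \<in> carrier G" "b \<in> carrier G" using gc by (auto simp: a_def b_def)
  have "a \<otimes> b = b \<otimes> a"
  proof -
    have "(h [^] j) [^] n \<otimes> g [^] i = g [^] i \<otimes> (h [^] j) [^] n"
      using comm gc by (intro G.group_commutes_pow) auto
    then have "(g [^] i) [^] m \<otimes> (h [^] j) [^] n = (h [^] j) [^] n \<otimes> (g [^] i) [^] m"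
      using gc by (intro G.group_commutes_pow) auto
    then show ?thesis
      using gc pow_signed[of g i "int m"] pow_signed[of h j "int n"] by (simp add: a_def b_def int_pow_int)
  qed
  then have ba: "\<phi> a (\<phi> b x) = \<phi> b (\<phi> a x)" using ab x by (simp flip: act_mult)
  let ?o = "x" and ?a = "\<phi> a x" and ?b = "\<phi> b x" and ?c = "\<phi> a (\<phi> b x)"
  have M: "?a \<in> M" "?b \<in> M" "?c \<in> M" using ab x by (auto intro!: act_closed)
  have e: "d ?a ?c = d x ?b" "d ?b ?c = d x ?a"
    using isometry[OF ab(1) x M(2)] isometry[OF ab(2) x M(1)] ba by simp_all
  have "gromov_product x ?a ?b \<le> B" using B by (simp add: a_def b_def)
  then have 1: "d x ?a + d x ?b - 2 * B \<le> d ?a ?b"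
    by (simp add: gromov_product_def commute)
  have "d x ?c = d (\<phi> (inv\<^bsub>G\<^esub> a) x) ?b" using dist_act_inv[OF ab(1) x M(2)] by simp
  moreover have "gromov_product x (\<phi> (inv\<^bsub>G\<^esub> a) x) ?b \<le> B"
    using B[of "- (i * int m)"] gc by (simp add: a_def b_def G.int_pow_neg)
  moreover have "d (\<phi> (inv\<^bsub>G\<^esub> a) x) x = d x ?a" using dist_act_inv[OF ab(1) x x] .
  ultimately have 2: "d x ?a + d x ?b - 2 * B \<le> d x ?c"
    by (simp add: gromov_product_def commute)
  have "d x ?c + d ?a ?b \<le> max (d x ?a + d ?c ?b) (d ?a ?c + d x ?b) + 2 * \<delta>"
    using four_point[OF hyp(1) x M(1) M(3) M(2)] by simp
  then have "d x ?c + d ?a ?b \<le> max (2 * d x ?a) (2 * d x ?b) + 2 * \<delta>"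
    using e by (simp add: commute)
  with 1 2 mn show False unfolding a_def[symmetric] b_def[symmetric] by (simp add: max_def split: if_splits)
qed

end

section \<open>Injective hulls\<close>

text \<open>Distances obtained as limits need not separate points; the tight span restores
  this.\<close>

locale pseudometric =
  fixes V :: "'v set" and D :: "'v \<Rightarrow> 'v \<Rightarrow> real"
  assumes nonempty: "V \<noteq> {}"
    and self: "x \<in> V \<Longrightarrow> D x x = 0"
    and sym: "\<lbrakk>x \<in> V; y \<in> V\<rbrakk> \<Longrightarrow> D x y = D y x"
    and tri: "\<lbrakk>x \<in> V; y \<in> V; z \<in> V\<rbrakk> \<Longrightarrow> D x z \<le> D x y + D y z"
begin

lemma nonneg: "\<lbrakk>x \<in> V; y \<in> V\<rbrakk> \<Longrightarrow> 0 \<le> D x y"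
  using tri[of x y x] self[of x] sym[of x y] by simp

text \<open>The value 0 outside \<open>V\<close> makes functions that agree on \<open>V\<close>
  equal.\<close>

definition dominating :: "('v \<Rightarrow> real) set" where
  "dominating = {f. (\<forall>x\<in>V. \<forall>y\<in>V. D x y \<le> f x + f y) \<and> (\<forall>x. x \<notin> V \<longrightarrow> f x = 0)}"

text \<open>Isbell's injective hull. Pointwise minimality in \<open>dominating\<close> is expressed
  by a partner \<open>y\<close> at which the inequality for \<open>x\<close> is almost
  sharp.\<close>

definition tight_span :: "('v \<Rightarrow> real) set" where
  "tight_span = {f \<in> dominating. \<forall>x\<in>V. \<forall>e>0. \<exists>y\<in>V. f x + f y \<le> D x y + e}"

text \<open>The outer absolute value is there because a metric space needs a nonnegative distance on the whole type, and the
  supremum of an unbounded set is unspecified.\<close>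

definition hdist :: "('v \<Rightarrow> real) \<Rightarrow> ('v \<Rightarrow> real) \<Rightarrow> real" where
  "hdist f g = \<bar>SUP x\<in>V. \<bar>f x - g x\<bar>\<bar>"

definition near :: "real \<Rightarrow> ('v \<Rightarrow> real) \<Rightarrow> ('v \<Rightarrow> real) \<Rightarrow> bool" where
  "near c f g \<longleftrightarrow> (\<forall>x\<in>V. \<bar>f x - g x\<bar> \<le> c)"

text \<open>For dominating \<open>f\<close> this is the least value at \<open>x\<close> that is
  compatible with the values of \<open>f\<close> everywhere; its fixed points are the extremal
  functions.\<close>

definition conjugate :: "('v \<Rightarrow> real) \<Rightarrow> 'v \<Rightarrow> real" where
  "conjugate f x = (SUP y\<in>V. D x y - f y)"

text \<open>The conjugate itself need not dominate. The mean does, because \<open>D x y\<close> is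
  at most \<open>conjugate f x + f y\<close> and also at most
  \<open>f x + conjugate f y\<close>.\<close>

definition average :: "('v \<Rightarrow> real) \<Rightarrow> 'v \<Rightarrow> real" where
  "average f x = (if x \<in> V then (f x + conjugate f x) / 2 else 0)"

text \<open>Iterated averaging picks a minimal function below \<open>f\<close> canonically. An
  arbitrary choice of minimal functions would not give a map that preserves distance bounds.\<close>

definition span_retraction :: "('v \<Rightarrow> real) \<Rightarrow> 'v \<Rightarrow> real" where
  "span_retraction f x = lim (\<lambda>n. (average ^^ n) f x)"

lemma dominatingD: "\<lbrakk>f \<in> dominating; x \<in> V; y \<in> V\<rbrakk> \<Longrightarrow> D x y \<le> f x + f y"
  by (simp add: dominating_def)

lemma dominating_nonneg: "\<lbrakk>f \<in> dominating; x \<in> V\<rbrakk> \<Longrightarrow> 0 \<le> f x"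
  using dominatingD[of f x x] self[of x] by simp

lemma hull_extremal: "\<lbrakk>f \<in> tight_span; x \<in> V; e > 0\<rbrakk> \<Longrightarrow> \<exists>y\<in>V. f x + f y \<le> D x y + e"
  by (simp add: tight_span_def)

lemma hull_dominating: "f \<in> tight_span \<Longrightarrow> f \<in> dominating"
  by (simp add: tight_span_def)

lemma conjugate_bdd:
  assumes "f \<in> dominating" "x \<in> V"
  shows "bdd_above ((\<lambda>y. D x y - f y) ` V)"
proof (rule bdd_aboveI2)
  show "D x y - f y \<le> f x" if "y \<in> V" for y
    using dominatingD[OF assms(1,2) that] by simp
qed

lemma conjugate_le: "\<lbrakk>f \<in> dominating; x \<in> V\<rbrakk> \<Longrightarrow> conjugate f x \<le> f x"
  unfolding conjugate_def using nonempty dominatingD by (intro cSUP_least) fastforce+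

lemma le_conjugate: "\<lbrakk>f \<in> dominating; x \<in> V; y \<in> V\<rbrakk> \<Longrightarrow> D x y - f y \<le> conjugate f x"
  unfolding conjugate_def by (intro cSUP_upper conjugate_bdd)

lemma conjugate_near:
  assumes "f \<in> dominating" "g \<in> dominating" "near c f g" "x \<in> V"
  shows "conjugate f x \<le> conjugate g x + c"
  unfolding conjugate_def[of f]
proof (rule cSUP_least[OF nonempty])
  fix y assume "y \<in> V"
  then show "D x y - f y \<le> conjugate g x + c"
    using le_conjugate[OF assms(2,4), of y] assms(3) unfolding near_def by (fastforce simp: abs_le_iff)
qed

lemma conjugate_antimono:
  assumes "f \<in> dominating" "g \<in> dominating" "\<And>y. y \<in> V \<Longrightarrow> g y \<le> f y" "x \<in> V"
  shows "conjugate f x \<le> conjugate g x"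
  unfolding conjugate_def[of f]
proof (rule cSUP_least[OF nonempty])
  fix y assume "y \<in> V"
  then show "D x y - f y \<le> conjugate g x"
    using le_conjugate[OF assms(2,4), of y] assms(3)[of y] by linarith
qed

lemma hull_iff: "f \<in> tight_span \<longleftrightarrow> f \<in> dominating \<and> (\<forall>x\<in>V. conjugate f x = f x)"
proof
  assume f: "f \<in> tight_span"
  have "f x \<le> conjugate f x" if x: "x \<in> V" for x
  proof (rule field_le_epsilon)
    fix e :: real assume "e > 0"
    then obtain y where "y \<in> V" "f x + f y \<le> D x y + e"
      using f x unfolding tight_span_def by blast
    then show "f x \<le> conjugate f x + e"
      using le_conjugate[OF hull_dominating[OF f] x, of y] by linarith
  qed
  then show "f \<in> dominating \<and> (\<forall>x\<in>V. conjugate f x = f x)"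
    using conjugate_le hull_dominating[OF f] by (simp add: antisym)
next
  assume f: "f \<in> dominating \<and> (\<forall>x\<in>V. conjugate f x = f x)"
  have "\<exists>y\<in>V. f x + f y \<le> D x y + e" if x: "x \<in> V" and e: "e > 0" for x e
  proof -
    have "f x - e < conjugate f x" using f x e by simp
    then obtain y where "y \<in> V" "f x - e < D x y - f y"
      unfolding conjugate_def using less_cSUP_iff[OF nonempty conjugate_bdd] f x by blast
    then show ?thesis by (intro bexI[of _ y]) auto
  qed
  then show "f \<in> tight_span" using f by (simp add: tight_span_def)
qed

section \<open>A nonexpanding retraction onto the tight span\<close>

lemma average_dominating:
  assumes f: "f \<in> dominating"
  shows "average f \<in> dominating"
proof -
  have "D x y \<le> average f x + average f y" if "x \<in> V" "y \<in> V" for x y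
    using le_conjugate[OF f that] le_conjugate[OF f that(2,1)] sym[OF that] that by (simp add: average_def field_simps)
  then show ?thesis by (simp add: dominating_def average_def)
qed

lemma average_pow_dominating: "f \<in> dominating \<Longrightarrow> (average ^^ n) f \<in> dominating"
  by (induction n) (auto intro: average_dominating)

lemma average_le: "f \<in> dominating \<Longrightarrow> x \<in> V \<Longrightarrow> average f x \<le> f x"
  using conjugate_le[of f x] by (simp add: average_def)

lemma retraction_LIMSEQ:
  assumes f: "f \<in> dominating" and x: "x \<in> V"
  shows "(\<lambda>n. (average ^^ n) f x) \<longlonglongrightarrow> span_retraction f x"
proof -
  have "decseq (\<lambda>n. (average ^^ n) f x)"
    using average_le[OF average_pow_dominating[OF f] x] by (simp add: decseq_Suc_iff)
  moreover have "0 \<le> (average ^^ n) f x" for n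
    using dominating_nonneg[OF average_pow_dominating[OF f] x] .
  ultimately have "convergent (\<lambda>n. (average ^^ n) f x)"
    using decseq_convergent[of "\<lambda>n. (average ^^ n) f x" 0] by (metis convergentI)
  then show ?thesis unfolding span_retraction_def by (rule convergent_LIMSEQ_iff[THEN iffD1])
qed

lemma retraction_le:
  assumes f: "f \<in> dominating" and x: "x \<in> V"
  shows "span_retraction f x \<le> (average ^^ n) f x"
proof (rule decseq_ge[OF _ retraction_LIMSEQ[OF assms]])
  show "decseq (\<lambda>n. (average ^^ n) f x)"
    using average_le[OF average_pow_dominating[OF f] x] by (simp add: decseq_Suc_iff)
qed

lemma retraction_outside:
  assumes "f \<in> dominating" "x \<notin> V"
  shows "span_retraction f x = 0"
proof -
  have "(average ^^ n) f x = 0" for n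
    using average_pow_dominating[OF assms(1), of n] assms(2) by (simp add: dominating_def)
  then show ?thesis by (simp add: span_retraction_def)
qed

lemma retraction_dominating:
  assumes f: "f \<in> dominating"
  shows "span_retraction f \<in> dominating"
proof -
  have "D x y \<le> span_retraction f x + span_retraction f y" if "x \<in> V" "y \<in> V" for x y
  proof (rule LIMSEQ_le_const)
    show "(\<lambda>n. (average ^^ n) f x + (average ^^ n) f y) \<longlonglongrightarrow> span_retraction f x + span_retraction f y"
      by (intro tendsto_add retraction_LIMSEQ f that)
    show "\<exists>N. \<forall>n\<ge>N. D x y \<le> (average ^^ n) f x + (average ^^ n) f y"
      using dominatingD[OF average_pow_dominating[OF f] that] by blast
  qed
  then show ?thesis using retraction_outside[OF f] by (simp add: dominating_def)
qed

text \<open>Conjugation reverses the order, so the conjugates of the decreasing iterates stay below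
  the conjugate of their limit. By the definition of the average these conjugates are
  \<open>2 * f_(n+1) - f_n\<close>, hence converge to the limit itself.\<close>

lemma retraction_hull:
  assumes f: "f \<in> dominating"
  shows "span_retraction f \<in> tight_span"
proof -
  let ?g = "span_retraction f"
  have g: "?g \<in> dominating" by (rule retraction_dominating[OF f])
  have "?g x \<le> conjugate ?g x" if x: "x \<in> V" for x
  proof (rule LIMSEQ_le_const2)
    have "(\<lambda>n. 2 * (average ^^ Suc n) f x - (average ^^ n) f x) \<longlonglongrightarrow> 2 * ?g x - ?g x"
      by (intro tendsto_intros retraction_LIMSEQ[OF f x] LIMSEQ_Suc)
    moreover have "2 * (average ^^ Suc n) f x - (average ^^ n) f x = conjugate ((average ^^ n) f) x" for n
      using x by (simp add: average_def field_simps)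
    ultimately show "(\<lambda>n. conjugate ((average ^^ n) f) x) \<longlonglongrightarrow> ?g x"
      by simp
    show "\<exists>N. \<forall>n\<ge>N. conjugate ((average ^^ n) f) x \<le> conjugate ?g x"
      using conjugate_antimono[OF average_pow_dominating[OF f] g _ x] retraction_le[OF f] by blast
  qed
  then show ?thesis
    unfolding hull_iff using g conjugate_le[OF g] by (simp add: antisym)
qed

lemma average_near:
  assumes "f \<in> dominating" "g \<in> dominating" "near c f g"
  shows "near c (average f) (average g)"
  unfolding near_def
proof
  fix x assume x: "x \<in> V"
  have "near c g f" using assms(3) by (simp add: near_def abs_minus_commute)
  then have "conjugate f x \<le> conjugate g x + c" "conjugate g x \<le> conjugate f x + c"
    using conjugate_near assms x by blast+
  moreover have "\<bar>f x - g x\<bar> \<le> c" using assms(3) x by (simp add: near_def)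
  ultimately show "\<bar>average f x - average g x\<bar> \<le> c"
    using x unfolding average_def by (simp add: abs_le_iff field_simps)
qed

lemma retraction_near:
  assumes f: "f \<in> dominating" and g: "g \<in> dominating" and c: "near c f g"
  shows "near c (span_retraction f) (span_retraction g)"
  unfolding near_def
proof
  fix x assume x: "x \<in> V"
  have near: "near c ((average ^^ n) f) ((average ^^ n) g)" for n
    using c by (induction n) (auto intro: average_near average_pow_dominating f g)
  show "\<bar>span_retraction f x - span_retraction g x\<bar> \<le> c"
  proof (rule LIMSEQ_le_const2)
    show "(\<lambda>n. \<bar>(average ^^ n) f x - (average ^^ n) g x\<bar>) \<longlonglongrightarrow> \<bar>span_retraction f x - span_retraction g x\<bar>"
      by (intro tendsto_intros retraction_LIMSEQ f g x)
    show "\<exists>N. \<forall>n\<ge>N. \<bar>(average ^^ n) f x - (average ^^ n) g x\<bar> \<le> c"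
      using near x unfolding near_def by blast
  qed
qed

lemma retraction_id:
  assumes "f \<in> tight_span"
  shows "span_retraction f = f"
proof -
  have "average f = f"
    using assms unfolding hull_iff dominating_def average_def by (auto simp: fun_eq_iff)
  then have "(average ^^ n) f = f" for n by (induction n) auto
  then show ?thesis by (simp add: span_retraction_def fun_eq_iff)
qed

section \<open>The supremum metric on the tight span\<close>

lemma hull_lipschitz:
  assumes f: "f \<in> tight_span" and "x \<in> V" "y \<in> V"
  shows "f x \<le> f y + D x y"
proof (rule field_le_epsilon)
  fix e :: real assume "e > 0"
  then obtain z where z: "z \<in> V" "f x + f z \<le> D x z + e"
    using f assms(2) unfolding tight_span_def by blast
  then show "f x \<le> f y + D x y + e"
    using dominatingD[OF hull_dominating[OF f] assms(3) z(1)] tri[OF assms(2,3) z(1)] by linarith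
qed

lemma hull_bdd:
  assumes "f \<in> tight_span" "g \<in> tight_span"
  shows "bdd_above ((\<lambda>x. \<bar>f x - g x\<bar>) ` V)"
proof -
  obtain b where b: "b \<in> V" using nonempty by blast
  show ?thesis
  proof (rule bdd_aboveI2)
    fix x assume x: "x \<in> V"
    have "f x \<le> f b + D x b" "g x \<le> g b + D x b" using hull_lipschitz assms x b by auto
    moreover have "D x b \<le> f x + f b" "D x b \<le> g x + g b"
      using dominatingD hull_dominating assms x b by auto
    ultimately show "\<bar>f x - g x\<bar> \<le> f b + g b" by (simp add: abs_le_iff)
  qed
qed

lemma hdist_eq:
  assumes "f \<in> tight_span" "g \<in> tight_span"
  shows "hdist f g = (SUP x\<in>V. \<bar>f x - g x\<bar>)"
proof -
  obtain b where b: "b \<in> V" using nonempty by blast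
  have "\<bar>f b - g b\<bar> \<le> (SUP x\<in>V. \<bar>f x - g x\<bar>)"
    by (rule cSUP_upper[OF b hull_bdd[OF assms]])
  then show ?thesis unfolding hdist_def by linarith
qed

lemma hdist_le_iff:
  assumes "f \<in> tight_span" "g \<in> tight_span"
  shows "hdist f g \<le> c \<longleftrightarrow> near c f g"
  unfolding hdist_eq[OF assms] near_def by (rule cSUP_le_iff[OF nonempty hull_bdd[OF assms]])

lemma hdist_upper: "\<lbrakk>f \<in> tight_span; g \<in> tight_span; x \<in> V\<rbrakk> \<Longrightarrow> \<bar>f x - g x\<bar> \<le> hdist f g"
  using hdist_le_iff[of f g "hdist f g"] by (simp add: near_def)

text \<open>At a point where the functions differ most, the larger one is replaced by means of its
  extremal partner. The distance becomes an expression in \<open>D\<close>, which is how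
  inequalities for \<open>D\<close> reach the hull.\<close>

lemma hdist_witness:
  assumes "f \<in> tight_span" "g \<in> tight_span" "e > 0"
  obtains x y where "x \<in> V" "y \<in> V" "hdist f g \<le> D x y - f x - g y + e"
proof -
  have "\<not> near (hdist f g - e / 2) f g"
    using hdist_le_iff[OF assms(1,2), of "hdist f g - e / 2"] assms(3) by simp
  then obtain x where x: "x \<in> V" "hdist f g - e / 2 < \<bar>f x - g x\<bar>"
    unfolding near_def by (meson not_le)
  obtain y where y: "y \<in> V" "f x + f y \<le> D x y + e / 2"
    using hull_extremal[OF assms(1) x(1), of "e / 2"] assms(3) by auto
  obtain z where z: "z \<in> V" "g x + g z \<le> D x z + e / 2"
    using hull_extremal[OF assms(2) x(1), of "e / 2"] assms(3) by auto
  show thesis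
  proof (cases "f x \<le> g x")
    case True
    then show thesis using that[of x z] x z by linarith
  next
    case False
    then show thesis using that[of y x] x y sym[of x y] by linarith
  qed
qed

lemma metric_hull: "Metric_space tight_span hdist"
proof
  fix f g :: "'v \<Rightarrow> real"
  show "0 \<le> hdist f g" by (simp add: hdist_def)
  show "hdist f g = hdist g f" by (simp add: hdist_def abs_minus_commute)
next
  fix f g assume fg: "f \<in> tight_span" "g \<in> tight_span"
  show "hdist f g = 0 \<longleftrightarrow> f = g"
  proof
    assume "hdist f g = 0"
    then have "f x = g x" if "x \<in> V" for x using hdist_upper[OF fg that] by simp
    moreover have "f x = g x" if "x \<notin> V" for x
      using fg that by (simp add: tight_span_def dominating_def)
    ultimately show "f = g" by blast
  next
    assume "f = g"
    then show "hdist f g = 0"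
      using hdist_le_iff[OF fg, of 0] by (simp add: near_def hdist_def)
  qed
next
  fix f g h assume fgh: "f \<in> tight_span" "g \<in> tight_span" "h \<in> tight_span"
  show "hdist f h \<le> hdist f g + hdist g h"
    unfolding hdist_le_iff[OF fgh(1,3)] near_def
  proof
    fix x assume "x \<in> V"
    then show "\<bar>f x - h x\<bar> \<le> hdist f g + hdist g h"
      using hdist_upper[OF fgh(1,2)] hdist_upper[OF fgh(2,3)] by fastforce
  qed
qed

sublocale H: Metric_space tight_span hdist by (rule metric_hull)

text \<open>Affine interpolation is a geodesic for the supremum distance in the convex set \<^term>\<open>dominating\<close>,
  and the retraction onto the tight span does not increase distances.\<close>

lemma geodesic_hull: "H.geodesic_space"
  unfolding H.geodesic_space_def
proof (intro ballI)
  fix f g assume fg: "f \<in> tight_span" "g \<in> tight_span"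
  let ?l = "hdist f g"
  define p where "p t = (\<lambda>x. f x + (t / ?l) * (g x - f x))" for t
  define c where "c t = span_retraction (p t)" for t
  have p: "p t \<in> dominating" if "t \<in> {0..?l}" for t
  proof -
    define s where "s = t / ?l"
    have s: "0 \<le> s" "s \<le> 1" using that by (auto simp: s_def divide_le_eq_1)
    have "D x y \<le> p t x + p t y" if "x \<in> V" "y \<in> V" for x y
    proof -
      have "D x y = (1 - s) * D x y + s * D x y" by (simp add: algebra_simps)
      also have "\<dots> \<le> (1 - s) * (f x + f y) + s * (g x + g y)"
        using s dominatingD hull_dominating fg that by (intro add_mono mult_left_mono) auto
      finally show ?thesis unfolding p_def s_def[symmetric] by (simp add: algebra_simps)
    qed
    then show ?thesis using fg by (simp add: dominating_def tight_span_def p_def)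
  qed
  have c: "c t \<in> tight_span" if "t \<in> {0..?l}" for t
    unfolding c_def using retraction_hull[OF p[OF that]] .
  have up: "hdist (c s) (c t) \<le> \<bar>s - t\<bar>" if st: "s \<in> {0..?l}" "t \<in> {0..?l}" for s t
    unfolding hdist_le_iff[OF c[OF st(1)] c[OF st(2)]] unfolding c_def
  proof (rule retraction_near[OF p[OF st(1)] p[OF st(2)]])
    show "near \<bar>s - t\<bar> (p s) (p t)"
      unfolding near_def
    proof
      fix x assume x: "x \<in> V"
      have "p s x - p t x = (s - t) * ((g x - f x) / ?l)"
        by (simp add: p_def algebra_simps diff_divide_distrib add_divide_distrib)
      then have "\<bar>p s x - p t x\<bar> = \<bar>s - t\<bar> * (\<bar>g x - f x\<bar> / ?l)"
        by (simp add: abs_mult)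
      also have "\<dots> \<le> \<bar>s - t\<bar> * 1"
        using hdist_upper[OF fg x] by (intro mult_left_mono) (auto simp: divide_le_eq_1 abs_minus_commute)
      finally show "\<bar>p s x - p t x\<bar> \<le> \<bar>s - t\<bar>" by simp
    qed
  qed
  have "p 0 = f" by (simp add: p_def)
  then have c0: "c 0 = f" using retraction_id fg by (simp add: c_def)
  \<comment> \<open>For \<open>?l = 0\<close> the quotient in \<open>p\<close> is 0 by convention,
    which is harmless since then \<open>f = g\<close>.\<close>
  have "p ?l = g"
    using fg by (cases "?l = 0") (auto simp: p_def)
  then have cl: "c ?l = g" using retraction_id fg by (simp add: c_def)
  have eq: "hdist (c s) (c t) = \<bar>s - t\<bar>" if st: "s \<in> {0..?l}" "t \<in> {0..?l}" for s t
  proof -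
    \<comment> \<open>A path of total length at most \<open>?l\<close> between points at distance
      \<open>?l\<close> can lose nothing on any part.\<close>
    have *: "t - s \<le> hdist (c s) (c t)" if st: "s \<in> {0..?l}" "t \<in> {0..?l}" for s t
    proof -
      have "?l \<le> hdist (c 0) (c s) + hdist (c s) (c t) + hdist (c t) (c ?l)"
        using H.triangle[OF fg(1) c[OF st(1)] fg(2)] H.triangle[OF c[OF st(1)] c[OF st(2)] fg(2)]
        by (simp add: c0 cl)
      moreover have "hdist (c 0) (c s) \<le> s" "hdist (c t) (c ?l) \<le> ?l - t"
        using up[of 0 s] up[of t ?l] st by auto
      ultimately show ?thesis by linarith
    qed
    show ?thesis using *[OF st] *[OF st(2,1)] up[OF st] H.commute[of "c s" "c t"] by linarith
  qed
  show "\<exists>c. c \<in> {0..?l} \<rightarrow> tight_span \<and> c 0 = f \<and> c ?l = g \<and>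
     (\<forall>s\<in>{0..?l}. \<forall>t\<in>{0..?l}. hdist (c s) (c t) = \<bar>s - t\<bar>)"
    using c c0 cl eq by (intro exI[of _ c]) auto
qed

text \<open>Witnesses turn the left side into distances of \<open>D\<close> minus values of the four
  functions. On the right each pair satisfies \<open>D x y - f x - g y \<le> hdist f g\<close>, and
  the same values are subtracted in both terms of the maximum.\<close>

lemma hull_four_point:
  assumes four: "\<And>x y z w. \<lbrakk>x \<in> V; y \<in> V; z \<in> V; w \<in> V\<rbrakk>
    \<Longrightarrow> D x z + D y w \<le> max (D x y + D z w) (D y z + D x w) + 2 * \<delta>"
    and h: "f \<in> tight_span" "g \<in> tight_span" "h \<in> tight_span" "k \<in> tight_span"
  shows "hdist f h + hdist g k \<le> max (hdist f g + hdist h k) (hdist g h + hdist f k) + 2 * \<delta>"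
proof (rule field_le_epsilon)
  fix e :: real assume "e > 0"
  then have e: "e / 2 > 0" by simp
  obtain x z where xz: "x \<in> V" "z \<in> V" "hdist f h \<le> D x z - f x - h z + e / 2"
    using hdist_witness[OF h(1,3) e] .
  obtain y w where yw: "y \<in> V" "w \<in> V" "hdist g k \<le> D y w - g y - k w + e / 2"
    using hdist_witness[OF h(2,4) e] .
  have low: "D x y - f x - g y \<le> hdist f g" if "f \<in> tight_span" "g \<in> tight_span" "x \<in> V" "y \<in> V" for f g x y
    using hdist_upper[OF that(1,2,4)] dominatingD[OF hull_dominating[OF that(1)] that(3,4)] by linarith
  show "hdist f h + hdist g k \<le> max (hdist f g + hdist h k) (hdist g h + hdist f k) + 2 * \<delta> + e"
    using xz(3) yw(3) four[OF xz(1) yw(1) xz(2) yw(2)] low[OF h(1,2) xz(1) yw(1)] low[OF h(3,4) xz(2) yw(2)]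
      low[OF h(2,3) yw(1) xz(2)] low[OF h(1,4) xz(1) yw(2)]
    by linarith
qed

section \<open>The Kuratowski embedding and its coarse density\<close>

definition embed :: "'v \<Rightarrow> 'v \<Rightarrow> real" where
  "embed v = (\<lambda>x. if x \<in> V then D v x else 0)"

lemma embed_hull:
  assumes v: "v \<in> V"
  shows "embed v \<in> tight_span"
proof -
  have "embed v \<in> dominating"
    using tri[OF _ v] sym[OF _ v] by (auto simp: dominating_def embed_def)
  moreover have "\<exists>y\<in>V. embed v x + embed v y \<le> D x y + e" if "x \<in> V" "e > 0" for x e
    using v that sym[OF that(1) v] self by (intro bexI[of _ v]) (auto simp: embed_def)
  ultimately show ?thesis by (simp add: tight_span_def)
qed

text \<open>The Lipschitz bound and domination give one inequality, evaluation at \<open>v\<close>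
  the other. Being close to the embedded space thus means having a small value.\<close>

lemma hdist_embed:
  assumes v: "v \<in> V" and f: "f \<in> tight_span"
  shows "hdist (embed v) f = f v"
proof (rule antisym)
  show "hdist (embed v) f \<le> f v"
    unfolding hdist_le_iff[OF embed_hull[OF v] f] near_def
  proof
    fix x assume x: "x \<in> V"
    show "\<bar>embed v x - f x\<bar> \<le> f v"
      using hull_lipschitz[OF f x v] dominatingD[OF hull_dominating[OF f] x v] sym[OF x v] x
      by (simp add: embed_def abs_le_iff)
  qed
  show "f v \<le> hdist (embed v) f"
    using hdist_upper[OF embed_hull[OF v] f v] self[OF v] v by (simp add: embed_def)
qed

lemma hdist_embed_embed: "\<lbrakk>v \<in> V; w \<in> V\<rbrakk> \<Longrightarrow> hdist (embed v) (embed w) = D v w"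
  using sym[of w v] by (subst hdist_embed) (auto simp: embed_hull, simp add: embed_def)

text \<open>Choose \<open>x\<close>, \<open>y\<close> with \<open>f x + f y\<close> almost equal to
  \<open>D x y\<close>, and \<open>v\<close> on a rough geodesic between them at distance about
  \<open>f x\<close> from \<open>x\<close>. For an extremal partner \<open>z\<close> of
  \<open>v\<close>, the four-point inequality for \<open>v\<close>, \<open>x\<close>,
  \<open>z\<close>, \<open>y\<close> bounds \<open>D v z\<close> by \<open>f z\<close> plus a
  constant, so \<open>f v\<close> is small.\<close>

lemma embed_dense:
  assumes four: "\<And>x y z w. \<lbrakk>x \<in> V; y \<in> V; z \<in> V; w \<in> V\<rbrakk>
    \<Longrightarrow> D x z + D y w \<le> max (D x y + D z w) (D y z + D x w) + 2 * \<delta>"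
    and rough: "\<And>x y s t. \<lbrakk>x \<in> V; y \<in> V; 0 \<le> s; 0 \<le> t; D x y \<le> s + t\<rbrakk> \<Longrightarrow> \<exists>v\<in>V. D x v \<le> s + C \<and> D v y \<le> t + C"
    and f: "f \<in> tight_span"
  shows "\<exists>v\<in>V. f v \<le> 2 * \<delta> + C + 2"
proof -
  obtain x where x: "x \<in> V" using nonempty by blast
  have f': "f \<in> dominating" by (rule hull_dominating[OF f])
  obtain y where y: "y \<in> V" "f x + f y \<le> D x y + 1"
    using hull_extremal[OF f x, of 1] by auto
  obtain v where v: "v \<in> V" "D x v \<le> f x + C" "D v y \<le> f y + C"
    using rough[OF x y(1) dominating_nonneg[OF f' x] dominating_nonneg[OF f' y(1)] dominatingD[OF f' x y(1)]] by blast
  obtain z where z: "z \<in> V" "f v + f z \<le> D v z + 1"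
    using hull_extremal[OF f v(1), of 1] by auto
  have "D v z + D x y \<le> max (D v x + D z y) (D x z + D v y) + 2 * \<delta>"
    by (rule four[OF v(1) x z(1) y(1)])
  moreover have "D x z \<le> f x + f z" "D z y \<le> f z + f y"
    using dominatingD[OF f'] x y z by auto
  moreover have "D v x = D x v" using sym x v by blast
  ultimately have "D v z \<le> f z + 2 * \<delta> + C + 1"
    using v(2,3) y(2) by linarith
  then show ?thesis using z v(1) by (intro bexI[of _ v]) linarith+
qed

end

section \<open>Actions on roughly geodesic pseudometric spaces\<close>

locale pseudometric_action = pseudometric V D + group G
  for V :: "'v set" and D and G :: "('a, 'b) monoid_scheme" (structure) +
  fixes act :: "'a \<Rightarrow> 'v \<Rightarrow> 'v"
  assumes act_closed: "\<lbrakk>g \<in> carrier G; x \<in> V\<rbrakk> \<Longrightarrow> act g x \<in> V"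
    and act_one: "x \<in> V \<Longrightarrow> act \<one> x = x"
    and act_mult: "\<lbrakk>g \<in> carrier G; h \<in> carrier G; x \<in> V\<rbrakk> \<Longrightarrow> act (g \<otimes> h) x = act g (act h x)"
    and act_dist: "\<lbrakk>g \<in> carrier G; x \<in> V; y \<in> V\<rbrakk> \<Longrightarrow> D (act g x) (act g y) = D x y"
begin

text \<open>Restricted to the tight span because an action consists of extensional
  bijections.\<close>

definition span_act :: "'a \<Rightarrow> ('v \<Rightarrow> real) \<Rightarrow> 'v \<Rightarrow> real" where
  "span_act g = (\<lambda>f\<in>tight_span. \<lambda>x. if x \<in> V then f (act (inv g) x) else 0)"

lemma act_inv_act [simp]: "\<lbrakk>g \<in> carrier G; x \<in> V\<rbrakk> \<Longrightarrow> act (inv g) (act g x) = x"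
  "\<lbrakk>g \<in> carrier G; x \<in> V\<rbrakk> \<Longrightarrow> act g (act (inv g) x) = x"
  by (simp_all add: act_one flip: act_mult)

lemma act_dist_inv: "\<lbrakk>g \<in> carrier G; x \<in> V; y \<in> V\<rbrakk> \<Longrightarrow> D (act (inv g) x) y = D x (act g y)"
  using act_dist[of g "act (inv g) x" y] by (simp add: act_closed)

lemma span_act_closed:
  assumes g: "g \<in> carrier G" and f: "f \<in> tight_span"
  shows "span_act g f \<in> tight_span"
proof -
  let ?i = "act (inv g)"
  have i: "?i x \<in> V" if "x \<in> V" for x using g that by (simp add: act_closed)
  have "\<exists>y\<in>V. f (?i x) + f (?i y) \<le> D x y + e" if x: "x \<in> V" and e: "e > 0" for x e
  proof -
    obtain y where y: "y \<in> V" "f (?i x) + f y \<le> D (?i x) y + e"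
      using hull_extremal[OF f i[OF x] e] by blast
    then show ?thesis using g x by (intro bexI[of _ "act g y"]) (auto simp: act_closed act_dist_inv)
  qed
  moreover have "D x y \<le> f (?i x) + f (?i y)" if "x \<in> V" "y \<in> V" for x y
    using dominatingD[OF hull_dominating[OF f] i[OF that(1)] i[OF that(2)]] act_dist[of "inv g" x y] g that by simp
  ultimately show ?thesis
    using f by (auto simp: tight_span_def dominating_def span_act_def)
qed

lemma span_act_apply: "\<lbrakk>f \<in> tight_span; x \<in> V\<rbrakk> \<Longrightarrow> span_act g f x = f (act (inv g) x)"
  by (simp add: span_act_def)

lemma span_ext: "\<lbrakk>f \<in> tight_span; h \<in> tight_span; \<And>x. x \<in> V \<Longrightarrow> f x = h x\<rbrakk> \<Longrightarrow> f = h"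
  unfolding tight_span_def dominating_def by (auto simp: fun_eq_iff) metis

lemma span_act_mult:
  assumes "g \<in> carrier G" "h \<in> carrier G" "f \<in> tight_span"
  shows "span_act (g \<otimes> h) f = span_act g (span_act h f)"
  using assms
  by (intro span_ext span_act_closed) (auto simp: span_act_apply span_act_closed act_closed inv_mult_group act_mult)

lemma span_act_one: "f \<in> tight_span \<Longrightarrow> span_act \<one> f = f"
  by (rule span_ext) (auto simp: span_act_closed span_act_apply act_one)

lemma span_act_dist_le:
  assumes g: "g \<in> carrier G" and f: "f \<in> tight_span" "h \<in> tight_span"
  shows "hdist (span_act g f) (span_act g h) \<le> hdist f h"
  unfolding hdist_le_iff[OF span_act_closed[OF g f(1)] span_act_closed[OF g f(2)]] near_def
  using hdist_upper[OF f] g f by (auto simp: span_act_apply act_closed)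

lemma span_act_dist:
  assumes g: "g \<in> carrier G" and f: "f \<in> tight_span" "h \<in> tight_span"
  shows "hdist (span_act g f) (span_act g h) = hdist f h"
proof (rule antisym)
  have "span_act (inv g) (span_act g f) = f" "span_act (inv g) (span_act g h) = h"
    using g f by (simp_all add: span_act_one flip: span_act_mult)
  then show "hdist f h \<le> hdist (span_act g f) (span_act g h)"
    using span_act_dist_le[of "inv g" "span_act g f" "span_act g h"] g f by (simp add: span_act_closed)
qed (rule span_act_dist_le[OF assms])

lemma span_act_embed:
  assumes "g \<in> carrier G" "v \<in> V"
  shows "span_act g (embed v) = embed (act g v)"
proof (rule span_ext)
  fix x assume x: "x \<in> V"
  have "span_act g (embed v) x = D v (act (inv g) x)"
    using assms x span_act_apply[OF embed_hull[OF assms(2)] x, of g] by (simp add: embed_def[of v] act_closed)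
  also have "\<dots> = D (act g v) x"
    using act_dist_inv[of "inv g" v x] assms x by (simp add: act_closed)
  finally show "span_act g (embed v) x = embed (act g v) x"
    using x by (simp add: embed_def)
qed (use assms in \<open>auto intro: span_act_closed embed_hull act_closed\<close>)

lemma span_action: "isometric_action tight_span hdist G span_act"
proof -
  have Bij: "span_act g \<in> Bij tight_span" if g: "g \<in> carrier G" for g
  proof -
    have "bij_betw (span_act g) tight_span tight_span"
    proof (rule bij_betwI)
      show "span_act g \<in> tight_span \<rightarrow> tight_span" "span_act (inv g) \<in> tight_span \<rightarrow> tight_span"
        using g by (auto simp: span_act_closed)
      show "span_act (inv g) (span_act g f) = f" "span_act g (span_act (inv g) f) = f" if "f \<in> tight_span" for f
        using g that by (simp_all add: span_act_one flip: span_act_mult)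
    qed
    then show ?thesis by (simp add: Bij_def span_act_def)
  qed
  have "span_act \<in> hom G (BijGroup tight_span)"
  proof (rule homI)
    show "span_act g \<in> carrier (BijGroup tight_span)" if "g \<in> carrier G" for g
      using Bij that by (simp add: BijGroup_def)
    show "span_act (g \<otimes> h) = span_act g \<otimes>\<^bsub>BijGroup tight_span\<^esub> span_act h"
      if "g \<in> carrier G" "h \<in> carrier G" for g h
    proof
      fix f
      show "span_act (g \<otimes> h) f = (span_act g \<otimes>\<^bsub>BijGroup tight_span\<^esub> span_act h) f"
        using that Bij span_act_mult[of g h f]
        by (cases "f \<in> tight_span") (simp_all add: BijGroup_def compose_def, simp add: span_act_def)
    qed
  qed
  then have "group_hom G (BijGroup tight_span) span_act"
    by (simp add: group_hom_def group_hom_axioms_def group_BijGroup is_group)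
  then show ?thesis
    unfolding isometric_action_def isometric_action_axioms_def group_action_def
    using metric_hull span_act_dist by blast
qed

sublocale S: isometric_action tight_span hdist G span_act by (rule span_action)

text \<open>The criterion used in both cases. Rough geodesics make the image of \<open>V\<close>
  coarsely dense in the hull, so acylindricity on \<open>V\<close> is inherited with enlarged
  constants. It is assumed for finite sets of group elements only, which is what limit arguments
  deliver; finiteness of the whole set follows from the uniform bound.\<close>

lemma acylindrically_hyperbolicI:
  assumes four: "\<And>x y z w. \<lbrakk>x \<in> V; y \<in> V; z \<in> V; w \<in> V\<rbrakk>
    \<Longrightarrow> D x z + D y w \<le> max (D x y + D z w) (D y z + D x w) + 2 * \<delta>"
    and \<delta>: "0 \<le> \<delta>"
    and rough: "\<And>x y s t. \<lbrakk>x \<in> V; y \<in> V; 0 \<le> s; 0 \<le> t; D x y \<le> s + t\<rbrakk>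
      \<Longrightarrow> \<exists>v\<in>V. D x v \<le> s + C \<and> D v y \<le> t + C"
    and acyl: "\<And>\<epsilon>. 0 \<le> \<epsilon> \<Longrightarrow> \<exists>(N::nat) R. \<forall>x\<in>V. \<forall>y\<in>V. D x y \<ge> R \<longrightarrow>
      (\<forall>F. finite F \<longrightarrow> F \<subseteq> {g \<in> carrier G. D x (act g x) \<le> \<epsilon> \<and> D y (act g y) \<le> \<epsilon>} \<longrightarrow> card F \<le> N)"
    and b: "b \<in> V" and g: "g \<in> carrier G" and h: "h \<in> carrier G" and L: "0 < L"
    and lox: "\<And>n::nat. n / L - K \<le> D b (act (g [^] int n) b)" "\<And>n::nat. n / L - K \<le> D b (act (h [^] int n) b)"
    and B: "\<And>(m::int) (n::int).
      D b (act (g [^] m) b) + D b (act (h [^] n) b) - D (act (g [^] m) b) (act (h [^] n) b) \<le> B"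
  shows "acylindrically_hyperbolic TYPE('v \<Rightarrow> real) G"
proof -
  have hyp: "H.delta_hyperbolic \<delta>"
    by (rule H.delta_hyperbolicI) (rule hull_four_point[OF four])
  have gromov: "H.gromov_hyperbolic"
    unfolding H.gromov_hyperbolic_def using geodesic_hull hyp \<delta> by blast
  have pow: "g [^] n \<in> carrier G" "h [^] n \<in> carrier G" for n :: int using g h by auto
  have orb: "hdist (embed b) (span_act k (embed b)) = D b (act k b)" if "k \<in> carrier G" for k
    using that b by (simp add: span_act_embed hdist_embed_embed act_closed)
  have loxg: "S.loxodromic g" "S.loxodromic h"
    using lox pow by (auto intro!: S.loxodromicI[OF g embed_hull[OF b] L, of K] S.loxodromicI[OF h embed_hull[OF b] L, of K] simp: orb)
  have "S.independent_loxodromics g h"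
  proof (rule S.independentI[OF hyp \<delta> loxg embed_hull[OF b]])
    fix m n :: int
    have "hdist (span_act (g [^] m) (embed b)) (span_act (h [^] n) (embed b)) = D (act (g [^] m) b) (act (h [^] n) b)"
      using pow b by (simp add: span_act_embed hdist_embed_embed act_closed)
    then show "H.gromov_product (embed b) (span_act (g [^] m) (embed b)) (span_act (h [^] n) (embed b)) \<le> B / 2"
      using B[of m n] orb[OF pow(1), of m] orb[OF pow(2), of n]
        H.commute[of "embed b" "span_act (g [^] m) (embed b)"] H.commute[of "embed b" "span_act (h [^] n) (embed b)"]
      unfolding H.gromov_product_def by (intro divide_right_mono) auto
  qed
  moreover have "S.acylindrical"
    unfolding S.acylindrical_def
  proof (intro allI impI)
    fix \<epsilon> :: real assume \<epsilon>: "0 \<le> \<epsilon>"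
    \<comment> \<open>The constant of \<open>embed_dense\<close>, made nonnegative since no sign is
      assumed for \<open>C\<close>.\<close>
    define c where "c = \<bar>2 * \<delta> + C + 2\<bar>"
    have "0 \<le> \<epsilon> + 2 * c" using \<epsilon> by (simp add: c_def)
    then obtain N :: nat and R where *: "\<forall>x\<in>V. \<forall>y\<in>V. D x y \<ge> R \<longrightarrow> (\<forall>F. finite F \<longrightarrow>
      F \<subseteq> {g \<in> carrier G. D x (act g x) \<le> \<epsilon> + 2 * c \<and> D y (act g y) \<le> \<epsilon> + 2 * c} \<longrightarrow> card F \<le> N)"
      using acyl[OF \<open>0 \<le> \<epsilon> + 2 * c\<close>] by (elim exE) (rule that)
    have NR: "card F \<le> N" if "x \<in> V" "y \<in> V" "D x y \<ge> R" "finite F"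
      "F \<subseteq> {g \<in> carrier G. D x (act g x) \<le> \<epsilon> + 2 * c \<and> D y (act g y) \<le> \<epsilon> + 2 * c}" for x y F
      by (rule *[rule_format, OF that])
    have close: "\<exists>v\<in>V. f v \<le> c" if "f \<in> tight_span" for f
    proof -
      have "\<exists>v\<in>V. f v \<le> 2 * \<delta> + C + 2"
        by (rule embed_dense[OF four rough that])
      then show ?thesis unfolding c_def by (meson abs_ge_self order_trans)
    qed
    \<comment> \<open>Moving both ends into \<open>V\<close> shortens their distance by at most
      \<open>2 * c\<close> and increases each displacement by at most \<open>2 * c\<close>. The
      extra 1 and \<open>Suc\<close> only make the constants positive.\<close>
    have main: "finite {g \<in> carrier G. hdist f (span_act g f) \<le> \<epsilon> \<and> hdist h (span_act g h) \<le> \<epsilon>} \<and>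
        card {g \<in> carrier G. hdist f (span_act g f) \<le> \<epsilon> \<and> hdist h (span_act g h) \<le> \<epsilon>} \<le> Suc N"
      if fh: "f \<in> tight_span" "h \<in> tight_span" and far: "\<bar>R\<bar> + 2 * c + 1 \<le> hdist f h" for f h
    proof -
      obtain x y where x: "x \<in> V" "f x \<le> c" and y: "y \<in> V" "h y \<le> c" using close fh by blast
      have dx: "hdist (embed x) f \<le> c" "hdist (embed y) h \<le> c"
        using x y fh by (simp_all add: hdist_embed)
      have "hdist f h \<le> hdist (embed x) f + hdist (embed x) (embed y) + hdist (embed y) h"
        using H.triangle[OF fh(1) embed_hull[OF x(1)] fh(2)] H.triangle[OF embed_hull[OF x(1)] embed_hull[OF y(1)] fh(2)]
          H.commute[of f "embed x"] by linarith
      then have xy: "R \<le> D x y"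
        using dx far x y by (simp add: hdist_embed_embed)
      have move: "D v (act g v) \<le> \<epsilon> + 2 * c"
        if "v \<in> V" "k \<in> tight_span" "hdist (embed v) k \<le> c" "g \<in> carrier G" "hdist k (span_act g k) \<le> \<epsilon>" for v k g
      proof -
        have e: "embed v \<in> tight_span" "span_act g (embed v) \<in> tight_span" "span_act g k \<in> tight_span"
          using that by (auto intro: embed_hull span_act_closed)
        have "D v (act g v) = hdist (embed v) (span_act g (embed v))"
          using that by (simp add: orb[symmetric] span_act_embed hdist_embed_embed act_closed)
        also have "\<dots> \<le> hdist (embed v) k + hdist k (span_act g k) + hdist (span_act g k) (span_act g (embed v))"
          using H.triangle[OF e(1) that(2) e(2)] H.triangle[OF that(2) e(3,2)] by linarith
        also have "\<dots> \<le> \<epsilon> + 2 * c"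
          using that span_act_dist[OF that(4,2) e(1)] H.commute[of k "embed v"] by linarith
        finally show ?thesis .
      qed
      show ?thesis (is "finite ?A \<and> _")
      proof (rule finite_if_finite_subsets_card_bdd)
        fix F assume F: "F \<subseteq> ?A" "finite F"
        then have "F \<subseteq> {g \<in> carrier G. D x (act g x) \<le> \<epsilon> + 2 * c \<and> D y (act g y) \<le> \<epsilon> + 2 * c}"
          using move[OF x(1) fh(1) dx(1)] move[OF y(1) fh(2) dx(2)] by auto
        from NR[OF x(1) y(1) xy F(2) this] show "card F \<le> Suc N" by simp
      qed
    qed
    have "0 < \<bar>R\<bar> + 2 * c + 1" by (simp add: c_def add_nonneg_pos)
    with main show "\<exists>(N::nat)>0. \<exists>R>0. \<forall>x\<in>tight_span. \<forall>y\<in>tight_span. hdist x y \<ge> R \<longrightarrow>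
      finite {g \<in> carrier G. hdist x (span_act g x) \<le> \<epsilon> \<and> hdist y (span_act g y) \<le> \<epsilon>} \<and>
      card {g \<in> carrier G. hdist x (span_act g x) \<le> \<epsilon> \<and> hdist y (span_act g y) \<le> \<epsilon>} \<le> N"
      by (meson zero_less_Suc)
  qed
  ultimately show ?thesis
    unfolding acylindrically_hyperbolic_def
    using span_action gromov g h by blast
qed

end

section \<open>Quasi-translations along a geodesic\<close>

context Metric_space
begin

definition geodesic :: "(real \<Rightarrow> 'a) \<Rightarrow> 'a \<Rightarrow> 'a \<Rightarrow> bool" where
  "geodesic c x y \<longleftrightarrow> c \<in> {0..d x y} \<rightarrow> M \<and> c 0 = x \<and> c (d x y) = y \<and>
     (\<forall>s\<in>{0..d x y}. \<forall>t\<in>{0..d x y}. d (c s) (c t) = \<bar>s - t\<bar>)"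

lemma geodesicD:
  assumes "geodesic c x y" "0 \<le> t" "t \<le> d x y"
  shows "c t \<in> M" "d x (c t) = t" "d (c t) y = d x y - t"
proof -
  have *: "c 0 = x" "c (d x y) = y" "\<And>s t. \<lbrakk>s \<in> {0..d x y}; t \<in> {0..d x y}\<rbrakk> \<Longrightarrow> d (c s) (c t) = \<bar>s - t\<bar>"
    using assms(1) by (auto simp: geodesic_def)
  show "c t \<in> M" using assms by (auto simp: geodesic_def)
  show "d x (c t) = t" "d (c t) y = d x y - t"
    using *(3)[of 0 t] *(3)[of t "d x y"] *(1,2) assms(2,3) by auto
qed

lemma geodesic_dist:
  "\<lbrakk>geodesic c x y; 0 \<le> s; s \<le> d x y; 0 \<le> t; t \<le> d x y\<rbrakk> \<Longrightarrow> d (c s) (c t) = \<bar>s - t\<bar>"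
  by (simp add: geodesic_def)

lemma geodesic_exists:
  assumes "geodesic_space" "x \<in> M" "y \<in> M"
  obtains c where "geodesic c x y"
  using assms unfolding geodesic_space_def geodesic_def by blast

text \<open>A point with small Gromov product to the ends is close to the point of the segment at
  the same distance from \<open>x\<close>: in the four-point inequality for \<open>z\<close>,
  \<open>x\<close>, \<open>p\<close>, \<open>y\<close> the sum \<open>d z x + d z y\<close> exceeds
  \<open>d x y\<close> by at most \<open>2 * e\<close>.\<close>

lemma dist_on_segment:
  assumes hyp: "delta_hyperbolic \<delta>" and M: "x \<in> M" "y \<in> M" "z \<in> M" "p \<in> M"
    and p: "d x p + d p y = d x y" and e: "gromov_product z x y \<le> e" "0 \<le> e"
  shows "d z p \<le> \<bar>d x z - d x p\<bar> + 2 * e + 2 * \<delta>"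
proof -
  have "d z p + d x y \<le> max (d z x + d p y) (d x p + d z y) + 2 * \<delta>"
    by (rule four_point[OF hyp M(3,1,4,2)])
  moreover have "d z x + d z y \<le> d x y + 2 * e"
    using e by (simp add: gromov_product_def commute)
  ultimately show ?thesis using p e commute[of z x] by linarith
qed

text \<open>The point \<open>c' r\<close> lies almost between \<open>c a\<close> and
  \<open>c b\<close>, at distance about \<open>r\<close> from \<open>c a\<close>. If
  \<open>r\<close> exceeds \<open>b - a\<close>, then by at most \<open>2 * e\<close>, and both
  points are near \<open>c b\<close>.\<close>

lemma close_geodesics:
  assumes hyp: "delta_hyperbolic \<delta>" "0 \<le> \<delta>" and M: "x \<in> M" "y \<in> M" "p \<in> M" "q \<in> M"
    and c: "geodesic c x y" and c': "geodesic c' p q"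
    and ab: "0 \<le> a" "a \<le> b" "b \<le> d x y"
    and near: "d p (c a) \<le> e" "d q (c b) \<le> e" and r: "0 \<le> r" "r \<le> d p q" "a + r \<le> d x y"
  shows "d (c (a + r)) (c' r) \<le> 5 * e + 2 * \<delta>"
proof -
  note ca = geodesicD(1)[OF c ab(1) order_trans[OF ab(2,3)]]
  note cb = geodesicD(1)[OF c order_trans[OF ab(1,2)] ab(3)]
  have "0 \<le> a + r" using ab r by simp
  note cr = geodesicD(1)[OF c this r(3)]
  note z = geodesicD[OF c' r(1,2)]
  have dab: "d (c a) (c b) = b - a" "d (c a) (c (a + r)) = r" "d (c (a + r)) (c b) = \<bar>a + r - b\<bar>"
    using ab r by (simp_all add: geodesic_dist[OF c])
  have pq: "\<bar>d p q - (b - a)\<bar> \<le> 2 * e"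
    using triangle[OF M(3) ca M(4)] triangle[OF ca cb M(4)] triangle[OF ca M(3) cb] triangle[OF M(3) M(4) cb]
      commute[of p "c a"] commute[of q "c b"] near dab by linarith
  have e: "0 \<le> e" using near(1) by (meson nonneg order_trans)
  show ?thesis
  proof (cases "r \<le> b - a")
    case True
    have zab: "d (c a) (c' r) \<le> r + e" "r - e \<le> d (c a) (c' r)" "d (c' r) (c b) \<le> d p q - r + e"
      using triangle[OF ca M(3) z(1)] triangle[OF M(3) ca z(1)] triangle[OF z(1) M(4) cb] near z commute[of p "c a"]
      by linarith+
    then have "gromov_product (c' r) (c a) (c b) \<le> 2 * e"
      unfolding gromov_product_def using dab pq commute[of "c b" "c' r"] by argo
    then have "d (c' r) (c (a + r)) \<le> \<bar>d (c a) (c' r) - d (c a) (c (a + r))\<bar> + 2 * (2 * e) + 2 * \<delta>"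
      using True dab e by (intro dist_on_segment[OF hyp(1) ca cb z(1) cr]) auto
    then show ?thesis using zab dab commute[of "c' r"] by (simp add: abs_le_iff)
  next
    case False
    have "d (c (a + r)) (c' r) \<le> d (c (a + r)) (c b) + d (c b) q + d q (c' r)"
      using triangle[OF cr cb z(1)] triangle[OF cb M(4) z(1)] by linarith
    then show ?thesis using False dab near z pq commute[of "c b" q] commute[of q "c' r"] r hyp(2) by linarith
  qed
qed

end

context isometric_action
begin

lemma geodesic_act:
  assumes c: "geodesic c x y" and g: "g \<in> carrier G" and M: "x \<in> M" "y \<in> M"
  shows "geodesic (\<lambda>t. \<phi> g (c t)) (\<phi> g x) (\<phi> g y)"
  using c isometry[OF g] M act_closed[OF g] unfolding geodesic_def by (auto simp: Pi_iff)

text \<open>The gain is that the error \<open>8 * \<delta>\<close> does not depend on the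
  displacement \<open>\<kappa>\<close> of the ends: away from the ends, hyperbolicity brings the
  image of the geodesic back to it, and only a shift by \<open>\<tau>\<close> remains.\<close>

lemma quasi_translation:
  assumes hyp: "delta_hyperbolic \<delta>" "0 \<le> \<delta>" and M: "x \<in> M" "y \<in> M" and c: "geodesic c x y" and g: "g \<in> carrier G"
    and \<kappa>: "d x (\<phi> g x) \<le> \<kappa>" "d y (\<phi> g y) \<le> \<kappa>"
    and r: "\<kappa> + 2 * \<delta> < r" "r < d x y - \<kappa> - 2 * \<delta>"
  defines "\<tau> \<equiv> d x (\<phi> g y) - d x y"
  shows "\<bar>\<tau>\<bar> \<le> \<kappa>" "d (\<phi> g (c r)) (c (r + \<tau>)) \<le> 8 * \<delta>"
proof -
  have M': "\<phi> g x \<in> M" "\<phi> g y \<in> M" using g M by (auto intro: act_closed)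
  show \<tau>: "\<bar>\<tau>\<bar> \<le> \<kappa>"
    using triangle[OF M(1,2) M'(2)] triangle[OF M(1) M'(2) M(2)] \<kappa> commute[of y] unfolding \<tau>_def by simp
  then have "0 \<le> \<kappa>" by linarith
  then have r': "0 \<le> r" "r \<le> d x y" "0 \<le> r + \<tau>" "r + \<tau> \<le> d x y" using r \<tau> hyp(2) by linarith+
  note p = geodesicD[OF c r'(1,2)] and q = geodesicD[OF c r'(3,4)]
  let ?z = "\<phi> g (c r)"
  have z: "?z \<in> M" using g p by (auto intro: act_closed)
  have e: "d (\<phi> g x) ?z = r" "d ?z (\<phi> g y) = d x y - r" "d (\<phi> g x) (\<phi> g y) = d x y"
    using isometry g M p by auto
  have 0: "gromov_product ?z (\<phi> g x) (\<phi> g y) = 0"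
    unfolding gromov_product_def using e commute[of ?z "\<phi> g y"] by simp
  \<comment> \<open>Seen from \<open>?z\<close>, the points \<open>\<phi> g x\<close> and
    \<open>x\<close> lie in the same direction, and so do \<open>\<phi> g y\<close> and
    \<open>y\<close>. Exchanging one after the other costs \<open>\<delta>\<close> each, which
    bounds the Gromov product of \<open>x\<close> and \<open>y\<close> at \<open>?z\<close> by
    \<open>2 * \<delta>\<close>.\<close>
  have "r - \<kappa> \<le> gromov_product ?z (\<phi> g x) x"
    unfolding gromov_product_def using e \<kappa> triangle[OF M'(1) M(1) z] commute[of "\<phi> g x" x] by (simp add: field_simps)
  moreover have "min (gromov_product ?z (\<phi> g x) x) (gromov_product ?z x (\<phi> g y)) \<le> gromov_product ?z (\<phi> g x) (\<phi> g y) + \<delta>"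
    by (rule gromov_product_min[OF hyp(1) z M'(1) M(1) M'(2)])
  ultimately have 1: "gromov_product ?z x (\<phi> g y) \<le> \<delta>"
    using 0 r hyp(2) by linarith
  have "d x y - r - \<kappa> \<le> gromov_product ?z y (\<phi> g y)"
    unfolding gromov_product_def using e \<kappa> triangle[OF z M(2) M'(2)] commute[of ?z y] commute[of ?z "\<phi> g y"] by (simp add: field_simps)
  moreover have "min (gromov_product ?z x y) (gromov_product ?z y (\<phi> g y)) \<le> gromov_product ?z x (\<phi> g y) + \<delta>"
    by (rule gromov_product_min[OF hyp(1) z M(1) M(2) M'(2)])
  ultimately have 2: "gromov_product ?z x y \<le> 2 * \<delta>"
    using 1 r by linarith
  have "d ?z (c (r + \<tau>)) \<le> \<bar>d x ?z - d x (c (r + \<tau>))\<bar> + 2 * (2 * \<delta>) + 2 * \<delta>"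
    using q hyp(2) 2 by (intro dist_on_segment[OF hyp(1) M z q(1)]) auto
  moreover have "r + \<tau> \<le> d x ?z" "d x ?z \<le> r + \<tau> + 2 * \<delta>"
    using triangle[OF M(1) z M'(2)] 1 e commute[of ?z x] commute[of ?z "\<phi> g y"] commute[of "\<phi> g y" x]
    unfolding gromov_product_def \<tau>_def by argo+
  ultimately show "d ?z (c (r + \<tau>)) \<le> 8 * \<delta>" using q by linarith
qed

end

text \<open>The concatenation \<^term>\<open>x\<close>, \<open>s x\<close>, \<open>s h s x\<close>, \<open>s h s h' s x\<close> is a quasi-geodesic, because it has bounded
  Gromov products at its two corners.\<close>

locale bent_word = isometric_action M d G \<phi>
  for M :: "'x set" and d and G :: "('a, 'b) monoid_scheme" (structure) and \<phi> :: "'a \<Rightarrow> 'x \<Rightarrow> 'x" +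
  fixes \<delta> B K :: real and x :: 'x and s h h' :: 'a
  assumes hyp: "delta_hyperbolic \<delta>" and \<delta>: "0 \<le> \<delta>" and B: "0 \<le> B" and K: "0 \<le> K" and geo: geodesic_space
    and x: "x \<in> M" and s: "s \<in> carrier G" and h: "h \<in> carrier G" "h' \<in> carrier G"
    and hK: "d x (\<phi> h x) \<le> K" "d x (\<phi> h' x) \<le> K"
    and sB: "gromov_product x (\<phi> (inv s) x) (\<phi> (h \<otimes> s) x) \<le> B"
      "gromov_product x (\<phi> (inv s) x) (\<phi> (h' \<otimes> s) x) \<le> B"
      "gromov_product x (\<phi> (h \<otimes> s) x) (\<phi> (h' \<otimes> s) x) \<le> B"
    and long: "1000 * (B + K + \<delta> + 1) \<le> d x (\<phi> s x)"
begin

definition "k = s \<otimes> h"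
definition "k' = s \<otimes> h'"
definition "w = k \<otimes> k' \<otimes> s"
definition "len = d x (\<phi> s x)"
text \<open>The bound of \<open>close_geodesics\<close> for ends that are
  \<open>4 * B + 4 * K + 4 * \<delta>\<close> apart.\<close>

definition "E = 20 * B + 20 * K + 22 * \<delta>"

lemma carrier: "k \<in> carrier G" "k' \<in> carrier G" "w \<in> carrier G" "k \<otimes> s \<in> carrier G" "k \<otimes> k' \<in> carrier G"
  using s h by (auto simp: k_def k'_def w_def)

section \<open>Corners and length of the bent path\<close>

lemma gromov_act: "\<lbrakk>g \<in> carrier G; u \<in> M; v \<in> M; z \<in> M\<rbrakk>
    \<Longrightarrow> gromov_product (\<phi> g z) (\<phi> g u) (\<phi> g v) = gromov_product z u v"
  by (simp add: gromov_product_def isometry)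

lemma points: "\<phi> s x \<in> M" "\<phi> (k \<otimes> s) x \<in> M" "\<phi> w x \<in> M" "\<phi> h x \<in> M" "\<phi> h' x \<in> M"
  "\<phi> k x \<in> M" "\<phi> (k \<otimes> k') x \<in> M" "\<phi> (h \<otimes> s) x \<in> M" "\<phi> (h' \<otimes> s) x \<in> M" "\<phi> (inv s) x \<in> M"
  using carrier s h x by (auto intro!: act_closed)

lemma corner1: "gromov_product (\<phi> s x) x (\<phi> (k \<otimes> s) x) \<le> B"
proof -
  have "\<phi> s (\<phi> (inv s) x) = x" "\<phi> s (\<phi> (h \<otimes> s) x) = \<phi> (k \<otimes> s) x"
    using s h x by (simp_all add: act_one k_def G.m_assoc flip: act_mult)
  then show ?thesis
    using gromov_act[OF s points(10) points(8) x] sB(1) by simp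
qed

text \<open>Translated to \<open>x\<close>, the incoming side ends at the image of \<open>x\<close>
  under \<open>inv s \<otimes> inv h\<close> instead of \<open>inv s\<close>; the two differ by the
  displacement of \<open>h\<close>, hence the summand \<open>K\<close>.\<close>

lemma corner2: "gromov_product (\<phi> (k \<otimes> s) x) (\<phi> s x) (\<phi> w x) \<le> B + K"
proof -
  let ?y = "\<phi> (inv s) (\<phi> (inv h) x)"
  have y: "?y \<in> M" using s h x by (auto intro!: act_closed)
  have "k \<otimes> s \<otimes> (inv s \<otimes> inv h) = s"
    using s h by (simp add: k_def G.m_assoc G.inv_solve_right' flip: G.inv_mult_group)
  then have "\<phi> (k \<otimes> s) ?y = \<phi> s x"
    using carrier s h x by (simp flip: act_mult)
  moreover have "\<phi> (k \<otimes> s) (\<phi> (h' \<otimes> s) x) = \<phi> w x"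
    using carrier s h x by (simp add: w_def k'_def G.m_assoc flip: act_mult)
  ultimately have "gromov_product (\<phi> (k \<otimes> s) x) (\<phi> s x) (\<phi> w x) = gromov_product x ?y (\<phi> (h' \<otimes> s) x)"
    using gromov_act[OF carrier(4) y points(9) x] by simp
  also have "\<dots> \<le> gromov_product x (\<phi> (inv s) x) (\<phi> (h' \<otimes> s) x) + d ?y (\<phi> (inv s) x)"
    by (rule gromov_product_move(1)[OF x y points(9,10)])
  also have "d ?y (\<phi> (inv s) x) = d (\<phi> (inv h) x) x"
    using s h x by (intro isometry) (auto intro: act_closed)
  also have "\<dots> = d x (\<phi> h x)" using dist_act_inv[OF h(1) x x] .
  finally show ?thesis using sB hK by linarith
qed

lemma piece_lengths: "\<bar>d (\<phi> s x) (\<phi> (k \<otimes> s) x) - len\<bar> \<le> K" "\<bar>d (\<phi> (k \<otimes> s) x) (\<phi> w x) - len\<bar> \<le> K"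
proof -
  have *: "\<bar>d x (\<phi> (f \<otimes> s) x) - len\<bar> \<le> K" if f: "f \<in> carrier G" "d x (\<phi> f x) \<le> K" for f
  proof -
    have m: "\<phi> f x \<in> M" "\<phi> (f \<otimes> s) x \<in> M" using f s x by (auto intro!: act_closed)
    have "d (\<phi> f x) (\<phi> (f \<otimes> s) x) = len"
      using f s x isometry[OF f(1) x points(1)] by (simp add: act_mult len_def)
    then show ?thesis
      using triangle[OF x m] triangle[OF m(1) x m(2)] f(2) commute[of x "\<phi> f x"] by linarith
  qed
  have "\<phi> s (\<phi> (h \<otimes> s) x) = \<phi> (k \<otimes> s) x" "\<phi> (k \<otimes> s) (\<phi> (h' \<otimes> s) x) = \<phi> w x"
    using carrier s h x by (simp_all add: k_def w_def k'_def G.m_assoc flip: act_mult)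
  then have "d (\<phi> s x) (\<phi> (k \<otimes> s) x) = d x (\<phi> (h \<otimes> s) x)" "d (\<phi> (k \<otimes> s) x) (\<phi> w x) = d x (\<phi> (h' \<otimes> s) x)"
    using isometry[OF s x points(8)] isometry[OF carrier(4) x points(9)] by simp_all
  then show "\<bar>d (\<phi> s x) (\<phi> (k \<otimes> s) x) - len\<bar> \<le> K" "\<bar>d (\<phi> (k \<otimes> s) x) (\<phi> w x) - len\<bar> \<le> K"
    using *[OF h(1) hK(1)] *[OF h(2) hK(2)] by simp_all
qed

text \<open>Local to global: since the second corner is also wide, the far end and the second corner
  lie in the same direction from the first corner for almost the whole length of the middle side, so
  they bend alike there.\<close>

lemma wide1: "gromov_product (\<phi> s x) x (\<phi> w x) \<le> B + \<delta>"
proof -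
  let ?a = "\<phi> s x" and ?b = "\<phi> (k \<otimes> s) x" and ?c = "\<phi> w x"
  have "min (gromov_product ?a x ?c) (gromov_product ?a ?c ?b) \<le> gromov_product ?a x ?b + \<delta>"
    by (rule gromov_product_min[OF hyp points(1) x points(3,2)])
  moreover have "gromov_product ?a ?c ?b = d ?a ?b - gromov_product ?b ?a ?c"
    unfolding gromov_product_def using commute[of ?a ?b] commute[of ?a ?c] by (simp add: commute field_simps)
  ultimately show ?thesis
    using corner1 corner2 piece_lengths(1) long B K \<delta> unfolding len_def by argo
qed

lemma wide2: "gromov_product (\<phi> (k \<otimes> s) x) x (\<phi> w x) \<le> B + K + \<delta>"
proof -
  let ?a = "\<phi> s x" and ?b = "\<phi> (k \<otimes> s) x" and ?c = "\<phi> w x"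
  have "min (gromov_product ?b ?c x) (gromov_product ?b x ?a) \<le> gromov_product ?b ?c ?a + \<delta>"
    by (rule gromov_product_min[OF hyp points(2,3) x points(1)])
  moreover have "gromov_product ?b x ?a = d ?a ?b - gromov_product ?a x ?b"
    unfolding gromov_product_def using commute[of ?a ?b] commute[of ?a x] commute[of ?b x] by (simp add: field_simps)
  ultimately show ?thesis
    using corner1 corner2 piece_lengths(1) long B K \<delta> gromov_product_commute[of ?b] unfolding len_def by (smt (verit))
qed

lemma total: "\<bar>d x (\<phi> (k \<otimes> s) x) - 2 * len\<bar> \<le> 2 * B + K" "3 * len - 4 * B - 4 * K - 2 * \<delta> \<le> d x (\<phi> w x)"
  using corner1 wide2 piece_lengths triangle[OF x points(1,2)]
    commute[of x "\<phi> s x"] commute[of x "\<phi> (k \<otimes> s) x"] commute[of "\<phi> w x" "\<phi> (k \<otimes> s) x"]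
    commute[of "\<phi> (k \<otimes> s) x" "\<phi> s x"]
  unfolding gromov_product_def len_def by argo+

section \<open>Motions along the geodesic that replaces the bent path\<close>

context
  fixes c c1 :: "real \<Rightarrow> 'x"
  assumes c: "geodesic c x (\<phi> w x)" and c1: "geodesic c1 x (\<phi> s x)"
begin

lemma bounds: "0 \<le> E" "1000 * (B + K + \<delta> + 1) \<le> len" "1000 * E \<le> 30000 * len" "2 * len \<le> d x (\<phi> w x)"
  "2 * len + len / 2 \<le> d x (\<phi> w x)"
  using long total(2) B K \<delta> unfolding E_def len_def by argo+

lemma c_in: "\<lbrakk>0 \<le> r; r \<le> d x (\<phi> w x)\<rbrakk> \<Longrightarrow> c r \<in> M"
  using geodesicD(1)[OF c] .

lemma c1_in: "\<lbrakk>0 \<le> r; r \<le> len\<rbrakk> \<Longrightarrow> c1 r \<in> M"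
  using geodesicD(1)[OF c1] by (simp add: len_def)

lemma near1: "d (\<phi> s x) (c len) \<le> 2 * B + 4 * \<delta>"
proof -
  have l: "0 \<le> len" "len \<le> d x (\<phi> w x)" using bounds B K \<delta> by argo+
  have "d (\<phi> s x) (c len) \<le> \<bar>d x (\<phi> s x) - d x (c len)\<bar> + 2 * (B + \<delta>) + 2 * \<delta>"
    using geodesicD[OF c l] wide1 B \<delta> by (intro dist_on_segment[OF hyp x points(3,1)]) auto
  then show ?thesis using geodesicD[OF c l] by (simp add: len_def)
qed

lemma near2: "d (\<phi> (k \<otimes> s) x) (c (2 * len)) \<le> 4 * B + 3 * K + 4 * \<delta>"
proof -
  have l: "0 \<le> 2 * len" "2 * len \<le> d x (\<phi> w x)" using bounds B K \<delta> by argo+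
  have "d (\<phi> (k \<otimes> s) x) (c (2 * len)) \<le> \<bar>d x (\<phi> (k \<otimes> s) x) - d x (c (2 * len))\<bar> + 2 * (B + K + \<delta>) + 2 * \<delta>"
    using geodesicD[OF c l] wide2 B K \<delta> by (intro dist_on_segment[OF hyp x points(3,2)]) auto
  then show ?thesis using geodesicD[OF c l] total(1) by argo
qed

lemma near_k: "d (\<phi> k x) (\<phi> s x) \<le> K" "d (\<phi> (k \<otimes> k') x) (\<phi> (k \<otimes> s) x) \<le> K"
proof -
  have "d (\<phi> s (\<phi> h x)) (\<phi> s x) = d (\<phi> h x) x"
    using isometry[OF s points(4) x] .
  then show "d (\<phi> k x) (\<phi> s x) \<le> K"
    using s h x hK commute[of x] by (simp add: k_def act_mult)
  have "d (\<phi> (k \<otimes> s) (\<phi> h' x)) (\<phi> (k \<otimes> s) x) = d (\<phi> h' x) x"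
    using isometry[OF carrier(4) points(5) x] .
  moreover have "\<phi> (k \<otimes> s) (\<phi> h' x) = \<phi> (k \<otimes> k') x"
    using carrier s h x by (simp add: k'_def G.m_assoc flip: act_mult)
  ultimately show "d (\<phi> (k \<otimes> k') x) (\<phi> (k \<otimes> s) x) \<le> K"
    using hK commute[of x "\<phi> h' x"] by simp
qed

text \<open>The geodesic \<open>c\<close> follows, with synchronous parameters, the translates of
  \<open>c1\<close> by the identity, \<open>k\<close> and \<open>k \<otimes> k'\<close> one after
  another. In particular \<open>k\<close> shifts the first third of \<open>c\<close> to the second
  third.\<close>

lemma piece1:
  assumes "0 \<le> r" "r \<le> len"
  shows "d (c r) (c1 r) \<le> E"
proof -
  have l: "0 \<le> len" "len \<le> d x (\<phi> w x)" "r \<le> d x (\<phi> w x)" using bounds B K \<delta> assms by argo+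
  have "d (c (0 + r)) (c1 r) \<le> 5 * (4 * B + 4 * K + 4 * \<delta>) + 2 * \<delta>"
    using near1 B K \<delta> l assms geodesicD(2)[OF c, of 0] points x
    by (intro close_geodesics[OF hyp \<delta> x points(3) x points(1) c c1, of 0 len]) (auto simp: len_def)
  then show ?thesis by (simp add: E_def)
qed

lemma piece2:
  assumes "0 \<le> r" "r \<le> len"
  shows "d (c (len + r)) (\<phi> k (c1 r)) \<le> E"
proof -
  have l: "0 \<le> len" "len \<le> 2 * len" "2 * len \<le> d x (\<phi> w x)" "len + r \<le> d x (\<phi> w x)" "0 \<le> 2 * len" "len \<le> d x (\<phi> w x)"
    using bounds B K \<delta> assms by argo+
  have c': "geodesic (\<lambda>t. \<phi> k (c1 t)) (\<phi> k x) (\<phi> (k \<otimes> s) x)"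
    using geodesic_act[OF c1 carrier(1) x points(1)] carrier s x by (simp add: act_mult)
  have "d (\<phi> k x) (\<phi> (k \<otimes> s) x) = len"
    using isometry[OF carrier(1) x points(1)] carrier s x by (simp add: act_mult len_def)
  moreover have "d (\<phi> k x) (c len) \<le> 4 * B + 4 * K + 4 * \<delta>"
    using triangle[OF points(6,1) c_in[OF l(1,6)]] near_k(1) near1 B K \<delta> by argo
  moreover have "d (\<phi> (k \<otimes> s) x) (c (2 * len)) \<le> 4 * B + 4 * K + 4 * \<delta>"
    using near2 K by argo
  ultimately have "d (c (len + r)) (\<phi> k (c1 r)) \<le> 5 * (4 * B + 4 * K + 4 * \<delta>) + 2 * \<delta>"
    using l assms by (intro close_geodesics[OF hyp \<delta> x points(3) points(6) points(2) c c', of len "2 * len"]) auto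
  then show ?thesis by (simp add: E_def)
qed

lemma piece3:
  assumes "0 \<le> r" "r \<le> len" "2 * len + r \<le> d x (\<phi> w x)"
  shows "d (c (2 * len + r)) (\<phi> (k \<otimes> k') (c1 r)) \<le> E"
proof -
  have l: "0 \<le> 2 * len" "2 * len \<le> d x (\<phi> w x)"
    using bounds B K \<delta> assms by argo+
  have c': "geodesic (\<lambda>t. \<phi> (k \<otimes> k') (c1 t)) (\<phi> (k \<otimes> k') x) (\<phi> w x)"
    using geodesic_act[OF c1 carrier(5) x points(1)] carrier s x by (simp add: act_mult w_def)
  have "d (\<phi> (k \<otimes> k') x) (\<phi> w x) = len"
    using isometry[OF carrier(5) x points(1)] carrier s x by (simp add: act_mult len_def w_def)
  moreover have "d (\<phi> (k \<otimes> k') x) (c (2 * len)) \<le> 4 * B + 4 * K + 4 * \<delta>"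
    using triangle[OF points(7,2) c_in[OF l]] near_k(2) near2 B K \<delta> by argo
  moreover have "d (\<phi> w x) (c (d x (\<phi> w x))) \<le> 4 * B + 4 * K + 4 * \<delta>"
    using c B K \<delta> points by (simp add: geodesic_def)
  ultimately have "d (c (2 * len + r)) (\<phi> (k \<otimes> k') (c1 r)) \<le> 5 * (4 * B + 4 * K + 4 * \<delta>) + 2 * \<delta>"
    using l assms by (intro close_geodesics[OF hyp \<delta> x points(3) points(7) points(3) c c', of "2 * len" "d x (\<phi> w x)"]) auto
  then show ?thesis by (simp add: E_def)
qed

lemma shift_k:
  assumes "0 \<le> r" "r \<le> len"
  shows "d (\<phi> k (c r)) (c (len + r)) \<le> 2 * E"
proof -
  have l: "r \<le> d x (\<phi> w x)" "len + r \<le> d x (\<phi> w x)" "0 \<le> len + r" using bounds B K \<delta> assms by argo+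
  have M: "c r \<in> M" "c1 r \<in> M" "c (len + r) \<in> M" "\<phi> k (c r) \<in> M" "\<phi> k (c1 r) \<in> M"
    using c_in c1_in l assms carrier by (auto intro: act_closed)
  have "d (\<phi> k (c r)) (\<phi> k (c1 r)) \<le> E"
    using isometry[OF carrier(1) M(1,2)] piece1[OF assms] by simp
  then show ?thesis
    using triangle[OF M(4,5,3)] piece2[OF assms] commute[of "c (len + r)" "\<phi> k (c1 r)"] by argo
qed

lemma translation:
  assumes g: "g \<in> carrier G" and \<kappa>: "d x (\<phi> g x) \<le> \<kappa>" "d (\<phi> w x) (\<phi> g (\<phi> w x)) \<le> \<kappa>" "\<kappa> \<le> len / 50"
  obtains \<tau> where "\<bar>\<tau>\<bar> \<le> \<kappa>" "\<And>r. \<lbrakk>len / 10 \<le> r; r \<le> 2 * len + len / 4\<rbrakk> \<Longrightarrow> d (\<phi> g (c r)) (c (r + \<tau>)) \<le> 8 * \<delta>"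
proof (rule that)
  have "0 \<le> \<kappa>" using \<kappa>(1) nonneg order_trans by blast
  then have r: "\<kappa> + 2 * \<delta> < r" "r < d x (\<phi> w x) - \<kappa> - 2 * \<delta>" if "len / 10 \<le> r" "r \<le> 2 * len + len / 4" for r
    using that bounds B K \<delta> \<kappa>(3) by argo+
  have "len / 10 \<le> len" "len \<le> 2 * len + len / 4" using bounds B K \<delta> by argo+
  from r[OF this] show "\<bar>d x (\<phi> g (\<phi> w x)) - d x (\<phi> w x)\<bar> \<le> \<kappa>"
    by (intro quasi_translation(1)[OF hyp \<delta> x points(3) c g \<kappa>(1,2)])
  show "d (\<phi> g (c r)) (c (r + (d x (\<phi> g (\<phi> w x)) - d x (\<phi> w x)))) \<le> 8 * \<delta>"
    if "len / 10 \<le> r" "r \<le> 2 * len + len / 4" for r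
    using r[OF that] by (intro quasi_translation(2)[OF hyp \<delta> x points(3) c g \<kappa>(1,2)])
qed

text \<open>On this part of \<open>c\<close> both elements are translations up to bounded error,
  \<open>k\<close> by \<open>len\<close> and \<open>g\<close> by some \<open>\<tau>\<close>, and
  translations commute. The bound depends neither on \<open>g\<close> nor on
  \<open>len\<close>.\<close>

lemma commutator_small:
  assumes g: "g \<in> carrier G" and \<kappa>: "d x (\<phi> g x) \<le> len / 100" "d (\<phi> w x) (\<phi> g (\<phi> w x)) \<le> len / 100"
    and r: "len / 4 \<le> r" "r \<le> len / 2"
  shows "d (c r) (\<phi> (inv (k \<otimes> g) \<otimes> (g \<otimes> k)) (c r)) \<le> 4 * E + 16 * \<delta>"
proof -
  have len: "0 \<le> len" using bounds B K \<delta> by argo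
  obtain \<tau> where \<tau>: "\<bar>\<tau>\<bar> \<le> len / 100"
    "\<And>r. \<lbrakk>len / 10 \<le> r; r \<le> 2 * len + len / 4\<rbrakk> \<Longrightarrow> d (\<phi> g (c r)) (c (r + \<tau>)) \<le> 8 * \<delta>"
    using translation[OF g \<kappa>] len by auto
  have l: "0 \<le> r" "r \<le> len" "len / 10 \<le> r" "r \<le> 2 * len + len / 4" "len / 10 \<le> len + r" "len + r \<le> 2 * len + len / 4"
    "0 \<le> r + \<tau>" "r + \<tau> \<le> len" "len + r \<le> d x (\<phi> w x)" "0 \<le> len + r" "r \<le> d x (\<phi> w x)" "r + \<tau> \<le> d x (\<phi> w x)"
    "len + r + \<tau> \<le> d x (\<phi> w x)" "0 \<le> len + r + \<tau>"
    using len r \<tau>(1) bounds(4) by argo+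
  have M: "c r \<in> M" "c (len + r) \<in> M" "c (r + \<tau>) \<in> M" "c (len + r + \<tau>) \<in> M"
    using c_in l by auto
  have M': "\<phi> g (\<phi> k (c r)) \<in> M" "\<phi> g (c (len + r)) \<in> M" "\<phi> k (c (r + \<tau>)) \<in> M" "\<phi> k (\<phi> g (c r)) \<in> M" "\<phi> k (c r) \<in> M" "\<phi> g (c r) \<in> M"
    using M g carrier by (auto intro!: act_closed)
  have "d (\<phi> g (\<phi> k (c r))) (\<phi> g (c (len + r))) \<le> 2 * E"
    using isometry[OF g M'(5) M(2)] shift_k[OF l(1,2)] by simp
  moreover have "d (\<phi> g (c (len + r))) (c (len + r + \<tau>)) \<le> 8 * \<delta>"
    using \<tau>(2) l by auto
  moreover have "d (\<phi> k (c (r + \<tau>))) (c (len + r + \<tau>)) \<le> 2 * E"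
    using shift_k[OF l(7,8)] by (simp add: add.assoc)
  moreover have "d (\<phi> k (\<phi> g (c r))) (\<phi> k (c (r + \<tau>))) \<le> 8 * \<delta>"
    using isometry[OF carrier(1) M'(6) M(3)] \<tau>(2) l by auto
  ultimately have "d (\<phi> g (\<phi> k (c r))) (\<phi> k (\<phi> g (c r))) \<le> 4 * E + 16 * \<delta>"
    using triangle[OF M'(1,2) M(4)] triangle[OF M'(1) M(4) M'(3)] triangle[OF M'(1,3,4)]
      commute[of "\<phi> k (c (r + \<tau>))" "c (len + r + \<tau>)"] commute[of "\<phi> k (c (r + \<tau>))" "\<phi> k (\<phi> g (c r))"] by argo
  moreover have "d (c r) (\<phi> (inv (k \<otimes> g) \<otimes> (g \<otimes> k)) (c r)) = d (\<phi> (k \<otimes> g) (c r)) (\<phi> (g \<otimes> k) (c r))"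
    using dist_act_inv[of "k \<otimes> g" "\<phi> (g \<otimes> k) (c r)" "c r"] carrier g M
    by (simp add: act_mult act_closed commute[of "c r"] commute[of "\<phi> k (\<phi> g (c r))"])
  ultimately show ?thesis
    using carrier g M commute[of "\<phi> k (\<phi> g (c r))"] by (simp add: act_mult)
qed

text \<open>As \<open>h\<close> and \<open>h'\<close> almost fix \<open>x\<close>, the two images of
  \<open>c1 t\<close> lie near geodesics from \<open>x\<close> towards
  \<open>\<phi> (h \<otimes> s) x\<close> and \<open>\<phi> (h' \<otimes> s) x\<close>. These part
  after a bounded length by the third bound in \<open>sB\<close>.\<close>

lemma diverging:
  assumes t: "0 \<le> t" "t \<le> len" and D: "d (\<phi> h (c1 t)) (\<phi> h' (c1 t)) \<le> D"
  shows "t \<le> K + B + 2 * \<delta> + D / 2"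
proof (rule ccontr)
  assume n: "\<not> ?thesis"
  let ?X = "\<phi> h (c1 t)" and ?Y = "\<phi> h' (c1 t)" and ?P = "\<phi> (h \<otimes> s) x" and ?Q = "\<phi> (h' \<otimes> s) x"
  have "0 \<le> D" using D nonneg order_trans by blast
  have M: "?X \<in> M" "?Y \<in> M" "c1 t \<in> M" using c1_in[OF t] h by (auto intro: act_closed)
  have c1t: "d x (c1 t) = t" "d (c1 t) (\<phi> s x) = len - t"
    using geodesicD[OF c1] t by (auto simp: len_def)
  have *: "t - K \<le> gromov_product x (\<phi> f (c1 t)) (\<phi> (f \<otimes> s) x) \<and> t - K \<le> d x (\<phi> f (c1 t))"
    if f: "f \<in> carrier G" "d x (\<phi> f x) \<le> K" for f
  proof -
    have Mf: "\<phi> f x \<in> M" "\<phi> f (c1 t) \<in> M" "\<phi> (f \<otimes> s) x \<in> M" using f s x M by (auto intro!: act_closed)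
    have "gromov_product (\<phi> f x) (\<phi> f (c1 t)) (\<phi> (f \<otimes> s) x) = gromov_product x (c1 t) (\<phi> s x)"
      using gromov_act[OF f(1) M(3) points(1) x] f s x by (simp add: act_mult)
    also have "\<dots> = t"
      using c1t commute[of x] by (simp add: gromov_product_def len_def)
    finally have "t \<le> gromov_product x (\<phi> f (c1 t)) (\<phi> (f \<otimes> s) x) + d (\<phi> f x) x"
      using gromov_product_base[OF Mf(1) x Mf(2,3)] by simp
    moreover have "gromov_product x (\<phi> f (c1 t)) (\<phi> (f \<otimes> s) x) \<le> d x (\<phi> f (c1 t))"
      by (rule gromov_product_le[OF x Mf(2,3)])
    ultimately show ?thesis using f(2) commute[of x "\<phi> f x"] by simp
  qed
  have 1: "min (gromov_product x ?P ?Y) (gromov_product x ?Y ?Q) \<le> gromov_product x ?P ?Q + \<delta>"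
    by (rule gromov_product_min[OF hyp x points(8) M(2) points(9)])
  have 2: "min (gromov_product x ?P ?X) (gromov_product x ?X ?Y) \<le> gromov_product x ?P ?Y + \<delta>"
    by (rule gromov_product_min[OF hyp x points(8) M(1,2)])
  have "gromov_product x ?X ?Y \<le> B + 2 * \<delta>"
    using 1 2 *[OF h(1) hK(1)] *[OF h(2) hK(2)] sB(3) n \<open>0 \<le> D\<close> \<delta> gromov_product_commute[of x ?P ?X] by argo
  then show False
    using *[OF h(1) hK(1)] *[OF h(2) hK(2)] D n \<delta> B K commute[of x ?X] commute[of x ?Y] unfolding gromov_product_def by argo
qed

text \<open>Before the first corner \<open>k\<close> carries \<open>c\<close> to the part before the
  second corner. Conjugation by the translation \<open>y\<close>, which commutes with
  \<open>k\<close>, carries this past the corners: \<open>k\<close> also matches the parts after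
  them. There \<open>c\<close> follows \<open>k\<close> and \<open>k \<otimes> k'\<close> applied to
  \<open>c1\<close>, so the points \<open>\<phi> h (c1 t)\<close> and
  \<open>\<phi> h' (c1 t)\<close> are close, and \<open>diverging\<close> bounds the
  translation.\<close>

lemma commuting_small:
  assumes y: "y \<in> carrier G" and comm: "k \<otimes> y = y \<otimes> k"
    and \<kappa>: "d x (\<phi> y x) \<le> len / 50" "d (\<phi> w x) (\<phi> y (\<phi> w x)) \<le> len / 50"
    and r: "len / 4 \<le> r" "r \<le> len / 2"
  shows "d (c r) (\<phi> y (c r)) \<le> 2 * K + 2 * B + 4 * E + 28 * \<delta>"
proof -
  have len: "0 \<le> len" using bounds B K \<delta> by argo
  obtain \<tau> where \<tau>: "\<bar>\<tau>\<bar> \<le> len / 50"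
    "\<And>r. \<lbrakk>len / 10 \<le> r; r \<le> 2 * len + len / 4\<rbrakk> \<Longrightarrow> d (\<phi> y (c r)) (c (r + \<tau>)) \<le> 8 * \<delta>"
    using translation[OF y \<kappa>] len by auto
  \<comment> \<open>Half the translation length: up to small error \<open>y\<close> maps the point
    at distance \<open>t\<close> on one side of a corner to the point at distance \<open>t\<close>
    on its other side, in a direction given by the sign of \<open>\<tau>\<close>.\<close>
  define t where "t = \<bar>\<tau>\<bar> / 2"
  have t: "0 \<le> t" "t \<le> len / 100" using \<tau>(1) by (auto simp: t_def)
  have M: "c u \<in> M" if "0 \<le> u" "u \<le> 2 * len + len / 2" for u
    using c_in that bounds by auto
  have ky: "\<phi> k (\<phi> y (c u)) = \<phi> y (\<phi> k (c u))" if "0 \<le> u" "u \<le> 2 * len + len / 2" for u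
    using M[OF that] y carrier comm by (simp flip: act_mult)
  have N: "c (len - t) \<in> M" "c (len + t) \<in> M" "c (2 * len - t) \<in> M" "c (2 * len + t) \<in> M"
    using t len by (auto intro!: M)
  have l: "len / 10 \<le> len - t" "len - t \<le> 2 * len + len / 4" "len / 10 \<le> len + t" "len + t \<le> 2 * len + len / 4"
    "len / 10 \<le> 2 * len - t" "2 * len - t \<le> 2 * len + len / 4" "len / 10 \<le> 2 * len + t" "2 * len + t \<le> 2 * len + len / 4"
    "0 \<le> len - t" "len - t \<le> len" "0 \<le> len + t" "len + t \<le> 2 * len + len / 2" "len - t \<le> 2 * len + len / 2"
    using t len by auto
  have kd: "d (\<phi> k u) (\<phi> k v) = d u v" "d (\<phi> y u) (\<phi> y v) = d u v" if "u \<in> M" "v \<in> M" for u v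
    using isometry carrier y that by auto
  have km: "\<phi> k u \<in> M" "\<phi> y u \<in> M" if "u \<in> M" for u
    using act_closed carrier y that by auto
  have sk: "d (\<phi> k (c (len - t))) (c (2 * len - t)) \<le> 2 * E"
    using shift_k[OF l(9,10)] by simp
  have "d (\<phi> k (c (len + t))) (c (2 * len + t)) \<le> 2 * E + 16 * \<delta>"
  proof (cases "0 \<le> \<tau>")
    case True
    then have \<tau>t: "len - t + \<tau> = len + t" "2 * len - t + \<tau> = 2 * len + t" by (auto simp: t_def)
    have 1: "d (\<phi> y (c (len - t))) (c (len + t)) \<le> 8 * \<delta>" "d (\<phi> y (c (2 * len - t))) (c (2 * len + t)) \<le> 8 * \<delta>"
      using \<tau>(2)[OF l(1,2)] \<tau>(2)[OF l(5,6)] unfolding \<tau>t by auto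
    have "d (\<phi> k (c (len + t))) (\<phi> y (\<phi> k (c (len - t)))) = d (\<phi> y (c (len - t))) (c (len + t))"
      using kd(1)[OF N(2) km(2)[OF N(1)]] commute[of "c (len + t)" "\<phi> y (c (len - t))"] ky[OF l(9,13)] by simp
    moreover have "d (\<phi> y (\<phi> k (c (len - t)))) (\<phi> y (c (2 * len - t))) = d (\<phi> k (c (len - t))) (c (2 * len - t))"
      using kd(2)[OF km(1)[OF N(1)] N(3)] .
    ultimately show ?thesis
      using 1 sk triangle[OF km(1)[OF N(2)] km(2)[OF km(1)[OF N(1)]] N(4)]
        triangle[OF km(2)[OF km(1)[OF N(1)]] km(2)[OF N(3)] N(4)] by argo
  next
    case False
    then have \<tau>t: "len + t + \<tau> = len - t" "2 * len + t + \<tau> = 2 * len - t" by (auto simp: t_def)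
    have 1: "d (\<phi> y (c (len + t))) (c (len - t)) \<le> 8 * \<delta>" "d (\<phi> y (c (2 * len + t))) (c (2 * len - t)) \<le> 8 * \<delta>"
      using \<tau>(2)[OF l(3,4)] \<tau>(2)[OF l(7,8)] unfolding \<tau>t by auto
    have 2: "d (\<phi> k (c (len + t))) (c (2 * len + t)) = d (\<phi> k (\<phi> y (c (len + t)))) (\<phi> y (c (2 * len + t)))"
      using kd(2)[OF km(1)[OF N(2)] N(4)] ky[OF l(11,12)] by simp
    have 3: "d (\<phi> k (\<phi> y (c (len + t)))) (\<phi> k (c (len - t))) = d (\<phi> y (c (len + t))) (c (len - t))"
      using kd(1)[OF km(2)[OF N(2)] N(1)] .
    show ?thesis
      using 1 2 3 sk triangle[OF km(1)[OF km(2)[OF N(2)]] km(1)[OF N(1)] km(2)[OF N(4)]]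
        triangle[OF km(1)[OF N(1)] N(3) km(2)[OF N(4)]] commute[of "\<phi> y (c (2 * len + t))" "c (2 * len - t)"] by argo
  qed
  note turn = this
  have t': "t \<le> len" "2 * len + t \<le> d x (\<phi> w x)" using t bounds len by auto
  have c1t: "c1 t \<in> M" using c1_in t t' by auto
  have "d (\<phi> k (c (len + t))) (\<phi> k (\<phi> k (c1 t))) \<le> E"
    using kd(1)[OF N(2) km(1)[OF c1t]] piece2[OF t(1) t'(1)] by simp
  moreover have kk': "\<phi> (k \<otimes> k') (c1 t) = \<phi> k (\<phi> k' (c1 t))" "\<phi> k (c1 t) = \<phi> s (\<phi> h (c1 t))" "\<phi> k' (c1 t) = \<phi> s (\<phi> h' (c1 t))"
    using carrier s h c1t by (auto simp: act_mult k_def k'_def act_closed)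
  moreover have P: "\<phi> k (\<phi> k (c1 t)) \<in> M" "\<phi> (k \<otimes> k') (c1 t) \<in> M" "\<phi> k' (c1 t) \<in> M"
    using km c1t carrier by (auto intro: act_closed)
  ultimately have "d (\<phi> k (\<phi> k (c1 t))) (\<phi> (k \<otimes> k') (c1 t)) \<le> 4 * E + 16 * \<delta>"
    using turn piece3[OF t(1) t'] triangle[OF P(1) km(1)[OF N(2)] P(2)] triangle[OF km(1)[OF N(2)] N(4) P(2)]
      commute[of "\<phi> k (c (len + t))" "\<phi> k (\<phi> k (c1 t))"] by argo
  also have "d (\<phi> k (\<phi> k (c1 t))) (\<phi> (k \<otimes> k') (c1 t)) = d (\<phi> h (c1 t)) (\<phi> h' (c1 t))"
    using kd(1)[OF km(1)[OF c1t] P(3)] isometry[OF s, of "\<phi> h (c1 t)" "\<phi> h' (c1 t)"] h c1t kk' by (simp add: act_closed)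
  finally have "t \<le> K + B + 2 * \<delta> + (4 * E + 16 * \<delta>) / 2"
    by (rule diverging[OF t(1) t'(1)])
  then have small: "\<bar>\<tau>\<bar> \<le> 2 * K + 2 * B + 4 * E + 20 * \<delta>"
    unfolding t_def by argo
  have r': "len / 10 \<le> r" "r \<le> 2 * len + len / 4" "0 \<le> r" "r \<le> d x (\<phi> w x)" "0 \<le> r + \<tau>" "r + \<tau> \<le> d x (\<phi> w x)"
    using r len \<tau>(1) bounds by auto
  have "d (c r) (c (r + \<tau>)) = \<bar>\<tau>\<bar>"
    using geodesic_dist[OF c r'(3-6)] by simp
  moreover have "c r \<in> M" "c (r + \<tau>) \<in> M" using c_in r' by auto
  ultimately show ?thesis
    using triangle[of "c r" "c (r + \<tau>)" "\<phi> y (c r)"] km \<tau>(2)[OF r'(1,2)] small commute[of "c (r + \<tau>)" "\<phi> y (c r)"] by auto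
qed

end

end

lemma pigeonhole_fibre:
  assumes "finite F" "f ` F \<subseteq> Q" "finite Q" "card Q \<le> N" "N * N' < card F"
  obtains q where "N' < card {g \<in> F. f g = q}"
proof -
  have "card F = (\<Sum>q\<in>f ` F. card {g \<in> F. f g = q})"
    using assms(1) by (subst card_eq_sum, subst sum.image_gen[OF assms(1), of _ f]) simp
  moreover have "(\<Sum>q\<in>f ` F. card {g \<in> F. f g = q}) \<le> N * N'" if "\<And>q. card {g \<in> F. f g = q} \<le> N'"
  proof -
    have "(\<Sum>q\<in>f ` F. card {g \<in> F. f g = q}) \<le> (\<Sum>q\<in>f ` F. N')"
      by (intro sum_mono that)
    also have "\<dots> \<le> N * N'"
      using card_mono[OF assms(3,2)] assms(4) by simp
    finally show ?thesis .
  qed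
  ultimately have "\<exists>q. N' < card {g \<in> F. f g = q}" using assms(5) by (metis not_less)
  then show thesis using that by blast
qed

text \<open>The fibres of the commutator with \<open>k\<close> are cosets of the centralizer of
  \<open>k\<close>.\<close>

lemma (in group) equal_commutators_imp_commute:
  assumes c: "k \<in> carrier G" "g \<in> carrier G" "g0 \<in> carrier G"
    and e: "inv (k \<otimes> g) \<otimes> (g \<otimes> k) = inv (k \<otimes> g0) \<otimes> (g0 \<otimes> k)"
  shows "k \<otimes> (g \<otimes> inv g0) = (g \<otimes> inv g0) \<otimes> k"
proof -
  have "g \<otimes> k = (k \<otimes> g) \<otimes> (inv (k \<otimes> g0) \<otimes> (g0 \<otimes> k))"
    using e c by (subst (asm) inv_solve_left') auto
  also have "\<dots> = (k \<otimes> g \<otimes> inv g0 \<otimes> inv k \<otimes> g0) \<otimes> k"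
    using c by (simp add: inv_mult_group m_assoc)
  finally have "g = (k \<otimes> g \<otimes> inv g0 \<otimes> inv k) \<otimes> g0"
    using c by simp
  then have "k \<otimes> (g \<otimes> inv g0) \<otimes> inv k = g \<otimes> inv g0"
    using c inv_solve_right[of "k \<otimes> g \<otimes> inv g0 \<otimes> inv k" g g0] by (simp add: m_assoc)
  then show ?thesis
    using c inv_solve_right'[of "g \<otimes> inv g0" "k \<otimes> (g \<otimes> inv g0)" k] by simp
qed

context isometric_action
begin

text \<open>If \<^term>\<open>s\<close> moves \<^term>\<open>x\<close> far, only boundedly many elements almost fix both ends of the bent path from
  \<^term>\<open>x\<close> to \<^term>\<open>w x\<close>: by pigeonhole, a quotient of two of them commutes with \<^term>\<open>k = s h\<close>, hence translates
  past both corners of the path by the same amount, which is impossible since these corners bend differently.\<close>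

lemma uniformly_discontinuous_word:
  assumes hyp: "delta_hyperbolic \<delta>" "0 \<le> \<delta>" and geo: geodesic_space and acyl: acylindrical and x: "x \<in> M"
    and BK: "0 \<le> B" "0 \<le> K"
  shows "\<exists>(N::nat) L. \<forall>s\<in>carrier G. \<forall>h\<in>carrier G. \<forall>h'\<in>carrier G.
    d x (\<phi> h x) \<le> K \<longrightarrow> d x (\<phi> h' x) \<le> K \<longrightarrow>
    gromov_product x (\<phi> (inv s) x) (\<phi> (h \<otimes> s) x) \<le> B \<longrightarrow>
    gromov_product x (\<phi> (inv s) x) (\<phi> (h' \<otimes> s) x) \<le> B \<longrightarrow>
    gromov_product x (\<phi> (h \<otimes> s) x) (\<phi> (h' \<otimes> s) x) \<le> B \<longrightarrow>
    L \<le> d x (\<phi> s x) \<longrightarrow>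
    (\<forall>F. finite F \<longrightarrow> F \<subseteq> carrier G \<longrightarrow>
      (\<forall>g\<in>F. d x (\<phi> g x) \<le> d x (\<phi> s x) / 100 \<and>
        d (\<phi> (s \<otimes> h \<otimes> (s \<otimes> h') \<otimes> s) x) (\<phi> g (\<phi> (s \<otimes> h \<otimes> (s \<otimes> h') \<otimes> s) x)) \<le> d x (\<phi> s x) / 100) \<longrightarrow>
      card F \<le> N)"
proof -
  define E where "E = 20 * B + 20 * K + 22 * \<delta>"
  \<comment> \<open>The bound of \<open>commuting_small\<close>, which exceeds that of
    \<open>commutator_small\<close>; one use of acylindricity thus serves both.\<close>
  define \<epsilon> where "\<epsilon> = 2 * K + 2 * B + 4 * E + 28 * \<delta>"
  have \<epsilon>: "0 \<le> \<epsilon>" "4 * E + 16 * \<delta> \<le> \<epsilon>" using BK hyp(2) by (auto simp: \<epsilon>_def E_def)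
  obtain N :: nat and R where R: "R > 0" and NR: "\<And>p q. \<lbrakk>p \<in> M; q \<in> M; d p q \<ge> R\<rbrakk> \<Longrightarrow>
     finite {g \<in> carrier G. d p (\<phi> g p) \<le> \<epsilon> \<and> d q (\<phi> g q) \<le> \<epsilon>} \<and>
     card {g \<in> carrier G. d p (\<phi> g p) \<le> \<epsilon> \<and> d q (\<phi> g q) \<le> \<epsilon>} \<le> N"
    using acyl \<epsilon>(1) unfolding acylindrical_def by meson
  \<comment> \<open>At most \<open>N\<close> commutators occur, and each comes from at most
    \<open>N\<close> elements. The summand \<open>4 * R\<close> puts the test points at parameters
    \<open>len / 4\<close> and \<open>len / 2\<close> at least \<open>R\<close> apart.\<close>
  show ?thesis
  proof (intro exI[of _ "N * N"] exI[of _ "4 * R + 1000 * (B + K + \<delta> + 1)"] ballI allI impI)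
    fix s h h' F
    assume c: "s \<in> carrier G" "h \<in> carrier G" "h' \<in> carrier G" and hK: "d x (\<phi> h x) \<le> K" "d x (\<phi> h' x) \<le> K"
      and sB: "gromov_product x (\<phi> (inv s) x) (\<phi> (h \<otimes> s) x) \<le> B"
      "gromov_product x (\<phi> (inv s) x) (\<phi> (h' \<otimes> s) x) \<le> B"
      "gromov_product x (\<phi> (h \<otimes> s) x) (\<phi> (h' \<otimes> s) x) \<le> B"
      and long: "4 * R + 1000 * (B + K + \<delta> + 1) \<le> d x (\<phi> s x)"
      and F: "finite F" "F \<subseteq> carrier G"
      "\<forall>g\<in>F. d x (\<phi> g x) \<le> d x (\<phi> s x) / 100 \<and>
        d (\<phi> (s \<otimes> h \<otimes> (s \<otimes> h') \<otimes> s) x) (\<phi> g (\<phi> (s \<otimes> h \<otimes> (s \<otimes> h') \<otimes> s) x)) \<le> d x (\<phi> s x) / 100"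
    interpret W: bent_word M d G \<phi> \<delta> B K x s h h'
      by unfold_locales (use hyp BK geo x c hK sB long R in auto)
    have w: "s \<otimes> h \<otimes> (s \<otimes> h') \<otimes> s = W.w" by (simp add: W.w_def W.k_def W.k'_def)
    note F = F[unfolded w, folded W.len_def]
    obtain c where c: "geodesic c x (\<phi> W.w x)" using geodesic_exists[OF geo x W.points(3)] .
    obtain c1 where c1: "geodesic c1 x (\<phi> s x)" using geodesic_exists[OF geo x W.points(1)] .
    have len: "0 \<le> W.len" "4 * R \<le> W.len" using long BK hyp(2) by (auto simp: W.len_def)
    let ?p = "c (W.len / 4)" and ?q = "c (W.len / 2)"
    have l: "0 \<le> W.len / 4" "W.len / 4 \<le> d x (\<phi> W.w x)" "0 \<le> W.len / 2" "W.len / 2 \<le> d x (\<phi> W.w x)"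
      using len W.bounds(4)[OF c c1] by auto
    have pq: "?p \<in> M" "?q \<in> M" "R \<le> d ?p ?q"
      using W.c_in[OF c c1] l geodesic_dist[OF c l] len by auto
    define Q where "Q = {g \<in> carrier G. d ?p (\<phi> g ?p) \<le> \<epsilon> \<and> d ?q (\<phi> g ?q) \<le> \<epsilon>}"
    have Q: "finite Q" "card Q \<le> N" using NR[OF pq] by (auto simp: Q_def)
    let ?f = "\<lambda>g. inv (W.k \<otimes> g) \<otimes> (g \<otimes> W.k)"
    have EE: "W.E = E" by (simp add: E_def W.E_def)
    have r: "W.len / 4 \<le> W.len / 4" "W.len / 4 \<le> W.len / 2" "W.len / 2 \<le> W.len / 2" using len by auto
    have "?f g \<in> Q" if g: "g \<in> F" for g
    proof -
      have g': "g \<in> carrier G" "d x (\<phi> g x) \<le> W.len / 100" "d (\<phi> W.w x) (\<phi> g (\<phi> W.w x)) \<le> W.len / 100"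
        using g F by auto
      have "?f g \<in> carrier G" using g' W.carrier by simp
      then show ?thesis
        unfolding Q_def using W.commutator_small[OF c c1 g' r(1,2)] W.commutator_small[OF c c1 g' r(2,3)] \<epsilon>(2) EE
        by simp
    qed
    then have fQ: "?f ` F \<subseteq> Q" by blast
    show "card F \<le> N * N"
    proof (rule ccontr)
      assume "\<not> card F \<le> N * N"
      then obtain z where z: "N < card {g \<in> F. ?f g = z}"
        using pigeonhole_fibre[OF F(1) fQ Q, of N] by (metis not_le)
      let ?F = "{g \<in> F. ?f g = z}"
      obtain g0 where g0: "g0 \<in> ?F" using z by (metis card.empty equals0I less_nat_zero_code)
      have "g \<otimes> inv g0 \<in> Q" if g: "g \<in> ?F" for g
      proof -
        have gc: "g \<in> carrier G" "g0 \<in> carrier G" using g g0 F by auto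
        let ?y = "g \<otimes> inv g0"
        have e: "?f g = ?f g0" using g g0 by simp
        have "W.k \<otimes> ?y = ?y \<otimes> W.k"
          using G.equal_commutators_imp_commute[OF W.carrier(1) gc e] .
        moreover have "d u (\<phi> ?y u) \<le> W.len / 50"
          if u: "u \<in> M" "d u (\<phi> g u) \<le> W.len / 100" "d u (\<phi> g0 u) \<le> W.len / 100" for u
        proof -
          have m: "\<phi> g u \<in> M" "\<phi> (inv g0) u \<in> M" "\<phi> ?y u \<in> M" using gc u by (auto intro!: act_closed)
          have "d (\<phi> g u) (\<phi> ?y u) = d u (\<phi> (inv g0) u)"
            using isometry[OF gc(1) u(1) m(2)] gc u by (simp add: act_mult)
          also have "\<dots> = d u (\<phi> g0 u)" using dist_act_inv[OF gc(2) u(1) u(1)] commute[of u "\<phi> (inv g0) u"] by simp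
          finally show ?thesis using triangle[OF u(1) m(1,3)] u by argo
        qed
        moreover have "d u (\<phi> g u) \<le> W.len / 100" "d u (\<phi> g0 u) \<le> W.len / 100" if "u = x \<or> u = \<phi> W.w x" for u
          using g g0 F(3) that by auto
        ultimately have y: "W.k \<otimes> ?y = ?y \<otimes> W.k" "d x (\<phi> ?y x) \<le> W.len / 50" "d (\<phi> W.w x) (\<phi> ?y (\<phi> W.w x)) \<le> W.len / 50"
          using x W.points(3) by simp_all
        have yc: "?y \<in> carrier G" using gc by simp
        show "?y \<in> Q"
          unfolding Q_def \<epsilon>_def
          using W.commuting_small[OF c c1 yc y r(1,2)] W.commuting_small[OF c c1 yc y r(2,3)] yc EE by simp
      qed
      moreover have "inj_on (\<lambda>g. g \<otimes> inv g0) ?F"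
        using F(2) g0 by (intro inj_onI) (metis (no_types, lifting) G.inv_closed G.right_cancel mem_Collect_eq subsetD)
      ultimately have "card ?F \<le> card Q"
        using Q(1) by (intro card_inj_on_le[of "\<lambda>g. g \<otimes> inv g0"]) auto
      then show False using z Q(2) by linarith
    qed
  qed
qed

end

section \<open>Ultrafilters and directions of divergence\<close>

definition ultrafilter :: "'i filter \<Rightarrow> bool" where
  "ultrafilter W \<longleftrightarrow> W \<noteq> bot \<and> (\<forall>P. eventually P W \<or> eventually (\<lambda>i. \<not> P i) W)"

text \<open>Finer filters are smaller, so Zorn's lemma is applied to the reversed order. A nonempty
  chain has a proper infimum because a property eventually true for the infimum is already
  eventually true for a member.\<close>

lemma ultrafilter_exists:
  assumes "F \<noteq> bot"
  shows "\<exists>W\<le>F. ultrafilter W"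
proof -
  let ?A = "{W. W \<noteq> bot \<and> W \<le> F}" and ?P = "\<lambda>V W :: 'a filter. W \<le> V"
  have "\<exists>m\<in>?A. \<forall>W\<in>?A. ?P m W \<longrightarrow> W = m"
  proof (rule predicate_Zorn)
    show "partial_order_on ?A (relation_of ?P ?A)"
      by (rule partial_order_on_relation_ofI) auto
    fix C assume C: "C \<in> Chains (relation_of ?P ?A)"
    show "\<exists>U\<in>?A. \<forall>W\<in>C. ?P W U"
    proof (cases "C = {}")
      case True
      then show ?thesis using assms by blast
    next
      case False
      have CA: "C \<subseteq> ?A" and total: "\<And>U V. \<lbrakk>U \<in> C; V \<in> C\<rbrakk> \<Longrightarrow> U \<le> V \<or> V \<le> U"
        using C by (auto simp: Chains_def relation_of_def)
      have "eventually P (Inf C) \<longleftrightarrow> (\<exists>W\<in>C. eventually P W)" for P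
      proof (rule eventually_Inf_base[OF False])
        fix U V assume UV: "U \<in> C" "V \<in> C"
        show "\<exists>x\<in>C. x \<le> inf U V"
        proof (cases "U \<le> V")
          case True
          then show ?thesis using UV(1) by (intro bexI[of _ U]) simp_all
        next
          case False
          then have "V \<le> U" using total[OF UV] by blast
          then show ?thesis using UV(2) by (intro bexI[of _ V]) simp_all
        qed
      qed
      then have "Inf C \<noteq> bot"
        using CA by (auto simp: trivial_limit_def)
      moreover obtain V where "V \<in> C" using False by blast
      then have "Inf C \<le> F"
        using CA Inf_lower[of V C] by (auto intro: order_trans)
      ultimately show ?thesis by (intro bexI[of _ "Inf C"]) (auto intro: Inf_lower)
    qed
  qed
  then obtain W where W: "W \<noteq> bot" "W \<le> F" and max: "\<And>U. \<lbrakk>U \<noteq> bot; U \<le> F; U \<le> W\<rbrakk> \<Longrightarrow> U = W"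
    by auto
  have "eventually P W \<or> eventually (\<lambda>i. \<not> P i) W" for P
  proof (cases "inf W (principal {i. \<not> P i}) = bot")
    case True
    then have "eventually (\<lambda>i. False) (inf W (principal {i. \<not> P i}))" by simp
    then show ?thesis by (simp add: eventually_inf_principal)
  next
    case False
    have le: "inf W (principal {i. \<not> P i}) \<le> W" by simp
    have "inf W (principal {i. \<not> P i}) = W"
      using max[OF False order_trans[OF le W(2)] le] .
    moreover have "eventually (\<lambda>i. \<not> P i) (inf W (principal {i. \<not> P i}))"
      by (simp add: eventually_inf_principal)
    ultimately show ?thesis by simp
  qed
  then show ?thesis using W by (auto simp: ultrafilter_def)
qed

lemma ultrafilter_not: "ultrafilter W \<Longrightarrow> \<not> eventually P W \<Longrightarrow> eventually (\<lambda>i. \<not> P i) W"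
  by (auto simp: ultrafilter_def)

text \<open>Compactness of an interval yields a cluster point, and a cluster point along an
  ultrafilter is a limit.\<close>

lemma ultrafilter_limit:
  fixes f :: "'i \<Rightarrow> real"
  assumes W: "ultrafilter W" and b: "eventually (\<lambda>i. \<bar>f i\<bar> \<le> C) W"
  shows "\<exists>l. (f \<longlongrightarrow> l) W"
proof -
  let ?F = "filtermap f W"
  have "?F \<noteq> bot" using W by (simp add: ultrafilter_def filtermap_bot_iff)
  moreover have "eventually (\<lambda>x. x \<in> {-C..C}) ?F"
    using b by (simp add: eventually_filtermap abs_le_iff minus_le_iff eventually_mono)
  ultimately obtain l where l: "inf (nhds l) ?F \<noteq> bot"
    using compact_Icc[of "-C" C] unfolding compact_filter by blast
  have "(f \<longlongrightarrow> l) W"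
  proof (rule topological_tendstoI, rule ccontr)
    fix S assume S: "open S" "l \<in> S" and n: "\<not> eventually (\<lambda>i. f i \<in> S) W"
    have "eventually (\<lambda>x. x \<notin> S) ?F"
      using ultrafilter_not[OF W n] by (simp add: eventually_filtermap)
    moreover have "eventually (\<lambda>x. x \<in> S) (nhds l)"
      using S eventually_nhds by blast
    ultimately have "eventually (\<lambda>x. False) (inf (nhds l) ?F)"
      unfolding eventually_inf by blast
    then show False using l by (simp add: trivial_limit_def)
  qed
  then show ?thesis by blast
qed

context Metric_space
begin

text \<open>Two families leave \<open>p\<close> in the same direction. The Gromov product is not
  rescaled: along an ultrafilter the negation gives a bound in the original metric, as the estimate
  for bent words requires.\<close>

definition fellow :: "'i filter \<Rightarrow> 'a \<Rightarrow> ('i \<Rightarrow> 'a) \<Rightarrow> ('i \<Rightarrow> 'a) \<Rightarrow> bool" where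
  "fellow W p x y \<longleftrightarrow> (\<forall>K. eventually (\<lambda>i. K \<le> gromov_product p (x i) (y i)) W)"

lemma fellow_sym: "fellow W p x y \<Longrightarrow> fellow W p y x"
  by (simp add: fellow_def gromov_product_commute)

lemma fellow_trans:
  assumes hyp: "delta_hyperbolic \<delta>" and M: "p \<in> M" "\<And>i. x i \<in> M" "\<And>i. y i \<in> M" "\<And>i. z i \<in> M"
    and xy: "fellow W p x y" and yz: "fellow W p y z"
  shows "fellow W p x z"
  unfolding fellow_def
proof
  fix K
  have "eventually (\<lambda>i. K + \<delta> \<le> gromov_product p (x i) (y i)) W" "eventually (\<lambda>i. K + \<delta> \<le> gromov_product p (y i) (z i)) W"
    using xy yz by (auto simp: fellow_def)
  then show "eventually (\<lambda>i. K \<le> gromov_product p (x i) (z i)) W"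
  proof eventually_elim
    case (elim i)
    then show ?case using gromov_product_min[OF hyp M(1) M(2)[of i] M(3)[of i] M(4)[of i]] by linarith
  qed
qed

lemma not_fellow:
  assumes "ultrafilter W" "\<not> fellow W p x y"
  obtains K where "eventually (\<lambda>i. gromov_product p (x i) (y i) \<le> K) W"
proof -
  obtain K where "\<not> eventually (\<lambda>i. K \<le> gromov_product p (x i) (y i)) W"
    using assms(2) by (auto simp: fellow_def)
  then have "eventually (\<lambda>i. \<not> K \<le> gromov_product p (x i) (y i)) W"
    by (rule ultrafilter_not[OF assms(1)])
  then have "eventually (\<lambda>i. gromov_product p (x i) (y i) \<le> K) W"
    by (rule eventually_mono) simp
  then show thesis by (rule that)
qed

end

section \<open>Stabilizers of a direction\<close>

context isometric_action
begin

lemma fellow_act: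
  assumes p: "p \<in> M" and g: "g \<in> carrier G" and M: "\<And>i. x i \<in> M" "\<And>i. y i \<in> M" and f: "fellow W p x y"
  shows "fellow W p (\<lambda>i. \<phi> g (x i)) (\<lambda>i. \<phi> g (y i))"
  unfolding fellow_def
proof
  fix K
  have "eventually (\<lambda>i. K + d (\<phi> g p) p \<le> gromov_product p (x i) (y i)) W"
    using f by (auto simp: fellow_def)
  then show "eventually (\<lambda>i. K \<le> gromov_product p (\<phi> g (x i)) (\<phi> g (y i))) W"
  proof eventually_elim
    case (elim i)
    have "gromov_product (\<phi> g p) (\<phi> g (x i)) (\<phi> g (y i)) = gromov_product p (x i) (y i)"
      using isometry g p M by (simp add: gromov_product_def)
    moreover have "gromov_product (\<phi> g p) (\<phi> g (x i)) (\<phi> g (y i)) \<le> gromov_product p (\<phi> g (x i)) (\<phi> g (y i)) + d (\<phi> g p) p"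
      using g p M by (intro gromov_product_base) (auto intro: act_closed)
    ultimately show ?case using elim by simp
  qed
qed

text \<open>The segments from \<open>p\<close> to \<open>x\<close> and from
  \<open>\<phi> g p\<close> to \<open>\<phi> g x\<close> start close together and stay so up to
  distance \<open>d p q\<close>; hence \<open>q\<close> and its image, at almost the same distance
  from \<open>p\<close>, are close.\<close>

lemma fellow_displacement:
  assumes hyp: "delta_hyperbolic \<delta>" "0 \<le> \<delta>" and M: "p \<in> M" "q \<in> M" "x \<in> M" and g: "g \<in> carrier G"
    and q: "d p q + d q x = d p x" and \<kappa>: "d p (\<phi> g p) \<le> \<kappa>" and far: "d p q \<le> gromov_product p x (\<phi> g x)"
  shows "d q (\<phi> g q) \<le> 3 * \<kappa> + 4 * \<delta>"
proof -
  have M': "\<phi> g p \<in> M" "\<phi> g q \<in> M" "\<phi> g x \<in> M" using g M by (auto intro: act_closed)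
  have "gromov_product p q x = d p q"
    using q unfolding gromov_product_def using commute[of q p] commute[of x p] by argo
  moreover have "gromov_product (\<phi> g p) (\<phi> g x) (\<phi> g q) = d p q"
    using q isometry[OF g M(3,1)] isometry[OF g M(2,1)] isometry[OF g M(3,2)] commute[of q p] commute[of x p] commute[of q x]
    unfolding gromov_product_def by argo
  moreover have "gromov_product (\<phi> g p) (\<phi> g x) (\<phi> g q) \<le> gromov_product p (\<phi> g x) (\<phi> g q) + d (\<phi> g p) p"
    by (rule gromov_product_base[OF M'(1) M(1) M'(3,2)])
  moreover have "min (gromov_product p q x) (gromov_product p x (\<phi> g x)) \<le> gromov_product p q (\<phi> g x) + \<delta>"
    by (rule gromov_product_min[OF hyp(1) M(1,2,3) M'(3)])
  moreover have "min (gromov_product p q (\<phi> g x)) (gromov_product p (\<phi> g x) (\<phi> g q)) \<le> gromov_product p q (\<phi> g q) + \<delta>"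
    by (rule gromov_product_min[OF hyp(1) M(1,2) M'(3,2)])
  moreover have "0 \<le> \<kappa>" using \<kappa> nonneg order_trans by blast
  moreover have "d p (\<phi> g q) \<le> d p (\<phi> g p) + d p q"
    using triangle[OF M(1) M'(1,2)] isometry[OF g M(1,2)] by simp
  moreover have "d q (\<phi> g q) = d p q + d p (\<phi> g q) - 2 * gromov_product p q (\<phi> g q)"
    unfolding gromov_product_def using commute[of p q] commute[of p "\<phi> g q"] by argo
  moreover have "d (\<phi> g p) p = d p (\<phi> g p)" "gromov_product p q x \<le> gromov_product p x (\<phi> g x)"
    using commute far calculation(1) by auto
  ultimately show ?thesis using \<kappa> far hyp(2) by argo
qed

text \<open>Each element translates along \<open>c\<close> up to \<open>8 * \<delta>\<close>, and
  each of the two products uses two such steps. Parameters farther than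
  \<open>2 * \<kappa> + 2 * \<delta>\<close> from the ends remain admissible after one shift by at
  most \<open>\<kappa>\<close>.\<close>

lemma commuting_up_to_constant:
  assumes hyp: "delta_hyperbolic \<delta>" "0 \<le> \<delta>" and M: "p \<in> M" "q \<in> M" and c: "geodesic c p q"
    and g: "g \<in> carrier G" "d p (\<phi> g p) \<le> \<kappa>" "d q (\<phi> g q) \<le> \<kappa>"
    and h: "h \<in> carrier G" "d p (\<phi> h p) \<le> \<kappa>" "d q (\<phi> h q) \<le> \<kappa>"
    and r: "2 * \<kappa> + 2 * \<delta> < r" "r < d p q - 2 * \<kappa> - 2 * \<delta>"
  shows "d (\<phi> (g \<otimes> h) (c r)) (\<phi> (h \<otimes> g) (c r)) \<le> 32 * \<delta>"
proof -
  define a b where "a = d p (\<phi> g q) - d p q" and "b = d p (\<phi> h q) - d p q"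
  have \<kappa>: "0 \<le> \<kappa>" using g nonneg order_trans by blast
  have 0: "\<kappa> + 2 * \<delta> < r" "r < d p q - \<kappa> - 2 * \<delta>" using r \<kappa> by auto
  note A = quasi_translation[OF hyp M c g, folded a_def] and B = quasi_translation[OF hyp M c h, folded b_def]
  have ab: "\<bar>a\<bar> \<le> \<kappa>" "\<bar>b\<bar> \<le> \<kappa>" using A(1)[OF 0] B(1)[OF 0] by auto
  have 1: "\<kappa> + 2 * \<delta> < r + a" "r + a < d p q - \<kappa> - 2 * \<delta>" "\<kappa> + 2 * \<delta> < r + b" "r + b < d p q - \<kappa> - 2 * \<delta>"
    using r ab by auto
  have in_M: "c t \<in> M" if "0 \<le> t" "t \<le> d p q" for t using geodesicD(1)[OF c that] .
  have "c r \<in> M" "c (r + a) \<in> M" "c (r + b) \<in> M" "c (r + b + a) \<in> M"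
    using 0 1 ab \<kappa> hyp(2) r by (auto intro!: in_M)
  note m = this
  have m': "\<phi> g (c r) \<in> M" "\<phi> h (c r) \<in> M" "\<phi> g (c (r + b)) \<in> M" "\<phi> h (c (r + a)) \<in> M"
    "\<phi> g (\<phi> h (c r)) \<in> M" "\<phi> h (\<phi> g (c r)) \<in> M"
    using m g h by (auto intro!: act_closed)
  have "d (\<phi> g (\<phi> h (c r))) (\<phi> g (c (r + b))) \<le> 8 * \<delta>" "d (\<phi> h (\<phi> g (c r))) (\<phi> h (c (r + a))) \<le> 8 * \<delta>"
    using isometry[OF g(1) m'(2) m(3)] isometry[OF h(1) m'(1) m(2)] A(2)[OF 0] B(2)[OF 0] by auto
  moreover have "d (\<phi> g (c (r + b))) (c (r + b + a)) \<le> 8 * \<delta>" "d (\<phi> h (c (r + a))) (c (r + b + a)) \<le> 8 * \<delta>"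
    using A(2)[OF 1(3,4)] B(2)[OF 1(1,2)] by (auto simp: ac_simps)
  ultimately have "d (\<phi> g (\<phi> h (c r))) (\<phi> h (\<phi> g (c r))) \<le> 32 * \<delta>"
    using triangle[OF m'(5) m'(3) m(4)] triangle[OF m'(6) m'(4) m(4)] triangle[OF m'(5) m(4) m'(6)]
      commute[of "c (r + b + a)" "\<phi> h (\<phi> g (c r))"] by argo
  then show ?thesis using g h m by (simp add: act_mult)
qed

text \<open>If the squares of \<open>a\<close> and \<open>b\<close> kept the direction, then all
  \<open>u j\<close> and \<open>v\<close> would translate along a long segment towards
  \<open>x i\<close>. The \<open>N + 1\<close> commutators of \<open>v\<close> with the
  \<open>u j\<close> almost fix two points far apart on it, so by acylindricity two commutators
  coincide. Then a nontrivial power of \<open>a\<close> commutes with a power of \<open>b\<close>,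
  against independence.\<close>

lemma direction_not_stabilized:
  assumes hyp: "delta_hyperbolic \<delta>" "0 \<le> \<delta>" and geo: geodesic_space and acyl: acylindrical
    and ind: "independent_loxodromics a b" and W: "W \<noteq> bot" and p: "p \<in> M" and x: "\<And>i. x i \<in> M"
    and far: "\<And>K. eventually (\<lambda>i. K \<le> d p (x i)) W"
    and stab: "fellow W p x (\<lambda>i. \<phi> (a [^] (2::int)) (x i))" "fellow W p x (\<lambda>i. \<phi> (b [^] (2::int)) (x i))"
  shows False
proof -
  have ab: "a \<in> carrier G" "b \<in> carrier G"
    using ind by (auto simp: independent_loxodromics_def loxodromic_def)
  define u where "u j = a [^] (2 * int j)" for j :: nat
  define v where "v = b [^] (2::int)"
  have uv: "u j \<in> carrier G" "v \<in> carrier G" for j using ab by (auto simp: u_def v_def)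
  have fu: "fellow W p x (\<lambda>i. \<phi> (u j) (x i))" for j
  proof (induction j)
    case 0
    have "fellow W p x x" unfolding fellow_def
    proof
      fix K show "eventually (\<lambda>i. K \<le> gromov_product p (x i) (x i)) W"
        using far[of K] by (rule eventually_mono) (use x p in \<open>simp add: gromov_product_def commute\<close>)
    qed
    then show ?case using x by (simp add: u_def act_one)
  next
    case (Suc j)
    have e: "u (Suc j) = a [^] (2::int) \<otimes> u j"
      using ab by (simp add: u_def G.int_pow_mult)
    have "fellow W p (\<lambda>i. \<phi> (a [^] (2::int)) (x i)) (\<lambda>i. \<phi> (a [^] (2::int)) (\<phi> (u j) (x i)))"
      using ab uv x p Suc by (intro fellow_act) (auto intro: act_closed)
    then have "fellow W p x (\<lambda>i. \<phi> (a [^] (2::int)) (\<phi> (u j) (x i)))"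
      using ab uv x p by (intro fellow_trans[OF hyp(1) p _ _ _ stab(1)]) (auto intro!: act_closed)
    then show ?case using ab uv x by (simp add: e act_mult)
  qed
  have "0 \<le> 32 * \<delta>" using hyp(2) by simp
  then obtain N :: nat and R where R: "R > 0" and NR: "\<And>y z. \<lbrakk>y \<in> M; z \<in> M; d y z \<ge> R\<rbrakk> \<Longrightarrow>
     finite {g \<in> carrier G. d y (\<phi> g y) \<le> 32 * \<delta> \<and> d z (\<phi> g z) \<le> 32 * \<delta>} \<and>
     card {g \<in> carrier G. d y (\<phi> g y) \<le> 32 * \<delta> \<and> d z (\<phi> g z) \<le> 32 * \<delta>} \<le> N"
    using acyl unfolding acylindrical_def by meson
  define \<kappa>0 where "\<kappa>0 = Max (insert (d p (\<phi> v p)) ((\<lambda>j. d p (\<phi> (u j) p)) ` {..N}))"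
  have \<kappa>0: "d p (\<phi> v p) \<le> \<kappa>0" "\<And>j. j \<le> N \<Longrightarrow> d p (\<phi> (u j) p) \<le> \<kappa>0"
    unfolding \<kappa>0_def by (rule Max_ge; simp)+
  have "0 \<le> \<kappa>0" using \<kappa>0(1) nonneg order_trans by blast
  define \<kappa> where "\<kappa> = 3 * \<kappa>0 + 4 * \<delta>"
  have \<kappa>: "\<kappa>0 \<le> \<kappa>" "0 \<le> \<kappa>" using \<open>0 \<le> \<kappa>0\<close> hyp(2) by (auto simp: \<kappa>_def)
  \<comment> \<open>The test points have parameters \<open>r1\<close> and \<open>r1 + R\<close>;
    with the following \<open>L\<close> both keep the distance from the ends of the segment that
    \<open>commuting_up_to_constant\<close> asks for.\<close>
  define r1 where "r1 = 2 * \<kappa> + 2 * \<delta> + 1"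
  define L where "L = r1 + R + 2 * \<kappa> + 2 * \<delta> + 1"
  have "eventually (\<lambda>i. \<forall>j\<in>{..N}. L \<le> gromov_product p (x i) (\<phi> (u j) (x i))) W"
    using fu by (intro eventually_ball_finite) (auto simp: fellow_def)
  moreover have "eventually (\<lambda>i. L \<le> gromov_product p (x i) (\<phi> v (x i))) W"
    using stab(2) by (simp add: fellow_def v_def)
  moreover note far[of L]
  ultimately have "eventually (\<lambda>i. (\<forall>j\<in>{..N}. L \<le> gromov_product p (x i) (\<phi> (u j) (x i))) \<and>
      L \<le> gromov_product p (x i) (\<phi> v (x i)) \<and> L \<le> d p (x i)) W"
    by eventually_elim auto
  then obtain i where i: "\<And>j. j \<le> N \<Longrightarrow> L \<le> gromov_product p (x i) (\<phi> (u j) (x i))"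
      "L \<le> gromov_product p (x i) (\<phi> v (x i))" "L \<le> d p (x i)"
    using eventually_happens'[OF W] by fastforce
  obtain c where c: "geodesic c p (x i)" using geodesic_exists[OF geo p x] .
  have L: "0 \<le> L" using \<kappa> R hyp(2) by (simp add: L_def r1_def)
  note q = geodesicD[OF c L i(3)]
  have dL: "d p (c L) = L" by (rule q)
  have c': "geodesic c p (c L)"
    using c L i(3) unfolding geodesic_def dL by (auto simp: Pi_iff)
  have disp: "d p (\<phi> g p) \<le> \<kappa>" "d (c L) (\<phi> g (c L)) \<le> \<kappa>"
    if "g \<in> carrier G" "d p (\<phi> g p) \<le> \<kappa>0" "L \<le> gromov_product p (x i) (\<phi> g (x i))" for g
    using fellow_displacement[OF hyp p q(1) x[of i] that(1) _ that(2)] that q \<kappa> by (auto simp: \<kappa>_def)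
  have r: "2 * \<kappa> + 2 * \<delta> < r1" "r1 < d p (c L) - 2 * \<kappa> - 2 * \<delta>"
    "2 * \<kappa> + 2 * \<delta> < r1 + R" "r1 + R < d p (c L) - 2 * \<kappa> - 2 * \<delta>"
    unfolding dL using R by (auto simp: L_def r1_def)
  have r': "0 \<le> r1" "r1 \<le> d p (c L)" "0 \<le> r1 + R" "r1 + R \<le> d p (c L)"
    using r \<kappa> hyp(2) by auto
  have y: "c r1 \<in> M" "c (r1 + R) \<in> M" "R \<le> d (c r1) (c (r1 + R))"
    using geodesicD(1)[OF c'] r' geodesic_dist[OF c' r'] by auto
  define Q where "Q = {g \<in> carrier G. d (c r1) (\<phi> g (c r1)) \<le> 32 * \<delta> \<and> d (c (r1 + R)) (\<phi> g (c (r1 + R))) \<le> 32 * \<delta>}"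
  have Q: "finite Q" "card Q \<le> N" using NR[OF y] by (auto simp: Q_def)
  define f where "f j = inv (v \<otimes> u j) \<otimes> (u j \<otimes> v)" for j
  have "f j \<in> Q" if j: "j \<le> N" for j
  proof -
    have *: "d z (\<phi> (f j) z) = d (\<phi> (u j \<otimes> v) z) (\<phi> (v \<otimes> u j) z)" if "z \<in> M" for z
      using dist_act_inv[of "v \<otimes> u j" "\<phi> (u j \<otimes> v) z" z] uv that commute[of z]
      by (simp add: f_def act_mult act_closed)
    have "f j \<in> carrier G" using uv by (simp add: f_def)
    moreover have "d (c r1) (\<phi> (f j) (c r1)) \<le> 32 * \<delta>"
      unfolding *[OF y(1)]
      using r disp[OF uv(1) \<kappa>0(2)[OF j] i(1)[OF j]] disp[OF uv(2) \<kappa>0(1) i(2)]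
      by (intro commuting_up_to_constant[OF hyp p q(1) c' uv(1) _ _ uv(2)])
    moreover have "d (c (r1 + R)) (\<phi> (f j) (c (r1 + R))) \<le> 32 * \<delta>"
      unfolding *[OF y(2)]
      using r disp[OF uv(1) \<kappa>0(2)[OF j] i(1)[OF j]] disp[OF uv(2) \<kappa>0(1) i(2)]
      by (intro commuting_up_to_constant[OF hyp p q(1) c' uv(1) _ _ uv(2)])
    ultimately show ?thesis by (simp add: Q_def)
  qed
  then have "f ` {..N} \<subseteq> Q" by auto
  then have "card (f ` {..N}) \<le> N" using card_mono[OF Q(1)] Q(2) order_trans by blast
  then have "\<not> inj_on f {..N}" by (auto dest!: card_image)
  then obtain j k where jk: "j \<noteq> k" "f j = f k" by (auto simp: inj_on_def)
  have "v \<otimes> (u j \<otimes> inv (u k)) = (u j \<otimes> inv (u k)) \<otimes> v"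
    using jk(2) uv by (intro G.equal_commutators_imp_commute) (auto simp: f_def)
  moreover have "u j \<otimes> inv (u k) = a [^] (2 * int j - 2 * int k)"
    using ab by (simp add: u_def G.int_pow_diff)
  ultimately have "a [^] (2 * int j - 2 * int k) \<otimes> b [^] (2::int) = b [^] (2::int) \<otimes> a [^] (2 * int j - 2 * int k)"
    by (simp add: v_def)
  then show False
    using independent_not_commuting[OF hyp ind, of "2 * int j - 2 * int k" 2] jk(1) by simp
qed

text \<open>It suffices that \<open>f [^] 2\<close> moves the direction: if \<open>f\<close> kept
  it, then by transitivity so would its square. This is why squares are considered above.\<close>

lemma three_directions:
  assumes hyp: "delta_hyperbolic \<delta>" "0 \<le> \<delta>" and geo: geodesic_space and acyl: acylindrical
    and ind: "independent_loxodromics a b" and W: "ultrafilter W" and p: "p \<in> M" and x: "\<And>i. x i \<in> M"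
    and far: "\<And>K. eventually (\<lambda>i. K \<le> d p (x i)) W"
  obtains f where "f \<in> {a, b}"
    "\<And>j k. \<lbrakk>j < k; k \<le> (2::nat)\<rbrakk> \<Longrightarrow> \<not> fellow W p (\<lambda>i. \<phi> (f [^] int j) (x i)) (\<lambda>i. \<phi> (f [^] int k) (x i))"
proof -
  have ab: "a \<in> carrier G" "b \<in> carrier G"
    using ind by (auto simp: independent_loxodromics_def loxodromic_def)
  have "W \<noteq> bot" using W by (simp add: ultrafilter_def)
  then obtain f where f: "f \<in> {a, b}" "\<not> fellow W p x (\<lambda>i. \<phi> (f [^] (2::int)) (x i))"
    using direction_not_stabilized[OF hyp geo acyl ind _ p x far] by blast
  have fc: "f \<in> carrier G" using f ab by auto
  have m: "\<phi> (f [^] n) (x i) \<in> M" for n :: int and i using fc x by simp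
  have shift: "fellow W p (\<lambda>i. \<phi> (f [^] (m + l)) (x i)) (\<lambda>i. \<phi> (f [^] (n + l)) (x i))"
    if "fellow W p (\<lambda>i. \<phi> (f [^] m) (x i)) (\<lambda>i. \<phi> (f [^] n) (x i))" for l m n :: int
  proof -
    have "fellow W p (\<lambda>i. \<phi> (f [^] l) (\<phi> (f [^] m) (x i))) (\<lambda>i. \<phi> (f [^] l) (\<phi> (f [^] n) (x i)))"
      using fc m by (intro fellow_act p that) auto
    then show ?thesis using fc x by (simp add: G.int_pow_mult add.commute flip: act_mult)
  qed
  have x0: "\<phi> (f [^] (0::int)) (x i) = x i" for i using x by (simp add: act_one)
  have 2: "\<not> fellow W p (\<lambda>i. \<phi> (f [^] (0::int)) (x i)) (\<lambda>i. \<phi> (f [^] (2::int)) (x i))"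
    using f(2) unfolding x0 .
  have 1: "\<not> fellow W p (\<lambda>i. \<phi> (f [^] (0::int)) (x i)) (\<lambda>i. \<phi> (f [^] (1::int)) (x i))"
  proof
    assume *: "fellow W p (\<lambda>i. \<phi> (f [^] (0::int)) (x i)) (\<lambda>i. \<phi> (f [^] (1::int)) (x i))"
    show False using fellow_trans[OF hyp(1) p m m m * ] shift[OF *, of 1] 2 by simp
  qed
  have 3: "\<not> fellow W p (\<lambda>i. \<phi> (f [^] (1::int)) (x i)) (\<lambda>i. \<phi> (f [^] (2::int)) (x i))"
    using 1 shift[of 1 2 "-1"] by auto
  show thesis
  proof (rule that[OF f(1)])
    fix j k :: nat assume "j < k" "k \<le> 2"
    then consider "j = 0" "k = 1" | "j = 0" "k = 2" | "j = 1" "k = 2" by linarith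
    then show "\<not> fellow W p (\<lambda>i. \<phi> (f [^] int j) (x i)) (\<lambda>i. \<phi> (f [^] int k) (x i))"
      using 1 2 3 by cases simp_all
  qed
qed

end

section \<open>Left-invariant tree metrics\<close>

text \<open>On a group with a left-invariant tree pseudometric \<open>d\<close>, count how many disjoint translates of the segment
  from \<open>\<one>\<close> to \<open>w\<close> fit on the segment from \<open>x\<close> to \<open>y\<close>. This collapses everything in the tree except for these
  translates. If only finitely many elements almost fix both ends of the segment, then the action for the new
  distance is acylindrical, although the stabilizers of segments of the tree may be infinite.\<close>

locale tree_pseudometric = group G
  for G :: "('a, 'b) monoid_scheme" (structure) +
  fixes d :: "'a \<Rightarrow> 'a \<Rightarrow> real"
  assumes self: "x \<in> carrier G \<Longrightarrow> d x x = 0"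
    and sym: "\<lbrakk>x \<in> carrier G; y \<in> carrier G\<rbrakk> \<Longrightarrow> d x y = d y x"
    and tri: "\<lbrakk>x \<in> carrier G; y \<in> carrier G; z \<in> carrier G\<rbrakk> \<Longrightarrow> d x z \<le> d x y + d y z"
    and four: "\<lbrakk>x \<in> carrier G; y \<in> carrier G; z \<in> carrier G; v \<in> carrier G\<rbrakk>
      \<Longrightarrow> d x z + d y v \<le> max (d x y + d z v) (d y z + d x v)"
    and left: "\<lbrakk>g \<in> carrier G; x \<in> carrier G; y \<in> carrier G\<rbrakk> \<Longrightarrow> d (g \<otimes> x) (g \<otimes> y) = d x y"
begin

lemma nonneg: "\<lbrakk>x \<in> carrier G; y \<in> carrier G\<rbrakk> \<Longrightarrow> 0 \<le> d x y"
  using tri[of x y x] self[of x] sym[of x y] by simp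

text \<open>The tree is never built. Only its points in the orbit of the base point, indexed by
  group elements, are used, and branch points may be missing among them.\<close>

definition between :: "'a \<Rightarrow> 'a \<Rightarrow> 'a \<Rightarrow> bool" where
  "between x p y \<longleftrightarrow> d x p + d p y = d x y"

lemma between_sym: "\<lbrakk>x \<in> carrier G; y \<in> carrier G; p \<in> carrier G\<rbrakk> \<Longrightarrow> between x p y \<longleftrightarrow> between y p x"
  using sym[of x y] sym[of x p] sym[of p y] by (auto simp: between_def)

lemma between_either:
  assumes c: "x \<in> carrier G" "y \<in> carrier G" "z \<in> carrier G" "p \<in> carrier G" and b: "between x p y"
  shows "between x p z \<or> between z p y"
  using b four[OF c(4,1,3,2)] tri[OF c(1,4,3)] tri[OF c(3,4,2)] sym[OF c(4,3)] sym[OF c(4,1)] unfolding between_def by argo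

lemma between_dist:
  assumes c: "x \<in> carrier G" "y \<in> carrier G" "p \<in> carrier G" "q \<in> carrier G" and b: "between x p y" "between x q y"
  shows "d p q = \<bar>d x p - d x q\<bar>"
  using b four[OF c(3,1,4,2)] tri[OF c(1,3,4)] tri[OF c(1,4,3)] sym[OF c(3,4)] sym[OF c(3,1)] unfolding between_def by argo

lemma between_nest:
  assumes c: "x \<in> carrier G" "y \<in> carrier G" "p \<in> carrier G" "q \<in> carrier G" and b: "between x p y" "between p q y"
  shows "between x q y" "between x p q"
  using b tri[OF c(1,3,4)] tri[OF c(1,4,2)] unfolding between_def by argo+

lemma between_nest':
  assumes c: "x \<in> carrier G" "y \<in> carrier G" "p \<in> carrier G" "q \<in> carrier G" and b: "between x q y" "between x p q"
  shows "between x p y" "between p q y"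
  using b tri[OF c(3,4,2)] tri[OF c(1,3,2)] unfolding between_def by argo+

lemma between_refl: "\<lbrakk>x \<in> carrier G; y \<in> carrier G\<rbrakk> \<Longrightarrow> between x x y" "\<lbrakk>x \<in> carrier G; y \<in> carrier G\<rbrakk> \<Longrightarrow> between x y y"
  by (simp_all add: between_def self)

lemma between_act:
  "\<lbrakk>g \<in> carrier G; x \<in> carrier G; y \<in> carrier G; p \<in> carrier G\<rbrakk> \<Longrightarrow> between (g \<otimes> x) (g \<otimes> p) (g \<otimes> y) \<longleftrightarrow> between x p y"
  by (simp add: between_def left)

text \<open>Local geodesics in a tree are geodesics. The overlap from \<open>y\<close> to
  \<open>z\<close> must be nondegenerate, since otherwise the path could turn back there.\<close>

lemma between_extend:
  assumes c: "x \<in> carrier G" "y \<in> carrier G" "z \<in> carrier G" "t \<in> carrier G"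
    and b: "between x y z" "between y z t" "0 < d y z"
  shows "between x z t" "between x y t"
  using b four[OF c(1,2,3,4)] tri[OF c(1,3,4)] tri[OF c(1,2,4)] unfolding between_def by argo+

section \<open>Elements of length zero and axes\<close>

lemma zero_right: 
  assumes "x \<in> carrier G" "h \<in> carrier G" "y \<in> carrier G" "d \<one> h = 0"
  shows "d (x \<otimes> h) y = d x y"
proof -
  have c: "x \<otimes> h \<in> carrier G" using assms by simp
  have "d x (x \<otimes> h) = 0" using left[OF assms(1) one_closed assms(2)] assms by simp
  then show ?thesis
    using tri[OF c assms(1,3)] tri[OF assms(1) c assms(3)] sym[OF c assms(1)] by argo
qed

lemma zero_inv: "\<lbrakk>h \<in> carrier G; d \<one> h = 0\<rbrakk> \<Longrightarrow> d \<one> (inv h) = 0"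
  using left[of h \<one> "inv h"] sym[of h \<one>] by simp

lemma dist_inv: "g \<in> carrier G \<Longrightarrow> d \<one> (inv g) = d \<one> g"
  using left[of g \<one> "inv g"] sym[of g \<one>] by simp

lemma dist_mult: "\<lbrakk>g \<in> carrier G; h \<in> carrier G\<rbrakk> \<Longrightarrow> d \<one> (g \<otimes> h) = d (inv g) h"
  using left[of g "inv g" h] by simp

text \<open>The hypothesis puts the identity on the axis of \<open>g\<close>, and consecutive
  segments concatenate by \<open>between_extend\<close>. Length zero is separate because it gives no
  nondegenerate overlap.\<close>

lemma straight_pow:
  assumes g: "g \<in> carrier G" and s: "between (inv g) \<one> g"
  shows "d \<one> (g [^] (n::nat)) = n * d \<one> g"
proof (cases "d \<one> g = 0")
  case True
  show ?thesis
  proof (induction n)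
    case (Suc n)
    have "d (g [^] n \<otimes> g) \<one> = d (g [^] n) \<one>" using g True by (intro zero_right) auto
    then show ?case using Suc True sym g by simp
  qed (simp add: self)
next
  case False
  then have pos: "0 < d \<one> g" using nonneg[OF one_closed g] by simp
  have "between \<one> (g [^] n) (g [^] Suc n) \<and> d \<one> (g [^] n) = n * d \<one> g"
  proof (induction n)
    case 0
    then show ?case using g by (simp add: between_def self)
  next
    case (Suc n)
    have c: "g [^] n \<in> carrier G" "g [^] Suc n \<in> carrier G" "g [^] Suc (Suc n) \<in> carrier G" using g by simp_all
    have "g [^] Suc n \<otimes> inv g = g [^] n" "g [^] Suc n \<otimes> \<one> = g [^] Suc n" "g [^] Suc n \<otimes> g = g [^] Suc (Suc n)"
      using g by (simp_all add: m_assoc)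
    then have b: "between (g [^] n) (g [^] Suc n) (g [^] Suc (Suc n))"
      using between_act[OF c(2), of "inv g" g \<one>] g s by simp
    have e: "d (g [^] n) (g [^] Suc n) = d \<one> g" using left[OF c(1) one_closed g] c g by simp
    have "between \<one> (g [^] Suc n) (g [^] Suc (Suc n))"
      using between_extend(1)[OF one_closed c conjunct1[OF Suc] b] e pos by simp
    moreover have "d \<one> (g [^] Suc n) = Suc n * d \<one> g"
      using conjunct1[OF Suc] conjunct2[OF Suc] unfolding between_def e by (simp add: algebra_simps)
    ultimately show ?case by blast
  qed
  then show ?thesis by blast
qed

text \<open>Displacement is convex along a segment of a tree.\<close>

lemma displacement_between:
  assumes c: "g \<in> carrier G" "x \<in> carrier G" "y \<in> carrier G" "q \<in> carrier G" and b: "between x q y"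
    and e: "d x (g \<otimes> x) \<le> e" "d y (g \<otimes> y) \<le> e"
  shows "d q (g \<otimes> q) \<le> e"
proof -
  have m: "g \<otimes> x \<in> carrier G" "g \<otimes> y \<in> carrier G" "g \<otimes> q \<in> carrier G" using c by auto
  show ?thesis
    using b e four[OF c(4,2) m(3) c(3)] tri[OF m(3,2) c(3)] tri[OF c(2) m(1,3)] left[OF c(1,4,3)] left[OF c(1,2,4)]
      sym[OF c(3) m(2)] sym[OF c(4,2)] unfolding between_def by argo
qed

text \<open>The axis of \<open>w\<close> contains the geodesic through \<open>k'\<^sup>-\<^sup>1\<close>, \<open>\<one>\<close>, \<open>k\<close> and \<open>k k'\<close>, and neither \<open>u\<close> nor its inverse
  starts in one of the two directions of this axis.\<close>

lemma word_axis:
  assumes c: "s \<in> carrier G" "h \<in> carrier G" "h' \<in> carrier G" "h1 \<in> carrier G" "h2 \<in> carrier G"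
    and zero: "d \<one> h = 0" "d \<one> h' = 0" "d \<one> h1 = 0" "d \<one> h2 = 0" and l: "d \<one> s = l" "0 < l"
    and bend: "d (inv s) (h \<otimes> s) = 2 * l" "d (inv s) (h' \<otimes> s) = 2 * l"
    and exit: "d s (h1 \<otimes> s) = 2 * l" "d (inv h' \<otimes> inv s) (h1 \<otimes> s) = 2 * l"
      "d s (h2 \<otimes> inv s) = 2 * l" "d (inv h' \<otimes> inv s) (h2 \<otimes> inv s) = 2 * l"
    and k: "k = s \<otimes> h" and k': "k' = s \<otimes> h'" and w: "w = k \<otimes> k' \<otimes> (k \<otimes> k')" and u: "u = h1 \<otimes> s \<otimes> inv h2"
  shows "d \<one> (w [^] (n::nat)) = n * (4 * l)" "d \<one> u = l" "between \<one> (k \<otimes> k' \<otimes> k) w"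
    "d (w [^] (m::int)) u = d \<one> (w [^] m) + d \<one> u" "d (inv u) (w [^] m) = d \<one> (inv u) + d \<one> (w [^] m)"
proof -
  have kc: "k \<in> carrier G" "k' \<in> carrier G" "k \<otimes> k' \<in> carrier G" "k \<otimes> k' \<otimes> k \<in> carrier G" "w \<in> carrier G" "u \<in> carrier G"
    using c by (auto simp: k k' w u)
  have ki: "inv k = inv h \<otimes> inv s" "inv k' = inv h' \<otimes> inv s" using c by (auto simp: k k' inv_mult_group)
  have k_l: "d \<one> k = l" "d \<one> k' = l"
    using zero_right[OF c(1,2) one_closed zero(1)] zero_right[OF c(1,3) one_closed zero(2)] sym c l kc unfolding k k' by auto
  have move: "d (inv f \<otimes> inv s) s = d (inv s) (f \<otimes> s)" if "f \<in> carrier G" for f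
    using left[OF that, of "inv f \<otimes> inv s" s] that c by (simp add: m_assoc[symmetric])
  have kk': "d \<one> (k \<otimes> k') = 2 * l"
    using dist_mult[OF kc(1,2)] zero_right[OF c(1,3) _ zero(2), of "inv k"] move[OF c(2)] bend(1) sym[of "inv k" k'] sym[of s "inv k"] kc c
    unfolding ki k' by simp
  have k'k: "d \<one> (k' \<otimes> k) = 2 * l"
    using dist_mult[OF kc(2,1)] zero_right[OF c(1,2) _ zero(1), of "inv k'"] move[OF c(3)] bend(2) sym[of "inv k'" k] sym[of s "inv k'"] kc c
    unfolding ki k by simp
  have steps: "d k (k \<otimes> k') = l" "d (k \<otimes> k') (k \<otimes> k' \<otimes> k) = l" "d (k \<otimes> k' \<otimes> k) w = l"
    "d k (k \<otimes> k' \<otimes> k) = 2 * l" "d (k \<otimes> k') w = 2 * l"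
    using left[OF kc(1) one_closed kc(2)] left[OF kc(3) one_closed kc(1)] left[OF kc(4) one_closed kc(2)]
      left[OF kc(1) one_closed, of "k' \<otimes> k"] left[OF kc(3) one_closed kc(3)] k_l kk' k'k kc
    by (simp_all add: m_assoc w)
  have 1: "between \<one> k (k \<otimes> k')" "between k (k \<otimes> k') (k \<otimes> k' \<otimes> k)" "between (k \<otimes> k') (k \<otimes> k' \<otimes> k) w"
    using steps k_l kk' by (simp_all add: between_def)
  have 2: "between \<one> (k \<otimes> k') (k \<otimes> k' \<otimes> k)"
    using between_extend(1)[OF one_closed kc(1,3,4) 1(1,2)] steps l by simp
  show 3: "between \<one> (k \<otimes> k' \<otimes> k) w"
    using between_extend(1)[OF one_closed kc(3,4,5) 2 1(3)] steps l by simp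
  have d3: "d \<one> (k \<otimes> k' \<otimes> k) = 3 * l" and d4: "d \<one> w = 4 * l"
    using 2 3 kk' steps by (auto simp: between_def)
  have kw: "between \<one> k w"
  proof -
    have "d k w = d \<one> (k' \<otimes> (k \<otimes> k'))" using left[OF kc(1) one_closed, of "k' \<otimes> (k \<otimes> k')"] kc by (simp add: w m_assoc)
    also have "\<dots> \<le> d \<one> k' + d k' (k' \<otimes> (k \<otimes> k'))" using kc by (intro tri) auto
    also have "d k' (k' \<otimes> (k \<otimes> k')) = d \<one> (k \<otimes> k')" using left[OF kc(2) one_closed kc(3)] kc by simp
    finally show ?thesis using tri[OF one_closed kc(1,5)] k_l kk' d4 by (simp add: between_def)
  qed
  have "between (inv w) \<one> w"
  proof -
    let ?a = "k \<otimes> k'"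
    have "between (inv ?a) \<one> ?a"
      using dist_mult[OF kc(3,3)] dist_inv[OF kc(3)] sym[of "inv ?a" \<one>] kk' d4 kc by (simp add: between_def w)
    \<comment> \<open>The element \<open>w\<close> is the square of \<open>?a\<close>, which is
      known to be straight from \<open>d \<one> w = 4 * l\<close>; the fourth power of
      \<open>?a\<close> shows that \<open>w\<close> is straight too.\<close>
    then have "d \<one> (?a [^] (4::nat)) = 4 * d \<one> ?a" using straight_pow[OF kc(3), of 4] by simp
    moreover have "?a [^] (4::nat) = w \<otimes> w" using kc by (simp add: w eval_nat_numeral m_assoc)
    ultimately show ?thesis
      using dist_mult[OF kc(5,5)] dist_inv[OF kc(5)] sym[of "inv w" \<one>] kk' d4 kc by (simp add: between_def)
  qed
  then show pow: "d \<one> (w [^] (n::nat)) = n * (4 * l)" for n using straight_pow[OF kc(5)] d4 by simp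
  have u_right: "d u y = d (h1 \<otimes> s) y" "d (inv u) y = d (h2 \<otimes> inv s) y" if "y \<in> carrier G" for y
  proof -
    show "d u y = d (h1 \<otimes> s) y"
      unfolding u using c zero that by (intro zero_right zero_inv) auto
    have "inv u = h2 \<otimes> inv s \<otimes> inv h1" using c by (simp add: u inv_mult_group m_assoc)
    then show "d (inv u) y = d (h2 \<otimes> inv s) y"
      using c zero that by (simp only:) (intro zero_right zero_inv; simp)
  qed
  have zero_left: "d \<one> (f \<otimes> y) = d \<one> y" if "f \<in> carrier G" "d \<one> f = 0" "y \<in> carrier G" for f y
    using dist_mult[OF that(1,3)] zero_right[OF one_closed _ that(3) zero_inv[OF that(1,2)]] that by simp
  show ul: "d \<one> u = l"
    using u_right(1)[OF one_closed] zero_left[OF c(4) zero(3) c(1)] sym[OF one_closed kc(6)] sym[of \<one> "h1 \<otimes> s"] c l by simp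
  have iul: "d \<one> (inv u) = l" using dist_inv[OF kc(6)] ul by simp
  have ik'l: "d \<one> (inv k') = l" using dist_inv[OF kc(2)] k_l by simp
  have out: "between k \<one> u" "between (inv k') \<one> u" "between k \<one> (inv u)" "between (inv k') \<one> (inv u)"
  proof -
    have kr: "d k y = d s y" if "y \<in> carrier G" for y unfolding k using zero_right[OF c(1,2) that zero(1)] .
    have m: "h1 \<otimes> s \<in> carrier G" "h2 \<otimes> inv s \<in> carrier G" "inv u \<in> carrier G" "inv k' \<in> carrier G" using c kc by auto
    have "d k u = 2 * l" using kr[OF m(1)] u_right(1)[OF kc(1)] sym[OF kc(1,6)] sym[OF kc(1) m(1)] exit(1) by simp
    moreover have "d k (inv u) = 2 * l" using kr[OF m(2)] u_right(2)[OF kc(1)] sym[OF kc(1) m(3)] sym[OF kc(1) m(2)] exit(3) by simp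
    moreover have "d (inv k') u = 2 * l" using u_right(1)[OF m(4)] sym[OF m(4) kc(6)] sym[OF m(4,1)] exit(2) ki by simp
    moreover have "d (inv k') (inv u) = 2 * l" using u_right(2)[OF m(4)] sym[OF m(4,3)] sym[OF m(4,2)] exit(4) ki by simp
    ultimately show "between k \<one> u" "between (inv k') \<one> u" "between k \<one> (inv u)" "between (inv k') \<one> (inv u)"
      using ul iul ik'l k_l sym[OF kc(1) one_closed] sym[OF m(4) one_closed] by (simp_all add: between_def)
  qed
  \<comment> \<open>A segment from the identity to a positive power of \<open>w\<close> starts
    through \<open>k\<close>, to a negative power through \<open>inv k'\<close>. As \<open>z\<close>
    leaves in neither direction, the path through the identity does not turn back.\<close>
  have main: "between (w [^] m) \<one> z" if z: "z \<in> carrier G" "between k \<one> z" "between (inv k') \<one> z" for m :: int and z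
  proof -
    have wm: "w [^] m \<in> carrier G" using kc by simp
    have *: "between (w [^] m) \<one> z" if y: "y \<in> carrier G" "between \<one> y (w [^] m)" "0 < d \<one> y" "between y \<one> z" for y
      using between_extend(1)[OF wm y(1) one_closed z(1) _ y(4)] y between_sym[OF one_closed wm y(1)] sym[OF y(1) one_closed] by simp
    consider "m = 0" | j :: nat where "m = int (Suc j)" | j :: nat where "m = - int (Suc j)"
      by (metis int_cases3 less_imp_Suc_add add_0 of_nat_0_less_iff)
    then show ?thesis
    proof cases
      case 1
      then show ?thesis using z by (simp add: between_def self)
    next
      case (2 j)
      have e: "w [^] m = w \<otimes> w [^] j" using nat_pow_Suc2[OF kc(5), of j] by (simp only: 2 int_pow_int)
      have "between \<one> w (w [^] m)"
        using pow[of "Suc j", unfolded nat_pow_Suc2[OF kc(5)]] pow[of j] left[OF kc(5) one_closed, of "w [^] j"] d4 kc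
        unfolding between_def e by (simp add: algebra_simps)
      then have "between \<one> k (w [^] m)" using between_nest'(1)[OF one_closed wm kc(1,5)] kw by blast
      then show ?thesis using *[OF kc(1)] k_l l z by simp
    next
      case (3 j)
      let ?i = "inv k'"
      have ic: "?i \<in> carrier G" "inv w \<in> carrier G" using kc by auto
      have e: "w [^] m = inv (w [^] Suc j)" using kc by (simp only: 3 int_pow_neg int_pow_int)
      have e': "w [^] m = inv w \<otimes> inv (w [^] j)" unfolding e using kc by (simp add: inv_mult_group)
      have "d (inv w) (w [^] m) = d \<one> (inv (w [^] j))"
        using left[OF ic(2) one_closed, of "inv (w [^] j)"] e' kc by simp
      then have "between \<one> (inv w) (w [^] m)"
        using pow[of "Suc j"] pow[of j] dist_inv[of "w [^] Suc j"] dist_inv[of "w [^] j"] dist_inv[OF kc(5)] d4 kc e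
        by (simp add: between_def algebra_simps)
      moreover have "between \<one> ?i (inv w)"
      proof -
        have "w \<otimes> ?i = k \<otimes> k' \<otimes> k" using kc by (simp add: w m_assoc)
        then have "d ?i (inv w) = d (k \<otimes> k' \<otimes> k) \<one>" using left[OF kc(5) ic] kc by simp
        then show ?thesis using d3 d4 ik'l dist_inv[OF kc(5)] sym[OF kc(4) one_closed] by (simp add: between_def)
      qed
      ultimately have "between \<one> ?i (w [^] m)" using between_nest'(1)[OF one_closed wm ic] by blast
      then show ?thesis using *[OF ic(1)] ik'l l z by simp
    qed
  qed
  have wm: "w [^] m \<in> carrier G" using kc by simp
  show "d (w [^] m) u = d \<one> (w [^] m) + d \<one> u"
    using main[OF kc(6) out(1,2), of m] sym[OF wm one_closed] by (simp add: between_def)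
  show "d (inv u) (w [^] m) = d \<one> (inv u) + d \<one> (w [^] m)"
    using main[OF _ out(3,4), of m] sym[OF wm one_closed] sym[OF wm, of "inv u"] kc by (simp add: between_def)
qed

end

section \<open>Counting translates of a segment\<close>

locale tree_word = tree_pseudometric G d
  for G :: "('a, 'b) monoid_scheme" (structure) and d +
  fixes w :: 'a and L :: real
  assumes w: "w \<in> carrier G" and L: "0 < L" and pow: "d \<one> (w [^] (n::nat)) = n * L"
begin

text \<open>Translates of the segment from the identity to \<open>w\<close>, in both orientations so
  that the count becomes symmetric.\<close>

definition piece :: "'a \<Rightarrow> 'a \<Rightarrow> bool" where
  "piece p q \<longleftrightarrow> p \<in> carrier G \<and> q \<in> carrier G \<and> (q = p \<otimes> w \<or> p = q \<otimes> w)"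

text \<open>The pieces are met in order on the way from \<open>x\<close> to \<open>y\<close> and do
  not overlap; gaps between them are free.\<close>

primrec fits :: "nat \<Rightarrow> 'a \<Rightarrow> 'a \<Rightarrow> bool" where
  "fits 0 x y \<longleftrightarrow> True"
| "fits (Suc k) x y \<longleftrightarrow> (\<exists>p q. piece p q \<and> d x p + L + d q y = d x y \<and> fits k q y)"

definition count :: "'a \<Rightarrow> 'a \<Rightarrow> nat" where
  "count x y = (GREATEST k. fits k x y)"

text \<open>A group element \<open>p\<close> on the common part of both segments stands for the
  branch point, which need not be given by a group element.\<close>

definition common :: "nat \<Rightarrow> 'a \<Rightarrow> 'a \<Rightarrow> 'a \<Rightarrow> bool" where
  "common k v x y \<longleftrightarrow> (\<exists>p\<in>carrier G. between v p x \<and> between v p y \<and> fits k v p)"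

definition count_product :: "'a \<Rightarrow> 'a \<Rightarrow> 'a \<Rightarrow> nat" where
  "count_product v x y = (GREATEST k. common k v x y)"

text \<open>The third point of a triangle may cut one piece, so \<open>count\<close> is subadditive
  only up to 1; the added 1 repairs the triangle inequality.\<close>

definition D :: "'a \<Rightarrow> 'a \<Rightarrow> real" where
  "D x y = (if x = y then 0 else count x y + 1)"

lemma pieceD:
  assumes "piece p q"
  shows "p \<in> carrier G" "q \<in> carrier G" "d p q = L"
proof -
  show c: "p \<in> carrier G" "q \<in> carrier G" using assms by (auto simp: piece_def)
  have "d \<one> w = L" using pow[of 1] w by simp
  then have "d r (r \<otimes> w) = L" if "r \<in> carrier G" for r
    using left[OF that one_closed w] that w by simp
  then show "d p q = L" using assms sym c by (auto simp: piece_def)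
qed

lemma piece_sym: "piece p q \<Longrightarrow> piece q p"
  by (auto simp: piece_def)

lemma piece_act: "\<lbrakk>g \<in> carrier G; piece p q\<rbrakk> \<Longrightarrow> piece (g \<otimes> p) (g \<otimes> q)"
  using w by (auto simp: piece_def m_assoc)

lemma piece_between:
  assumes p: "piece p q" and c: "x \<in> carrier G" "y \<in> carrier G" and b: "d x p + L + d q y = d x y"
  shows "between x p y" "between x q y" "between x p q" "between p q y" "d x q = d x p + L" "d p y = L + d q y"
proof -
  note q = pieceD[OF p]
  note t = tri[OF c(1) q(1,2)] tri[OF q(1,2) c(2)] tri[OF c(1) q(2) c(2)] tri[OF c(1) q(1) c(2)]
  show xq: "d x q = d x p + L" using b q(3) t by linarith
  show py: "d p y = L + d q y" using b q(3) t by linarith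
  show "between x p y" using b py by (simp add: between_def)
  show "between x q y" using b xq by (simp add: between_def)
  show "between x p q" using q(3) xq by (simp add: between_def)
  show "between p q y" using q(3) py by (simp add: between_def)
qed

lemma fits_act:
  assumes "g \<in> carrier G" "x \<in> carrier G" "y \<in> carrier G" "fits k x y"
  shows "fits k (g \<otimes> x) (g \<otimes> y)"
  using assms(2-4)
proof (induction k arbitrary: x)
  case (Suc k)
  then obtain p q where p: "piece p q" "d x p + L + d q y = d x y" "fits k q y" by auto
  note pq = pieceD[OF p(1)]
  show ?case
    unfolding fits.simps
    using piece_act[OF assms(1) p(1)] p(2) Suc.IH[OF pq(2) Suc.prems(2) p(3)] left[OF assms(1)] Suc.prems(1,2) pq
    by (intro exI[of _ "g \<otimes> p"] exI[of _ "g \<otimes> q"]) simp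
qed simp

lemma fits_bound:
  assumes "x \<in> carrier G" "y \<in> carrier G" "fits k x y"
  shows "k * L \<le> d x y"
  using assms
proof (induction k arbitrary: x)
  case (Suc k)
  then obtain p q where p: "piece p q" "d x p + L + d q y = d x y" "fits k q y" by auto
  then have "k * L \<le> d q y" using Suc pieceD by blast
  then show ?case using p(2) nonneg[of x p] pieceD[OF p(1)] Suc.prems by (simp add: algebra_simps)
qed (simp add: nonneg)

lemma fits_extend_left:
  assumes "x \<in> carrier G" "y \<in> carrier G" "z \<in> carrier G" "between x z y" "fits k z y"
  shows "fits k x y"
proof (cases k)
  case (Suc l)
  then obtain p q where p: "piece p q" "d z p + L + d q y = d z y" "fits l q y" using assms(5) by auto
  note pq = pieceD[OF p(1)]
  have "d x p + L + d q y = d x y"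
    using p(2) assms(4) between_nest(1)[OF assms(1,2,3) pq(1) assms(4) piece_between(1)[OF p(1) assms(3,2) p(2)]]
      between_nest(2)[OF assms(1,2,3) pq(1) assms(4) piece_between(1)[OF p(1) assms(3,2) p(2)]]
    unfolding between_def by argo
  then show ?thesis using p Suc by auto
qed simp

lemma fits_append:
  assumes "x \<in> carrier G" "y \<in> carrier G" "z \<in> carrier G" "between x z y" "fits j x z" "fits k z y"
  shows "fits (j + k) x y"
  using assms
proof (induction j arbitrary: x)
  case 0
  then show ?case using fits_extend_left by simp
next
  case (Suc j)
  obtain p q where p: "piece p q" "d x p + L + d q z = d x z" "fits j q z" using Suc.prems(5) by auto
  note pq = pieceD[OF p(1)]
  note b = piece_between[OF p(1) Suc.prems(1,3) p(2)]
  have xq: "between x q y" "between q z y"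
    using between_nest'[OF Suc.prems(1,2) pq(2) Suc.prems(3,4) b(2)] .
  have "fits (j + k) q y" using Suc.IH[OF pq(2) Suc.prems(2,3) xq(2) p(3) Suc.prems(6)] .
  moreover have "d x p + L + d q y = d x y" using xq(1) b(5) unfolding between_def by argo
  ultimately show ?case using p(1) by auto
qed

lemma fits_extend_right:
  assumes "x \<in> carrier G" "y \<in> carrier G" "z \<in> carrier G" "between x z y" "fits k x z"
  shows "fits k x y"
  using fits_append[OF assms, of 0] by simp

lemma fits_sym:
  assumes "x \<in> carrier G" "y \<in> carrier G" "fits k x y"
  shows "fits k y x"
  using assms
proof (induction k arbitrary: x)
  case (Suc k)
  then obtain p q where p: "piece p q" "d x p + L + d q y = d x y" "fits k q y" by auto
  note pq = pieceD[OF p(1)]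
  note b = piece_between[OF p(1) Suc.prems(1,2) p(2)]
  have "fits k y q" using Suc.IH[OF pq(2) Suc.prems(2) p(3)] .
  moreover have "fits (Suc 0) q x"
    unfolding fits.simps
    by (rule exI[of _ q], rule exI[of _ p])
       (use piece_sym[OF p(1)] b(5) self[OF pq(2)] sym[OF Suc.prems(1) pq(1)] sym[OF Suc.prems(1) pq(2)] in simp)
  moreover have "between y q x" using b(2) between_sym Suc.prems pq by blast
  ultimately have "fits (k + Suc 0) y x" using Suc.prems pq by (intro fits_append[of y x q k "Suc 0"]) auto
  then show ?case by simp
qed simp

lemma fits_split_at:
  assumes "x \<in> carrier G" "y \<in> carrier G" "fits (i + Suc j) x y"
  shows "\<exists>p q. piece p q \<and> d x p + L + d q y = d x y \<and> fits i x p \<and> fits j q y"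
  using assms
proof (induction i arbitrary: x)
  case (Suc i)
  then obtain p0 q0 where p0: "piece p0 q0" "d x p0 + L + d q0 y = d x y" "fits (i + Suc j) q0 y" by auto
  note c0 = pieceD[OF p0(1)]
  note b0 = piece_between[OF p0(1) Suc.prems(1,2) p0(2)]
  obtain p q where p: "piece p q" "d q0 p + L + d q y = d q0 y" "fits i q0 p" "fits j q y"
    using Suc.IH[OF c0(2) Suc.prems(2) p0(3)] by blast
  note c = pieceD[OF p(1)]
  note b = piece_between[OF p(1) c0(2) Suc.prems(2) p(2)]
  have x: "between x p y" "between x q0 p" using between_nest[OF Suc.prems(1,2) c0(2) c(1) b0(2) b(1)] .
  have "d x p0 + L + d q0 p = d x p" using x(2) b0(5) unfolding between_def by argo
  then have "fits (Suc i) x p" using p0(1) p(3) by auto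
  moreover have "d x p + L + d q y = d x y" using x(1) b(6) unfolding between_def by argo
  ultimately show ?case using p by blast
qed simp

text \<open>Pieces are followed from \<open>x\<close> as long as they end on the segment to
  \<open>z\<close>. After the first one that does not, all others lie on the segment from
  \<open>z\<close> to \<open>y\<close>; only that one is lost.\<close>

lemma fits_split_towards:
  assumes "x \<in> carrier G" "y \<in> carrier G" "z \<in> carrier G" "fits k x y"
  shows "\<exists>i j e f. k \<le> i + j + 1 \<and> e \<in> carrier G \<and> f \<in> carrier G \<and> between x e y \<and> between x e z \<and> fits i x e \<and>
    between x f y \<and> between z f y \<and> fits j f y"
  using assms
proof (induction k arbitrary: x)
  case 0
  show ?case
    by (rule exI[of _ 0], rule exI[of _ 0], rule exI[of _ x], rule exI[of _ y])
       (use 0 between_refl in auto)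
next
  case (Suc k)
  obtain p q where p: "piece p q" "d x p + L + d q y = d x y" "fits k q y" using Suc.prems(4) by auto
  note pq = pieceD[OF p(1)]
  note b = piece_between[OF p(1) Suc.prems(1,2) p(2)]
  show ?case
  proof (cases "between x q z")
    case True
    obtain i j e f where ih: "k \<le> i + j + 1" "e \<in> carrier G" "f \<in> carrier G" "between q e y" "between q e z" "fits i q e"
      "between q f y" "between z f y" "fits j f y"
      using Suc.IH[OF pq(2) Suc.prems(2,3) p(3)] by blast
    have e: "between x e y" "between x q e" "between x e z" "between x f y"
      using between_nest[OF Suc.prems(1,2) pq(2) ih(2) b(2) ih(4)] between_nest(2)[OF Suc.prems(1,3) pq(2) ih(2) True ih(5)]
        between_nest(1)[OF Suc.prems(1,3) pq(2) ih(2) True ih(5)] between_nest(1)[OF Suc.prems(1,2) pq(2) ih(3) b(2) ih(7)] by blast+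
    have "d x p + L + d q e = d x e" using e(2) b(5) unfolding between_def by argo
    then have "fits (Suc i) x e" using p(1) ih(6) by auto
    then show ?thesis
      by - (rule exI[of _ "Suc i"], rule exI[of _ j], rule exI[of _ e], rule exI[of _ f], use ih e in auto)
  next
    case False
    then have "between z q y" using between_either[OF Suc.prems(1,2,3) pq(2) b(2)] by blast
    then show ?thesis
      by - (rule exI[of _ 0], rule exI[of _ k], rule exI[of _ x], rule exI[of _ q],
        use p(3) pq b(2) Suc.prems between_refl in auto)
  qed
qed

lemma fits_le_nat: "\<lbrakk>x \<in> carrier G; y \<in> carrier G; fits k x y\<rbrakk> \<Longrightarrow> k \<le> nat \<lfloor>d x y / L\<rfloor>"
  using fits_bound[of x y k] L by (simp add: le_nat_floor pos_le_divide_eq)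

lemma count:
  assumes "x \<in> carrier G" "y \<in> carrier G"
  shows "fits (count x y) x y"
  unfolding count_def using fits_le_nat[OF assms] by (rule GreatestI_nat[of "\<lambda>k. fits k x y" 0, OF fits.simps(1)[THEN iffD2, OF TrueI]])

lemma count_ge:
  assumes "x \<in> carrier G" "y \<in> carrier G" "fits k x y"
  shows "k \<le> count x y"
  unfolding count_def using assms(3) fits_le_nat[OF assms(1,2)] by (rule Greatest_le_nat)

lemma count_sym:
  assumes c: "x \<in> carrier G" "y \<in> carrier G"
  shows "count x y = count y x"
  using count_ge[OF c fits_sym[OF c(2,1) count[OF c(2,1)]]] count_ge[OF c(2,1) fits_sym[OF c count[OF c]]] by simp

lemma count_act:
  assumes c: "g \<in> carrier G" "x \<in> carrier G" "y \<in> carrier G"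
  shows "count (g \<otimes> x) (g \<otimes> y) = count x y"
proof (rule antisym)
  have "fits (count (g \<otimes> x) (g \<otimes> y)) (inv g \<otimes> (g \<otimes> x)) (inv g \<otimes> (g \<otimes> y))"
    using c by (intro fits_act count) auto
  moreover have "inv g \<otimes> (g \<otimes> x) = x" "inv g \<otimes> (g \<otimes> y) = y"
    using c by (simp_all flip: m_assoc)
  ultimately show "count (g \<otimes> x) (g \<otimes> y) \<le> count x y"
    using c by (intro count_ge) auto
  show "count x y \<le> count (g \<otimes> x) (g \<otimes> y)"
    using c by (intro count_ge fits_act count) auto
qed

lemma count_triangle:
  assumes "x \<in> carrier G" "y \<in> carrier G" "z \<in> carrier G"
  shows "count x y \<le> count x z + count z y + 1"
proof -
  obtain i j e f where e: "count x y \<le> i + j + 1" "e \<in> carrier G" "f \<in> carrier G" "between x e z" "fits i x e"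
      "between z f y" "fits j f y"
    using fits_split_towards[OF assms count[OF assms(1,2)]] by blast
  have "i \<le> count x z" "j \<le> count z y"
    using fits_extend_right[OF assms(1,3) e(2,4,5)] fits_extend_left[OF assms(3,2) e(3,6,7)] count_ge assms by blast+
  then show ?thesis using e(1) by simp
qed

lemma common_le: "\<lbrakk>v \<in> carrier G; x \<in> carrier G; y \<in> carrier G; common k v x y\<rbrakk> \<Longrightarrow> k \<le> count v x"
  using fits_extend_right count_ge by (fastforce simp: common_def)

lemma count_product:
  assumes "v \<in> carrier G" "x \<in> carrier G" "y \<in> carrier G"
  shows "common (count_product v x y) v x y" "common k v x y \<Longrightarrow> k \<le> count_product v x y"
proof -
  have "common 0 v x y" using assms between_refl by (auto simp: common_def)
  then show "common (count_product v x y) v x y"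
    unfolding count_product_def using common_le[OF assms] by (rule GreatestI_nat) auto
  show "common k v x y \<Longrightarrow> k \<le> count_product v x y"
    unfolding count_product_def using common_le[OF assms] by (intro Greatest_le_nat) auto
qed

text \<open>Both marked points lie on the segment from \<open>v\<close> to \<open>y\<close>, so the
  nearer one is common to all three segments. This substitute for the Gromov product therefore
  satisfies the ultrametric inequality without error.\<close>

lemma count_product_min:
  assumes "v \<in> carrier G" "x \<in> carrier G" "y \<in> carrier G" "z \<in> carrier G"
  shows "min (count_product v x y) (count_product v y z) \<le> count_product v x z"
proof -
  obtain p where p: "p \<in> carrier G" "between v p x" "between v p y" "fits (count_product v x y) v p"
    using count_product(1)[OF assms(1-3)] by (auto simp: common_def)
  obtain q where q: "q \<in> carrier G" "between v q y" "between v q z" "fits (count_product v y z) v q"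
    using count_product(1)[OF assms(1,3,4)] by (auto simp: common_def)
  have pq: "d p q = \<bar>d v p - d v q\<bar>" using between_dist assms p q by blast
  show ?thesis
  proof (cases "d v p \<le> d v q")
    case True
    then have "between v p q" using pq by (simp add: between_def)
    then have "between v p z" using between_nest'(1)[of v z p q] assms p q by blast
    then have "common (count_product v x y) v x z" using p by (auto simp: common_def)
    then show ?thesis using count_product(2) assms by (simp add: min.coboundedI1)
  next
    case False
    then have "between v q p" using pq sym[of p q] p q by (simp add: between_def)
    then have "between v q x" using between_nest'(1)[of v x q p] assms p q by blast
    then have "common (count_product v y z) v x z" using q by (auto simp: common_def)
    then show ?thesis using count_product(2) assms by (simp add: min.coboundedI2)
  qed
qed

lemma fits_join:
  assumes c: "x \<in> carrier G" "y \<in> carrier G" "p \<in> carrier G" "q \<in> carrier G"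
    and b: "between x p y" "between x q y" "d x p + d q y \<le> d x y" and f: "fits i x p" "fits j q y"
  shows "fits (i + j) x y"
proof -
  have "d x p \<le> d x q" using b(2,3) by (simp add: between_def)
  then have "between p q y" using between_dist[OF c b(1,2)] b(1,2) by (simp add: between_def)
  then have "fits j p y" using fits_extend_left[OF c(3,2,4) _ f(2)] by simp
  then show ?thesis using fits_append[OF c(1,2,3) b(1) f(1)] by simp
qed

lemma common_bound:
  assumes c: "v \<in> carrier G" "x \<in> carrier G" "y \<in> carrier G" "p \<in> carrier G" and b: "between v p x" "between v p y"
  shows "2 * d v p \<le> d v x + d v y - d x y"
  using b tri[OF c(2,4,3)] sym[OF c(2,4)] unfolding between_def by argo

text \<open>Splitting each segment at the branch point leaves pieces on the common part, counted by
  the product, and pieces on the two legs, which do not overlap on the segment from \<open>x\<close>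
  to \<open>y\<close>. Each splitting loses at most one piece.\<close>

lemma count_product_lower:
  assumes v: "v \<in> carrier G" and x: "x \<in> carrier G" and y: "y \<in> carrier G"
  shows "count v x + count v y \<le> count x y + 2 * count_product v x y + 2"
proof -
  obtain i j e f where e: "count v x \<le> i + j + 1" "e \<in> carrier G" "f \<in> carrier G" "between v e x" "between v e y" "fits i v e"
      "between v f x" "between y f x" "fits j f x"
    using fits_split_towards[OF v x y count[OF v x]] by blast
  obtain i' j' e' f' where e': "count v y \<le> i' + j' + 1" "e' \<in> carrier G" "f' \<in> carrier G" "between v e' y" "between v e' x" "fits i' v e'"
      "between v f' y" "between x f' y" "fits j' f' y"
    using fits_split_towards[OF v y x count[OF v y]] by blast
  have "i \<le> count_product v x y" "i' \<le> count_product v x y"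
    using e e' count_product(2)[OF v x y] by (auto simp: common_def)
  moreover have "j + j' \<le> count x y"
  proof (rule count_ge[OF x y fits_join[OF x y e(3) e'(3)]])
    show f: "between x f y" using e between_sym x y by blast
    show "between x f' y" by (rule e')
    have "2 * d x f \<le> d x v + d x y - d v y"
      using e f between_sym v x by (intro common_bound x v y) blast+
    moreover have "2 * d y f' \<le> d y v + d y x - d v x"
      using e' between_sym v x y by (intro common_bound x v y) blast+
    ultimately show "d x f + d f' y \<le> d x y"
      using sym[OF x v] sym[OF y v] sym[OF x y] sym[OF y e'(3)] by argo
    show "fits j x f" using e fits_sym x by blast
    show "fits j' f' y" by (rule e')
  qed
  ultimately show ?thesis using e(1) e'(1) by linarith
qed

lemma count_product_upper:
  assumes v: "v \<in> carrier G" and x: "x \<in> carrier G" and y: "y \<in> carrier G"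
  shows "count x y + 2 * count_product v x y \<le> count v x + count v y + 1"
proof -
  let ?m = "count_product v x y"
  obtain p where p: "p \<in> carrier G" "between v p x" "between v p y" "fits ?m v p"
    using count_product(1)[OF assms] by (auto simp: common_def)
  obtain i j e f where e: "count x y \<le> i + j + 1" "e \<in> carrier G" "f \<in> carrier G" "between x e y" "between x e v" "fits i x e"
      "between x f y" "between v f y" "fits j f y"
    using fits_split_towards[OF x y v count[OF x y]] by blast
  have vp: "2 * d v p \<le> d v x + d v y - d x y"
    by (rule common_bound[OF v x y p(1-3)])
  have "?m + i \<le> count v x"
  proof (rule count_ge[OF v x fits_join[OF v x p(1) e(2) p(2) _ _ p(4)]])
    show "between v e x" using e between_sym v x by blast
    have "2 * d x e \<le> d x y + d x v - d y v"
      using e by (intro common_bound x v y)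
    then show "d v p + d e x \<le> d v x"
      using vp sym[OF x v] sym[OF y v] sym[OF x e(2)] by argo
    show "fits i e x" using e fits_sym x by blast
  qed
  moreover have "?m + j \<le> count v y"
  proof (rule count_ge[OF v y fits_join[OF v y p(1) e(3) p(3) e(8) _ p(4) e(9)]])
    have "2 * d y f \<le> d y x + d y v - d x v"
      using e between_sym v x y by (intro common_bound x v y) blast+
    then show "d v p + d f y \<le> d v y"
      using vp sym[OF x v] sym[OF y v] sym[OF y e(3)] sym[OF x y] by argo
  qed
  ultimately show ?thesis using e(1) by linarith
qed

section \<open>Geometry and acylindricity of the counting distance\<close>

lemma D_bounds: "\<lbrakk>x \<in> carrier G; y \<in> carrier G\<rbrakk> \<Longrightarrow> count x y \<le> D x y \<and> D x y \<le> count x y + 1"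
  using fits_bound[OF _ _ count, of x x] self[of x] L by (auto simp: D_def mult_le_0_iff)

lemma D_sym: "\<lbrakk>x \<in> carrier G; y \<in> carrier G\<rbrakk> \<Longrightarrow> D x y = D y x"
  using count_sym by (simp add: D_def)

lemma D_product:
  assumes "v \<in> carrier G" "x \<in> carrier G" "y \<in> carrier G"
  shows "D v x + D v y - D x y \<le> 2 * real (count_product v x y) + 4" "2 * real (count_product v x y) - 2 \<le> D v x + D v y - D x y"
proof -
  have "real (count v x + count v y) \<le> real (count x y + 2 * count_product v x y + 2)"
    "real (count x y + 2 * count_product v x y) \<le> real (count v x + count v y + 1)"
    using count_product_lower[OF assms] count_product_upper[OF assms] by (simp_all only: of_nat_le_iff)
  then show "D v x + D v y - D x y \<le> 2 * real (count_product v x y) + 4" "2 * real (count_product v x y) - 2 \<le> D v x + D v y - D x y"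
    using D_bounds[OF assms(1,2)] D_bounds[OF assms(1,3)] D_bounds[OF assms(2,3)] by auto
qed

text \<open>The constant \<open>2 * 3\<close> is the sum of the errors 4 and 2 in
  \<open>D_product\<close>.\<close>

lemma D_four_point:
  assumes "x \<in> carrier G" "y \<in> carrier G" "z \<in> carrier G" "v \<in> carrier G"
  shows "D x z + D y v \<le> max (D x y + D z v) (D y z + D x v) + 2 * 3"
proof -
  have "min (real (count_product v x y)) (real (count_product v y z)) \<le> real (count_product v x z)"
    using count_product_min[OF assms(4,1,2,3)] by (simp add: min_def split: if_splits)
  then show ?thesis
    using D_product(1)[OF assms(4,1,2)] D_product(1)[OF assms(4,2,3)] D_product(2)[OF assms(4,1,3)]
      D_sym[OF assms(4,1)] D_sym[OF assms(4,2)] D_sym[OF assms(4,3)]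
    by argo
qed

text \<open>Cut a maximal family of pieces after the first \<open>\<lfloor>s\<rfloor>\<close> of
  them. By additivity of \<open>fits\<close> neither part can hold more pieces than the maximal
  family leaves for it.\<close>

lemma D_rough:
  assumes x: "x \<in> carrier G" and y: "y \<in> carrier G" and s: "0 \<le> s" "0 \<le> t" and st: "D x y \<le> s + t"
  shows "\<exists>v\<in>carrier G. D x v \<le> s + 2 \<and> D v y \<le> t + 2"
proof (cases "count x y \<le> s")
  case True
  then show ?thesis using D_bounds[OF x y] y s by (intro bexI[of _ y]) (auto simp: D_def)
next
  case False
  define i where "i = nat \<lfloor>s\<rfloor>"
  have i: "real i \<le> s" "s < real i + 1" using s by (auto simp: i_def)
  then obtain j where j: "count x y = i + Suc j"
    using False less_imp_Suc_add[of i "count x y"] by auto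
  obtain p q where p: "piece p q" "d x p + L + d q y = d x y" "fits i x p" "fits j q y"
    using fits_split_at[OF x y] count[OF x y] j by metis
  note pc = pieceD[OF p(1)] and b = piece_between[OF p(1) x y p(2)]
  have py: "fits (Suc j) p y"
    unfolding fits.simps by (rule exI[of _ p], rule exI[of _ q]) (use p b(6) self[OF pc(1)] in simp)
  have "count x p + Suc j \<le> count x y" "i + count p y \<le> count x y"
    using count_ge[OF x y fits_append[OF x y pc(1) b(1) count[OF x pc(1)] py]]
      count_ge[OF x y fits_append[OF x y pc(1) b(1) p(3) count[OF pc(1) y]]] by simp_all
  then have "real (count x p) \<le> real i" "real (count p y) \<le> real (count x y) - real i"
    using j by linarith+
  then show ?thesis
    using D_bounds[OF x pc(1)] D_bounds[OF pc(1) y] D_bounds[OF x y] st i pc(1) by (intro bexI[of _ p]) auto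
qed

text \<open>Greedy selection: keep the translate that starts nearest to \<open>x\<close>, discard
  the at most \<open>N\<close> translates that start less than \<open>L\<close> after it, itself
  included, and continue. At least the \<open>N\<close>-th part of \<open>F\<close> survives as
  disjoint pieces.\<close>

lemma fits_separated:
  assumes c: "x \<in> carrier G" "y \<in> carrier G"
    and F: "finite F" "F \<noteq> {}" "\<And>g. g \<in> F \<Longrightarrow> piece (P g) (Q g) \<and> between x (P g) y \<and> between x (Q g) y \<and> d x (Q g) = d x (P g) + L"
    and N: "\<And>g. g \<in> F \<Longrightarrow> card {h \<in> F. d x (P g) \<le> d x (P h) \<and> d x (P h) < d x (P g) + L} \<le> N"
  shows "\<exists>k. card F \<le> k * N \<and> (\<exists>g\<in>F. \<exists>h\<in>F. (\<forall>f\<in>F. d x (P g) \<le> d x (P f)) \<and> d x (P g) \<le> d x (P h) \<and> fits k (P g) (Q h))"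
  using F N
proof (induction "card F" arbitrary: F rule: less_induct)
  case less
  obtain g where g: "g \<in> F" "\<And>f. f \<in> F \<Longrightarrow> d x (P g) \<le> d x (P f)"
    using arg_min_if_finite(1)[OF less.prems(1,2), of "\<lambda>g. d x (P g)"] arg_min_least[OF less.prems(1,2), of _ "\<lambda>g. d x (P g)"]
    by blast
  define A where "A = {h \<in> F. d x (P h) < d x (P g) + L}"
  define B where "B = {h \<in> F. d x (P g) + L \<le> d x (P h)}"
  have AB: "A \<union> B = F" "A \<inter> B = {}" unfolding A_def B_def by fastforce+
  then have fin: "finite A" "finite B" using less.prems(1) by auto
  have "A = {h \<in> F. d x (P g) \<le> d x (P h) \<and> d x (P h) < d x (P g) + L}"
    unfolding A_def using g(2) by blast
  then have cA: "card A \<le> N" using less.prems(4)[OF g(1)] by (simp only:)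
  have cF: "card F = card A + card B" using card_Un_disjoint[OF fin AB(2)] unfolding AB(1) .
  note Pg = less.prems(3)[OF g(1)]
  note pg = pieceD[OF Pg[THEN conjunct1]]
  have gQ: "fits (Suc 0) (P g) (Q g)"
    unfolding fits.simps by (rule exI[of _ "P g"], rule exI[of _ "Q g"]) (use Pg pg self in simp)
  show ?case
  proof (cases "B = {}")
    case True
    have "card F \<le> Suc 0 * N" using cF cA True by simp
    then show ?thesis using g gQ by blast
  next
    case False
    have "g \<in> A" using g L by (simp add: A_def)
    then have lt: "card B < card F" using cF fin(1) card_gt_0_iff[of A] by auto
    have sub: "card {h \<in> B. d x (P f) \<le> d x (P h) \<and> d x (P h) < d x (P f) + L} \<le> N" if "f \<in> B" for f
    proof -
      have "f \<in> F" using that by (simp add: B_def)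
      have "card {h \<in> B. d x (P f) \<le> d x (P h) \<and> d x (P h) < d x (P f) + L} \<le>
        card {h \<in> F. d x (P f) \<le> d x (P h) \<and> d x (P h) < d x (P f) + L}"
        using less.prems(1) by (intro card_mono) (auto simp: B_def)
      then show ?thesis using less.prems(4)[OF \<open>f \<in> F\<close>] by simp
    qed
    have BF: "piece (P f) (Q f) \<and> between x (P f) y \<and> between x (Q f) y \<and> d x (Q f) = d x (P f) + L" if "f \<in> B" for f
      using less.prems(3) that by (auto simp: B_def)
    obtain k a h where k: "card B \<le> k * N" "a \<in> B" "h \<in> B" "d x (P a) \<le> d x (P h)" "fits k (P a) (Q h)"
      using less.hyps[OF lt fin(2) False BF sub] by blast
    note Pa = BF[OF k(2)] note pa = pieceD[OF Pa[THEN conjunct1]]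
    note Ph = BF[OF k(3)] note ph = pieceD[OF Ph[THEN conjunct1]]
    have pos: "d x (P g) + L \<le> d x (P a)" using k(2) by (simp add: B_def)
    have dist: "d (Q g) (P a) = d x (P a) - d x (Q g)" "d (P a) (Q h) = d x (Q h) - d x (P a)"
      "d (Q g) (Q h) = d x (Q h) - d x (Q g)" "d (P g) (Q h) = d x (Q h) - d x (P g)"
      using between_dist[OF c pg(2) pa(1)] between_dist[OF c pa(1) ph(2)] between_dist[OF c pg(2) ph(2)]
        between_dist[OF c pg(1) ph(2)] Pg Pa Ph pos k(4) L by auto
    have "fits k (Q g) (Q h)"
      using dist by (intro fits_extend_left[OF pg(2) ph(2) pa(1) _ k(5)]) (simp add: between_def)
    moreover have "d (P g) (P g) + L + d (Q g) (Q h) = d (P g) (Q h)"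
      using dist Pg self[OF pg(1)] by simp
    ultimately have "fits (Suc k) (P g) (Q h)"
      using Pg by auto
    moreover have "card F \<le> Suc k * N" using cF cA k(1) by simp
    moreover have "h \<in> F" "d x (P g) \<le> d x (P h)" using k(3) g(2) by (auto simp: B_def)
    ultimately show ?thesis using g by blast
  qed
qed

text \<open>The window is cut into slots of length \<open>\<eta>\<close>. Translates with equal
  direction and starting in one slot differ by an element that, up to conjugation, moves both ends
  of the segment of \<open>w\<close> by at most \<open>\<eta>\<close>, so each slot holds at most
  \<open>N\<close> of them.\<close>

lemma few_nearby_translates:
  assumes \<eta>: "0 < \<eta>" and P: "\<And>F. \<lbrakk>finite F; F \<subseteq> {g \<in> carrier G. d \<one> g \<le> \<eta> \<and> d w (g \<otimes> w) \<le> \<eta>}\<rbrakk> \<Longrightarrow> card F \<le> N"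
    and c: "x \<in> carrier G" "y \<in> carrier G" and pq: "piece p q"
    and F: "finite F" "F \<subseteq> carrier G"
      "\<And>g. g \<in> F \<Longrightarrow> between x (g \<otimes> p) y \<and> between x (g \<otimes> q) y \<and> d x (g \<otimes> q) = d x (g \<otimes> p) + L"
      "\<And>g. g \<in> F \<Longrightarrow> a \<le> d x (g \<otimes> p) \<and> d x (g \<otimes> p) < a + L"
  shows "card F \<le> (nat \<lfloor>L / \<eta>\<rfloor> + 1) * N"
proof (rule ccontr)
  assume n: "\<not> ?thesis"
  define slot where "slot g = nat \<lfloor>(d x (g \<otimes> p) - a) / \<eta>\<rfloor>" for g
  have "slot ` F \<subseteq> {..nat \<lfloor>L / \<eta>\<rfloor>}"
  proof (rule image_subsetI)
    fix g assume "g \<in> F"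
    then have "(d x (g \<otimes> p) - a) / \<eta> \<le> L / \<eta>" using F(4)[of g] \<eta> by (intro divide_right_mono) auto
    then show "slot g \<in> {..nat \<lfloor>L / \<eta>\<rfloor>}" unfolding slot_def by (simp add: nat_mono floor_mono)
  qed
  then obtain k where k: "N < card {g \<in> F. slot g = k}"
    using pigeonhole_fibre[OF F(1), of slot "{..nat \<lfloor>L / \<eta>\<rfloor>}" "nat \<lfloor>L / \<eta>\<rfloor> + 1" N] n by force
  let ?F = "{g \<in> F. slot g = k}"
  obtain h where h: "h \<in> F" "slot h = k" using k by (metis (mono_tags, lifting) card.empty equals0I less_nat_zero_code mem_Collect_eq)
  note pc = pieceD[OF pq]
  \<comment> \<open>A set of ends, because the piece may be traversed against the orientation of
    \<open>w\<close>.\<close>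
  obtain f where f: "f \<in> carrier G" "{f, f \<otimes> w} = {p, q}"
    using pq by (auto simp: piece_def)
  have fw: "f \<in> {p, q}" "f \<otimes> w \<in> {p, q}" using f(2) by auto
  define z where "z g = inv f \<otimes> (inv h \<otimes> (g \<otimes> f))" for g
  have hc: "h \<in> carrier G" using h F by auto
  have close: "d (h \<otimes> r) (g \<otimes> r) \<le> \<eta>" if g: "g \<in> ?F" and r: "r \<in> {p, q}" for g r
  proof -
    have gc: "g \<in> carrier G" "g \<in> F" using g F by auto
    have hg: "h \<otimes> p \<in> carrier G" "g \<otimes> p \<in> carrier G" "h \<otimes> q \<in> carrier G" "g \<otimes> q \<in> carrier G" using hc gc pc by auto
    have "\<lfloor>(d x (g \<otimes> p) - a) / \<eta>\<rfloor> = \<lfloor>(d x (h \<otimes> p) - a) / \<eta>\<rfloor>"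
    proof -
      have "0 \<le> (d x (g \<otimes> p) - a) / \<eta>" "0 \<le> (d x (h \<otimes> p) - a) / \<eta>" using F(4)[OF gc(2)] F(4)[OF h(1)] \<eta> by auto
      then have "0 \<le> \<lfloor>(d x (g \<otimes> p) - a) / \<eta>\<rfloor>" "0 \<le> \<lfloor>(d x (h \<otimes> p) - a) / \<eta>\<rfloor>" by (simp_all only: zero_le_floor)
      moreover have "slot g = slot h" using g h by simp
      ultimately show ?thesis unfolding slot_def using eq_nat_nat_iff by blast
    qed
    then have "\<bar>(d x (g \<otimes> p) - a) / \<eta> - (d x (h \<otimes> p) - a) / \<eta>\<bar> \<le> 1" by linarith
    moreover have "(d x (g \<otimes> p) - a) / \<eta> - (d x (h \<otimes> p) - a) / \<eta> = (d x (g \<otimes> p) - d x (h \<otimes> p)) / \<eta>"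
      by (simp add: diff_divide_distrib)
    ultimately have "\<bar>d x (g \<otimes> p) - d x (h \<otimes> p)\<bar> \<le> \<eta>" using \<eta> by (simp add: abs_divide divide_le_eq_1)
    then show ?thesis
      using between_dist[OF c hg(1,2)] between_dist[OF c hg(3,4)] F(3)[OF gc(2)] F(3)[OF h(1)] r by auto
  qed
  have "z g \<in> {g \<in> carrier G. d \<one> g \<le> \<eta> \<and> d w (g \<otimes> w) \<le> \<eta>}" if g: "g \<in> ?F" for g
  proof -
    have gc: "g \<in> carrier G" using g F by auto
    have zc: "z g \<in> carrier G" using gc hc f by (simp add: z_def)
    have hf: "h \<otimes> f \<in> carrier G" using hc f by simp
    have e: "h \<otimes> f \<otimes> z g = g \<otimes> f"
      using gc hc f by (simp add: z_def m_assoc[symmetric]) (simp add: m_assoc)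
    have "d \<one> (z g) = d (h \<otimes> f) (g \<otimes> f)"
      using left[OF hf one_closed zc] e hf by simp
    moreover have "d w (z g \<otimes> w) = d (h \<otimes> (f \<otimes> w)) (g \<otimes> (f \<otimes> w))"
      using left[OF hf w, of "z g \<otimes> w"] e hf zc w gc hc f by (simp add: m_assoc[symmetric])
    ultimately show ?thesis using close[OF g] fw zc by auto
  qed
  then have "card (z ` ?F) \<le> N" using F(1) by (intro P) auto
  moreover have "inj_on z ?F"
  proof (rule inj_onI)
    fix g g' assume "g \<in> ?F" "g' \<in> ?F" "z g = z g'"
    moreover from this have "g \<in> carrier G" "g' \<in> carrier G" using F by auto
    ultimately show "g = g'" using hc f by (simp add: z_def)
  qed
  ultimately show False using k by (simp add: card_image)
qed

lemma D_acylindrical: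
  assumes \<eta>: "0 < \<eta>" and P: "\<And>F. \<lbrakk>finite F; F \<subseteq> {g \<in> carrier G. d \<one> g \<le> \<eta> \<and> d w (g \<otimes> w) \<le> \<eta>}\<rbrakk> \<Longrightarrow> card F \<le> N"
    and \<epsilon>: "0 \<le> \<epsilon>"
  shows "\<exists>(N::nat) R. \<forall>x\<in>carrier G. \<forall>y\<in>carrier G. D x y \<ge> R \<longrightarrow>
      (\<forall>F. finite F \<longrightarrow> F \<subseteq> {g \<in> carrier G. D x (g \<otimes> x) \<le> \<epsilon> \<and> D y (g \<otimes> y) \<le> \<epsilon>} \<longrightarrow> card F \<le> N)"
proof -
  define E where "E = nat \<lceil>\<epsilon>\<rceil>"
  have E: "\<epsilon> \<le> E" unfolding E_def by (rule real_nat_ceiling_ge)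
  let ?N = "(nat \<lfloor>L / \<eta>\<rfloor> + 1) * N"
  \<comment> \<open>The threshold leaves \<open>E + 1\<close> pieces in front of a chosen piece and
    at least \<open>E + 2\<close> behind it, so an element that moves the ends \<open>x\<close> and
    \<open>y\<close> by at most \<open>\<epsilon>\<close> cannot push it off the segment.\<close>
  show ?thesis
  proof (intro exI[of _ "(2 * E + 3) * ?N"] exI[of _ "2 * real E + 5"] ballI allI impI)
    fix x y F
    assume c: "x \<in> carrier G" "y \<in> carrier G" and far: "2 * real E + 5 \<le> D x y" and fin: "finite F"
      and F: "F \<subseteq> {g \<in> carrier G. D x (g \<otimes> x) \<le> \<epsilon> \<and> D y (g \<otimes> y) \<le> \<epsilon>}"
    have "2 * E + 4 \<le> count x y" using far D_bounds[OF c] by linarith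
    define j where "j = count x y - (E + 2)"
    have j: "count x y = Suc E + Suc j" "E + 2 \<le> j"
      using \<open>2 * E + 4 \<le> count x y\<close> by (auto simp: j_def)
    obtain p q where p: "piece p q" "d x p + L + d q y = d x y" "fits (Suc E) x p" "fits j q y"
      using fits_split_at[OF c] count[OF c] j(1) by metis
    note pc = pieceD[OF p(1)] and b = piece_between[OF p(1) c p(2)]
    have xq: "fits (Suc E) x q" using fits_extend_right[OF c(1) pc(2,1) b(3) p(3)] .
    have py: "fits j p y" using fits_extend_left[OF pc(1) c(2) pc(2) b(4) p(4)] .
    have main: "between x (g \<otimes> p) y \<and> between x (g \<otimes> q) y \<and> d x (g \<otimes> q) = d x (g \<otimes> p) + L \<and>
        count x y \<le> E + 1 + count x (g \<otimes> p) + Suc j \<and> j \<le> E + 1 + count (g \<otimes> q) y"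
      if g: "g \<in> F" for g
    proof -
      have gc: "g \<in> carrier G" and gD: "D x (g \<otimes> x) \<le> \<epsilon>" "D y (g \<otimes> y) \<le> \<epsilon>" using g F by auto
      let ?p = "g \<otimes> p" and ?q = "g \<otimes> q" and ?x = "g \<otimes> x" and ?y = "g \<otimes> y"
      have m: "?p \<in> carrier G" "?q \<in> carrier G" "?x \<in> carrier G" "?y \<in> carrier G" using gc c pc by auto
      have small: "count ?x x \<le> E" "count y ?y \<le> E"
        using D_bounds[OF c(1) m(3)] D_bounds[OF c(2) m(4)] gD E count_sym[OF c(1) m(3)] by linarith+
      note gx = fits_act[OF gc c(1) pc(1) p(3)] fits_act[OF gc c(1) pc(2) xq]
      note gy = fits_act[OF gc pc(1) c(2) py] fits_act[OF gc pc(2) c(2) p(4)]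
      \<comment> \<open>Otherwise the translates of the \<open>Suc E\<close> pieces in front would
        lie between \<open>?x\<close> and \<open>x\<close>, more than the displacement of
        \<open>x\<close> allows.\<close>
      have no_x: "\<not> between ?x r x" if "r \<in> {?p, ?q}" for r
      proof
        assume br: "between ?x r x"
        have "fits (Suc E) ?x r" "r \<in> carrier G" using that gx m(1,2) by blast+
        then have "Suc E \<le> count ?x x" using fits_extend_right[OF m(3) c(1) _ br] count_ge[OF m(3) c(1)] by blast
        then show False using small by simp
      qed
      have no_y: "\<not> between y r ?y" if "r \<in> {?p, ?q}" for r
      proof
        assume br: "between y r ?y"
        have "fits j r ?y" "r \<in> carrier G" using that gy m(1,2) by blast+
        then have "j \<le> count y ?y" using fits_extend_left[OF c(2) m(4) _ br] count_ge[OF c(2) m(4)] by blast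
        then show False using small j by simp
      qed
      have gb: "between ?x ?p ?y" "between ?x ?q ?y" "between ?x ?p ?q"
        using between_act gc c pc b by auto
      have 1: "between x r ?y" if "r \<in> {?p, ?q}" for r
        using between_either[OF m(3,4) c(1), of r] no_x[OF that] gb that m by blast
      have 2: "between x r y" if "r \<in> {?p, ?q}" for r
        using between_either[OF c(1) m(4) c(2), of r] 1[OF that] no_y[OF that] that m by blast
      have 3: "between x ?p ?q"
        using between_either[OF m(3,2) c(1) m(1) gb(3)] no_x by blast
      have "Suc E \<le> count ?x ?p" "j \<le> count ?q ?y"
        using count_ge[OF m(3,1) gx(1)] count_ge[OF m(2,4) gy(2)] .
      moreover have "count ?q ?y \<le> count ?q y + count y ?y + 1"
        using count_triangle[OF m(2,4) c(2)] .
      moreover have "d ?p ?q = L" using left[OF gc pc(1,2)] pc(3) by simp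
      ultimately show ?thesis
        using 2 3 small j(1) by (auto simp: between_def)
    qed
    show "card F \<le> (2 * E + 3) * ?N"
    proof (cases "F = {}")
      case False
      have "piece (g \<otimes> p) (g \<otimes> q) \<and> between x (g \<otimes> p) y \<and> between x (g \<otimes> q) y \<and> d x (g \<otimes> q) = d x (g \<otimes> p) + L" if "g \<in> F" for g
        using main[OF that] piece_act[OF _ p(1)] F that by blast
      moreover have "card {h \<in> F. d x (g \<otimes> p) \<le> d x (h \<otimes> p) \<and> d x (h \<otimes> p) < d x (g \<otimes> p) + L} \<le> ?N" if "g \<in> F" for g
        using fin F main by (intro few_nearby_translates[OF \<eta> P c p(1)]) auto
      ultimately obtain k g h where k: "card F \<le> k * ?N" "g \<in> F" "h \<in> F" "d x (g \<otimes> p) \<le> d x (h \<otimes> p)" "fits k (g \<otimes> p) (h \<otimes> q)"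
        using fits_separated[OF c fin False, of "\<lambda>g. g \<otimes> p" "\<lambda>g. g \<otimes> q" ?N] by blast
      have gh: "g \<otimes> p \<in> carrier G" "h \<otimes> q \<in> carrier G" using k F pc by auto
      note mg = main[OF k(2)] and mh = main[OF k(3)]
      have pos: "d x (g \<otimes> p) \<le> d x (h \<otimes> q)" using k(4) mh L by auto
      have "between (g \<otimes> p) (h \<otimes> q) y"
        using between_dist[OF c gh] mg mh pos unfolding between_def by auto
      then have "fits (k + count (h \<otimes> q) y) (g \<otimes> p) y"
        by (rule fits_append[OF gh(1) c(2) gh(2) _ k(5) count[OF gh(2) c(2)]])
      then have "k + count (h \<otimes> q) y \<le> count x y"
        using fits_extend_left[OF c gh(1)] mg count_ge[OF c] by blast
      \<comment> \<open>Of the \<open>E + 2 + j\<close> pieces in total, at least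
        \<open>j - (E + 1)\<close> still fit behind the last translate.\<close>
      then have "k \<le> 2 * E + 3" using mh j(1) by linarith
      then have "k * ?N \<le> (2 * E + 3) * ?N" by (intro mult_right_mono) auto
      then show ?thesis using k(1) by linarith
    qed simp
  qed
qed

section \<open>Independent loxodromic elements for the counting distance\<close>

lemma fits_pow: "fits n \<one> (w [^] n)"
proof (induction n)
  case (Suc n)
  have c: "w [^] n \<in> carrier G" "w [^] Suc n \<in> carrier G" using w by auto
  have d: "d (w [^] n) (w [^] Suc n) = L"
    using left[OF c(1) one_closed w] pow[of 1] w by simp
  have "fits (Suc 0) (w [^] n) (w [^] Suc n)"
    unfolding fits.simps by (rule exI[of _ "w [^] n"], rule exI[of _ "w [^] Suc n"]) (use c d w self in \<open>simp add: piece_def\<close>)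
  moreover have "between \<one> (w [^] n) (w [^] Suc n)"
    unfolding between_def d pow by (simp add: algebra_simps)
  ultimately have "fits (n + Suc 0) \<one> (w [^] Suc n)"
    using Suc c by (intro fits_append[of \<one> _ "w [^] n"]) auto
  then show ?case by simp
qed simp

text \<open>The partner of \<open>w\<close> is its conjugate \<open>v\<close> by \<open>u\<close>.
  By \<open>uw\<close> the segment from the identity to \<open>u\<close> meets the orbits of the
  powers of \<open>w\<close> and of their translates by \<open>u\<close> without turning back, so
  orbits of \<open>w\<close> and \<open>v\<close> share at most the length
  \<open>d \<one> u\<close>.\<close>

theorem acylindrically_hyperbolic_tree:
  assumes \<eta>: "0 < \<eta>" and P: "\<And>F. \<lbrakk>finite F; F \<subseteq> {g \<in> carrier G. d \<one> g \<le> \<eta> \<and> d w (g \<otimes> w) \<le> \<eta>}\<rbrakk> \<Longrightarrow> card F \<le> N"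
    and u: "u \<in> carrier G" "0 < d \<one> u"
    and uw: "\<And>n::int. d (w [^] n) u = d \<one> (w [^] n) + d \<one> u" "\<And>n::int. d (inv u) (w [^] n) = d \<one> (inv u) + d \<one> (w [^] n)"
  shows "acylindrically_hyperbolic TYPE('a \<Rightarrow> real) G"
proof -
  have D_act: "D (g \<otimes> x) (g \<otimes> y) = D x y" if "g \<in> carrier G" "x \<in> carrier G" "y \<in> carrier G" for g x y
    using that count_act by (simp add: D_def)
  have D_tri: "D x z \<le> D x y + D y z" if "x \<in> carrier G" "y \<in> carrier G" "z \<in> carrier G" for x y z
  proof -
    have "real (count x z) \<le> real (count x y + count y z + 1)" using count_triangle that by (simp only: of_nat_le_iff)
    then show ?thesis by (auto simp: D_def)
  qed
  interpret A: pseudometric_action "carrier G" D G "(\<otimes>)"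
    by unfold_locales (use D_sym D_tri D_act in \<open>auto simp: D_def m_assoc\<close>)
  define v where "v = u \<otimes> w \<otimes> inv u"
  have v: "v \<in> carrier G" using u w by (simp add: v_def)
  have v_nat: "v [^] (n::nat) = u \<otimes> w [^] n \<otimes> inv u" for n
  proof (induction n)
    case (Suc n)
    have "v [^] Suc n = u \<otimes> w [^] n \<otimes> inv u \<otimes> (u \<otimes> w \<otimes> inv u)" using Suc by (simp add: v_def)
    also have "\<dots> = u \<otimes> w [^] n \<otimes> (inv u \<otimes> u) \<otimes> w \<otimes> inv u" using u w by (simp add: m_assoc del: l_inv)
    finally show ?case using u w by (simp add: m_assoc)
  qed (use u in simp)
  have v_int: "v [^] n = u \<otimes> w [^] n \<otimes> inv u" for n :: int
  proof (cases "0 \<le> n")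
    case True
    then have m: "n = int (nat n)" by simp
    show ?thesis using v_nat[of "nat n"] by (subst (1 2) m) (simp only: int_pow_int)
  next
    case False
    then have m: "n = - int (nat (- n))" by simp
    show ?thesis using v_nat[of "nat (- n)"] u w v by (subst (1 2) m) (simp add: int_pow_neg int_pow_int inv_mult_group m_assoc del: int_nat_eq)
  qed
  have wc: "w [^] n \<in> carrier G" for n :: int using w by simp
  \<comment> \<open>One piece per power of \<open>w\<close> gives \<open>L = 1\<close>; conjugation
    by \<open>u\<close> costs twice \<open>D \<one> (inv u)\<close>. In \<open>B\<close>, the common
    length \<open>d \<one> u\<close> is converted into pieces, and 4 is the error of
    \<open>D_product\<close>.\<close>
  show ?thesis
  proof (rule A.acylindrically_hyperbolicI[where \<delta> = 3 and C = 2 and b = \<one> and g = w and h = v and L = 1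
        and K = "2 * D \<one> (inv u)" and B = "2 * d \<one> u / L + 4"])
    show "D x z + D y v \<le> max (D x y + D z v) (D y z + D x v) + 2 * 3"
      if "x \<in> carrier G" "y \<in> carrier G" "z \<in> carrier G" "v \<in> carrier G" for x y z v
      using D_four_point that .
    show "\<exists>v\<in>carrier G. D x v \<le> s + 2 \<and> D v y \<le> t + 2"
      if "x \<in> carrier G" "y \<in> carrier G" "0 \<le> s" "0 \<le> t" "D x y \<le> s + t" for x y s t
      using D_rough that .
    show "\<exists>(N::nat) R. \<forall>x\<in>carrier G. \<forall>y\<in>carrier G. D x y \<ge> R \<longrightarrow>
      (\<forall>F. finite F \<longrightarrow> F \<subseteq> {g \<in> carrier G. D x (g \<otimes> x) \<le> \<epsilon> \<and> D y (g \<otimes> y) \<le> \<epsilon>} \<longrightarrow> card F \<le> N)"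
      if "0 \<le> \<epsilon>" for \<epsilon>
      by (rule D_acylindrical[OF \<eta> P that])
    have wn: "real n \<le> D \<one> (w [^] int n)" for n :: nat
      using count_ge[OF one_closed _ fits_pow[of n]] D_bounds[of \<one> "w [^] n"] w by (simp add: int_pow_int)
    have nn: "0 \<le> D \<one> (inv u)" using A.nonneg u by simp
    show "real n / 1 - 2 * D \<one> (inv u) \<le> D \<one> (w [^] int n \<otimes> \<one>)" for n
      using wn[of n] nn wc by simp
    show "real n / 1 - 2 * D \<one> (inv u) \<le> D \<one> (v [^] int n \<otimes> \<one>)" for n
    proof -
      have "D \<one> (v [^] int n) = D (u \<otimes> inv u) (u \<otimes> (w [^] int n \<otimes> inv u))"
        using u wc v_int[of "int n"] by (simp add: m_assoc)
      also have "\<dots> = D (inv u) (w [^] int n \<otimes> inv u)"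
        using u wc by (intro D_act) auto
      finally have "D \<one> (v [^] int n) = D (inv u) (w [^] int n \<otimes> inv u)" .
      moreover have "D (w [^] int n) (w [^] int n \<otimes> inv u) = D \<one> (inv u)"
        using D_act[OF wc one_closed, of "inv u" "int n"] u wc by simp
      moreover have "D \<one> (w [^] int n) \<le> D \<one> (inv u) + D (inv u) (w [^] int n \<otimes> inv u) + D (w [^] int n \<otimes> inv u) (w [^] int n)"
        using D_tri[of \<one> "inv u" "w [^] int n"] D_tri[of "inv u" "w [^] int n \<otimes> inv u" "w [^] int n"] u wc by fastforce
      ultimately show ?thesis using wn[of n] v D_sym[of "w [^] int n \<otimes> inv u" "w [^] int n"] u wc by simp
    qed
    fix m n :: int
    let ?a = "w [^] m" and ?b = "v [^] n" and ?c = "u \<otimes> w [^] n"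
    have abc: "?a \<in> carrier G" "?b \<in> carrier G" "?c \<in> carrier G" using wc v u by auto
    have cb: "d ?c ?b = d \<one> u"
    proof -
      have "d ?c ?b = d (?c \<otimes> \<one>) (?c \<otimes> inv u)" using v_int[of n] abc by simp
      also have "\<dots> = d \<one> (inv u)" using abc u by (intro left) auto
      also have "\<dots> = d (u \<otimes> \<one>) (u \<otimes> inv u)" using left[OF u(1) one_closed, of "inv u"] u by simp
      also have "\<dots> = d \<one> u" using u sym by simp
      finally show ?thesis .
    qed
    have uc: "d u ?c = d \<one> (w [^] n)" using left[OF u(1) one_closed wc] u by simp
    have oc: "d \<one> ?c = d \<one> u + d \<one> (w [^] n)"
    proof -
      have "d \<one> ?c = d (inv u \<otimes> \<one>) (inv u \<otimes> ?c)" using left[of "inv u" \<one> ?c] u abc by simp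
      also have "inv u \<otimes> ?c = w [^] n" using u wc by (simp flip: m_assoc)
      also have "d (inv u \<otimes> \<one>) (w [^] n) = d \<one> (inv u) + d \<one> (w [^] n)" using uw(2) u by simp
      also have "d \<one> (inv u) = d \<one> u" using left[OF u(1) one_closed, of "inv u"] u sym by simp
      finally show ?thesis .
    qed
    \<comment> \<open>The path from \<open>?a\<close> through the identity and \<open>u\<close> to
      \<open>?c\<close> is geodesic, because the middle segment is nondegenerate.\<close>
    have ac: "d ?a ?c = d \<one> ?a + d \<one> ?c"
      using four[OF abc(1) one_closed u(1) abc(3)] uw(1)[of m] oc uc u(2) tri[OF abc(1) one_closed abc(3)]
        sym[OF abc(1) one_closed] sym[OF abc(3) u(1)] sym[OF abc(3) one_closed] by argo
    obtain p where p: "p \<in> carrier G" "between \<one> p ?a" "between \<one> p ?b" "fits (count_product \<one> ?a ?b) \<one> p"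
      using count_product(1)[OF one_closed abc(1,2)] by (auto simp: common_def)
    have "count_product \<one> ?a ?b * L \<le> d \<one> p" using fits_bound[OF one_closed p(1,4)] .
    moreover have "2 * d \<one> p \<le> d \<one> ?a + d \<one> ?b - d ?a ?b" by (rule common_bound[OF one_closed abc(1,2) p(1-3)])
    moreover have "d ?a ?c \<le> d ?a ?b + d ?b ?c" "d \<one> ?b \<le> d \<one> ?c + d ?c ?b" "d ?b ?c = d ?c ?b"
      using tri[OF abc(1,2,3)] tri[OF one_closed abc(3,2)] sym[OF abc(2,3)] .
    ultimately have "count_product \<one> ?a ?b * L \<le> d \<one> u" using ac cb by linarith
    then have "count_product \<one> ?a ?b \<le> d \<one> u / L" using L by (simp add: pos_le_divide_eq)
    then show "D \<one> (?a \<otimes> \<one>) + D \<one> (?b \<otimes> \<one>) - D (?a \<otimes> \<one>) (?b \<otimes> \<one>) \<le> 2 * d \<one> u / L + 4"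
      using D_product(1)[OF one_closed abc(1,2)] abc by simp
  qed (use w v in auto)
qed

end

section \<open>Homomorphisms from finitely presented groups to existentially closed subgroups\<close>

primrec word_val :: "('a, 'b) monoid_scheme \<Rightarrow> ('s \<Rightarrow> 'a) \<Rightarrow> 's word \<Rightarrow> 'a" where
  "word_val G x [] = \<one>\<^bsub>G\<^esub>"
| "word_val G x (l # u) = (if snd l then x (fst l) else inv\<^bsub>G\<^esub> (x (fst l))) \<otimes>\<^bsub>G\<^esub> word_val G x u"

primrec word_term :: "nat word \<Rightarrow> gterm" where
  "word_term [] = Unit"
| "word_term (l # u) = Times (if snd l then Var (fst l) else Inverse (Var (fst l))) (word_term u)"

primrec conjunction :: "gformula list \<Rightarrow> gformula" where
  "conjunction [] = Eq Unit Unit"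
| "conjunction (\<psi> # \<psi>s) = And \<psi> (conjunction \<psi>s)"

primrec exists_below :: "nat \<Rightarrow> gformula \<Rightarrow> gformula" where
  "exists_below 0 \<psi> = \<psi>"
| "exists_below (Suc k) \<psi> = Exists k (exists_below k \<psi>)"

lemma gterm_val_word: "gterm_val G e (word_term u) = word_val G e u"
  by (induction u) auto

lemma satisfies_conjunction: "satisfies G e (conjunction \<psi>s) \<longleftrightarrow> (\<forall>\<psi>\<in>set \<psi>s. satisfies G e \<psi>)"
  by (induction \<psi>s) auto

lemma quantifier_free_conjunction: "quantifier_free (conjunction \<psi>s) \<longleftrightarrow> (\<forall>\<psi>\<in>set \<psi>s. quantifier_free \<psi>)"
  by (induction \<psi>s) auto

lemma existential_exists_below: "existential \<psi> \<Longrightarrow> existential (exists_below k \<psi>)"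
  by (induction k) (auto intro: existential.intros)

lemma satisfies_exists_below:
  "satisfies G e (exists_below k \<psi>) \<longleftrightarrow>
     (\<exists>x. (\<forall>i<k. x i \<in> carrier G) \<and> satisfies G (\<lambda>i. if i < k then x i else e i) \<psi>)"
proof (induction k arbitrary: e)
  case (Suc k)
  have "satisfies G e (exists_below (Suc k) \<psi>) \<longleftrightarrow>
     (\<exists>a\<in>carrier G. \<exists>x. (\<forall>i<k. x i \<in> carrier G) \<and> satisfies G (\<lambda>i. if i < k then x i else (e(k := a)) i) \<psi>)"
    by (simp only: exists_below.simps satisfies.simps Suc)
  also have "\<dots> \<longleftrightarrow> (\<exists>x. (\<forall>i<Suc k. x i \<in> carrier G) \<and> satisfies G (\<lambda>i. if i < Suc k then x i else e i) \<psi>)"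
  proof (intro iffI; elim bexE exE conjE)
    fix a x assume a: "a \<in> carrier G" "\<forall>i<k. x i \<in> carrier G" "satisfies G (\<lambda>i. if i < k then x i else (e(k := a)) i) \<psi>"
    have "(\<lambda>i. if i < k then x i else (e(k := a)) i) = (\<lambda>i. if i < Suc k then (x(k := a)) i else e i)"
      by (auto simp: fun_eq_iff)
    with a show "\<exists>x. (\<forall>i<Suc k. x i \<in> carrier G) \<and> satisfies G (\<lambda>i. if i < Suc k then x i else e i) \<psi>"
      by (intro exI[of _ "x(k := a)"]) auto
  next
    fix x assume x: "\<forall>i<Suc k. x i \<in> carrier G" "satisfies G (\<lambda>i. if i < Suc k then x i else e i) \<psi>"
    have "(\<lambda>i. if i < Suc k then x i else e i) = (\<lambda>i. if i < k then x i else (e(k := x k)) i)"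
      by (auto simp: fun_eq_iff)
    with x show "\<exists>a\<in>carrier G. \<exists>x. (\<forall>i<k. x i \<in> carrier G) \<and> satisfies G (\<lambda>i. if i < k then x i else (e(k := a)) i) \<psi>"
      by (intro bexI[of _ "x k"] exI[of _ x]) auto
  qed
  finally show ?case .
qed simp

section \<open>Evaluation of words in a group\<close>

context group
begin

lemma word_val_closed: "\<lbrakk>u \<in> words S; \<And>s. s \<in> S \<Longrightarrow> x s \<in> carrier G\<rbrakk> \<Longrightarrow> word_val G x u \<in> carrier G"
  by (induction u) (auto simp: words_def)

lemma word_val_append:
  assumes "u \<in> words S" "v \<in> words S" "\<And>s. s \<in> S \<Longrightarrow> x s \<in> carrier G"
  shows "word_val G x (u @ v) = word_val G x u \<otimes> word_val G x v"
  using assms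
proof (induction u)
  case (Cons l u)
  have "u \<in> words S" "fst l \<in> S" using Cons.prems(1) by (auto simp: words_def)
  moreover from this have "word_val G x u \<in> carrier G" "word_val G x v \<in> carrier G"
    using word_val_closed Cons.prems by blast+
  ultimately show ?case using Cons by (simp add: m_assoc)
next
  case Nil
  then show ?case using word_val_closed[of v S x] by simp
qed

lemma word_val_free_cong:
  assumes "(u, v) \<in> free_cong S" "\<And>s. s \<in> S \<Longrightarrow> x s \<in> carrier G"
  shows "word_val G x u = word_val G x v"
  using assms(1)
proof induction
  case (cancel u v s b)
  have w: "[(s, b), (s, \<not> b)] \<in> words S" using cancel by (auto simp: words_def)
  have c: "word_val G x u \<in> carrier G" "word_val G x v \<in> carrier G" "x s \<in> carrier G"
    using word_val_closed cancel assms(2) by blast+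
  have cv: "[(s, b), (s, \<not> b)] @ v \<in> words S" using w cancel(2) by (simp only: words_append_iff)
  have "word_val G x (u @ [(s, b), (s, \<not> b)] @ v)
      = word_val G x u \<otimes> (word_val G x [(s, b), (s, \<not> b)] \<otimes> word_val G x v)"
    using word_val_append[OF cancel(1) cv, of x] word_val_append[OF w cancel(2), of x] assms(2) by (simp only:)
  also have "word_val G x [(s, b), (s, \<not> b)] = \<one>" using c by auto
  finally show ?case using word_val_append[OF cancel(1,2), of x] assms(2) c by simp
qed auto

text \<open>Evaluation is constant on classes of freely equivalent words, so its image of a class is
  a singleton.\<close>

definition word_hom :: "('s \<Rightarrow> 'a) \<Rightarrow> 's word set \<Rightarrow> 'a" where
  "word_hom x A = the_elem (word_val G x ` A)"

lemma word_hom_class: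
  assumes u: "u \<in> words S" and x: "\<And>s. s \<in> S \<Longrightarrow> x s \<in> carrier G"
  shows "word_hom x (free_cong S `` {u}) = word_val G x u"
proof -
  have "word_val G x v = word_val G x u" if "v \<in> free_cong S `` {u}" for v
    using word_val_free_cong[of u v S x] that x by simp
  then have "word_val G x ` (free_cong S `` {u}) = (\<lambda>_. word_val G x u) ` (free_cong S `` {u})"
    by (rule image_cong[OF HOL.refl])
  also have "\<dots> = {word_val G x u}" using free_cong.refl[OF u] by blast
  finally show ?thesis unfolding word_hom_def by (simp only: the_elem_eq)
qed

lemma free_group_carrierE:
  assumes "A \<in> carrier (free_group S)"
  obtains u where "u \<in> words S" "A = free_cong S `` {u}"
proof -
  have "A \<in> words S // free_cong S" using assms by (simp add: free_group_def)
  then show thesis by (rule quotientE) (rule that)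
qed

lemma word_hom_hom:
  assumes x: "\<And>s. s \<in> S \<Longrightarrow> x s \<in> carrier G"
  shows "word_hom x \<in> hom (free_group S) G"
proof (rule homI)
  fix A assume "A \<in> carrier (free_group S)"
  then obtain u where u: "u \<in> words S" "A = free_cong S `` {u}" by (rule free_group_carrierE)
  then show "word_hom x A \<in> carrier G" using word_hom_class[OF u(1), of x] word_val_closed[OF u(1), of x] x by simp
  fix B assume "B \<in> carrier (free_group S)"
  then obtain v where v: "v \<in> words S" "B = free_cong S `` {v}" by (rule free_group_carrierE)
  have "word_hom x (free_cong S `` {u @ v}) = word_val G x (u @ v)"
    using u v x by (intro word_hom_class) auto
  then show "word_hom x (A \<otimes>\<^bsub>free_group S\<^esub> B) = word_hom x A \<otimes> word_hom x B"
    using u v x word_hom_class[OF u(1), of x] word_hom_class[OF v(1), of x] word_val_append[OF u(1) v(1), of x]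
    by (simp add: free_group_mult)
qed

lemma word_hom_normal_closure:
  assumes x: "\<And>s. s \<in> S \<Longrightarrow> x s \<in> carrier G" and R: "R \<subseteq> carrier (free_group S)" "\<And>A. A \<in> R \<Longrightarrow> word_hom x A = \<one>"
    and A: "A \<in> normal_closure (free_group S) R"
  shows "word_hom x A = \<one>"
proof -
  have "word_hom x \<in> hom (free_group S) G" by (rule word_hom_hom[OF x])
  then interpret h: group_hom "free_group S" G "word_hom x"
    using group_free_group is_group by (simp add: group_hom_def group_hom_axioms_def)
  have "R \<subseteq> kernel (free_group S) G (word_hom x)" using R by (auto simp: kernel_def)
  then have "A \<in> kernel (free_group S) G (word_hom x)"
    using A h.normal_kernel unfolding normal_closure_def by blast
  then show ?thesis by (simp add: kernel_def)
qed

end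

text \<open>Von Dyck's theorem in terms of words, so that the relators can be written as equations
  of a formula. The target \<open>K\<close> has the type of \<open>G\<close>, as it will be
  \<open>G\<close> with smaller carrier.\<close>

lemma finitely_presented_presentation:
  fixes G :: "('a, 'b) monoid_scheme"
  assumes G: "group G" and fp: "finitely_presented G"
  shows "\<exists>(n::nat) x T. finite T \<and> T \<subseteq> words {..<n} \<and> (\<forall>s<n. x s \<in> carrier G) \<and>
    (\<forall>u\<in>T. word_val G x u = \<one>\<^bsub>G\<^esub>) \<and> (\<forall>g\<in>carrier G. \<exists>u\<in>words {..<n}. g = word_val G x u) \<and>
    (\<forall>(K :: ('a, 'b) monoid_scheme) y. group K \<longrightarrow> (\<forall>s<n. y s \<in> carrier K) \<longrightarrow> (\<forall>u\<in>T. word_val K y u = \<one>\<^bsub>K\<^esub>) \<longrightarrow>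
      (\<forall>u\<in>words {..<n}. \<forall>v\<in>words {..<n}. word_val G x u = word_val G x v \<longrightarrow> word_val K y u = word_val K y v))"
proof -
  interpret G: group G by (rule G)
  obtain n :: nat and R where R: "finite R" "R \<subseteq> carrier (free_group {..<n})" "presented_group {..<n} R \<cong> G"
    using fp unfolding finitely_presented_def by blast
  define F where "F = free_group {..<n}"
  define N where "N = normal_closure F R"
  interpret F: group F unfolding F_def by (rule group_free_group)
  interpret N: normal N F unfolding N_def using F.normal_closure_normal R(2) by (simp add: F_def)
  obtain \<psi> where \<psi>: "\<psi> \<in> iso (F Mod N) G"
    using R(3) unfolding presented_group_def is_iso_def F_def N_def by blast
  define cl where "cl u = free_cong {..<n} `` {u}" for u
  have cl: "cl u \<in> carrier F" if "u \<in> words {..<n}" for u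
    using that by (auto simp: F_def free_group_def cl_def intro: quotientI)
  have cl_mult: "cl u \<otimes>\<^bsub>F\<^esub> cl v = cl (u @ v)" if "u \<in> words {..<n}" "v \<in> words {..<n}" for u v
    using free_group_mult[OF that] by (simp add: F_def cl_def)
  have cl_Nil: "cl [] = \<one>\<^bsub>F\<^esub>" by (simp add: F_def free_group_def cl_def)
  define \<theta> where "\<theta> = (\<lambda>A. \<psi> (N #>\<^bsub>F\<^esub> A))"
  have \<theta>: "\<theta> \<in> hom F G"
  proof -
    have "\<psi> \<circ> (\<lambda>a. N #>\<^bsub>F\<^esub> a) \<in> hom F G"
      using N.r_coset_hom_Mod \<psi> by (intro hom_compose[of _ F "F Mod N"]) (auto simp: iso_def)
    then show ?thesis by (simp add: \<theta>_def comp_def)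
  qed
  interpret \<theta>: group_hom F G \<theta>
    using \<theta> by (simp add: group_hom_def group_hom_axioms_def F.is_group G)
  define x where "x s = \<theta> (cl [(s, True)])" for s
  have w1: "[(s, b)] \<in> words {..<n}" if "s < n" for s b using that by (simp add: words_def)
  have x: "x s \<in> carrier G" if "s < n" for s
    using cl[OF w1[OF that]] by (simp add: x_def)
  have inv_x: "\<theta> (cl [(s, False)]) = inv\<^bsub>G\<^esub> (x s)" if s: "s < n" for s
  proof -
    have "([(s, False), (s, True)], []) \<in> free_cong {..<n}"
      using free_cong.cancel[of "[]" "{..<n}" "[]" s False] s by (simp add: words_def)
    then have "cl [(s, False), (s, True)] = cl []"
      unfolding cl_def using equiv_class_eq[OF equiv_free_cong] by blast
    then have "cl [(s, False)] \<otimes>\<^bsub>F\<^esub> cl [(s, True)] = \<one>\<^bsub>F\<^esub>"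
      using cl_mult[OF w1 w1, OF s s] cl_Nil by simp
    then have "\<theta> (cl [(s, False)]) \<otimes>\<^bsub>G\<^esub> x s = \<one>\<^bsub>G\<^esub>"
      using cl[OF w1[OF s]] unfolding x_def by (simp flip: \<theta>.hom_mult)
    then show ?thesis using G.inv_equality[of "\<theta> (cl [(s, False)])" "x s"] x[OF s] cl[OF w1[OF s]] by simp
  qed
  have \<theta>_cl: "\<theta> (cl u) = word_val G x u" if "u \<in> words {..<n}" for u
    using that
  proof (induction u)
    case Nil
    then show ?case using cl_Nil by simp
  next
    case (Cons l u)
    have l: "fst l < n" "u \<in> words {..<n}" "[l] \<in> words {..<n}" using Cons.prems by (auto simp: words_def)
    have "cl (l # u) = cl [l] \<otimes>\<^bsub>F\<^esub> cl u" using cl_mult[OF l(3,2)] by simp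
    then have "\<theta> (cl (l # u)) = \<theta> (cl [l]) \<otimes>\<^bsub>G\<^esub> word_val G x u"
      using cl[OF l(2)] cl[OF l(3)] Cons.IH[OF l(2)] by simp
    moreover have "\<theta> (cl [l]) = (if snd l then x (fst l) else inv\<^bsub>G\<^esub> (x (fst l)))"
      using inv_x[OF l(1)] by (cases l) (auto simp: x_def)
    ultimately show ?case by simp
  qed
  \<comment> \<open>Relators are classes of words; formulas need one representative of each.\<close>
  define T where "T = (\<lambda>A. SOME u. u \<in> words {..<n} \<and> A = cl u) ` R"
  have T: "\<exists>u\<in>T. u \<in> words {..<n} \<and> A = cl u" if "A \<in> R" for A
  proof -
    have "\<exists>u. u \<in> words {..<n} \<and> A = cl u"
      using that R(2) G.free_group_carrierE unfolding cl_def by blast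
    then show ?thesis using someI_ex that unfolding T_def by (metis (mono_tags, lifting) imageI)
  qed
  have T': "u \<in> words {..<n} \<and> cl u \<in> R" if "u \<in> T" for u
  proof -
    from that obtain A where A: "A \<in> R" "u = (SOME u. u \<in> words {..<n} \<and> A = cl u)" unfolding T_def by blast
    have "\<exists>u. u \<in> words {..<n} \<and> A = cl u"
      using A(1) R(2) G.free_group_carrierE unfolding cl_def by blast
    then show ?thesis using someI_ex A by (metis (mono_tags, lifting))
  qed
  have RN: "R \<subseteq> N" unfolding N_def normal_closure_def by blast
  have in_N: "A \<in> N" if A: "A \<in> carrier F" "\<theta> A = \<one>\<^bsub>G\<^esub>" for A
  proof -
    have "\<psi> (N #>\<^bsub>F\<^esub> A) = \<psi> (N #>\<^bsub>F\<^esub> \<one>\<^bsub>F\<^esub>)" using A(2) \<theta>.hom_one by (simp add: \<theta>_def)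
    moreover have "N #>\<^bsub>F\<^esub> A \<in> carrier (F Mod N)" "N #>\<^bsub>F\<^esub> \<one>\<^bsub>F\<^esub> \<in> carrier (F Mod N)"
      using F.rcosetsI[OF N.subset A(1)] F.rcosetsI[OF N.subset F.one_closed] unfolding FactGroup_def by simp_all
    ultimately have "N #>\<^bsub>F\<^esub> A = N #>\<^bsub>F\<^esub> \<one>\<^bsub>F\<^esub>"
      using \<psi> unfolding iso_def bij_betw_def by (auto dest: inj_onD)
    then have "A \<in> N #>\<^bsub>F\<^esub> \<one>\<^bsub>F\<^esub>" using F.rcos_self[OF A(1) N.is_subgroup] by simp
    then show ?thesis using N.subset by (simp add: F.coset_mult_one)
  qed
  show ?thesis
  proof (intro exI[of _ n] exI[of _ x] exI[of _ T] conjI ballI allI impI)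
    show "finite T" using R(1) by (simp add: T_def)
    show "T \<subseteq> words {..<n}" using T' by blast
    show "x s \<in> carrier G" if "s < n" for s using x that .
    show "word_val G x u = \<one>\<^bsub>G\<^esub>" if "u \<in> T" for u
    proof -
      have u: "u \<in> words {..<n}" "cl u \<in> N" using T'[OF that] RN by auto
      have "N #>\<^bsub>F\<^esub> cl u = N #>\<^bsub>F\<^esub> \<one>\<^bsub>F\<^esub>"
        using F.coset_join2[OF cl[OF u(1)] N.is_subgroup u(2)] N.subset by (simp add: F.coset_mult_one)
      then have "\<theta> (cl u) = \<theta> \<one>\<^bsub>F\<^esub>" by (simp add: \<theta>_def)
      then show ?thesis using \<theta>_cl[OF u(1)] by simp
    qed
    show "\<exists>u\<in>words {..<n}. g = word_val G x u" if g: "g \<in> carrier G" for g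
    proof -
      have "\<psi> ` carrier (F Mod N) = carrier G" using \<psi> by (simp add: iso_def bij_betw_def)
      then obtain C where C: "C \<in> carrier (F Mod N)" "g = \<psi> C" using g by blast
      then obtain A where A: "A \<in> carrier F" "C = N #>\<^bsub>F\<^esub> A" by (auto simp: FactGroup_def RCOSETS_def)
      then obtain u where u: "u \<in> words {..<n}" "A = cl u"
        using G.free_group_carrierE unfolding F_def cl_def by blast
      then show ?thesis using C A \<theta>_cl by (auto simp: \<theta>_def)
    qed
    fix K :: "('a, 'b) monoid_scheme" and y u v
    assume K: "group K" and y: "\<forall>s<n. y s \<in> carrier K" and rel: "\<forall>u\<in>T. word_val K y u = \<one>\<^bsub>K\<^esub>"
      and uv: "u \<in> words {..<n}" "v \<in> words {..<n}" "word_val G x u = word_val G x v"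
    interpret K: group K by (rule K)
    have y': "\<And>s. s \<in> {..<n} \<Longrightarrow> y s \<in> carrier K" using y by simp
    have h: "K.word_hom y \<in> hom F K" unfolding F_def by (rule K.word_hom_hom[OF y'])
    interpret h: group_hom F K "K.word_hom y"
      using h by (simp add: group_hom_def group_hom_axioms_def F.is_group K)
    have hcl: "K.word_hom y (cl u) = word_val K y u" if "u \<in> words {..<n}" for u
      unfolding cl_def by (rule K.word_hom_class[OF that y'])
    have hR: "K.word_hom y A = \<one>\<^bsub>K\<^esub>" if "A \<in> R" for A
      using T[OF that] rel hcl by auto
    let ?A = "cl u \<otimes>\<^bsub>F\<^esub> inv\<^bsub>F\<^esub> cl v"
    have c: "cl u \<in> carrier F" "cl v \<in> carrier F" using cl uv by auto
    have "\<theta> ?A = \<one>\<^bsub>G\<^esub>" using c \<theta>_cl uv G.word_val_closed[OF uv(2), of x] x by (simp add: \<theta>.hom_inv)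
    then have "?A \<in> N" using c by (intro in_N) auto
    then have "K.word_hom y ?A = \<one>\<^bsub>K\<^esub>"
      using K.word_hom_normal_closure[OF y' R(2) hR] unfolding N_def F_def by blast
    then have "K.word_hom y (cl u) \<otimes>\<^bsub>K\<^esub> inv\<^bsub>K\<^esub> K.word_hom y (cl v) = \<one>\<^bsub>K\<^esub>"
      using c by (simp add: h.hom_inv)
    then have "K.word_hom y (cl u) = K.word_hom y (cl v)"
      using c K.inv_solve_right'[of "\<one>\<^bsub>K\<^esub>" "K.word_hom y (cl u)" "K.word_hom y (cl v)"] by simp
    then show "word_val K y u = word_val K y v" using hcl uv by simp
  qed
qed

text \<open>A homomorphism from a finitely presented group that is injective on a finite set is a solution of a
  finite system of equations and inequations.\<close>

lemma existentially_closed_homs: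
  fixes G :: "('a, 'b) monoid_scheme"
  assumes G: "group G" and fp: "finitely_presented G" and ec: "existentially_closed H G"
    and ab: "a \<in> H" "b \<in> H"
  shows "\<exists>Y. finite Y \<and> Y \<subseteq> carrier G \<and> generate G Y = carrier G \<and>
    (\<forall>F. finite F \<longrightarrow> F \<subseteq> carrier G \<longrightarrow>
      (\<exists>f\<in>hom G (G\<lparr>carrier := H\<rparr>). f a = a \<and> f b = b \<and> inj_on f F))"
proof -
  interpret G: group G by (rule G)
  have H: "subgroup H G" using ec by (simp add: existentially_closed_def)
  let ?K = "G\<lparr>carrier := H\<rparr>"
  interpret K: group ?K using H G.subgroup_imp_group by blast
  obtain n :: nat and x and T where T: "finite T" "T \<subseteq> words {..<n}" and x': "\<forall>s<n. x s \<in> carrier G"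
    and relG: "\<forall>u\<in>T. word_val G x u = \<one>\<^bsub>G\<^esub>"
    and gen: "\<forall>g\<in>carrier G. \<exists>u\<in>words {..<n}. g = word_val G x u"
    and univ: "\<forall>(K :: ('a, 'b) monoid_scheme) y. group K \<longrightarrow> (\<forall>s<n. y s \<in> carrier K) \<longrightarrow> (\<forall>u\<in>T. word_val K y u = \<one>\<^bsub>K\<^esub>) \<longrightarrow>
      (\<forall>u\<in>words {..<n}. \<forall>v\<in>words {..<n}. word_val G x u = word_val G x v \<longrightarrow> word_val K y u = word_val K y v)"
    using finitely_presented_presentation[OF G fp] by (elim exE conjE) (rule that)
  have x: "x s \<in> carrier G" if "s < n" for s using x' that by blast
  obtain wd where wd: "\<And>g. g \<in> carrier G \<Longrightarrow> wd g \<in> words {..<n} \<and> word_val G x (wd g) = g"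
    using gen by metis
  have cut: "word_val K' (\<lambda>i. if i < n then z i else e i) u = word_val K' z u" if "u \<in> words {..<n}"
    for K' :: "('a, 'b) monoid_scheme" and z e u
    using that by (induction u) (auto simp: words_def)
  have abG: "a \<in> carrier G" "b \<in> carrier G" using ab subgroup.subset[OF H] by auto
  have "generate G (x ` {..<n}) = carrier G"
  proof
    show "generate G (x ` {..<n}) \<subseteq> carrier G" by (intro G.generate_incl image_subsetI) (use x in simp)
    have "word_val G x u \<in> generate G (x ` {..<n})" if "u \<in> words {..<n}" for u
      using that by (induction u) (auto simp: words_def intro!: generate.eng intro: generate.one generate.incl generate.inv)
    then show "carrier G \<subseteq> generate G (x ` {..<n})"
      using wd by (metis subsetI)
  qed
  moreover have "\<exists>f\<in>hom G ?K. f a = a \<and> f b = b \<and> inj_on f F" if F: "finite F" "F \<subseteq> carrier G" for F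
  proof -
    \<comment> \<open>The variables below \<open>n\<close> stand for the images of the generators
      and will be bound; \<open>n\<close> and \<open>Suc n\<close> carry the constants. The value
      \<one> elsewhere only keeps the valuation in \<open>H\<close>.\<close>
    define e where "e i = (if i = n then a else if i = Suc n then b else \<one>\<^bsub>G\<^esub>)" for i
    have e: "e i \<in> H" for i using ab subgroup.one_closed[OF H] by (simp add: e_def)
    obtain ts where ts: "set ts = T" using T(1) finite_list by blast
    obtain ps where ps: "set ps = {(g, h). g \<in> F \<and> h \<in> F \<and> g \<noteq> h}"
      using finite_list[of "{(g, h). g \<in> F \<and> h \<in> F \<and> g \<noteq> h}"] F(1)
        finite_subset[of "{(g, h). g \<in> F \<and> h \<in> F \<and> g \<noteq> h}" "F \<times> F"] by auto
    define \<psi> where "\<psi> = conjunction (map (\<lambda>u. Eq (word_term u) Unit) ts @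
      [Eq (word_term (wd a)) (Var n), Eq (word_term (wd b)) (Var (Suc n))] @
      map (\<lambda>(g, h). Neg (Eq (word_term (wd g)) (word_term (wd h)))) ps)"
    have sat: "satisfies K' (\<lambda>i. if i < n then z i else e i) \<psi> \<longleftrightarrow>
        (\<forall>u\<in>T. word_val K' z u = \<one>\<^bsub>K'\<^esub>) \<and> word_val K' z (wd a) = a \<and> word_val K' z (wd b) = b \<and>
        (\<forall>g\<in>F. \<forall>h\<in>F. g \<noteq> h \<longrightarrow> word_val K' z (wd g) \<noteq> word_val K' z (wd h))"
      for K' :: "('a, 'b) monoid_scheme" and z
    proof -
      have "wd g \<in> words {..<n}" if "g \<in> F" for g using wd F(2) that by blast
      then show ?thesis
        using T(2) wd[OF abG(1)] wd[OF abG(2)] unfolding \<psi>_def satisfies_conjunction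
        by (auto simp: ts ps ball_Un gterm_val_word cut e_def subset_iff)
    qed
    \<comment> \<open>In \<open>G\<close> the generators themselves are a solution; existential
      closedness moves one into \<open>H\<close>.\<close>
    have "satisfies G e (exists_below n \<psi>)"
      unfolding satisfies_exists_below using x relG wd abG F(2) by (intro exI[of _ x]) (auto simp: sat subset_iff)
    moreover have "existential (exists_below n \<psi>)"
      by (intro existential_exists_below existential.intros(1)) (auto simp: \<psi>_def quantifier_free_conjunction)
    ultimately have "satisfies ?K e (exists_below n \<psi>)"
      using ec e unfolding existentially_closed_def by blast
    then obtain y where y': "\<forall>s<n. y s \<in> H" "\<forall>u\<in>T. word_val ?K y u = \<one>\<^bsub>?K\<^esub>"
      "word_val ?K y (wd a) = a" "word_val ?K y (wd b) = b"
      "\<forall>g\<in>F. \<forall>h\<in>F. g \<noteq> h \<longrightarrow> word_val ?K y (wd g) \<noteq> word_val ?K y (wd h)"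
      unfolding satisfies_exists_below sat by auto
    have y: "\<And>s. s < n \<Longrightarrow> y s \<in> H" "\<And>u. u \<in> T \<Longrightarrow> word_val ?K y u = \<one>\<^bsub>?K\<^esub>"
      "word_val ?K y (wd a) = a" "word_val ?K y (wd b) = b"
      "\<And>g h. \<lbrakk>g \<in> F; h \<in> F; g \<noteq> h\<rbrakk> \<Longrightarrow> word_val ?K y (wd g) \<noteq> word_val ?K y (wd h)"
      using y' by blast+
    define f where "f g = word_val ?K y (wd g)" for g
    have f: "f (word_val G x u) = word_val ?K y u" if u: "u \<in> words {..<n}" for u
    proof -
      have "word_val G x u \<in> carrier G" using G.word_val_closed[OF u] x by simp
      then show ?thesis
        unfolding f_def using wd u y
        by (intro univ[rule_format, where K = ?K] K.is_group) auto
    qed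
    have "f \<in> hom G ?K"
    proof (rule homI)
      fix g assume g: "g \<in> carrier G"
      show "f g \<in> carrier ?K"
        unfolding f_def using K.word_val_closed[of "wd g" "{..<n}" y] wd[OF g] y(1) by simp
      fix h assume h: "h \<in> carrier G"
      have w: "wd g \<in> words {..<n}" "wd h \<in> words {..<n}" using wd g h by auto
      have "g \<otimes>\<^bsub>G\<^esub> h = word_val G x (wd g @ wd h)"
        using G.word_val_append[OF w, of x] x wd g h by simp
      then show "f (g \<otimes>\<^bsub>G\<^esub> h) = f g \<otimes>\<^bsub>?K\<^esub> f h"
        using f[of "wd g @ wd h"] w K.word_val_append[OF w, of y] y(1) by (simp add: f_def)
    qed
    then show ?thesis using y by (intro bexI[of _ f]) (auto simp: f_def inj_on_def)
  qed
  ultimately show ?thesis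
    using x by (intro exI[of _ "x ` {..<n}"]) auto
qed

section \<open>Limits of actions along discriminating families of homomorphisms\<close>

text \<open>The images of \<open>a\<close> and \<open>b\<close> do not depend on \<open>i\<close>,
  so the estimates for their orbits pass to any limit. Separation is required for pairs only; a
  filter extends it to finite sets.\<close>

locale discriminating_family = isometric_action M d K \<psi> + Q: group Q
  for M :: "'x set" and d and K :: "('a, 'c) monoid_scheme" and \<psi> :: "'a \<Rightarrow> 'x \<Rightarrow> 'x"
    and Q :: "('g, 'e) monoid_scheme" (structure) +
  fixes W :: "'i filter" and f :: "'i \<Rightarrow> 'g \<Rightarrow> 'a" and \<delta> :: real and a b :: 'g and a' b' :: 'a and p :: 'x
  assumes W: "ultrafilter W" and f_hom: "f i \<in> hom Q K"
    and separate: "\<lbrakk>g \<in> carrier Q; h \<in> carrier Q; g \<noteq> h\<rbrakk> \<Longrightarrow> eventually (\<lambda>i. f i g \<noteq> f i h) W"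
    and ab: "a \<in> carrier Q" "b \<in> carrier Q" "f i a = a'" "f i b = b'"
    and hyp: "delta_hyperbolic \<delta>" "0 \<le> \<delta>" and geo: geodesic_space and acyl: acylindrical
    and ind: "independent_loxodromics a' b'" and p: "p \<in> M"
begin

lemma W_bot: "W \<noteq> bot"
  using W by (simp add: ultrafilter_def)

lemma f_group_hom: "group_hom Q K (f i)"
  using f_hom G.is_group Q.is_group by (simp add: group_hom_def group_hom_axioms_def)

lemma f_closed [simp]: "g \<in> carrier Q \<Longrightarrow> f i g \<in> carrier K"
  using group_hom.hom_closed[OF f_group_hom] .

lemma f_mult: "\<lbrakk>g \<in> carrier Q; h \<in> carrier Q\<rbrakk> \<Longrightarrow> f i (g \<otimes> h) = f i g \<otimes>\<^bsub>K\<^esub> f i h"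
  using group_hom.hom_mult[OF f_group_hom] .

lemma f_one: "f i \<one> = \<one>\<^bsub>K\<^esub>"
  using group_hom.hom_one[OF f_group_hom] .

lemma f_inv: "g \<in> carrier Q \<Longrightarrow> f i (inv g) = inv\<^bsub>K\<^esub> f i g"
  using group_hom.hom_inv[OF f_group_hom] .

lemma f_pow: "g \<in> carrier Q \<Longrightarrow> f i (g [^] (n::int)) = f i g [^]\<^bsub>K\<^esub> n"
  using group_hom.hom_int_pow[OF f_group_hom] .

lemma act_in [simp]: "\<lbrakk>g \<in> carrier Q; x \<in> M\<rbrakk> \<Longrightarrow> \<psi> (f i g) x \<in> M"
  by (simp add: act_closed)

lemma tendsto_unique_W: "\<lbrakk>(u \<longlongrightarrow> l) W; (u \<longlongrightarrow> m) W\<rbrakk> \<Longrightarrow> l = (m::real)"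
  using tendsto_unique[OF W_bot] .

lemma eventually_injective:
  assumes "finite F" "F \<subseteq> carrier Q"
  shows "eventually (\<lambda>i. inj_on (f i) F) W"
proof -
  have "eventually (\<lambda>i. \<forall>g\<in>F. \<forall>h\<in>F. g \<noteq> h \<longrightarrow> f i g \<noteq> f i h) W"
  proof (intro eventually_ball_finite[OF assms(1)] ballI)
    fix g h assume "g \<in> F" "h \<in> F"
    then show "eventually (\<lambda>i. g \<noteq> h \<longrightarrow> f i g \<noteq> f i h) W"
      using separate[of g h] assms(2) by (cases "g = h") auto
  qed
  then show ?thesis by (rule eventually_mono) (auto simp: inj_on_def)
qed

lemma eventually_ball_F: "\<lbrakk>finite F; \<And>g. g \<in> F \<Longrightarrow> eventually (\<lambda>i. P i g) W\<rbrakk> \<Longrightarrow> eventually (\<lambda>i. \<forall>g\<in>F. P i g) W"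
  by (intro eventually_ball_finite) auto

text \<open>On the unscaled limit, finitely many elements with small displacements are mapped
  injectively, for suitable \<open>i\<close>, to elements of \<open>K\<close> with small
  displacements at the corresponding points. The bound for \<open>K\<close> thus holds for the
  limit.\<close>

lemma acylindrically_hyperbolic_if_bounded:
  assumes bounded: "\<And>g. g \<in> carrier Q \<Longrightarrow> \<exists>C. eventually (\<lambda>i. d p (\<psi> (f i g) p) \<le> C) W"
  shows "acylindrically_hyperbolic TYPE(('i \<Rightarrow> 'x) \<Rightarrow> real) Q"
proof -
  define V where "V = {x. (\<forall>i. x i \<in> M) \<and> (\<exists>C. eventually (\<lambda>i. d p (x i) \<le> C) W)}"
  define D where "D x y = Lim W (\<lambda>i. d (x i) (y i))" for x y
  define act where "act g x = (\<lambda>i. \<psi> (f i g) (x i))" for g x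
  have VM: "x i \<in> M" if "x \<in> V" for x i using that by (simp add: V_def)
  have D: "((\<lambda>i. d (x i) (y i)) \<longlongrightarrow> D x y) W" if xy: "x \<in> V" "y \<in> V" for x y
  proof -
    obtain C C' where C: "eventually (\<lambda>i. d p (x i) \<le> C) W" "eventually (\<lambda>i. d p (y i) \<le> C') W"
      using xy by (auto simp: V_def)
    have "eventually (\<lambda>i. \<bar>d (x i) (y i)\<bar> \<le> C + C') W"
      using C
    proof eventually_elim
      case (elim i)
      show ?case using triangle[OF VM[OF xy(1), of i] p VM[OF xy(2), of i]] elim commute[of p "x i"] by simp
    qed
    from ultrafilter_limit[OF W this] obtain l where "((\<lambda>i. d (x i) (y i)) \<longlongrightarrow> l) W" by blast
    then show ?thesis unfolding D_def using tendsto_Lim[OF W_bot] by blast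
  qed
  have D_eq: "D x y = l" if "x \<in> V" "y \<in> V" "((\<lambda>i. d (x i) (y i)) \<longlongrightarrow> l) W" for x y l
    using tendsto_unique_W[OF D[OF that(1,2)] that(3)] .
  have act_V: "act g x \<in> V" if g: "g \<in> carrier Q" and x: "x \<in> V" for g x
  proof -
    obtain C C' where C: "eventually (\<lambda>i. d p (\<psi> (f i g) p) \<le> C) W" "eventually (\<lambda>i. d p (x i) \<le> C') W"
      using bounded[OF g] x by (auto simp: V_def)
    have "eventually (\<lambda>i. d p (act g x i) \<le> C + C') W"
      using C
    proof eventually_elim
      case (elim i)
      have "d (\<psi> (f i g) p) (\<psi> (f i g) (x i)) = d p (x i)"
        using g VM[OF x] p by (intro isometry) auto
      then show ?case
        using triangle[OF p act_in[OF g p, of i] act_in[OF g VM[OF x, of i], of i]] elim by (simp add: act_def)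
    qed
    then show ?thesis using g VM[OF x] by (auto simp: V_def act_def)
  qed
  have const_V: "(\<lambda>i. x) \<in> V" if "x \<in> M" for x using that by (auto simp: V_def intro: exI[of _ "d p x"])
  have D_const: "D (\<lambda>i. x) (\<lambda>i. y) = d x y" if "x \<in> M" "y \<in> M" for x y
    using D_eq[OF const_V const_V] that by simp
  interpret A: pseudometric_action V D Q act
  proof unfold_locales
    show "V \<noteq> {}" using const_V[OF p] by blast
    fix x assume x: "x \<in> V"
    show "D x x = 0"
      using VM[OF x] by (intro D_eq[OF x x]) simp
    show "act \<one> x = x" using VM[OF x] by (simp add: act_def f_one act_one)
    fix y assume y: "y \<in> V"
    show "D x y = D y x"
      using D[OF y x] by (intro D_eq[OF x y]) (simp add: commute)
    show "D (act g x) (act g y) = D x y" if g: "g \<in> carrier Q" for g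
    proof (rule D_eq[OF act_V[OF g x] act_V[OF g y]])
      have "d (act g x i) (act g y i) = d (x i) (y i)" for i
        unfolding act_def using g VM x y by (intro isometry) auto
      then show "((\<lambda>i. d (act g x i) (act g y i)) \<longlongrightarrow> D x y) W" using D[OF x y] by simp
    qed
    show "act (g \<otimes> h) x = act g (act h x)" if "g \<in> carrier Q" "h \<in> carrier Q" for g h
      using that VM[OF x] by (simp add: act_def f_mult act_mult)
    fix z assume z: "z \<in> V"
    show "D x z \<le> D x y + D y z"
      using triangle[OF VM[OF x] VM[OF y] VM[OF z]]
      by (intro tendsto_le[OF W_bot tendsto_add[OF D[OF x y] D[OF y z]] D[OF x z]] always_eventually) auto
  qed (rule act_V)
  have f_a: "f i (a [^] n) = a' [^]\<^bsub>K\<^esub> n" "f i (b [^] n) = b' [^]\<^bsub>K\<^esub> n" for i and n :: int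
    using ab by (auto simp: f_pow)
  have act_const: "act (a [^] n) (\<lambda>i. p) = (\<lambda>i. \<psi> (a' [^]\<^bsub>K\<^esub> n) p)" "act (b [^] n) (\<lambda>i. p) = (\<lambda>i. \<psi> (b' [^]\<^bsub>K\<^esub> n) p)" for n :: int
    by (simp_all add: act_def f_a)
  have lox: "loxodromic a'" "loxodromic b'" and ab': "a' \<in> carrier K" "b' \<in> carrier K"
    using ind by (auto simp: independent_loxodromics_def loxodromic_def)
  have orb: "\<psi> (a' [^]\<^bsub>K\<^esub> n) p \<in> M" "\<psi> (b' [^]\<^bsub>K\<^esub> n) p \<in> M" for n :: int using ab' p by auto
  obtain L1 C1 where L1: "0 < L1" "\<And>n::int. \<bar>real_of_int n\<bar> / L1 - C1 \<le> d p (\<psi> (a' [^]\<^bsub>K\<^esub> n) p)"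
    using loxodromic_lower[OF lox(1) p] by blast
  obtain L2 C2 where L2: "0 < L2" "\<And>n::int. \<bar>real_of_int n\<bar> / L2 - C2 \<le> d p (\<psi> (b' [^]\<^bsub>K\<^esub> n) p)"
    using loxodromic_lower[OF lox(2) p] by blast
  obtain B where B: "\<And>(m::int) (n::int). gromov_product p (\<psi> (a' [^]\<^bsub>K\<^esub> m) p) (\<psi> (b' [^]\<^bsub>K\<^esub> n) p) \<le> B"
    using independent_bounded[OF hyp ind p] by blast
  show ?thesis
  proof (rule A.acylindrically_hyperbolicI[where \<delta> = \<delta> and C = 0 and b = "\<lambda>i. p" and g = a and h = b and L = "max L1 L2"
        and K = "max C1 C2" and B = "2 * B"])
    fix x y z v assume V: "x \<in> V" "y \<in> V" "z \<in> V" "v \<in> V"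
    show "D x z + D y v \<le> max (D x y + D z v) (D y z + D x v) + 2 * \<delta>"
    proof (rule tendsto_le[OF W_bot])
      show "((\<lambda>i. max (d (x i) (y i) + d (z i) (v i)) (d (y i) (z i) + d (x i) (v i)) + 2 * \<delta>) \<longlongrightarrow>
          max (D x y + D z v) (D y z + D x v) + 2 * \<delta>) W"
        using V by (intro tendsto_intros tendsto_max D)
      show "((\<lambda>i. d (x i) (z i) + d (y i) (v i)) \<longlongrightarrow> D x z + D y v) W"
        using V by (intro tendsto_intros D)
    qed (intro always_eventually allI four_point[OF hyp(1)] VM V)
  next
    fix x y s t assume V: "x \<in> V" "y \<in> V" and st: "0 \<le> s" "0 \<le> t" "D x y \<le> s + t"
    \<comment> \<open>At single indices the distance may be smaller than \<open>s\<close> or larger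
      than \<open>s + t\<close>; the maximum covers both, and only its limit has to be at most
      \<open>t\<close>.\<close>
    have "\<exists>z\<in>M. d (x i) z \<le> s \<and> d z (y i) \<le> max 0 (d (x i) (y i) - s)" for i
    proof -
      obtain c where c: "geodesic c (x i) (y i)" using geodesic_exists[OF geo VM[OF V(1)] VM[OF V(2)]] .
      let ?t = "min s (d (x i) (y i))"
      have "0 \<le> ?t" "?t \<le> d (x i) (y i)" using st by auto
      note g = geodesicD[OF c this]
      show ?thesis using g by (intro bexI[of _ "c ?t"]) auto
    qed
    then obtain z where z: "\<And>i. z i \<in> M" "\<And>i. d (x i) (z i) \<le> s" "\<And>i. d (z i) (y i) \<le> max 0 (d (x i) (y i) - s)"
      by metis
    obtain C where C: "eventually (\<lambda>i. d p (x i) \<le> C) W" using V(1) by (auto simp: V_def)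
    have "eventually (\<lambda>i. d p (z i) \<le> C + s) W"
      using C
    proof eventually_elim
      case (elim i)
      then show ?case using triangle[OF p VM[OF V(1), of i] z(1)[of i]] z(2)[of i] by simp
    qed
    then have zV: "z \<in> V" using z by (auto simp: V_def)
    have "D x z \<le> s" using z(2) by (intro tendsto_le[OF W_bot tendsto_const D[OF V(1) zV]] always_eventually) auto
    moreover have "D z y \<le> max 0 (D x y - s)"
      using z(3) by (intro tendsto_le[OF W_bot tendsto_max[OF tendsto_const tendsto_diff[OF D[OF V] tendsto_const]] D[OF zV V(2)]]
          always_eventually) auto
    ultimately show "\<exists>v\<in>V. D x v \<le> s + 0 \<and> D v y \<le> t + 0"
      using st zV by (intro bexI[of _ z]) auto
  next
    fix \<epsilon> :: real assume "0 \<le> \<epsilon>"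
    \<comment> \<open>A limit of at most \<open>\<epsilon>\<close> makes the displacements
      eventually less than \<open>\<epsilon> + 1\<close>, not eventually at most
      \<open>\<epsilon>\<close>.\<close>
    then have "0 \<le> \<epsilon> + 1" by simp
    then obtain N :: nat and R where NR: "\<And>y z. \<lbrakk>y \<in> M; z \<in> M; d y z \<ge> R\<rbrakk> \<Longrightarrow>
       finite {g \<in> carrier K. d y (\<psi> g y) \<le> \<epsilon> + 1 \<and> d z (\<psi> g z) \<le> \<epsilon> + 1} \<and>
       card {g \<in> carrier K. d y (\<psi> g y) \<le> \<epsilon> + 1 \<and> d z (\<psi> g z) \<le> \<epsilon> + 1} \<le> N"
      using acyl unfolding acylindrical_def by meson
    show "\<exists>(N::nat) R. \<forall>x\<in>V. \<forall>y\<in>V. D x y \<ge> R \<longrightarrow>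
      (\<forall>F. finite F \<longrightarrow> F \<subseteq> {g \<in> carrier Q. D x (act g x) \<le> \<epsilon> \<and> D y (act g y) \<le> \<epsilon>} \<longrightarrow> card F \<le> N)"
    proof (intro exI[of _ N] exI[of _ "R + 1"] ballI allI impI)
      fix x y F assume V: "x \<in> V" "y \<in> V" and far: "R + 1 \<le> D x y" and fin: "finite F"
        and F: "F \<subseteq> {g \<in> carrier Q. D x (act g x) \<le> \<epsilon> \<and> D y (act g y) \<le> \<epsilon>}"
      have FQ: "F \<subseteq> carrier Q" using F by blast
      have small: "eventually (\<lambda>i. \<forall>g\<in>F. d (z i) (act g z i) \<le> \<epsilon> + 1) W" if z: "z \<in> V" "\<And>g. g \<in> F \<Longrightarrow> D z (act g z) \<le> \<epsilon>" for z
      proof (rule eventually_ball_F[OF fin])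
        fix g assume g: "g \<in> F"
        have gQ: "g \<in> carrier Q" using g FQ by blast
        have "D z (act g z) < \<epsilon> + 1" using z(2)[OF g] by simp
        from order_tendstoD(2)[OF D[OF z(1) act_V[OF gQ z(1)]] this]
        show "eventually (\<lambda>i. d (z i) (act g z i) \<le> \<epsilon> + 1) W" by (rule eventually_mono) simp
      qed
      have "R < D x y" using far by simp
      from order_tendstoD(1)[OF D[OF V] this] have "eventually (\<lambda>i. R < d (x i) (y i)) W" .
      moreover have "eventually (\<lambda>i. \<forall>g\<in>F. d (x i) (act g x i) \<le> \<epsilon> + 1) W" using F by (intro small V) auto
      moreover have "eventually (\<lambda>i. \<forall>g\<in>F. d (y i) (act g y i) \<le> \<epsilon> + 1) W" using F by (intro small V) auto
      moreover note eventually_injective[OF fin FQ]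
      ultimately have "eventually (\<lambda>i. card F \<le> N) W"
      proof eventually_elim
        case (elim i)
        have "f i ` F \<subseteq> {g \<in> carrier K. d (x i) (\<psi> g (x i)) \<le> \<epsilon> + 1 \<and> d (y i) (\<psi> g (y i)) \<le> \<epsilon> + 1}"
          using elim FQ by (auto simp: act_def)
        moreover have "R \<le> d (x i) (y i)" using elim by simp
        ultimately have "card (f i ` F) \<le> N"
          using NR[OF VM[OF V(1), of i] VM[OF V(2), of i]] card_mono order_trans by blast
        then show ?case using elim by (simp add: card_image)
      qed
      then show "card F \<le> N" using W_bot by (simp add: eventually_const_iff)
    qed
  next
    fix n :: nat
    have "real n / max L1 L2 \<le> real n / L1" "real n / max L1 L2 \<le> real n / L2"
      using L1(1) L2(1) by (auto intro!: divide_left_mono)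
    then show "real n / max L1 L2 - max C1 C2 \<le> D (\<lambda>i. p) (act (a [^] int n) (\<lambda>i. p))"
      "real n / max L1 L2 - max C1 C2 \<le> D (\<lambda>i. p) (act (b [^] int n) (\<lambda>i. p))"
      using L1(2)[of "int n"] L2(2)[of "int n"] unfolding act_const D_const[OF p orb(1)] D_const[OF p orb(2)] by simp_all
  next
    fix m n :: int
    show "D (\<lambda>i. p) (act (a [^] m) (\<lambda>i. p)) + D (\<lambda>i. p) (act (b [^] n) (\<lambda>i. p)) - D (act (a [^] m) (\<lambda>i. p)) (act (b [^] n) (\<lambda>i. p)) \<le> 2 * B"
      unfolding act_const D_const[OF p orb(1)] D_const[OF p orb(2)] D_const[OF orb]
      using B[of m n] commute[of p "\<psi> (a' [^]\<^bsub>K\<^esub> m) p"] commute[of p "\<psi> (b' [^]\<^bsub>K\<^esub> n) p"] unfolding gromov_product_def by argo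
  qed (use const_V p ab hyp L1 in auto)
qed

section \<open>Directions of escape of the orbits\<close>

definition pt :: "'g \<Rightarrow> 'i \<Rightarrow> 'x" where
  "pt g i = \<psi> (f i g) p"

lemma pt_in [simp]: "g \<in> carrier Q \<Longrightarrow> pt g i \<in> M"
  by (simp add: pt_def p)

lemma pt_one: "pt \<one> i = p"
  by (simp add: pt_def f_one act_one p)

lemma pt_mult: "\<lbrakk>g \<in> carrier Q; h \<in> carrier Q\<rbrakk> \<Longrightarrow> pt (g \<otimes> h) i = \<psi> (f i g) (pt h i)"
  by (simp add: pt_def f_mult act_mult p)

lemma dist_pt_left: "\<lbrakk>g \<in> carrier Q; x \<in> carrier Q; y \<in> carrier Q\<rbrakk> \<Longrightarrow> d (pt (g \<otimes> x) i) (pt (g \<otimes> y) i) = d (pt x i) (pt y i)"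
  by (simp add: pt_mult isometry)

definition same_direction :: "'g \<Rightarrow> 'g \<Rightarrow> bool" where
  "same_direction g h \<longleftrightarrow> fellow W p (pt g) (pt h)"

lemma same_direction_trans:
  "\<lbrakk>x \<in> carrier Q; y \<in> carrier Q; z \<in> carrier Q; same_direction x y; same_direction y z\<rbrakk> \<Longrightarrow> same_direction x z"
  unfolding same_direction_def using fellow_trans[OF hyp(1) p, of "pt x" "pt y" "pt z"] by simp

lemma same_direction_sym: "same_direction x y \<Longrightarrow> same_direction y x"
  unfolding same_direction_def by (rule fellow_sym)

text \<open>Such elements displace \<open>p\<close> by an amount independent of \<open>i\<close>,
  hence not at all in a rescaled limit.\<close>

definition fixed_image :: "'g \<Rightarrow> bool" where
  "fixed_image h \<longleftrightarrow> h \<in> carrier Q \<and> (\<exists>h'\<in>carrier K. \<forall>i. f i h = h')"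

lemma fixed_image_inv: "fixed_image h \<Longrightarrow> fixed_image (inv h)"
  unfolding fixed_image_def by (auto simp: f_inv)

lemma three_same_direction:
  assumes g: "g \<in> carrier Q" and far: "\<And>C. eventually (\<lambda>i. C \<le> d p (pt g i)) W"
  obtains h where "\<And>j::nat. fixed_image (h j)"
    "\<And>j k. \<lbrakk>j < k; k \<le> 2\<rbrakk> \<Longrightarrow> \<not> same_direction (h j \<otimes> g) (h k \<otimes> g)"
proof -
  obtain f0 where f0: "f0 \<in> {a', b'}"
    "\<And>j k. \<lbrakk>j < k; k \<le> (2::nat)\<rbrakk> \<Longrightarrow> \<not> fellow W p (\<lambda>i. \<psi> (f0 [^]\<^bsub>K\<^esub> int j) (pt g i)) (\<lambda>i. \<psi> (f0 [^]\<^bsub>K\<^esub> int k) (pt g i))"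
    using three_directions[OF hyp geo acyl ind W p pt_in[OF g] far] by blast
  obtain c where c: "c \<in> carrier Q" "\<And>i. f i c = f0" using f0(1) ab by auto
  have "f0 \<in> carrier K" using f_closed[OF c(1)] c(2) by metis
  then have "fixed_image (c [^] int j)" for j
    unfolding fixed_image_def using c by (auto simp: f_pow)
  moreover have "pt (c [^] int j \<otimes> g) = (\<lambda>i. \<psi> (f0 [^]\<^bsub>K\<^esub> int j) (pt g i))" for j
    using c g by (simp add: fun_eq_iff pt_mult f_pow)
  ultimately show thesis
    using f0(2) by (intro that[of "\<lambda>j. c [^] int j"]) (auto simp: same_direction_def)
qed

text \<open>Of three pairwise different directions at most one agrees with that of \<open>y\<close>.
  The same count with two directions then avoids a second element.\<close>

lemma two_directions_avoiding:
  assumes g: "g \<in> carrier Q" "\<And>C. eventually (\<lambda>i. C \<le> d p (pt g i)) W" and y: "y \<in> carrier Q"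
  obtains h h' where "fixed_image h" "fixed_image h'" "\<not> same_direction (h \<otimes> g) y" "\<not> same_direction (h' \<otimes> g) y"
    "\<not> same_direction (h \<otimes> g) (h' \<otimes> g)"
proof -
  obtain h where h: "\<And>j::nat. fixed_image (h j)" "\<And>j k. \<lbrakk>j < k; k \<le> 2\<rbrakk> \<Longrightarrow> \<not> same_direction (h j \<otimes> g) (h k \<otimes> g)"
    by (rule three_same_direction[OF g]) blast
  have c: "h j \<otimes> g \<in> carrier Q" for j using h(1)[of j] g by (simp add: fixed_image_def)
  have n: "\<not> same_direction (h j \<otimes> g) y \<or> \<not> same_direction (h k \<otimes> g) y" if "j < k" "k \<le> 2" for j k
    using same_direction_trans[OF c y c] same_direction_sym h(2)[OF that] by blast
  have hh: "\<not> same_direction (h 0 \<otimes> g) (h 1 \<otimes> g)" "\<not> same_direction (h 0 \<otimes> g) (h 2 \<otimes> g)" "\<not> same_direction (h 1 \<otimes> g) (h 2 \<otimes> g)"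
    using h(2) by auto
  show thesis
    using n[of 0 1] n[of 0 2] n[of 1 2] that[OF h(1)[of 0] h(1)[of 1] _ _ hh(1)] that[OF h(1)[of 0] h(1)[of 2] _ _ hh(2)]
      that[OF h(1)[of 1] h(1)[of 2] _ _ hh(3)] by auto
qed

lemma direction_avoiding:
  assumes g: "g \<in> carrier Q" "\<And>C. eventually (\<lambda>i. C \<le> d p (pt g i)) W" and y: "y \<in> carrier Q" and z: "z \<in> carrier Q"
  obtains h where "fixed_image h" "\<not> same_direction (h \<otimes> g) y" "\<not> same_direction (h \<otimes> g) z"
proof -
  obtain h h' where h: "fixed_image h" "fixed_image h'" "\<not> same_direction (h \<otimes> g) y" "\<not> same_direction (h' \<otimes> g) y"
    "\<not> same_direction (h \<otimes> g) (h' \<otimes> g)"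
    by (rule two_directions_avoiding[OF g y]) blast
  have c: "h \<otimes> g \<in> carrier Q" "h' \<otimes> g \<in> carrier Q" using h g by (auto simp: fixed_image_def)
  have "\<not> same_direction (h \<otimes> g) z \<or> \<not> same_direction (h' \<otimes> g) z"
    using same_direction_trans[OF c(1) z c(2)] same_direction_sym h(5) by blast
  then show thesis using that[OF h(1,3)] that[OF h(2,4)] by blast
qed

end

section \<open>The rescaled limit tree\<close>

locale escaping_family = discriminating_family M d K \<psi> Q W f \<delta> a b a' b' p
  for M :: "'x set" and d and K :: "('a, 'c) monoid_scheme" and \<psi> :: "'a \<Rightarrow> 'x \<Rightarrow> 'x"
    and Q :: "('g, 'e) monoid_scheme" (structure)
    and W :: "'i filter" and f :: "'i \<Rightarrow> 'g \<Rightarrow> 'a" and \<delta> :: real and a b :: 'g and a' b' :: 'a and p :: 'x +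
  fixes Y :: "'g set" and g0 :: 'g
  assumes Y: "finite Y" "Y \<subseteq> carrier Q" "generate Q Y = carrier Q"
    and g0: "g0 \<in> carrier Q" "\<not> (\<exists>C. eventually (\<lambda>i. d p (\<psi> (f i g0) p) \<le> C) W)"
begin

text \<open>Summing over a generating set bounds all rescaled orbits and prevents the limit from
  being trivial; the 1 allows division for every \<open>i\<close>.\<close>

definition \<Lambda> :: "'i \<Rightarrow> real" where
  "\<Lambda> i = 1 + (\<Sum>y\<in>Y. d p (pt y i))"

definition T :: "'g \<Rightarrow> 'g \<Rightarrow> real" where
  "T g h = Lim W (\<lambda>i. d (pt g i) (pt h i) / \<Lambda> i)"

lemma \<Lambda>_pos: "0 < \<Lambda> i"
  by (simp add: \<Lambda>_def add_pos_nonneg sum_nonneg)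

lemma orbit_le_\<Lambda>:
  assumes "g \<in> carrier Q"
  shows "\<exists>C\<ge>0. \<forall>i. d p (pt g i) \<le> C * \<Lambda> i"
proof -
  have "g \<in> generate Q Y" using assms Y(3) by simp
  then show ?thesis
  proof (induction g)
    case one
    then show ?case using p by (intro exI[of _ 0]) (simp add: pt_one)
  next
    case (incl h)
    have "d p (pt h i) \<le> 1 * \<Lambda> i" for i
      using member_le_sum[OF incl, of "\<lambda>y. d p (pt y i)"] Y(1) by (simp add: \<Lambda>_def)
    then show ?case by (intro exI[of _ 1]) simp
  next
    case (inv h)
    then have h: "h \<in> carrier Q" using Y by blast
    have "d p (pt (inv h) i) = d p (pt h i)" for i
      using dist_pt_left[OF h, of \<one> "inv h" i] h by (simp add: pt_one commute)
    moreover have "d p (pt h i) \<le> 1 * \<Lambda> i" for i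
      using member_le_sum[OF inv, of "\<lambda>y. d p (pt y i)"] Y(1) by (simp add: \<Lambda>_def)
    ultimately show ?case by (intro exI[of _ 1]) simp
  next
    case (eng g h)
    have gh: "g \<in> carrier Q" "h \<in> carrier Q" using eng.hyps Y(3) by auto
    obtain C C' where C: "C \<ge> 0" "\<And>i. d p (pt g i) \<le> C * \<Lambda> i" "C' \<ge> 0" "\<And>i. d p (pt h i) \<le> C' * \<Lambda> i"
      using eng.IH by blast
    have "d p (pt (g \<otimes> h) i) \<le> (C + C') * \<Lambda> i" for i
    proof -
      have "d (pt g i) (pt (g \<otimes> h) i) = d p (pt h i)"
        using dist_pt_left[OF gh(1) Q.one_closed gh(2), of i] gh by (simp add: pt_one)
      then show ?thesis
        using triangle[OF p pt_in[OF gh(1), of i] pt_in[of "g \<otimes> h" i]] C(2)[of i] C(4)[of i] gh by (simp add: algebra_simps)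
    qed
    then show ?case using C by (intro exI[of _ "C + C'"]) auto
  qed
qed

text \<open>The displacement of \<open>g0\<close> is at most a multiple of the scale, and by
  assumption it is not bounded along \<open>W\<close>.\<close>

lemma \<Lambda>_large: "eventually (\<lambda>i. C \<le> \<Lambda> i) W"
proof (rule ccontr)
  assume "\<not> ?thesis"
  obtain B where B: "B \<ge> 0" "\<And>i. d p (pt g0 i) \<le> B * \<Lambda> i" using orbit_le_\<Lambda>[OF g0(1)] by blast
  from \<open>\<not> ?thesis\<close> have "eventually (\<lambda>i. \<not> C \<le> \<Lambda> i) W" by (rule ultrafilter_not[OF W])
  then have "eventually (\<lambda>i. d p (\<psi> (f i g0) p) \<le> B * C) W"
  proof eventually_elim
    case (elim i)
    then have "B * \<Lambda> i \<le> B * C" using B(1) by (intro mult_left_mono) auto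
    then show ?case using B(2)[of i] by (simp add: pt_def)
  qed
  then show False using g0(2) by blast
qed

lemma \<Lambda>_lim: "((\<lambda>i. c / \<Lambda> i) \<longlongrightarrow> 0) W"
  using \<Lambda>_large by (intro real_tendsto_divide_at_top[OF tendsto_const]) (simp add: filterlim_at_top)

lemma T_lim:
  assumes gh: "g \<in> carrier Q" "h \<in> carrier Q"
  shows "((\<lambda>i. d (pt g i) (pt h i) / \<Lambda> i) \<longlongrightarrow> T g h) W"
proof -
  obtain C C' where C: "\<forall>i. d p (pt g i) \<le> C * \<Lambda> i" "\<forall>i. d p (pt h i) \<le> C' * \<Lambda> i"
    using orbit_le_\<Lambda>[OF gh(1)] orbit_le_\<Lambda>[OF gh(2)] by blast
  have "\<bar>d (pt g i) (pt h i) / \<Lambda> i\<bar> \<le> C + C'" for i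
  proof -
    have "d (pt g i) (pt h i) \<le> (C + C') * \<Lambda> i"
      using triangle[OF pt_in[OF gh(1), of i] p pt_in[OF gh(2), of i]] C(1)[rule_format, of i] C(2)[rule_format, of i] commute[of p "pt g i"]
      by (simp add: algebra_simps)
    then show ?thesis using \<Lambda>_pos[of i] by (simp add: abs_divide pos_divide_le_eq)
  qed
  then obtain l where "((\<lambda>i. d (pt g i) (pt h i) / \<Lambda> i) \<longlongrightarrow> l) W"
    using ultrafilter_limit[OF W, of "\<lambda>i. d (pt g i) (pt h i) / \<Lambda> i" "C + C'"] by (auto simp: eventually_mono)
  then show ?thesis unfolding T_def using tendsto_Lim[OF W_bot] by blast
qed

lemma T_eq:
  assumes "g \<in> carrier Q" "h \<in> carrier Q" "((\<lambda>i. d (pt g i) (pt h i) / \<Lambda> i) \<longlongrightarrow> l) W"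
  shows "T g h = l"
  using tendsto_unique_W[OF T_lim[OF assms(1,2)] assms(3)] .

text \<open>The hyperbolicity error \<open>2 * \<delta>\<close> divided by the scale tends to
  0.\<close>

sublocale T: tree_pseudometric Q T
proof unfold_locales
  fix x assume x: "x \<in> carrier Q"
  show "T x x = 0" using x by (intro T_eq) auto
  fix y assume y: "y \<in> carrier Q"
  show "T x y = T y x" using T_lim[OF y x] by (intro T_eq x y) (simp add: commute)
  show "T (g \<otimes> x) (g \<otimes> y) = T x y" if "g \<in> carrier Q" for g
    using that x y T_lim[OF x y] by (intro T_eq) (auto simp: dist_pt_left)
  fix z assume z: "z \<in> carrier Q"
  show "T x z \<le> T x y + T y z"
  proof (rule tendsto_le[OF W_bot tendsto_add[OF T_lim[OF x y] T_lim[OF y z]] T_lim[OF x z]], intro always_eventually allI)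
    fix i
    show "d (pt x i) (pt z i) / \<Lambda> i \<le> d (pt x i) (pt y i) / \<Lambda> i + d (pt y i) (pt z i) / \<Lambda> i"
      using triangle[of "pt x i" "pt y i" "pt z i"] x y z \<Lambda>_pos[of i] by (simp add: divide_right_mono flip: add_divide_distrib)
  qed
  fix v assume v: "v \<in> carrier Q"
  have "T x z + T y v \<le> max (T x y + T z v) (T y z + T x v) + 0"
  proof (rule tendsto_le[OF W_bot])
    show "((\<lambda>i. max (d (pt x i) (pt y i) / \<Lambda> i + d (pt z i) (pt v i) / \<Lambda> i) (d (pt y i) (pt z i) / \<Lambda> i + d (pt x i) (pt v i) / \<Lambda> i)
        + 2 * \<delta> / \<Lambda> i) \<longlongrightarrow> max (T x y + T z v) (T y z + T x v) + 0) W"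
      by (intro tendsto_add tendsto_max T_lim \<Lambda>_lim x y z v)
    show "((\<lambda>i. d (pt x i) (pt z i) / \<Lambda> i + d (pt y i) (pt v i) / \<Lambda> i) \<longlongrightarrow> T x z + T y v) W"
      by (intro tendsto_add T_lim x y z v)
    show "eventually (\<lambda>i. d (pt x i) (pt z i) / \<Lambda> i + d (pt y i) (pt v i) / \<Lambda> i \<le>
        max (d (pt x i) (pt y i) / \<Lambda> i + d (pt z i) (pt v i) / \<Lambda> i) (d (pt y i) (pt z i) / \<Lambda> i + d (pt x i) (pt v i) / \<Lambda> i)
        + 2 * \<delta> / \<Lambda> i) W"
    proof (intro always_eventually allI)
      fix i
      have "d (pt x i) (pt z i) + d (pt y i) (pt v i) \<le> max (d (pt x i) (pt y i) + d (pt z i) (pt v i)) (d (pt y i) (pt z i) + d (pt x i) (pt v i)) + 2 * \<delta>"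
        using x y z v by (intro four_point[OF hyp(1)]) auto
      then have "(d (pt x i) (pt z i) + d (pt y i) (pt v i)) / \<Lambda> i \<le>
        (max (d (pt x i) (pt y i) + d (pt z i) (pt v i)) (d (pt y i) (pt z i) + d (pt x i) (pt v i)) + 2 * \<delta>) / \<Lambda> i"
        using \<Lambda>_pos[of i] by (intro divide_right_mono) auto
      then show "d (pt x i) (pt z i) / \<Lambda> i + d (pt y i) (pt v i) / \<Lambda> i \<le>
        max (d (pt x i) (pt y i) / \<Lambda> i + d (pt z i) (pt v i) / \<Lambda> i) (d (pt y i) (pt z i) / \<Lambda> i + d (pt x i) (pt v i) / \<Lambda> i)
        + 2 * \<delta> / \<Lambda> i"
        using \<Lambda>_pos[of i] by (simp add: add_divide_distrib max_divide_distrib_right)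
    qed
  qed
  then show "T x z + T y v \<le> max (T x y + T z v) (T y z + T x v)" by simp
qed

text \<open>A bounded Gromov product disappears after rescaling, so the path through the identity is
  geodesic in the limit.\<close>

lemma T_turn:
  assumes gh: "g \<in> carrier Q" "h \<in> carrier Q" and turn: "\<not> same_direction g h"
  shows "T g h = T \<one> g + T \<one> h"
proof -
  obtain B where B: "eventually (\<lambda>i. gromov_product p (pt g i) (pt h i) \<le> B) W"
    using not_fellow[OF W] turn unfolding same_direction_def by metis
  have "T \<one> g + T \<one> h - 0 \<le> T g h"
  proof (rule tendsto_le[OF W_bot T_lim[OF gh]])
    show "((\<lambda>i. d (pt \<one> i) (pt g i) / \<Lambda> i + d (pt \<one> i) (pt h i) / \<Lambda> i - 2 * B / \<Lambda> i) \<longlongrightarrow> T \<one> g + T \<one> h - 0) W"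
      by (intro tendsto_add tendsto_diff T_lim \<Lambda>_lim gh Q.one_closed)
    show "eventually (\<lambda>i. d (pt \<one> i) (pt g i) / \<Lambda> i + d (pt \<one> i) (pt h i) / \<Lambda> i - 2 * B / \<Lambda> i \<le> d (pt g i) (pt h i) / \<Lambda> i) W"
      using B
    proof eventually_elim
      case (elim i)
      then have "d p (pt g i) + d p (pt h i) - 2 * B \<le> d (pt g i) (pt h i)"
        unfolding gromov_product_def using commute[of p "pt g i"] commute[of p "pt h i"] by argo
      then have "(d p (pt g i) + d p (pt h i) - 2 * B) / \<Lambda> i \<le> d (pt g i) (pt h i) / \<Lambda> i"
        using \<Lambda>_pos[of i] by (intro divide_right_mono) auto
      then show ?case by (simp add: pt_one add_divide_distrib diff_divide_distrib)
    qed
  qed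
  then show ?thesis using T.tri[OF gh(1) Q.one_closed gh(2)] T.sym[OF gh(1) Q.one_closed] by simp
qed

lemma T_fixed_image:
  assumes "fixed_image h"
  shows "T \<one> h = 0"
proof -
  obtain h' where h: "h \<in> carrier Q" "\<And>i. f i h = h'" using assms by (auto simp: fixed_image_def)
  show ?thesis
    using \<Lambda>_lim[of "d p (\<psi> h' p)"] h by (intro T_eq) (simp_all add: pt_one, simp add: pt_def)
qed

text \<open>The rescaled displacements of the generators add up to
  \<open>1 - 1 / \<Lambda> i\<close>, so their limits have sum 1.\<close>

lemma generator_pos:
  obtains s where "s \<in> Y" "0 < T \<one> s"
proof -
  have "((\<lambda>i. \<Sum>y\<in>Y. d (pt \<one> i) (pt y i) / \<Lambda> i) \<longlongrightarrow> (\<Sum>y\<in>Y. T \<one> y)) W"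
    using Y(2) by (intro tendsto_sum T_lim) auto
  moreover have "(\<Sum>y\<in>Y. d (pt \<one> i) (pt y i) / \<Lambda> i) = 1 - 1 / \<Lambda> i" for i
  proof -
    have "(\<Sum>y\<in>Y. d (pt \<one> i) (pt y i) / \<Lambda> i) = (\<Lambda> i - 1) / \<Lambda> i"
      by (simp add: pt_one \<Lambda>_def sum_divide_distrib)
    also have "\<dots> = 1 - 1 / \<Lambda> i" using \<Lambda>_pos[of i] by (simp add: diff_divide_distrib)
    finally show ?thesis .
  qed
  moreover have "((\<lambda>i. 1 - 1 / \<Lambda> i) \<longlongrightarrow> 1 - 0) W" by (intro tendsto_diff tendsto_const \<Lambda>_lim)
  ultimately have "(\<Sum>y\<in>Y. T \<one> y) = 1" using tendsto_unique_W by fastforce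
  then have "\<not> (\<forall>y\<in>Y. T \<one> y \<le> 0)" using sum_nonpos[of Y "T \<one>"] by force
  then show thesis using that by force
qed

lemma acylindrically_hyperbolic_escaping: "acylindrically_hyperbolic TYPE('g \<Rightarrow> real) Q"
proof -
  obtain s where s: "s \<in> Y" "0 < T \<one> s" by (rule generator_pos)
  have sQ: "s \<in> carrier Q" "inv s \<in> carrier Q" using s Y by auto
  define l where "l = T \<one> s"
  have l: "0 < l" using s by (simp add: l_def)
  have s_large: "eventually (\<lambda>i. l / 2 * \<Lambda> i < d p (pt s i)) W"
  proof -
    have "l / 2 < T \<one> s" using l by (simp add: l_def)
    from order_tendstoD(1)[OF T_lim[OF Q.one_closed sQ(1)] this] show ?thesis
    proof (rule eventually_mono)
      fix i assume "l / 2 < d (pt \<one> i) (pt s i) / \<Lambda> i"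
      then show "l / 2 * \<Lambda> i < d p (pt s i)" using \<Lambda>_pos[of i] by (simp add: pt_one pos_less_divide_eq)
    qed
  qed
  have far: "eventually (\<lambda>i. C \<le> d p (pt s i)) W" for C
    using \<Lambda>_large[of "2 * C / l"] s_large
  proof eventually_elim
    case (elim i)
    then show ?case using l by (simp add: field_simps)
  qed
  have far': "eventually (\<lambda>i. C \<le> d p (pt (inv s) i)) W" for C
  proof -
    have "d p (pt (inv s) i) = d p (pt s i)" for i
      using dist_pt_left[OF sQ(1) Q.one_closed sQ(2), of i] sQ by (simp add: pt_one commute)
    then show ?thesis using far[of C] by simp
  qed
  obtain h h' where h: "fixed_image h" "fixed_image h'" "\<not> same_direction (h \<otimes> s) (inv s)" "\<not> same_direction (h' \<otimes> s) (inv s)"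
    "\<not> same_direction (h \<otimes> s) (h' \<otimes> s)"
    by (rule two_directions_avoiding[OF sQ(1) far sQ(2)]) blast
  have hQ: "h \<in> carrier Q" "h' \<in> carrier Q" using h by (auto simp: fixed_image_def)
  have backQ: "inv h' \<otimes> inv s \<in> carrier Q" using hQ sQ by simp
  \<comment> \<open>The axis of \<open>w\<close> leaves the identity in the directions of
    \<open>s\<close> and of \<open>inv h' \<otimes> inv s\<close>. Here \<open>h1\<close> steers
    \<open>u\<close>, and below \<open>h2\<close> steers \<open>inv u\<close>, away from
    both.\<close>
  obtain h1 where h1: "fixed_image h1" "\<not> same_direction (h1 \<otimes> s) s" "\<not> same_direction (h1 \<otimes> s) (inv h' \<otimes> inv s)"
    by (rule direction_avoiding[OF sQ(1) far sQ(1) backQ]) blast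
  obtain h2 where h2: "fixed_image h2" "\<not> same_direction (h2 \<otimes> inv s) s" "\<not> same_direction (h2 \<otimes> inv s) (inv h' \<otimes> inv s)"
    by (rule direction_avoiding[OF sQ(2) far' sQ(1) backQ]) blast
  have hQ': "h1 \<in> carrier Q" "h2 \<in> carrier Q" using h1 h2 by (auto simp: fixed_image_def)
  have zero: "T \<one> h = 0" "T \<one> h' = 0" "T \<one> h1 = 0" "T \<one> h2 = 0" using T_fixed_image h h1 h2 by auto
  have T_left: "T \<one> (c \<otimes> g) = T \<one> g" if "fixed_image c" "g \<in> carrier Q" for c g
  proof -
    have "c \<in> carrier Q" using that by (simp add: fixed_image_def)
    then show ?thesis
      using T.dist_mult[of c g] T.zero_right[OF Q.one_closed _ that(2) T_fixed_image[OF fixed_image_inv[OF that(1)]]] that by simp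
  qed
  have lens: "T \<one> (inv s) = l" "T \<one> (h \<otimes> s) = l" "T \<one> (h' \<otimes> s) = l" "T \<one> (h1 \<otimes> s) = l" "T \<one> (h2 \<otimes> inv s) = l"
    "T \<one> (inv h' \<otimes> inv s) = l"
    using T_left h h1 h2 sQ fixed_image_inv T.dist_inv[OF sQ(1)] by (simp_all add: l_def)
  have m: "h \<otimes> s \<in> carrier Q" "h' \<otimes> s \<in> carrier Q" "h1 \<otimes> s \<in> carrier Q" "h2 \<otimes> inv s \<in> carrier Q"
    using hQ hQ' sQ by auto
  have bend: "T (inv s) (h \<otimes> s) = 2 * l" "T (inv s) (h' \<otimes> s) = 2 * l"
    and escape: "T s (h1 \<otimes> s) = 2 * l" "T (inv h' \<otimes> inv s) (h1 \<otimes> s) = 2 * l"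
      "T s (h2 \<otimes> inv s) = 2 * l" "T (inv h' \<otimes> inv s) (h2 \<otimes> inv s) = 2 * l"
    using T_turn[OF sQ(2) m(1)] T_turn[OF sQ(2) m(2)] T_turn[OF sQ(1) m(3)] T_turn[OF backQ m(3)] T_turn[OF sQ(1) m(4)]
      T_turn[OF backQ m(4)] h h1 h2 same_direction_sym lens by (auto simp flip: l_def)
  define k k' w u where "k = s \<otimes> h" and "k' = s \<otimes> h'" and "w = k \<otimes> k' \<otimes> (k \<otimes> k')" and "u = h1 \<otimes> s \<otimes> inv h2"
  note axis = T.word_axis[OF sQ(1) hQ hQ' zero l_def[symmetric] l bend escape k_def k'_def w_def u_def]
  have kQ: "k \<in> carrier Q" "k' \<in> carrier Q" "w \<in> carrier Q" "u \<in> carrier Q"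
    using sQ hQ hQ' by (auto simp: k_def k'_def w_def u_def)
  interpret W: tree_word Q T w "4 * l"
    by unfold_locales (use kQ l axis(1) in auto)
  \<comment> \<open>The bent word whose ends acylindricity of \<open>K\<close> controls. Up to
    \<open>h\<close>, which has length zero, it is the point
    \<open>k \<otimes> k' \<otimes> k\<close> on the segment from the identity to
    \<open>w\<close>.\<close>
  define q where "q = k \<otimes> k' \<otimes> s"
  have qQ: "q \<in> carrier Q" "k \<otimes> k' \<otimes> k \<in> carrier Q" using kQ sQ by (auto simp: q_def)
  have qk: "k \<otimes> k' \<otimes> k = q \<otimes> h" using kQ sQ hQ by (simp add: q_def k_def Q.m_assoc)
  obtain hK hK' where hK: "hK \<in> carrier K" "\<And>i. f i h = hK" "hK' \<in> carrier K" "\<And>i. f i h' = hK'"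
    using h by (auto simp: fixed_image_def)
  define \<kappa> where "\<kappa> = max (d p (\<psi> hK p)) (d p (\<psi> hK' p))"
  obtain B1 where B1: "eventually (\<lambda>i. gromov_product p (pt (inv s) i) (pt (h \<otimes> s) i) \<le> B1) W"
    using not_fellow[OF W] h(3) same_direction_sym unfolding same_direction_def by metis
  obtain B2 where B2: "eventually (\<lambda>i. gromov_product p (pt (inv s) i) (pt (h' \<otimes> s) i) \<le> B2) W"
    using not_fellow[OF W] h(4) same_direction_sym unfolding same_direction_def by metis
  obtain B3 where B3: "eventually (\<lambda>i. gromov_product p (pt (h \<otimes> s) i) (pt (h' \<otimes> s) i) \<le> B3) W"
    using not_fellow[OF W] h(5) unfolding same_direction_def by metis
  \<comment> \<open>Neither \<open>B\<close> nor \<open>\<kappa>\<close> depends on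
    \<open>i\<close>; hence neither do the constants of
    \<open>uniformly_discontinuous_word\<close>.\<close>
  define B where "B = max 0 (max B1 (max B2 B3))"
  have "0 \<le> B" "0 \<le> \<kappa>" by (auto simp: B_def \<kappa>_def le_max_iff_disj)
  from uniformly_discontinuous_word[OF hyp geo acyl p this] obtain N :: nat and L where NL: "\<And>s h h' F. \<lbrakk>s \<in> carrier K; h \<in> carrier K; h' \<in> carrier K;
    d p (\<psi> h p) \<le> \<kappa>; d p (\<psi> h' p) \<le> \<kappa>;
    gromov_product p (\<psi> (inv\<^bsub>K\<^esub> s) p) (\<psi> (h \<otimes>\<^bsub>K\<^esub> s) p) \<le> B;
    gromov_product p (\<psi> (inv\<^bsub>K\<^esub> s) p) (\<psi> (h' \<otimes>\<^bsub>K\<^esub> s) p) \<le> B;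
    gromov_product p (\<psi> (h \<otimes>\<^bsub>K\<^esub> s) p) (\<psi> (h' \<otimes>\<^bsub>K\<^esub> s) p) \<le> B;
    L \<le> d p (\<psi> s p); finite F; F \<subseteq> carrier K;
    \<forall>g\<in>F. d p (\<psi> g p) \<le> d p (\<psi> s p) / 100 \<and>
        d (\<psi> (s \<otimes>\<^bsub>K\<^esub> h \<otimes>\<^bsub>K\<^esub> (s \<otimes>\<^bsub>K\<^esub> h') \<otimes>\<^bsub>K\<^esub> s) p) (\<psi> g (\<psi> (s \<otimes>\<^bsub>K\<^esub> h \<otimes>\<^bsub>K\<^esub> (s \<otimes>\<^bsub>K\<^esub> h') \<otimes>\<^bsub>K\<^esub> s) p)) \<le> d p (\<psi> s p) / 100\<rbrakk>
    \<Longrightarrow> card F \<le> N"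
    by (elim exE) (rule that; blast)
  show ?thesis
  \<comment> \<open>Limits of at most \<open>l / 400\<close> give displacements of at most
    \<open>l / 200 * \<Lambda> i\<close> for suitable \<open>i\<close>, while \<open>s\<close> moves
    \<open>p\<close> by more than \<open>l / 2 * \<Lambda> i\<close>: this is the factor 1/100
    allowed for bent words.\<close>
  proof (rule W.acylindrically_hyperbolic_tree[of "l / 400" N u])
    show "0 < l / 400" using l by simp
    show "u \<in> carrier Q" by (rule kQ)
    show "0 < T \<one> u" using axis(2) l by simp
    show "T (w [^] n) u = T \<one> (w [^] n) + T \<one> u" "T (inv u) (w [^] n) = T \<one> (inv u) + T \<one> (w [^] n)" for n :: int
      using axis(4,5) .
    fix F assume fin: "finite F" and F: "F \<subseteq> {g \<in> carrier Q. T \<one> g \<le> l / 400 \<and> T w (g \<otimes> w) \<le> l / 400}"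
    have FQ: "F \<subseteq> carrier Q" using F by blast
    \<comment> \<open>The displacement at the interior point \<open>q \<otimes> h\<close> is bounded
      by those at the ends; \<open>h\<close> is then cancelled.\<close>
    have "T q (g \<otimes> q) \<le> l / 400" if g: "g \<in> F" for g
    proof -
      have gQ: "g \<in> carrier Q" "g \<otimes> q \<in> carrier Q" using g FQ qQ by auto
      have "T (q \<otimes> h) (g \<otimes> (q \<otimes> h)) \<le> l / 400"
        using g F gQ unfolding qk[symmetric] by (intro T.displacement_between[OF gQ(1) Q.one_closed kQ(3) qQ(2) axis(3)]) auto
      also have "T (q \<otimes> h) (g \<otimes> (q \<otimes> h)) = T q (g \<otimes> (q \<otimes> h))"
        using gQ qQ hQ by (intro T.zero_right zero) auto
      also have "\<dots> = T (g \<otimes> q \<otimes> h) q" using gQ qQ hQ by (subst T.sym) (auto simp: Q.m_assoc)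
      also have "\<dots> = T (g \<otimes> q) q" using gQ qQ hQ zero by (intro T.zero_right) auto
      finally show ?thesis using T.sym gQ qQ by simp
    qed
    then have small: "T \<one> g \<le> l / 400" "T q (g \<otimes> q) \<le> l / 400" if "g \<in> F" for g using that F by auto
    have shrink: "eventually (\<lambda>i. d (pt x i) (pt y i) \<le> l / 200 * \<Lambda> i) W" if "x \<in> carrier Q" "y \<in> carrier Q" "T x y \<le> l / 400" for x y
    proof -
      have "T x y < l / 200" using that(3) l by simp
      from order_tendstoD(2)[OF T_lim[OF that(1,2)] this] show ?thesis
      proof (rule eventually_mono)
        fix i assume "d (pt x i) (pt y i) / \<Lambda> i < l / 200"
        then show "d (pt x i) (pt y i) \<le> l / 200 * \<Lambda> i" using \<Lambda>_pos[of i] by (simp add: pos_divide_less_eq)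
      qed
    qed
    have "eventually (\<lambda>i. \<forall>g\<in>F. d (pt \<one> i) (pt g i) \<le> l / 200 * \<Lambda> i) W"
      using small FQ by (intro eventually_ball_F[OF fin] shrink) auto
    moreover have "eventually (\<lambda>i. \<forall>g\<in>F. d (pt q i) (pt (g \<otimes> q) i) \<le> l / 200 * \<Lambda> i) W"
      using small FQ qQ by (intro eventually_ball_F[OF fin] shrink) auto
    moreover note s_large far[of L] B1 B2 B3 eventually_injective[OF fin FQ]
    ultimately have "eventually (\<lambda>i. card F \<le> N) W"
    proof eventually_elim
      case (elim i)
      let ?s = "f i s"
      have q_eq: "?s \<otimes>\<^bsub>K\<^esub> hK \<otimes>\<^bsub>K\<^esub> (?s \<otimes>\<^bsub>K\<^esub> hK') \<otimes>\<^bsub>K\<^esub> ?s = f i q"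
        using sQ hQ kQ by (simp add: q_def k_def k'_def f_mult hK)
      have "card (f i ` F) \<le> N"
      proof (rule NL[of ?s hK hK'])
        show "?s \<in> carrier K" "hK \<in> carrier K" "hK' \<in> carrier K" using sQ hK by auto
        show "d p (\<psi> hK p) \<le> \<kappa>" "d p (\<psi> hK' p) \<le> \<kappa>" by (auto simp: \<kappa>_def)
        have e: "\<psi> (inv\<^bsub>K\<^esub> ?s) p = pt (inv s) i" "\<psi> (hK \<otimes>\<^bsub>K\<^esub> ?s) p = pt (h \<otimes> s) i" "\<psi> (hK' \<otimes>\<^bsub>K\<^esub> ?s) p = pt (h' \<otimes> s) i"
          using sQ hQ by (simp_all add: pt_def f_inv f_mult hK)
        show "gromov_product p (\<psi> (inv\<^bsub>K\<^esub> ?s) p) (\<psi> (hK \<otimes>\<^bsub>K\<^esub> ?s) p) \<le> B"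
          "gromov_product p (\<psi> (inv\<^bsub>K\<^esub> ?s) p) (\<psi> (hK' \<otimes>\<^bsub>K\<^esub> ?s) p) \<le> B"
          "gromov_product p (\<psi> (hK \<otimes>\<^bsub>K\<^esub> ?s) p) (\<psi> (hK' \<otimes>\<^bsub>K\<^esub> ?s) p) \<le> B"
          unfolding e using elim by (auto simp: B_def)
        show "L \<le> d p (\<psi> ?s p)" using elim by (simp add: pt_def)
        show "finite (f i ` F)" "f i ` F \<subseteq> carrier K" using fin FQ by auto
        have sl: "l / 200 * \<Lambda> i \<le> d p (\<psi> ?s p) / 100" using elim by (simp add: pt_def)
        show "\<forall>g\<in>f i ` F. d p (\<psi> g p) \<le> d p (\<psi> ?s p) / 100 \<and>
          d (\<psi> (?s \<otimes>\<^bsub>K\<^esub> hK \<otimes>\<^bsub>K\<^esub> (?s \<otimes>\<^bsub>K\<^esub> hK') \<otimes>\<^bsub>K\<^esub> ?s) p) (\<psi> g (\<psi> (?s \<otimes>\<^bsub>K\<^esub> hK \<otimes>\<^bsub>K\<^esub> (?s \<otimes>\<^bsub>K\<^esub> hK') \<otimes>\<^bsub>K\<^esub> ?s) p)) \<le> d p (\<psi> ?s p) / 100"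
          unfolding q_eq
        proof (intro ballI)
          fix g' assume "g' \<in> f i ` F"
          then obtain g where g: "g \<in> F" "g' = f i g" by blast
          then have gQ: "g \<in> carrier Q" using FQ by blast
          have "d p (pt g i) \<le> l / 200 * \<Lambda> i" "d (pt q i) (pt (g \<otimes> q) i) \<le> l / 200 * \<Lambda> i"
            using elim g by (auto simp: pt_one)
          then show "d p (\<psi> g' p) \<le> d p (\<psi> ?s p) / 100 \<and> d (\<psi> (f i q) p) (\<psi> g' (\<psi> (f i q) p)) \<le> d p (\<psi> ?s p) / 100"
            using sl gQ qQ(1) p by (simp add: pt_def g(2) f_mult act_mult)
        qed
      qed
      then show ?case using elim by (simp add: card_image)
    qed
    then show "card F \<le> N" using W_bot by (simp add: eventually_const_iff)
  qed
qed

end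

theorem theorem1p2:
  fixes G :: "('a, 'b) monoid_scheme" and H :: "'a set"
  assumes "group G"
    and "finitely_presented G"
    and "subgroup H G"
    and "acylindrically_hyperbolic TYPE('x) (G\<lparr>carrier := H\<rparr>)"
    and "existentially_closed H G"
  shows "acylindrically_hyperbolic TYPE('a \<times> real) G"
proof -
  let ?K = "G\<lparr>carrier := H\<rparr>"
  obtain M :: "'x set" and d \<phi> a b where act: "isometric_action M d ?K \<phi>" and hyp: "Metric_space.gromov_hyperbolic M d" and
    acyl: "isometric_action.acylindrical M d ?K \<phi>" and ind: "isometric_action.independent_loxodromics M d ?K \<phi> a b"
    using assms(4) unfolding acylindrically_hyperbolic_def by (elim exE conjE bexE) (rule that)
  interpret isometric_action M d ?K \<phi> by (rule act)
  have ab: "a \<in> H" "b \<in> H" using ind by (auto simp: independent_loxodromics_def loxodromic_def)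
  obtain p where p: "p \<in> M" using ind unfolding independent_loxodromics_def loxodromic_def by blast
  obtain \<delta> where \<delta>: "0 \<le> \<delta>" "delta_hyperbolic \<delta>" and geo: geodesic_space
    using hyp unfolding gromov_hyperbolic_def by blast
  obtain Y where Y: "finite Y" "Y \<subseteq> carrier G" "generate G Y = carrier G" and
    homs: "\<forall>F. finite F \<longrightarrow> F \<subseteq> carrier G \<longrightarrow> (\<exists>f\<in>hom G ?K. f a = a \<and> f b = b \<and> inj_on f F)"
    using existentially_closed_homs[OF assms(1,2,5) ab] by (elim exE conjE) (rule that)
  \<comment> \<open>Indexing by the sets to be separated makes the family discriminating. For other
    sets any homomorphism fixing \<open>a\<close> and \<open>b\<close> will do, so that
    \<open>f\<close> is total.\<close>
  define f where "f F = (SOME f. f \<in> hom G ?K \<and> f a = a \<and> f b = b \<and>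
    (finite F \<and> F \<subseteq> carrier G \<longrightarrow> inj_on f F))" for F
  have f: "f F \<in> hom G ?K \<and> f F a = a \<and> f F b = b \<and> (finite F \<and> F \<subseteq> carrier G \<longrightarrow> inj_on (f F) F)" for F
  proof -
    have "\<exists>f. f \<in> hom G ?K \<and> f a = a \<and> f b = b \<and> (finite F \<and> F \<subseteq> carrier G \<longrightarrow> inj_on f F)"
    proof (cases "finite F \<and> F \<subseteq> carrier G")
      case True
      then obtain g where "g \<in> hom G ?K" "g a = a \<and> g b = b \<and> inj_on g F"
        using bexE[OF homs[rule_format, of F]] by metis
      then show ?thesis by (intro exI[of _ g]) simp
    next
      case False
      obtain g where "g \<in> hom G ?K" "g a = a \<and> g b = b \<and> inj_on g {}"
        using bexE[OF homs[rule_format, of "{}"]] by (metis empty_subsetI finite.emptyI)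
      then show ?thesis using False by (intro exI[of _ g]) blast
    qed
    then show ?thesis unfolding f_def by (rule someI_ex)
  qed
  \<comment> \<open>Along this filter every finite set is eventually contained in the index, so
    distinct elements are eventually separated.\<close>
  obtain W :: "'a set filter" where W: "W \<le> finite_subsets_at_top (carrier G)" "ultrafilter W"
    using ultrafilter_exists[OF finite_subsets_at_top_neq_bot] by blast
  interpret discriminating_family M d ?K \<phi> G W f \<delta> a b a b p
  proof (intro discriminating_family.intro discriminating_family_axioms.intro act assms(1))
    show "ultrafilter W" by (rule W)
    show "f i \<in> hom G ?K" for i using f by blast
    show "eventually (\<lambda>i. f i g \<noteq> f i h) W" if gh: "g \<in> carrier G" "h \<in> carrier G" "g \<noteq> h" for g h
    proof (rule filter_leD[OF W(1)])
      have "f F g \<noteq> f F h" if "finite F" "{g, h} \<subseteq> F" "F \<subseteq> carrier G" for F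
        using f[of F] that gh(3) by (auto dest: inj_onD)
      then show "eventually (\<lambda>F. f F g \<noteq> f F h) (finite_subsets_at_top (carrier G))"
        unfolding eventually_finite_subsets_at_top using gh by (intro exI[of _ "{g, h}"]) auto
    qed
    show "a \<in> carrier G" "b \<in> carrier G" using ab subgroup.subset[OF assms(3)] by auto
    show "f i a = a" "f i b = b" for i using f by blast+
  qed (use \<delta> geo acyl ind p in auto)
  \<comment> \<open>Bounded orbits lead to the unscaled limit, an unbounded one to the tree. The
    spaces consist of functions of different types, which
    \<open>acylindrically_hyperbolic_any_type\<close> brings to the required one.\<close>
  show ?thesis
  proof (cases "\<forall>g\<in>carrier G. \<exists>C. eventually (\<lambda>i. d p (\<phi> (f i g) p) \<le> C) W")
    case True
    then have "acylindrically_hyperbolic TYPE(('a set \<Rightarrow> 'x) \<Rightarrow> real) G"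
      by (intro acylindrically_hyperbolic_if_bounded) (rule bspec)
    then show ?thesis by (rule acylindrically_hyperbolic_any_type)
  next
    case False
    then obtain g where "g \<in> carrier G" "\<not> (\<exists>C. eventually (\<lambda>i. d p (\<phi> (f i g) p) \<le> C) W)" by blast
    then interpret escaping_family M d ?K \<phi> G W f \<delta> a b a b p Y g
      using Y by unfold_locales
    have "acylindrically_hyperbolic TYPE('a \<Rightarrow> real) G"
      by (rule acylindrically_hyperbolic_escaping)
    then show ?thesis by (rule acylindrically_hyperbolic_any_type)
  qed
qed

end
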